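(* Let $p$ be a prime and $s>-1$ a real number. The group $\overline{\overline{\mathrm{GL}}}(2\infty,\mathbb{O}_p)$ acts on $\mathrm{Mat}(\infty,\mathbb{Q}_p)$ by the transformations $z\mapsto(a+zc)^{-1}(b+zd)$, leaving the measure $\mu_s^\infty$ quasiinvariant. The Radon--Nikodym derivative is $|\det(a+zc)|^{s}$, i.e. $d\mu_s^\infty\bigl((a+zc)^{-1}(b+zd)\bigr)=|\det(a+zc)|^s\,d\mu_s^\infty(z)$.
   Context: $\mathbb{Q}_p$ is the field of $p$-adic numbers with its norm $|\cdot|$ ($|p|=p^{-1}$), $\mathbb{O}_p$ the ring of $p$-adic integers, $\mathrm{Mat}(n,\mathbb{Q}_p)$ the space of $n\times n$ matrices over $\mathbb{Q}_p$, $\mathrm{vol}$ the translation-invariant measure on it with $\mathrm{vol}(\mathrm{Mat}(n,\mathbb{O}_p))=1$, and $\mathrm{GL}(n,\mathbb{O}_p)$ the group of $n\times n$ matrices invertible over $\mathbb{O}_p$. Measures. Any $z\in\mathrm{Mat}(n,\mathbb{Q}_p)$ can be written as $z=A\,\mathrm{diag}(p^{-k_1},\dots,p^{-k_n})\,B$ with $A,B\in\mathrm{GL}(n,\mathbb{O}_p)$ and $k_1\ge\dots\ge k_n\ge-\infty$ ($k_j$ integers or $-\infty$, with $p^{-k_j}=0$ if $k_j=-\infty$). Put $\gamma(z)=\prod_{j:\,k_j>0}p^{k_j}$ (empty product equal to $1$). For $s>-1$ let $\mu_s^n$ be the probability measure on $\mathrm{Mat}(n,\mathbb{Q}_p)$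 with $d\mu_s^n(z)=c(n,s+2n)^{-1}\gamma(z)^{-s-2n}\,d\mathrm{vol}(z)$, where $c(n,\alpha)=\int\gamma(z)^{-\alpha}\,d\mathrm{vol}(z)$. The pushforward of $\mu_s^{n+1}$ under taking the upper left $n\times n$ corner is $\mu_s^n$; hence there is a unique probability measure $\mu_s^\infty$ on the space $\mathrm{Mat}(\infty,\mathbb{Q}_p)\simeq\mathbb{Q}_p^{\infty\times\infty}$ of all infinite matrices $(z_{ij})_{i,j\ge1}$ over $\mathbb{Q}_p$ (product $\sigma$-algebra) whose pushforward under taking the upper left $n\times n$ corner is $\mu_s^n$ for every $n$. Groups. $\mathrm{GL}(2\infty,\mathbb{O}_p)$ is the group of $(\infty+\infty)\times(\infty+\infty)$ block matrices $g$ with entries in $\mathbb{O}_p$ such that $g^{-1}$ has entries in $\mathbb{O}_p$ and $g-1$ has only finitely many nonzero entries. $\overline{\overline{T}}$ is the group of $(\infty+\infty)\times(\infty+\infty)$ matrices $\begin{pmatrix} a & b \\ 0 & d \end{pmatrix}$ over $\mathbb{O}_p$ where $a=(\alpha_{ij})$ is lower triangular, $d=(\delta_{ij})$ is upper triangular, $|\alpha_{jj}|=|\delta_{jj}|=1$ for all $j$, and $b$ is arbitrary. $\overline{\overline{\mathrm{GL}}}(2\infty,\mathbb{O}_p)$ is the group of matrices generated by $\mathrm{GL}(2\infty,\mathbb{O}_p)$ and $\overline{\overline{T}}$; it consists of the invertible matrices $g=\begin{pmatrix} a & b \\ c & d \end{pmatrix}$ over $\mathbb{O}_p$ such that $c$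 has only finitely many nonzero entries, $a$ has only finitely many nonzero entries above the diagonal, $d$ has only finitely many nonzero entries below the diagonal, and $g^{-1}$ has entries in $\mathbb{O}_p$. Action and determinant. For $g\in\overline{\overline{\mathrm{GL}}}(2\infty,\mathbb{O}_p)$ and $k$ sufficiently large, in blocks of size $k+\infty$ one has $a=\begin{pmatrix} a_{11} & 0 \\ a_{21} & a_{22} \end{pmatrix}$, $b=\begin{pmatrix} b_{11} & b_{12} \\ b_{21} & b_{22} \end{pmatrix}$, $c=\begin{pmatrix} c_{11} & 0 \\ 0 & 0 \end{pmatrix}$, $d=\begin{pmatrix} d_{11} & d_{12} \\ 0 & d_{22} \end{pmatrix}$, with $a_{22}$ lower triangular and $d_{22}$ upper triangular, both with diagonal entries of norm $1$. Write $z=\begin{pmatrix} z_{11} & z_{12} \\ z_{21} & z_{22} \end{pmatrix}$. Then $a+zc=\begin{pmatrix} a_{11}+z_{11}c_{11} & 0 \\ a_{21}+z_{21}c_{11} & a_{22} \end{pmatrix}$ and one sets $|\det(a+zc)|:=|\det(a_{11}+z_{11}c_{11})|$ (i.e. $|\det a_{22}|$ is taken to be $1$), which does not depend on the choice of large $k$. When this is nonzero ($\mu_s^\infty$-almost everywhere), $(a+zc)^{-1}(b+zd)$ is defined by matrix multiplication (all sums being finite); for all sufficiently large $k$ its upper left $k\times k$ corner is $(a_{11}+z_{11}c_{11})^{-1}(b_{11}+z_{11}d_{11})$. The action is a right action by almost everywhere defined transformations. Quasiinvariance with Radon--Nikodym derivative $h$ under an almost everywhere defined invertible transformation $\phi$,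 written $d\mu(\phi(z))=h(z)\,d\mu(z)$, means that $\phi$ preserves the class of null sets and $\mu(\phi(B))=\int_B h\,d\mu$ for measurable $B$ in the domain of $\phi$. *)

theory Defs
  imports
    "HOL-Probability.Probability"
    "HOL-Computational_Algebra.Squarefree"
    "HOL-Library.Groups_Big_Fun"
    "HOL-Library.Option_ord"
    "Jordan_Normal_Form.Determinant"
    "Berlekamp_Zassenhaus.Finite_Field"
begin

section \<open>The field of p-adic numbers\<close>

text \<open>
  \<open>'p padic\<close> is the completion of the rationals for the \<open>p\<close>-adic absolute value, where the
  prime \<open>p\<close> is the number of elements of the type \<open>'p\<close> (class \<^class>\<open>prime_card\<close>).
\<close>

definition padic_abs :: "nat \<Rightarrow> rat \<Rightarrow> real" where
  "padic_abs p q = (if q = 0 then 0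
     else real p powi (int (multiplicity (int p) (snd (quotient_of q)))
                       - int (multiplicity (int p) (fst (quotient_of q)))))"

lemma padic_abs_0 [simp]: "padic_abs p 0 = 0"
  by (simp add: padic_abs_def)

lemma padic_abs_divide:
  assumes p: "prime p" and a: "a \<noteq> 0" and b: "b \<noteq> 0"
  shows "padic_abs p (of_int a / of_int b)
    = real p powi (int (multiplicity (int p) b) - int (multiplicity (int p) a))"
proof -
  obtain c d where cd: "quotient_of (of_int a / of_int b) = (c, d)" by fastforce
  have d: "d > 0" using cd quotient_of_denom_pos by blast
  have eq: "(of_int a / of_int b :: rat) = of_int c / of_int d"
    using cd quotient_of_div by blast
  have c: "c \<noteq> 0" using eq a b d by auto
  from eq have "(of_int (a * d) :: rat) = of_int (c * b)"
    using b d by (simp add: field_simps)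
  then have e: "a * d = c * b" by (simp only: of_int_eq_iff)
  have pp: "prime_elem (int p)" using p by simp
  have "multiplicity (int p) a + multiplicity (int p) d = multiplicity (int p) c + multiplicity (int p) b"
    using prime_elem_multiplicity_mult_distrib[OF pp] e a b c d by (metis less_irrefl)
  then have "int (multiplicity (int p) d) - int (multiplicity (int p) c)
     = int (multiplicity (int p) b) - int (multiplicity (int p) a)" by linarith
  then show ?thesis using a b by (simp add: padic_abs_def cd)
qed

lemma rat_cases_int:
  fixes q :: rat
  obtains a b :: int where "b \<noteq> 0" "q = of_int a / of_int b"
proof -
  obtain a b where ab: "quotient_of q = (a, b)" by fastforce
  show thesis using that[of b a] quotient_of_denom_pos[OF ab] quotient_of_div[OF ab] by simp
qed

lemma padic_abs_nonneg: "padic_abs p q \<ge> 0"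
  by (simp add: padic_abs_def)

lemma padic_abs_pos: "prime p \<Longrightarrow> q \<noteq> 0 \<Longrightarrow> padic_abs p q > 0"
  by (simp add: padic_abs_def prime_gt_0_nat)

lemma padic_abs_eq_0_iff: "prime p \<Longrightarrow> padic_abs p q = 0 \<longleftrightarrow> q = 0"
  using padic_abs_pos[of p q] by (cases "q = 0") auto

lemma padic_abs_mult:
  assumes p: "prime p" shows "padic_abs p (x * y) = padic_abs p x * padic_abs p y"
proof (cases "x = 0 \<or> y = 0")
  case False
  obtain a b where b: "b \<noteq> 0" "x = of_int a / of_int b" by (rule rat_cases_int)
  obtain c d where d: "d \<noteq> 0" "y = of_int c / of_int d" by (rule rat_cases_int)
  have nz: "a \<noteq> 0" "c \<noteq> 0" using False b d by auto
  have p0: "real p \<noteq> 0" using p by (simp add: prime_gt_0_nat)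
  have pp: "prime_elem (int p)" using p by simp
  have mult: "multiplicity (int p) (u * v) = multiplicity (int p) u + multiplicity (int p) v"
    if "u \<noteq> 0" "v \<noteq> 0" for u v
    using that prime_elem_multiplicity_mult_distrib[OF pp] by blast
  have "x * y = of_int (a * c) / of_int (b * d)" using b d by simp
  also have "padic_abs p \<dots> = real p powi (int (multiplicity (int p) (b * d)) - int (multiplicity (int p) (a * c)))"
    using nz b d by (intro padic_abs_divide[OF p]) auto
  also have "\<dots> = real p powi ((int (multiplicity (int p) b) - int (multiplicity (int p) a))
      + (int (multiplicity (int p) d) - int (multiplicity (int p) c)))"
    by (rule arg_cong[of _ _ "\<lambda>k. real p powi k"]) (simp add: mult nz b(1) d(1))
  also have "\<dots> = padic_abs p x * padic_abs p y"
    unfolding b(2) d(2) padic_abs_divide[OF p nz(1) b(1)] padic_abs_divide[OF p nz(2) d(1)]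
    by (rule power_int_add) (use p0 in simp)
  finally show ?thesis .
qed auto

lemma padic_abs_1 [simp]: "padic_abs p 1 = 1"
  unfolding padic_abs_def rat_one_code by simp

lemma padic_abs_minus [simp]:
  "padic_abs p (- x) = padic_abs p x"
  by (simp add: padic_abs_def rat_uminus_code Let_def split_beta)

lemma padic_abs_of_int_le_1:
  assumes p: "prime p" shows "padic_abs p (of_int a) \<le> 1"
proof (cases "a = 0")
  case False
  have "real p > 1" using prime_gt_1_nat[OF p] by simp
  then show ?thesis using padic_abs_divide[OF p False, of 1] 
    by (simp add: power_int_minus inverse_le_1_iff)
qed auto

lemma padic_abs_of_prime: "prime p \<Longrightarrow> padic_abs p (of_nat p) = 1 / real p"
  using padic_abs_divide[of p "int p" 1]
  by (simp add: prime_gt_0_nat power_int_minus field_simps)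

lemma padic_abs_inverse:
  assumes p: "prime p" shows "padic_abs p (inverse x) = inverse (padic_abs p x)"
proof (cases "x = 0")
  case False
  then have "padic_abs p (inverse x) * padic_abs p x = 1"
    using padic_abs_mult[OF p, of "inverse x" x] by simp
  then show ?thesis by (metis inverse_unique mult.commute)
qed auto

lemma padic_abs_one_plus_le_1:
  assumes p: "prime p" and x: "padic_abs p x \<le> 1"
  shows "padic_abs p (1 + x) \<le> 1"
proof (cases "x = 0")
  case False
  obtain a b where ab: "quotient_of x = (a, b)" by fastforce
  have b: "b > 0" using ab quotient_of_denom_pos by blast
  have cop: "coprime a b" using ab quotient_of_coprime by blast
  have xe: "x = of_int a / of_int b" using ab quotient_of_div by blast
  have a: "a \<noteq> 0" using xe False by auto
  have p1: "real p > 1" using prime_gt_1_nat[OF p] by simp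
  have pu: "\<not> is_unit (int p)" using prime_gt_1_nat[OF p] by simp
  have "int (multiplicity (int p) b) - int (multiplicity (int p) a) \<le> 0"
  proof (rule ccontr)
    assume "\<not> ?thesis"
    then have "1 < real p powi (int (multiplicity (int p) b) - int (multiplicity (int p) a))"
      by (intro one_less_power_int[OF p1]) linarith
    then show False using x False by (simp add: padic_abs_def ab)
  qed
  then have le: "multiplicity (int p) b \<le> multiplicity (int p) a" by simp
  have mb: "multiplicity (int p) b = 0"
  proof (rule ccontr)
    assume "multiplicity (int p) b \<noteq> 0"
    then have "multiplicity (int p) b \<noteq> 0" "multiplicity (int p) a \<noteq> 0" using le by linarith+
    then have "int p dvd b" and "int p dvd a"
      using not_dvd_imp_multiplicity_0[of "int p" b] not_dvd_imp_multiplicity_0[of "int p" a] by auto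
    then show False using pu coprime_common_divisor[OF cop] by blast
  qed
  have e: "1 + x = of_int (a + b) * inverse (of_int b)" unfolding xe using b by (simp add: field_simps)
  have 1: "padic_abs p (of_int b) = 1"
    using padic_abs_divide[OF p, of b 1] b mb by simp
  have "padic_abs p (1 + x) = padic_abs p (of_int (a + b))"
    unfolding e padic_abs_mult[OF p] padic_abs_inverse[OF p] 1 by simp
  then show ?thesis using padic_abs_of_int_le_1[OF p, of "a + b"] by (simp only:)
qed auto

lemma padic_abs_ultrametric:
  assumes p: "prime p" shows "padic_abs p (x + y) \<le> max (padic_abs p x) (padic_abs p y)"
proof -
  have *: "padic_abs p (x + y) \<le> padic_abs p x" if "padic_abs p y \<le> padic_abs p x" for x y
  proof (cases "x = 0")
    case True
    then show ?thesis using that padic_abs_nonneg[of p y] by simp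
  next
    case False
    have pos: "padic_abs p x > 0" using padic_abs_pos[OF p False] .
    have e: "padic_abs p (y * inverse x) \<le> 1"
      unfolding padic_abs_mult[OF p] padic_abs_inverse[OF p] using that pos by (simp add: field_simps)
    have "x + y = x * (1 + y * inverse x)" using False by (simp add: field_simps)
    then have "padic_abs p (x + y) = padic_abs p x * padic_abs p (1 + y * inverse x)"
      using padic_abs_mult[OF p] by metis
    also have "\<dots> \<le> padic_abs p x * 1"
      using padic_abs_one_plus_le_1[OF p e] pos by (intro mult_left_mono) auto
    finally show ?thesis by simp
  qed
  show ?thesis
  proof (cases "padic_abs p y \<le> padic_abs p x")
    case True
    then show ?thesis using *[OF True] by simp
  next
    case False
    then have "padic_abs p (y + x) \<le> padic_abs p y" by (intro *) simp
    then show ?thesis using False by (simp add: add.commute[of x y])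
  qed
qed

lemma padic_abs_triangle:
  assumes p: "prime p" shows "padic_abs p (x + y) \<le> padic_abs p x + padic_abs p y"
  using padic_abs_ultrametric[OF p, of x y] padic_abs_nonneg[of p x] padic_abs_nonneg[of p y] by linarith

lemma padic_abs_diff_commute: "padic_abs p (x - y) = padic_abs p (y - x)"
  using padic_abs_minus[of p "x - y"] by simp

lemma padic_abs_diff_ineq:
  assumes p: "prime p" shows "\<bar>padic_abs p x - padic_abs p y\<bar> \<le> padic_abs p (x - y)"
proof -
  have "padic_abs p x \<le> padic_abs p (x - y) + padic_abs p y"
    using padic_abs_triangle[OF p, of "x - y" y] by simp
  moreover have "padic_abs p y \<le> padic_abs p (y - x) + padic_abs p x"
    using padic_abs_triangle[OF p, of "y - x" x] by simp
  ultimately show ?thesis unfolding padic_abs_diff_commute[of p y x] by linarith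
qed

definition padic_vanishes :: "nat \<Rightarrow> (nat \<Rightarrow> rat) \<Rightarrow> bool" where
  "padic_vanishes p X \<longleftrightarrow> (\<lambda>n. padic_abs p (X n)) \<longlonglongrightarrow> 0"

definition padic_cauchy :: "nat \<Rightarrow> (nat \<Rightarrow> rat) \<Rightarrow> bool" where
  "padic_cauchy p X \<longleftrightarrow>
     (\<forall>e>0. \<exists>K. \<forall>m\<ge>K. \<forall>n\<ge>K. padic_abs p (X m - X n) < e)"

lemma padic_cauchyE:
  assumes "padic_cauchy p X" "e > 0"
  obtains K where "\<And>m n. m \<ge> K \<Longrightarrow> n \<ge> K \<Longrightarrow> padic_abs p (X m - X n) < e"
  using assms unfolding padic_cauchy_def by blast

lemma padic_vanishes_const [simp]:
  "prime p \<Longrightarrow> padic_vanishes p (\<lambda>n. c) \<longleftrightarrow> c = 0"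
  by (auto simp: padic_vanishes_def padic_abs_eq_0_iff LIMSEQ_const_iff)

lemma padic_vanishes_minus: "padic_vanishes p X \<Longrightarrow> padic_vanishes p (\<lambda>n. - X n)"
  by (simp add: padic_vanishes_def)

lemma padic_vanishes_add:
  assumes p: "prime p" and "padic_vanishes p X" "padic_vanishes p Y"
  shows "padic_vanishes p (\<lambda>n. X n + Y n)"
  unfolding padic_vanishes_def
proof (rule tendsto_sandwich[OF _ _ tendsto_const])
  show "(\<lambda>n. padic_abs p (X n) + padic_abs p (Y n)) \<longlonglongrightarrow> 0"
    using tendsto_add[OF assms(2,3)[unfolded padic_vanishes_def]] by simp
qed (auto simp: padic_abs_nonneg padic_abs_triangle[OF p])

lemma padic_vanishes_diff:
  "prime p \<Longrightarrow> padic_vanishes p X \<Longrightarrow> padic_vanishes p Y \<Longrightarrow> padic_vanishes p (\<lambda>n. X n - Y n)"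
  using padic_vanishes_add[of p X "\<lambda>n. - Y n"] padic_vanishes_minus[of p Y] by simp

lemma padic_vanishes_mult_bounded:
  assumes p: "prime p" and b: "\<And>n. padic_abs p (X n) \<le> b" and "padic_vanishes p Y"
  shows "padic_vanishes p (\<lambda>n. X n * Y n)"
  unfolding padic_vanishes_def
proof (rule tendsto_sandwich[OF _ _ tendsto_const])
  show "(\<lambda>n. b * padic_abs p (Y n)) \<longlonglongrightarrow> 0"
    using tendsto_mult_left[OF assms(3)[unfolded padic_vanishes_def], of b] by simp
  show "\<forall>\<^sub>F n in sequentially. padic_abs p (X n * Y n) \<le> b * padic_abs p (Y n)"
    by (intro always_eventually allI) (simp add: padic_abs_mult[OF p] mult_right_mono b padic_abs_nonneg)
qed (auto simp: padic_abs_nonneg)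

lemma padic_cauchy_const [simp]: "padic_cauchy p (\<lambda>n. c)"
  by (simp add: padic_cauchy_def)

lemma padic_cauchy_minus [simp]: "padic_cauchy p X \<Longrightarrow> padic_cauchy p (\<lambda>n. - X n)"
proof -
  have "padic_abs p (- X m - - X n) = padic_abs p (X m - X n)" for m n
    using padic_abs_minus[of p "X m - X n"] by simp
  then show "padic_cauchy p X \<Longrightarrow> padic_cauchy p (\<lambda>n. - X n)"
    unfolding padic_cauchy_def by presburger
qed

lemma padic_cauchy_add:
  assumes p: "prime p" and X: "padic_cauchy p X" and Y: "padic_cauchy p Y"
  shows "padic_cauchy p (\<lambda>n. X n + Y n)"
  unfolding padic_cauchy_def
proof (intro allI impI)
  fix e :: real assume e: "e > 0"
  obtain K where K: "\<And>m n. m \<ge> K \<Longrightarrow> n \<ge> K \<Longrightarrow> padic_abs p (X m - X n) < e"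
    using padic_cauchyE[OF X e] by blast
  obtain L where L: "\<And>m n. m \<ge> L \<Longrightarrow> n \<ge> L \<Longrightarrow> padic_abs p (Y m - Y n) < e"
    using padic_cauchyE[OF Y e] by blast
  have "padic_abs p (X m + Y m - (X n + Y n)) < e" if "m \<ge> max K L" "n \<ge> max K L" for m n
  proof -
    have "padic_abs p ((X m - X n) + (Y m - Y n)) \<le> max (padic_abs p (X m - X n)) (padic_abs p (Y m - Y n))"
      by (rule padic_abs_ultrametric[OF p])
    moreover have "padic_abs p (X m - X n) < e" "padic_abs p (Y m - Y n) < e" using K L that by auto
    moreover have eq: "X m + Y m - (X n + Y n) = (X m - X n) + (Y m - Y n)" by simp
    ultimately show ?thesis unfolding eq by linarith
  qed
  then show "\<exists>K. \<forall>m\<ge>K. \<forall>n\<ge>K. padic_abs p (X m + Y m - (X n + Y n)) < e" by blast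
qed

lemma padic_cauchy_bounded:
  assumes p: "prime p" and X: "padic_cauchy p X"
  obtains b where "b > 0" "\<And>n. padic_abs p (X n) \<le> b"
proof -
  obtain K where K: "\<And>m n. m \<ge> K \<Longrightarrow> n \<ge> K \<Longrightarrow> padic_abs p (X m - X n) < 1"
    using padic_cauchyE[OF X, of 1] by auto
  define b where "b = 1 + (\<Sum>n\<le>K. padic_abs p (X n))"
  have s: "padic_abs p (X n) \<le> (\<Sum>n\<le>K. padic_abs p (X n))" if "n \<le> K" for n
    using that by (intro member_le_sum) (auto simp: padic_abs_nonneg)
  show thesis
  proof (rule that)
    show "b > 0" unfolding b_def using sum_nonneg[of "{..K}" "\<lambda>n. padic_abs p (X n)"]
      by (simp add: padic_abs_nonneg)
    fix n show "padic_abs p (X n) \<le> b"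
    proof (cases "n \<le> K")
      case True then show ?thesis using s[OF True] by (simp add: b_def)
    next
      case False
      then have "padic_abs p (X n - X K) < 1" using K by auto
      moreover have "padic_abs p (X n - X K + X K) \<le> padic_abs p (X n - X K) + padic_abs p (X K)"
        by (rule padic_abs_triangle[OF p])
      ultimately show ?thesis using s[of K] by (simp add: b_def)
    qed
  qed
qed

lemma padic_cauchy_mult:
  assumes p: "prime p" and X: "padic_cauchy p X" and Y: "padic_cauchy p Y"
  shows "padic_cauchy p (\<lambda>n. X n * Y n)"
  unfolding padic_cauchy_def
proof (intro allI impI)
  fix e :: real assume e: "e > 0"
  obtain a where a: "a > 0" "\<And>n. padic_abs p (X n) \<le> a" using padic_cauchy_bounded[OF p X] by metis
  obtain b where b: "b > 0" "\<And>n. padic_abs p (Y n) \<le> b" using padic_cauchy_bounded[OF p Y] by metis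
  obtain K where K: "\<And>m n. m \<ge> K \<Longrightarrow> n \<ge> K \<Longrightarrow> padic_abs p (X m - X n) < e / b"
    using padic_cauchyE[OF X divide_pos_pos[OF e b(1)]] by blast
  obtain L where L: "\<And>m n. m \<ge> L \<Longrightarrow> n \<ge> L \<Longrightarrow> padic_abs p (Y m - Y n) < e / a"
    using padic_cauchyE[OF Y divide_pos_pos[OF e a(1)]] by blast
  have "padic_abs p (X m * Y m - X n * Y n) < e" if "m \<ge> max K L" "n \<ge> max K L" for m n
  proof -
    have "padic_abs p (X m * (Y m - Y n)) \<le> a * padic_abs p (Y m - Y n)"
      using a by (simp add: padic_abs_mult[OF p] mult_right_mono padic_abs_nonneg)
    also have "\<dots> < e" using L that a by (simp add: field_simps)
    finally have 1: "padic_abs p (X m * (Y m - Y n)) < e" .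
    have "padic_abs p ((X m - X n) * Y n) \<le> padic_abs p (X m - X n) * b"
      using b by (simp add: padic_abs_mult[OF p] mult_left_mono padic_abs_nonneg)
    also have "\<dots> < e" using K that b by (simp add: field_simps)
    finally have 2: "padic_abs p ((X m - X n) * Y n) < e" .
    have "X m * Y m - X n * Y n = X m * (Y m - Y n) + (X m - X n) * Y n"
      by (simp add: algebra_simps)
    then show ?thesis
      using padic_abs_ultrametric[OF p, of "X m * (Y m - Y n)" "(X m - X n) * Y n"] 1 2 by simp
  qed
  then show "\<exists>K. \<forall>m\<ge>K. \<forall>n\<ge>K. padic_abs p (X m * Y m - X n * Y n) < e" by blast
qed

lemma padic_cauchy_convergent_abs:
  assumes p: "prime p" and X: "padic_cauchy p X"
  shows "convergent (\<lambda>n. padic_abs p (X n))"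
proof (rule Cauchy_convergent, rule CauchyI)
  fix e :: real assume "e > 0"
  then obtain K where "\<forall>m\<ge>K. \<forall>n\<ge>K. padic_abs p (X m - X n) < e"
    using X unfolding padic_cauchy_def by blast
  then show "\<exists>K. \<forall>m\<ge>K. \<forall>n\<ge>K. norm (padic_abs p (X m) - padic_abs p (X n)) < e"
    using padic_abs_diff_ineq[OF p] by (metis le_less_trans real_norm_def)
qed

lemma padic_cauchy_LIMSEQ_abs:
  "prime p \<Longrightarrow> padic_cauchy p X \<Longrightarrow> (\<lambda>n. padic_abs p (X n)) \<longlonglongrightarrow> lim (\<lambda>n. padic_abs p (X n))"
  using padic_cauchy_convergent_abs convergent_LIMSEQ_iff by blast

lemma padic_cauchy_not_vanishes:
  assumes p: "prime p" and X: "padic_cauchy p X" and nz: "\<not> padic_vanishes p X"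
  obtains b K where "b > 0" "\<And>n. n \<ge> K \<Longrightarrow> b < padic_abs p (X n)"
proof -
  define l where "l = lim (\<lambda>n. padic_abs p (X n))"
  have l: "(\<lambda>n. padic_abs p (X n)) \<longlonglongrightarrow> l"
    unfolding l_def by (rule padic_cauchy_LIMSEQ_abs[OF p X])
  have "l \<noteq> 0" using l nz unfolding padic_vanishes_def by auto
  moreover have "l \<ge> 0" using LIMSEQ_le_const[OF l] padic_abs_nonneg by blast
  ultimately have "l > 0" by simp
  then have "\<forall>\<^sub>F n in sequentially. l / 2 < padic_abs p (X n)"
    by (intro order_tendstoD(1)[OF l]) simp
  then show thesis using that[of "l / 2"] \<open>l > 0\<close> by (auto simp: eventually_sequentially)
qed

lemma padic_inverse_diff_bound:
  assumes p: "prime p" and "b > 0" "b < padic_abs p x" "c > 0" "c < padic_abs p y"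
  shows "padic_abs p (inverse x - inverse y) \<le> padic_abs p (x - y) / (b * c)"
proof -
  have nz: "x \<noteq> 0" "y \<noteq> 0" using assms by auto
  have "inverse x - inverse y = (y - x) * inverse x * inverse y" using nz by (simp add: field_simps)
  then have "padic_abs p (inverse x - inverse y) = padic_abs p (x - y) / (padic_abs p x * padic_abs p y)"
    by (simp add: padic_abs_mult[OF p] padic_abs_inverse[OF p] padic_abs_diff_commute[of p x y] divide_inverse)
  also have "\<dots> \<le> padic_abs p (x - y) / (b * c)"
    using assms by (intro divide_left_mono mult_mono mult_pos_pos) (auto simp: padic_abs_nonneg)
  finally show ?thesis .
qed

lemma padic_cauchy_inverse:
  assumes p: "prime p" and X: "padic_cauchy p X" and nz: "\<not> padic_vanishes p X"
  shows "padic_cauchy p (\<lambda>n. inverse (X n))"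
  unfolding padic_cauchy_def
proof (intro allI impI)
  fix e :: real assume e: "e > 0"
  obtain b L where b: "b > 0" and L: "\<And>n. n \<ge> L \<Longrightarrow> b < padic_abs p (X n)"
    using padic_cauchy_not_vanishes[OF p X nz] by metis
  have pos: "e * (b * b) > 0" using e b by simp
  obtain K where K: "\<And>m n. m \<ge> K \<Longrightarrow> n \<ge> K \<Longrightarrow> padic_abs p (X m - X n) < e * (b * b)"
    using padic_cauchyE[OF X pos] by blast
  have "padic_abs p (inverse (X m) - inverse (X n)) < e" if "m \<ge> max K L" "n \<ge> max K L" for m n
  proof -
    have "padic_abs p (inverse (X m) - inverse (X n)) \<le> padic_abs p (X m - X n) / (b * b)"
      using that b L by (intro padic_inverse_diff_bound[OF p]) auto
    also have "\<dots> < e" using K that b by (simp add: pos_divide_less_eq)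
    finally show ?thesis .
  qed
  then show "\<exists>K. \<forall>m\<ge>K. \<forall>n\<ge>K. padic_abs p (inverse (X m) - inverse (X n)) < e" by blast
qed

lemma padic_vanishes_diff_inverse:
  assumes p: "prime p" and X: "padic_cauchy p X" "\<not> padic_vanishes p X"
    and Y: "padic_cauchy p Y" "\<not> padic_vanishes p Y"
    and XY: "padic_vanishes p (\<lambda>n. X n - Y n)"
  shows "padic_vanishes p (\<lambda>n. inverse (X n) - inverse (Y n))"
proof -
  obtain b K where b: "b > 0" and K: "\<And>n. n \<ge> K \<Longrightarrow> b < padic_abs p (X n)"
    using padic_cauchy_not_vanishes[OF p X] by metis
  obtain c L where c: "c > 0" and L: "\<And>n. n \<ge> L \<Longrightarrow> c < padic_abs p (Y n)"
    using padic_cauchy_not_vanishes[OF p Y] by metis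
  show ?thesis unfolding padic_vanishes_def
  proof (rule tendsto_sandwich[OF _ _ tendsto_const])
    show "(\<lambda>n. padic_abs p (X n - Y n) / (b * c)) \<longlonglongrightarrow> 0"
      using tendsto_divide[OF XY[unfolded padic_vanishes_def] tendsto_const, of "b * c"] b c by simp
    show "\<forall>\<^sub>F n in sequentially. padic_abs p (inverse (X n) - inverse (Y n)) \<le> padic_abs p (X n - Y n) / (b * c)"
      unfolding eventually_sequentially
      using padic_inverse_diff_bound[OF p b _ c] K L by (intro exI[of _ "max K L"]) auto
  qed (auto simp: padic_abs_nonneg)
qed

definition padic_rel :: "'p::prime_card itself \<Rightarrow> (nat \<Rightarrow> rat) \<Rightarrow> (nat \<Rightarrow> rat) \<Rightarrow> bool" where
  "padic_rel _ X Y \<longleftrightarrow> padic_cauchy CARD('p) X \<and> padic_cauchy CARD('p) Y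
     \<and> padic_vanishes CARD('p) (\<lambda>n. X n - Y n)"

lemma part_equivp_padic_rel: "part_equivp (padic_rel TYPE('p::prime_card))"
proof (rule part_equivpI)
  have p: "prime CARD('p)" by (rule prime_card)
  show "\<exists>X. padic_rel TYPE('p) X X"
    by (rule exI[of _ "\<lambda>n. 0"]) (simp add: padic_rel_def p)
  show "symp (padic_rel TYPE('p))"
    by (rule sympI) (auto simp: padic_rel_def dest: padic_vanishes_minus)
  show "transp (padic_rel TYPE('p))"
  proof (rule transpI)
    fix X Y Z assume "padic_rel TYPE('p) X Y" "padic_rel TYPE('p) Y Z"
    then show "padic_rel TYPE('p) X Z"
      using padic_vanishes_add[OF p, of "\<lambda>n. X n - Y n" "\<lambda>n. Y n - Z n"]
      by (simp add: padic_rel_def)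
  qed
qed

typedef (overloaded) 'p padic =
  "{C. \<exists>X. padic_rel TYPE('p::prime_card) X X \<and> C = Collect (padic_rel TYPE('p) X)}"
  morphisms class_of_padic padic_of_class
  using part_equivp_padic_rel[where 'p = 'p] unfolding part_equivp_def by blast

definition Padic :: "(nat \<Rightarrow> rat) \<Rightarrow> 'p::prime_card padic" where
  "Padic X = padic_of_class (Collect (padic_rel TYPE('p) X))"

definition rep_padic :: "'p::prime_card padic \<Rightarrow> nat \<Rightarrow> rat" where
  "rep_padic x = (SOME X. padic_cauchy CARD('p) X \<and> Padic X = x)"

lemma eq_Padic:
  assumes X: "padic_cauchy CARD('p) X" and Y: "padic_cauchy CARD('p) Y"
  shows "(Padic X :: 'p::prime_card padic) = Padic Y \<longleftrightarrow> padic_vanishes CARD('p) (\<lambda>n. X n - Y n)"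
proof -
  have p: "prime CARD('p)" by (rule prime_card)
  have r: "padic_rel TYPE('p) X X" "padic_rel TYPE('p) Y Y" using X Y by (simp_all add: padic_rel_def p)
  then have "(Padic X :: 'p padic) = Padic Y
    \<longleftrightarrow> Collect (padic_rel TYPE('p) X) = Collect (padic_rel TYPE('p) Y)"
    unfolding Padic_def by (intro padic_of_class_inject) auto
  also have "\<dots> \<longleftrightarrow> padic_rel TYPE('p) X Y"
    using part_equivp_padic_rel[where 'p = 'p, unfolded part_equivp_def, THEN conjunct2, rule_format, of X Y] r
    by (metis Collect_inj)
  finally show ?thesis using X Y by (simp add: padic_rel_def)
qed

lemma Padic_cases [cases type: padic]:
  obtains X where "padic_cauchy CARD('p) X" "(x :: 'p::prime_card padic) = Padic X"
proof -
  obtain X where X: "padic_rel TYPE('p) X X" "class_of_padic x = Collect (padic_rel TYPE('p) X)"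
    using class_of_padic[of x] by auto
  then have "x = Padic X" unfolding Padic_def by (metis class_of_padic_inverse)
  moreover have "padic_cauchy CARD('p) X" using X(1) by (simp add: padic_rel_def)
  ultimately show thesis by (rule that[rotated])
qed

lemma rep_padic: "padic_cauchy CARD('p) (rep_padic x)" "Padic (rep_padic x) = (x :: 'p::prime_card padic)"
proof -
  obtain X where "padic_cauchy CARD('p) X" "x = Padic X" by (rule Padic_cases)
  then have "\<exists>X. padic_cauchy CARD('p) X \<and> Padic X = x" by (intro exI[of _ X]) simp
  then have "padic_cauchy CARD('p) (rep_padic x) \<and> Padic (rep_padic x) = x"
    unfolding rep_padic_def by (rule someI_ex)
  then show "padic_cauchy CARD('p) (rep_padic x)" "Padic (rep_padic x) = x"
    by simp_all
qed

lemma rep_Padic: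
  assumes "padic_cauchy CARD('p) X"
  shows "padic_vanishes CARD('p) (\<lambda>n. rep_padic (Padic X :: 'p::prime_card padic) n - X n)"
  using eq_Padic[OF rep_padic(1) assms] rep_padic(2) by blast

instantiation padic :: (prime_card) field
begin

definition zero_padic :: "'a padic" where "0 = Padic (\<lambda>n. 0)"

definition one_padic :: "'a padic" where "1 = Padic (\<lambda>n. 1)"

definition plus_padic :: "'a padic \<Rightarrow> 'a padic \<Rightarrow> 'a padic" where
  "x + y = Padic (\<lambda>n. rep_padic x n + rep_padic y n)"

definition uminus_padic :: "'a padic \<Rightarrow> 'a padic" where
  "- x = Padic (\<lambda>n. - rep_padic x n)"

definition times_padic :: "'a padic \<Rightarrow> 'a padic \<Rightarrow> 'a padic" where
  "x * y = Padic (\<lambda>n. rep_padic x n * rep_padic y n)"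

definition inverse_padic :: "'a padic \<Rightarrow> 'a padic" where
  "inverse x = (if x = 0 then 0 else Padic (\<lambda>n. inverse (rep_padic x n)))"

definition "x - y = x + - y" for x y :: "'a padic"

definition "x div y = x * inverse y" for x y :: "'a padic"

lemma add_Padic:
  assumes X: "padic_cauchy CARD('a) X" and Y: "padic_cauchy CARD('a) Y"
  shows "Padic X + Padic Y = (Padic (\<lambda>n. X n + Y n) :: 'a padic)"
proof -
  have p: "prime CARD('a)" by (rule prime_card)
  show ?thesis unfolding plus_padic_def
    using padic_vanishes_add[OF p rep_Padic[OF X] rep_Padic[OF Y]]
    by (simp add: eq_Padic padic_cauchy_add[OF p] rep_padic X Y algebra_simps)
qed

lemma minus_Padic:
  assumes X: "padic_cauchy CARD('a) X"
  shows "- Padic X = (Padic (\<lambda>n. - X n) :: 'a padic)"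
  unfolding uminus_padic_def using padic_vanishes_minus[OF rep_Padic[OF X]]
  by (simp add: eq_Padic rep_padic X)

lemma mult_Padic:
  assumes X: "padic_cauchy CARD('a) X" and Y: "padic_cauchy CARD('a) Y"
  shows "Padic X * Padic Y = (Padic (\<lambda>n. X n * Y n) :: 'a padic)"
proof -
  have p: "prime CARD('a)" by (rule prime_card)
  define X' where "X' = rep_padic (Padic X :: 'a padic)"
  define Y' where "Y' = rep_padic (Padic Y :: 'a padic)"
  have X': "padic_cauchy CARD('a) X'" and Y': "padic_cauchy CARD('a) Y'"
    unfolding X'_def Y'_def by (rule rep_padic)+
  obtain b where b: "\<And>n. padic_abs CARD('a) (X' n) \<le> b" using padic_cauchy_bounded[OF p X'] by metis
  obtain c where c: "\<And>n. padic_abs CARD('a) (Y n) \<le> c" using padic_cauchy_bounded[OF p Y] by metis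
  have "padic_vanishes CARD('a) (\<lambda>n. X' n * (Y' n - Y n) + Y n * (X' n - X n))"
    unfolding X'_def Y'_def
    by (intro padic_vanishes_add[OF p] padic_vanishes_mult_bounded[OF p, of _ b]
        padic_vanishes_mult_bounded[OF p, of _ c] b[unfolded X'_def] c rep_Padic X Y)
  then have "padic_vanishes CARD('a) (\<lambda>n. X' n * Y' n - X n * Y n)"
    by (simp add: algebra_simps)
  then show ?thesis unfolding times_padic_def X'_def[symmetric] Y'_def[symmetric]
    by (simp add: eq_Padic padic_cauchy_mult[OF p] X Y X' Y')
qed

lemma Padic_eq_0_iff:
  "padic_cauchy CARD('a) X \<Longrightarrow> (Padic X :: 'a padic) = 0 \<longleftrightarrow> padic_vanishes CARD('a) X"
  by (simp add: zero_padic_def eq_Padic)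

lemma inverse_Padic:
  assumes X: "padic_cauchy CARD('a) X" and nz: "\<not> padic_vanishes CARD('a) X"
  shows "inverse (Padic X) = (Padic (\<lambda>n. inverse (X n)) :: 'a padic)"
proof -
  have p: "prime CARD('a)" by (rule prime_card)
  have nz': "(Padic X :: 'a padic) \<noteq> 0" using X nz by (simp add: Padic_eq_0_iff)
  then have r: "\<not> padic_vanishes CARD('a) (rep_padic (Padic X :: 'a padic))"
    using Padic_eq_0_iff[OF rep_padic(1), of "Padic X :: 'a padic"] by (simp add: rep_padic(2))
  show ?thesis unfolding inverse_padic_def
    using nz' padic_vanishes_diff_inverse[OF p rep_padic(1) r X nz rep_Padic[OF X]]
    by (simp add: eq_Padic padic_cauchy_inverse[OF p] rep_padic X nz r)
qed

instance
proof
  have p: "prime CARD('a)" by (rule prime_card)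
  fix a b c :: "'a padic"
  note s = p padic_cauchy_add[OF p] padic_cauchy_mult[OF p] add_Padic mult_Padic minus_Padic
    zero_padic_def one_padic_def
  show "a + b = b + a" by (cases a; cases b) (simp add: s ac_simps)
  show "(a + b) + c = a + (b + c)" by (cases a; cases b; cases c) (simp add: s ac_simps)
  show "0 + a = a" by (cases a) (simp add: s)
  show "- a + a = 0" by (cases a) (simp add: s)
  show "a - b = a + - b" by (rule minus_padic_def)
  show "(a * b) * c = a * (b * c)" by (cases a; cases b; cases c) (simp add: s ac_simps)
  show "a * b = b * a" by (cases a; cases b) (simp add: s ac_simps)
  show "1 * a = a" by (cases a) (simp add: s)
  show "(a + b) * c = a * c + b * c" by (cases a; cases b; cases c) (simp add: s distrib_right)
  show "(0::'a padic) \<noteq> 1" by (simp add: zero_padic_def one_padic_def eq_Padic p)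
  show "a div b = a * inverse b" by (rule divide_padic_def)
  show "inverse (0::'a padic) = 0" by (simp add: inverse_padic_def)
  show "inverse a * a = 1" if "a \<noteq> 0"
  proof (cases a)
    case (1 X)
    then have X: "padic_cauchy CARD('a) X" "\<not> padic_vanishes CARD('a) X"
      using that by (auto simp: Padic_eq_0_iff)
    obtain b K where "b > 0" and "\<And>n. n \<ge> K \<Longrightarrow> b < padic_abs CARD('a) (X n)"
      using padic_cauchy_not_vanishes[OF p X] by metis
    then have "X n \<noteq> 0" if "n \<ge> K" for n using that by force
    then have "\<forall>\<^sub>F n in sequentially. padic_abs CARD('a) (inverse (X n) * X n - 1) = 0"
      unfolding eventually_sequentially by (intro exI[of _ K]) auto
    then have "padic_vanishes CARD('a) (\<lambda>n. inverse (X n) * X n - 1)"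
      unfolding padic_vanishes_def by (rule tendsto_eventually)
    then show ?thesis using X
      by (simp add: 1 inverse_Padic mult_Padic padic_cauchy_inverse[OF p] padic_cauchy_mult[OF p]
          one_padic_def eq_Padic)
  qed
qed

end

definition pnorm :: "'p::prime_card padic \<Rightarrow> real" where
  "pnorm x = lim (\<lambda>n. padic_abs CARD('p) (rep_padic x n))"

lemma LIMSEQ_pnorm_Padic:
  assumes X: "padic_cauchy CARD('p) X"
  shows "(\<lambda>n. padic_abs CARD('p) (X n)) \<longlonglongrightarrow> pnorm (Padic X :: 'p::prime_card padic)"
proof -
  have p: "prime CARD('p)" by (rule prime_card)
  define Y where "Y = rep_padic (Padic X :: 'p padic)"
  have "(\<lambda>n. padic_abs CARD('p) (Y n)) \<longlonglongrightarrow> pnorm (Padic X :: 'p padic)"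
    unfolding pnorm_def Y_def by (intro padic_cauchy_LIMSEQ_abs[OF p] rep_padic)
  moreover have "(\<lambda>n. padic_abs CARD('p) (Y n) - padic_abs CARD('p) (X n)) \<longlonglongrightarrow> 0"
  proof (rule Lim_null_comparison)
    show "(\<lambda>n. padic_abs CARD('p) (Y n - X n)) \<longlonglongrightarrow> 0"
      using rep_Padic[OF X] by (simp add: padic_vanishes_def Y_def)
  qed (simp add: padic_abs_diff_ineq[OF p])
  ultimately show ?thesis using tendsto_diff by fastforce
qed

lemma pnorm_mult: "pnorm (x * y) = pnorm x * pnorm (y :: 'p::prime_card padic)"
proof -
  have p: "prime CARD('p)" by (rule prime_card)
  obtain X where X: "padic_cauchy CARD('p) X" "x = Padic X" by (cases x)
  obtain Y where Y: "padic_cauchy CARD('p) Y" "y = Padic Y" by (cases y)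
  show ?thesis
    using LIMSEQ_unique[OF LIMSEQ_pnorm_Padic[OF padic_cauchy_mult[OF p X(1) Y(1)], unfolded padic_abs_mult[OF p]]
        tendsto_mult[OF LIMSEQ_pnorm_Padic[OF X(1)] LIMSEQ_pnorm_Padic[OF Y(1)]]] X Y
    by (simp add: mult_Padic)
qed

lemma pnorm_ultrametric: "pnorm (x + y) \<le> max (pnorm x) (pnorm (y :: 'p::prime_card padic))"
proof -
  have p: "prime CARD('p)" by (rule prime_card)
  obtain X where X: "padic_cauchy CARD('p) X" "x = Padic X" by (cases x)
  obtain Y where Y: "padic_cauchy CARD('p) Y" "y = Padic Y" by (cases y)
  have "pnorm (Padic (\<lambda>n. X n + Y n) :: 'p padic) \<le> max (pnorm (Padic X :: 'p padic)) (pnorm (Padic Y :: 'p padic))"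
    using padic_abs_ultrametric[OF p]
    by (intro LIMSEQ_le[OF LIMSEQ_pnorm_Padic[OF padic_cauchy_add[OF p X(1) Y(1)]]
        tendsto_max[OF LIMSEQ_pnorm_Padic[OF X(1)] LIMSEQ_pnorm_Padic[OF Y(1)]]]) auto
  then show ?thesis using X Y by (simp add: add_Padic)
qed

lemma pnorm_nonneg: "pnorm (x :: 'p::prime_card padic) \<ge> 0"
proof (cases x)
  case (1 X)
  show ?thesis unfolding 1(2)
    by (rule LIMSEQ_le_const[OF LIMSEQ_pnorm_Padic[OF 1(1)]]) (simp add: padic_abs_nonneg)
qed

lemma pnorm_eq_0_iff: "pnorm (x :: 'p::prime_card padic) = 0 \<longleftrightarrow> x = 0"
proof (cases x)
  case (1 X)
  show ?thesis using LIMSEQ_pnorm_Padic[OF 1(1)] LIMSEQ_unique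
    unfolding 1(2) Padic_eq_0_iff[OF 1(1)] padic_vanishes_def by metis
qed

lemma pnorm_minus: "pnorm (- x) = pnorm (x :: 'p::prime_card padic)"
proof (cases x)
  case (1 X)
  show ?thesis
    using LIMSEQ_unique[OF LIMSEQ_pnorm_Padic[OF padic_cauchy_minus[OF 1(1)]]] LIMSEQ_pnorm_Padic[OF 1(1)]
    by (simp add: 1 minus_Padic)
qed

instantiation padic :: (prime_card) metric_space
begin

definition dist_padic :: "'a padic \<Rightarrow> 'a padic \<Rightarrow> real" where
  "dist_padic x y = pnorm (x - y)"

definition uniformity_padic :: "('a padic \<times> 'a padic) filter" where
  "uniformity_padic = (INF e\<in>{0<..}. principal {(x, y). dist x y < e})"

definition open_padic :: "'a padic set \<Rightarrow> bool" where
  "open_padic U \<longleftrightarrow> (\<forall>x\<in>U. \<forall>\<^sub>F (x', y) in uniformity. x' = x \<longrightarrow> y \<in> U)"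

instance
proof
  fix x y z :: "'a padic"
  show "dist x y = 0 \<longleftrightarrow> x = y"
    by (simp add: dist_padic_def pnorm_eq_0_iff)
  have "pnorm ((x - z) + (z - y)) \<le> max (pnorm (x - z)) (pnorm (z - y))"
    by (rule pnorm_ultrametric)
  then have "pnorm (x - y) \<le> max (pnorm (x - z)) (pnorm (z - y))" by simp
  moreover have "pnorm (z - y) = pnorm (y - z)" using pnorm_minus[of "z - y"] by simp
  ultimately show "dist x y \<le> dist x z + dist y z"
    using pnorm_nonneg[of "x - z"] pnorm_nonneg[of "y - z"] by (simp add: dist_padic_def)
qed (simp_all add: uniformity_padic_def open_padic_def)

end

lemma of_nat_Padic: "of_nat k = (Padic (\<lambda>n. of_nat k) :: 'p::prime_card padic)"
  by (induction k) (simp_all add: zero_padic_def one_padic_def add_Padic)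

lemma pnorm_prime: "pnorm (of_nat CARD('p) :: 'p::prime_card padic) = 1 / real CARD('p)"
  using LIMSEQ_pnorm_Padic[where 'p = 'p, of "\<lambda>n. of_nat CARD('p)"]
  by (simp add: of_nat_Padic padic_abs_of_prime[OF prime_card] LIMSEQ_const_iff)

definition padic_ints :: "'p::prime_card padic set" where
  "padic_ints = {x. pnorm x \<le> 1}"

section \<open>The measures on finite matrices\<close>

text \<open>
  For measure theory an \<open>n \<times> n\<close> matrix is a function on the index set \<^term>\<open>ix n\<close> (extended by
  \<^const>\<open>undefined\<close>, as usual for \<^const>\<open>PiM\<close>); for algebra it is turned into a matrix by
  \<^const>\<open>Matrix.mat\<close>. The product sigma-algebra below is the Borel sigma-algebra of
  \<open>Mat(n, Q\<^sub>p)\<close>, because \<open>Q\<^sub>p\<close> is second countable.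
\<close>

abbreviation ix :: "nat \<Rightarrow> (nat \<times> nat) set" where
  "ix n \<equiv> {..<n} \<times> {..<n}"

definition mat_space :: "nat \<Rightarrow> (nat \<times> nat \<Rightarrow> 'p::prime_card padic) measure" where
  "mat_space n = PiM (ix n) (\<lambda>_. borel)"

definition vol :: "nat \<Rightarrow> (nat \<times> nat \<Rightarrow> 'p::prime_card padic) measure" where
  "vol n = (THE V. sets V = sets (mat_space n)
     \<and> (\<forall>w\<in>space (mat_space n). distr V (mat_space n) (\<lambda>z. \<lambda>ij\<in>ix n. z ij + w ij) = V)
     \<and> emeasure V (\<Pi>\<^sub>E ij\<in>ix n. padic_ints) = 1)"

definition GL_int :: "nat \<Rightarrow> 'p::prime_card padic Matrix.mat set" where
  "GL_int n = {A \<in> carrier_mat n n. elements_mat A \<subseteq> padic_ints \<and>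
     (\<exists>B\<in>carrier_mat n n. elements_mat B \<subseteq> padic_ints \<and> A * B = 1\<^sub>m n \<and> B * A = 1\<^sub>m n)}"

text \<open>
  The exponents \<open>k\<^sub>j\<close> range over the integers and \<open>-\<infinity>\<close>; the latter is \<^const>\<open>None\<close>, which is the
  least element in the order of \<^theory>\<open>HOL-Library.Option_ord\<close>.
\<close>

definition p_power_minus :: "int option \<Rightarrow> 'p::prime_card padic" where
  "p_power_minus k = (case k of None \<Rightarrow> 0 | Some m \<Rightarrow> of_nat CARD('p) powi (- m))"

definition singular_exponents ::
  "nat \<Rightarrow> (nat \<times> nat \<Rightarrow> 'p::prime_card padic) \<Rightarrow> (nat \<Rightarrow> int option) \<Rightarrow> bool" where
  "singular_exponents n z k \<longleftrightarrow>
     (\<forall>i j. i \<le> j \<and> j < n \<longrightarrow> k j \<le> k i) \<and>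
     (\<exists>A\<in>GL_int n. \<exists>B\<in>GL_int n.
        Matrix.mat n n z = A * mat_diag n (\<lambda>j. p_power_minus (k j)) * B)"

definition gamma :: "nat \<Rightarrow> (nat \<times> nat \<Rightarrow> 'p::prime_card padic) \<Rightarrow> real" where
  "gamma n z = (THE r. \<exists>k. singular_exponents n z k \<and>
     r = (\<Prod>j | j < n \<and> Some 0 < k j. real CARD('p) powi the (k j)))"

definition mu_const :: "'p::prime_card itself \<Rightarrow> nat \<Rightarrow> real \<Rightarrow> ennreal" where
  "mu_const _ n \<alpha> = (\<integral>\<^sup>+ z. ennreal (gamma n z powr (- \<alpha>)) \<partial>(vol n :: (nat \<times> nat \<Rightarrow> 'p padic) measure))"

definition mu :: "nat \<Rightarrow> real \<Rightarrow> (nat \<times> nat \<Rightarrow> 'p::prime_card padic) measure" where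
  "mu n s = density (vol n)
     (\<lambda>z. ennreal (gamma n z powr (- s - 2 * real n)) / mu_const TYPE('p) n (s + 2 * real n))"

section \<open>The measure on infinite matrices\<close>

definition inf_mat_space :: "(nat \<times> nat \<Rightarrow> 'p::prime_card padic) measure" where
  "inf_mat_space = PiM UNIV (\<lambda>_. borel)"

text \<open>
  The projective limit of the measures \<^term>\<open>mu n s\<close> is specified by its defining property; at most
  one measure has it, because the cylinder sets generate the sigma-algebra.
\<close>

definition is_mu_inf :: "real \<Rightarrow> (nat \<times> nat \<Rightarrow> 'p::prime_card padic) measure \<Rightarrow> bool" where
  "is_mu_inf s M \<longleftrightarrow> prob_space M \<and> sets M = sets inf_mat_space \<and>
     (\<forall>n. distr M (mat_space n) (\<lambda>z. restrict z (ix n)) = mu n s)"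

section \<open>Groups of infinite matrices\<close>

text \<open>
  Indices start at 0. In \<^typ>\<open>nat + nat\<close>, the rows (columns) of the first block are indexed by
  \<^const>\<open>Inl\<close>, those of the second by \<^const>\<open>Inr\<close>. \<^const>\<open>Sum_any\<close> is the sum over all indices of a
  finitely supported family; in all products formed below the supports are finite.
\<close>

type_synonym 'p bmat = "(nat + nat) \<times> (nat + nat) \<Rightarrow> 'p padic"

definition mmul :: "('i \<times> 'k \<Rightarrow> 'a::semiring_0) \<Rightarrow> ('k \<times> 'j \<Rightarrow> 'a) \<Rightarrow> 'i \<times> 'j \<Rightarrow> 'a"
    (infixl \<open>\<star>\<close> 70) where
  "A \<star> B = (\<lambda>(i, j). Sum_any (\<lambda>k. A (i, k) * B (k, j)))"

definition mone :: "'i \<times> 'i \<Rightarrow> 'a::zero_neq_one" where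
  "mone = (\<lambda>(i, j). if i = j then 1 else 0)"

definition block_a :: "'p bmat \<Rightarrow> nat \<times> nat \<Rightarrow> 'p::prime_card padic" where
  "block_a g = (\<lambda>(i, j). g (Inl i, Inl j))"

definition block_b :: "'p bmat \<Rightarrow> nat \<times> nat \<Rightarrow> 'p::prime_card padic" where
  "block_b g = (\<lambda>(i, j). g (Inl i, Inr j))"

definition block_c :: "'p bmat \<Rightarrow> nat \<times> nat \<Rightarrow> 'p::prime_card padic" where
  "block_c g = (\<lambda>(i, j). g (Inr i, Inl j))"

definition block_d :: "'p bmat \<Rightarrow> nat \<times> nat \<Rightarrow> 'p::prime_card padic" where
  "block_d g = (\<lambda>(i, j). g (Inr i, Inr j))"

definition GL_2inf :: "'p::prime_card bmat set" where
  "GL_2inf = {g. range g \<subseteq> padic_ints \<and> finite {ij. g ij \<noteq> mone ij} \<and>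
     (\<exists>h. range h \<subseteq> padic_ints \<and> g \<star> h = mone \<and> h \<star> g = mone)}"

definition T_2inf :: "'p::prime_card bmat set" where
  "T_2inf = {g. range g \<subseteq> padic_ints \<and>
     (\<forall>i j. i < j \<longrightarrow> block_a g (i, j) = 0) \<and>
     (\<forall>i j. block_c g (i, j) = 0) \<and>
     (\<forall>i j. j < i \<longrightarrow> block_d g (i, j) = 0) \<and>
     (\<forall>j. pnorm (block_a g (j, j)) = 1 \<and> pnorm (block_d g (j, j)) = 1)}"

text \<open>
  The group generated by \<^const>\<open>GL_2inf\<close> and \<^const>\<open>T_2inf\<close>: both are closed under inverses and
  contain the identity, so the generated group consists of the finite products of their elements.
\<close>

inductive_set GL_bar :: "'p::prime_card bmat set" where
  GL_2inf: "g \<in> GL_2inf \<Longrightarrow> g \<in> GL_bar"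
| T_2inf: "g \<in> T_2inf \<Longrightarrow> g \<in> GL_bar"
| mult: "g \<in> GL_bar \<Longrightarrow> h \<in> GL_bar \<Longrightarrow> g \<star> h \<in> GL_bar"

section \<open>The action\<close>

definition denom :: "'p bmat \<Rightarrow> (nat \<times> nat \<Rightarrow> 'p padic) \<Rightarrow> nat \<times> nat \<Rightarrow> 'p::prime_card padic" where
  "denom g z = (\<lambda>ij. block_a g ij + (z \<star> block_c g) ij)"

definition numer :: "'p bmat \<Rightarrow> (nat \<times> nat \<Rightarrow> 'p padic) \<Rightarrow> nat \<times> nat \<Rightarrow> 'p::prime_card padic" where
  "numer g z = (\<lambda>ij. block_b g ij + (z \<star> block_d g) ij)"

text \<open>
  \<open>adapted g k\<close>: in blocks of size \<open>k + \<infinity>\<close> we have \<open>a\<^sub>1\<^sub>2 = 0\<close>, \<open>c\<^sub>1\<^sub>2 = c\<^sub>2\<^sub>1 = c\<^sub>2\<^sub>2 = 0\<close>, \<open>d\<^sub>2\<^sub>1 = 0\<close>, while \<open>a\<^sub>2\<^sub>2\<close> is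
  lower and \<open>d\<^sub>2\<^sub>2\<close> upper triangular with diagonal entries of norm 1. If \<open>k\<close> is adapted, so is \<open>k + 1\<close>.
\<close>

definition adapted :: "'p::prime_card bmat \<Rightarrow> nat \<Rightarrow> bool" where
  "adapted g k \<longleftrightarrow>
     (\<forall>i j. i < k \<and> k \<le> j \<longrightarrow> block_a g (i, j) = 0) \<and>
     (\<forall>i j. k \<le> i \<and> i < j \<longrightarrow> block_a g (i, j) = 0) \<and>
     (\<forall>i j. k \<le> i \<or> k \<le> j \<longrightarrow> block_c g (i, j) = 0) \<and>
     (\<forall>i j. k \<le> i \<and> j < k \<longrightarrow> block_d g (i, j) = 0) \<and>
     (\<forall>i j. k \<le> j \<and> j < i \<longrightarrow> block_d g (i, j) = 0) \<and>
     (\<forall>j\<ge>k. pnorm (block_a g (j, j)) = 1 \<and> pnorm (block_d g (j, j)) = 1)"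

text \<open>\<open>|det (a + zc)|\<close>, computed from the upper left corner of size \<open>k\<close>; every adapted \<open>k\<close> gives
  the same value.\<close>

definition abs_det :: "'p::prime_card bmat \<Rightarrow> (nat \<times> nat \<Rightarrow> 'p padic) \<Rightarrow> real" where
  "abs_det g z =
     (let k = (LEAST k. adapted g k) in pnorm (Determinant.det (Matrix.mat k k (denom g z))))"

text \<open>
  Inverses are taken among matrices with finite rows: there all products are finite sums and the
  inverse is unique, and \<open>a + zc\<close> is such a matrix.
\<close>

definition row_finite :: "(nat \<times> nat \<Rightarrow> 'a::zero) \<Rightarrow> bool" where
  "row_finite A \<longleftrightarrow> (\<forall>i. finite {j. A (i, j) \<noteq> 0})"

definition minv :: "(nat \<times> nat \<Rightarrow> 'a::semiring_1) \<Rightarrow> nat \<times> nat \<Rightarrow> 'a" where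
  "minv A = (THE X. row_finite X \<and> A \<star> X = mone \<and> X \<star> A = mone)"

definition act :: "'p bmat \<Rightarrow> (nat \<times> nat \<Rightarrow> 'p padic) \<Rightarrow> nat \<times> nat \<Rightarrow> 'p::prime_card padic" where
  "act g z = minv (denom g z) \<star> numer g z"

definition act_dom :: "'p::prime_card bmat \<Rightarrow> (nat \<times> nat \<Rightarrow> 'p padic) set" where
  "act_dom g = {z. abs_det g z \<noteq> 0}"

section \<open>Quasiinvariance\<close>

text \<open>
  \<open>\<phi>\<close> is an almost everywhere defined invertible transformation with domain \<open>D\<close>, it preserves the
  class of null sets, and \<open>d\<mu>(\<phi>(z)) = h(z) d\<mu>(z)\<close>.
\<close>

definition quasiinvariant :: "'a measure \<Rightarrow> 'a set \<Rightarrow> ('a \<Rightarrow> 'a) \<Rightarrow> ('a \<Rightarrow> real) \<Rightarrow> bool" where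
  "quasiinvariant M D \<phi> h \<longleftrightarrow>
     D \<in> sets M \<and> space M - D \<in> null_sets M \<and>
     \<phi> \<in> measurable (restrict_space M D) M \<and>
     inj_on \<phi> D \<and> space M - \<phi> ` D \<in> null_sets M \<and>
     (\<forall>B\<in>sets M. B \<subseteq> D \<longrightarrow>
        \<phi> ` B \<in> sets M \<and>
        (\<phi> ` B \<in> null_sets M \<longleftrightarrow> B \<in> null_sets M) \<and>
        emeasure M (\<phi> ` B) = (\<integral>\<^sup>+ z\<in>B. ennreal (h z) \<partial>M))"

end

theory Submission
  imports Defs "Jordan_Normal_Form.Char_Poly"
begin

text \<open>
  Let \<open>K = Mat(n, O\<^sub>p)\<close>. Up to a constant, \<^term>\<open>mu n s\<close> is the image of the measure
  \<open>1\<^sub>K(x) 1\<^sub>K(y) |det x|\<^sup>s dx dy\<close> under \<open>(x, y) \<mapsto> x\<inverse> y\<close>. If \<open>g\<close> is a \<open>2n \<times> 2n\<close> matrix invertible over the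
  integers, then \<open>(x, y) \<mapsto> (x, y) g\<close> preserves \<open>dx dy\<close> and \<open>K \<times> K\<close>, and for \<open>z = x\<inverse> y\<close> it is
  \<open>(x (a + z c), x (b + z d))\<close>. So it induces \<open>z \<mapsto> (a + z c)\<inverse> (b + z d)\<close> and multiplies the weight by
  \<open>|det (a + z c)|\<^sup>s\<close>, which is the theorem for finite matrices. On infinite matrices, \<open>g\<close> acts on all
  sufficiently large corners through its own corners, which are invertible over the integers, and the
  corners determine a measure.
\<close>

text \<open>Since \<open>vol\<close> and \<open>gamma\<close> are definite descriptions, both must
  first be shown to denote something. Haar measure is constructed from random digits and identified
  with \<open>vol\<close> by uniqueness; \<open>gamma\<close> is well defined because its n-th power
  is the index of a lattice in whose description the exponents do not occur. The exponent
  \<open>- s - 2 * n\<close> has two sources: the substitution \<open>y = x z\<close> contributes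
  \<open>|det x|^n\<close>, and passing to that lattice turns \<open>|det x|^(s+n)\<close> into
  \<open>gamma^(-s-n)\<close> with a Jacobian \<open>gamma^(-n)\<close>. For negative
  \<open>s\<close> the integrability of \<open>|det x|^s\<close> over \<open>K\<close> is never
  estimated directly: after the substitution only the exponent \<open>s + n\<close>, which is
  positive, remains, and there the integrand is at most 1 on \<open>K\<close>. On infinite matrices
  the inverse transformation is not taken from an inverse group element: the image is cut out by one
  finite determinant, and the inverse map is assembled from the inverses of the finite corners,
  whose compatibility comes from injectivity.\<close>

type_synonym 'p mfun = "nat \<times> nat \<Rightarrow> 'p padic"

section \<open>The norm and the ring of p-adic integers\<close>

lemma card_gt_1: "real CARD('p::prime_card) > 1"
  using prime_gt_1_nat[OF prime_card[where 'a = 'p]] by simp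

lemma card_pos: "real CARD('p::prime_card) > 0"
  using card_gt_1[where 'p = 'p] by linarith

lemma pnorm_0 [simp]: "pnorm (0 :: 'p::prime_card padic) = 0"
  by (simp add: pnorm_eq_0_iff)

lemma pnorm_1 [simp]: "pnorm (1 :: 'p::prime_card padic) = 1"
proof -
  have "pnorm (1 :: 'p padic) * pnorm (1 :: 'p padic) = pnorm (1 :: 'p padic)"
    by (simp flip: pnorm_mult)
  moreover have "pnorm (1 :: 'p padic) \<noteq> 0" by (simp add: pnorm_eq_0_iff)
  ultimately show ?thesis by simp
qed

lemma pnorm_inverse: "pnorm (inverse x) = inverse (pnorm (x :: 'p::prime_card padic))"
proof (cases "x = 0")
  case False
  then have "pnorm (inverse x) * pnorm x = 1" by (simp flip: pnorm_mult)
  then show ?thesis by (metis inverse_unique mult.commute)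
qed simp

lemma pnorm_divide: "pnorm (x / y) = pnorm x / pnorm (y :: 'p::prime_card padic)"
  by (simp add: divide_inverse pnorm_mult pnorm_inverse)

lemma pnorm_power: "pnorm (x ^ n) = pnorm (x :: 'p::prime_card padic) ^ n"
  by (induction n) (simp_all add: pnorm_mult)

lemma pnorm_prod: "pnorm (\<Prod>i\<in>I. f i) = (\<Prod>i\<in>I. pnorm (f i :: 'p::prime_card padic))"
  by (induction I rule: infinite_finite_induct) (simp_all add: pnorm_mult)

lemma pnorm_power_int: "pnorm (x powi k) = pnorm (x :: 'p::prime_card padic) powi k"
  by (simp add: power_int_def pnorm_power pnorm_inverse)

lemma pnorm_diff_commute: "pnorm (x - y) = pnorm (y - x :: 'p::prime_card padic)"
  using pnorm_minus[of "x - y"] by simp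

lemma pnorm_diff_ultrametric: "pnorm (x - y :: 'p::prime_card padic) \<le> max (pnorm x) (pnorm y)"
  using pnorm_ultrametric[of x "- y"] by (simp add: pnorm_minus)

lemma pnorm_add_le: "pnorm x \<le> b \<Longrightarrow> pnorm y \<le> b \<Longrightarrow> pnorm (x + y :: 'p::prime_card padic) \<le> b"
  using pnorm_ultrametric[of x y] by linarith

lemma pnorm_diff_le: "pnorm x \<le> b \<Longrightarrow> pnorm y \<le> b \<Longrightarrow> pnorm (x - y :: 'p::prime_card padic) \<le> b"
  using pnorm_diff_ultrametric[of x y] by linarith

lemma padic_ints_closed [intro, simp]:
  "0 \<in> padic_ints" "1 \<in> padic_ints"
  "x \<in> padic_ints \<Longrightarrow> y \<in> padic_ints \<Longrightarrow> x + y \<in> padic_ints"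
  "x \<in> padic_ints \<Longrightarrow> y \<in> padic_ints \<Longrightarrow> x - y \<in> padic_ints"
  "x \<in> padic_ints \<Longrightarrow> - x \<in> padic_ints"
  "x \<in> padic_ints \<Longrightarrow> y \<in> padic_ints \<Longrightarrow> x * y \<in> padic_ints"
  by (auto simp: padic_ints_def pnorm_add_le pnorm_diff_le pnorm_minus pnorm_mult mult_le_one pnorm_nonneg)

lemma padic_ints_sum: "(\<And>i. i \<in> I \<Longrightarrow> f i \<in> padic_ints) \<Longrightarrow> (\<Sum>i\<in>I. f i) \<in> padic_ints"
  by (induction I rule: infinite_finite_induct) auto

lemma padic_ints_prod: "(\<And>i. i \<in> I \<Longrightarrow> f i \<in> padic_ints) \<Longrightarrow> (\<Prod>i\<in>I. f i) \<in> padic_ints"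
  by (induction I rule: infinite_finite_induct) auto

section \<open>Values of the norm, density of the rationals, second countability\<close>

lemma pnorm_Padic_const: "pnorm (Padic (\<lambda>_. q) :: 'p::prime_card padic) = padic_abs CARD('p) q"
  using LIMSEQ_pnorm_Padic[where 'p = 'p and X = "\<lambda>_. q"] by (simp add: LIMSEQ_const_iff)

text \<open>A nonzero limit keeps the terms above some \<open>b\<close>, while their differences
  drop below \<open>b\<close>; the ultrametric inequality then makes the absolute values equal.
  Hence nonzero norms are integral powers of the prime (\<open>pnorm_value\<close>).\<close>

lemma pnorm_Padic_eventually:
  assumes X: "padic_cauchy CARD('p) X" and nz: "(Padic X :: 'p::prime_card padic) \<noteq> 0"
  shows "\<forall>\<^sub>F n in sequentially. padic_abs CARD('p) (X n) = pnorm (Padic X :: 'p padic)"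
proof -
  have p: "prime CARD('p)" by (rule prime_card)
  obtain b K where b: "b > 0" and K: "\<And>n. n \<ge> K \<Longrightarrow> b < padic_abs CARD('p) (X n)"
    using padic_cauchy_not_vanishes[OF p X] nz X Padic_eq_0_iff by blast
  obtain L where L: "\<And>m n. m \<ge> L \<Longrightarrow> n \<ge> L \<Longrightarrow> padic_abs CARD('p) (X m - X n) < b"
    using padic_cauchyE[OF X b] by blast
  have le: "padic_abs CARD('p) (X n) \<le> padic_abs CARD('p) (X m)" if "n \<ge> max K L" "m \<ge> max K L" for n m
  proof -
    have "padic_abs CARD('p) (X n - X m + X m) \<le> max (padic_abs CARD('p) (X n - X m)) (padic_abs CARD('p) (X m))"
      by (rule padic_abs_ultrametric[OF p])
    then have "padic_abs CARD('p) (X n) \<le> max (padic_abs CARD('p) (X n - X m)) (padic_abs CARD('p) (X m))"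
      by simp
    moreover have "padic_abs CARD('p) (X n - X m) < b" "b < padic_abs CARD('p) (X n)"
      using L[of n m] K[of n] that by auto
    ultimately show ?thesis by linarith
  qed
  have eq: "padic_abs CARD('p) (X n) = padic_abs CARD('p) (X m)" if "n \<ge> max K L" "m \<ge> max K L" for n m
    using le that by (intro order.antisym)
  have "(\<lambda>n. padic_abs CARD('p) (X n)) \<longlonglongrightarrow> padic_abs CARD('p) (X (max K L))"
    by (rule tendsto_eventually, unfold eventually_sequentially, rule exI[of _ "max K L"]) (blast intro: eq)
  then have "pnorm (Padic X :: 'p padic) = padic_abs CARD('p) (X (max K L))"
    using LIMSEQ_pnorm_Padic[OF X] LIMSEQ_unique by blast
  then show ?thesis unfolding eventually_sequentially by (intro exI[of _ "max K L"]) (metis eq order.refl)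
qed

lemma pnorm_value:
  assumes "(x :: 'p::prime_card padic) \<noteq> 0"
  obtains k :: int where "pnorm x = real CARD('p) powi k"
proof (cases x)
  case (1 X)
  obtain n where "padic_abs CARD('p) (X n) = pnorm x"
    using pnorm_Padic_eventually[OF 1(1)] assms 1 by (auto simp: eventually_sequentially)
  moreover have "pnorm x \<noteq> 0" using assms by (simp add: pnorm_eq_0_iff)
  moreover have "\<exists>k. padic_abs CARD('p) q = real CARD('p) powi k" if "q \<noteq> 0" for q
    using that by (auto simp: padic_abs_def)
  ultimately show thesis using that by (metis padic_abs_0)
qed

lemma padic_rat_dense:
  assumes "e > 0"
  obtains q where "pnorm (x - (Padic (\<lambda>_. q) :: 'p::prime_card padic)) < e"
proof (cases x)
  case (1 X)
  have p: "prime CARD('p)" by (rule prime_card)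
  \<comment> \<open>Half of \<open>e\<close>, because the limit preserves only weak
    inequalities.\<close>
  obtain K where K: "\<And>m n. m \<ge> K \<Longrightarrow> n \<ge> K \<Longrightarrow> padic_abs CARD('p) (X m - X n) < e / 2"
    using padic_cauchyE[OF 1(1) half_gt_zero[OF assms]] by blast
  have c: "padic_cauchy CARD('p) (\<lambda>n. X n + - X K)"
    by (intro padic_cauchy_add[OF p] 1) simp
  have "x - Padic (\<lambda>_. X K) = Padic (\<lambda>n. X n + - X K)"
    unfolding 1(2) diff_conv_add_uminus minus_Padic[OF padic_cauchy_const]
    by (rule add_Padic[OF 1(1)]) simp
  also have "pnorm \<dots> \<le> e / 2"
    by (rule LIMSEQ_le_const2[OF LIMSEQ_pnorm_Padic[OF c]])
       (use K in \<open>auto intro!: exI[of _ K] less_imp_le\<close>)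
  finally show thesis using that[of "X K"] assms by linarith
qed

text \<open>Second countability, for which this basis is built, makes pairs of Borel functions
  Borel; the measurability of sums and products rests on that.\<close>

lemma topological_basis_padic:
  "topological_basis (case_prod (\<lambda>q n. ball (Padic (\<lambda>_. q) :: 'p::prime_card padic) (1 / real (Suc n))) ` UNIV)"
proof (rule topological_basisI)
  fix U :: "'p padic set" and x assume "open U" "x \<in> U"
  then obtain e where e: "e > 0" "ball x e \<subseteq> U" using open_contains_ball by blast
  obtain n where n: "1 / real (Suc n) < e / 2" using nat_approx_posE[OF half_gt_zero[OF e(1)]] by blast
  obtain q where q: "pnorm (x - (Padic (\<lambda>_. q) :: 'p padic)) < 1 / real (Suc n)"
    using padic_rat_dense[of "1 / real (Suc n)" x] by auto
  let ?c = "Padic (\<lambda>_. q) :: 'p padic"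
  show "\<exists>B\<in>case_prod (\<lambda>q n. ball (Padic (\<lambda>_. q)) (1 / real (Suc n))) ` UNIV. x \<in> B \<and> B \<subseteq> U"
  proof (intro bexI[of _ "ball ?c (1 / real (Suc n))"] conjI)
    show xb: "x \<in> ball ?c (1 / real (Suc n))"
      using q by (simp add: dist_padic_def pnorm_diff_commute)
    have "ball ?c (1 / real (Suc n)) \<subseteq> ball x e"
    proof
      fix y assume "y \<in> ball ?c (1 / real (Suc n))"
      then show "y \<in> ball x e" using xb n
        dist_triangle[of x y ?c] by (auto simp: dist_commute)
    qed
    then show "ball ?c (1 / real (Suc n)) \<subseteq> U" using e by blast
  qed (auto intro!: image_eqI[of _ _ "(q, n)"])
qed auto

instance padic :: (prime_card) second_countable_topology
proof
  have "countable (case_prod (\<lambda>q n. ball (Padic (\<lambda>_. q) :: 'a padic) (1 / real (Suc n))) ` UNIV)"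
    by simp
  then show "\<exists>B :: 'a padic set set. countable B \<and> open = generate_topology B"
    using topological_basis_imp_subbasis[OF topological_basis_padic] by blast
qed

section \<open>Continuity and Borel measurability of the field operations\<close>

lemma tendsto_padic_iff:
  "(f \<longlongrightarrow> (l :: 'p::prime_card padic)) F \<longleftrightarrow> ((\<lambda>x. pnorm (f x - l)) \<longlongrightarrow> 0) F"
  using tendsto_dist_iff[of f l F] by (simp add: dist_padic_def)

lemma continuous_pnorm: "continuous_on UNIV (pnorm :: 'p::prime_card padic \<Rightarrow> real)"
proof -
  have "pnorm = (\<lambda>x :: 'p padic. dist x 0)" by (simp add: fun_eq_iff dist_padic_def)
  moreover have "continuous_on UNIV (\<lambda>x :: 'p padic. dist x 0)"
    by (intro continuous_on_dist continuous_on_const continuous_on_id)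
  ultimately show ?thesis by metis
qed

lemma continuous_padic_add:
  "continuous_on UNIV (\<lambda>x :: 'p::prime_card padic \<times> 'p padic. fst x + snd x)"
  unfolding continuous_on_def
proof (intro ballI)
  fix x :: "'p padic \<times> 'p padic"
  have f: "((\<lambda>y. pnorm (fst y - fst x)) \<longlongrightarrow> 0) (at x)" "((\<lambda>y. pnorm (snd y - snd x)) \<longlongrightarrow> 0) (at x)"
    by (rule tendsto_padic_iff[THEN iffD1], rule tendsto_fst[OF tendsto_ident_at],
        rule tendsto_padic_iff[THEN iffD1], rule tendsto_snd[OF tendsto_ident_at])
  show "((\<lambda>x. fst x + snd x) \<longlongrightarrow> fst x + snd x) (at x)"
    unfolding tendsto_padic_iff
  proof (rule tendsto_sandwich[OF _ _ tendsto_const])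
    show "((\<lambda>y. max (pnorm (fst y - fst x)) (pnorm (snd y - snd x))) \<longlongrightarrow> 0) (at x)"
      using tendsto_max[OF f] by simp
    show "\<forall>\<^sub>F y in at x. pnorm (fst y + snd y - (fst x + snd x)) \<le> max (pnorm (fst y - fst x)) (pnorm (snd y - snd x))"
      by (intro always_eventually allI) (metis add_diff_add pnorm_ultrametric)
  qed (simp add: pnorm_nonneg)
qed

lemma continuous_padic_mult:
  "continuous_on UNIV (\<lambda>x :: 'p::prime_card padic \<times> 'p padic. fst x * snd x)"
  unfolding continuous_on_def
proof (intro ballI)
  fix x :: "'p padic \<times> 'p padic"
  have f: "((\<lambda>y. pnorm (fst y - fst x)) \<longlongrightarrow> 0) (at x)" "((\<lambda>y. pnorm (snd y - snd x)) \<longlongrightarrow> 0) (at x)"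
    by (rule tendsto_padic_iff[THEN iffD1], rule tendsto_fst[OF tendsto_ident_at],
        rule tendsto_padic_iff[THEN iffD1], rule tendsto_snd[OF tendsto_ident_at])
  have g: "((\<lambda>y. pnorm (snd y)) \<longlongrightarrow> pnorm (snd x)) (at x)"
    by (rule continuous_on_tendsto_compose[OF continuous_pnorm tendsto_snd[OF tendsto_ident_at]]) simp_all
  show "((\<lambda>x. fst x * snd x) \<longlongrightarrow> fst x * snd x) (at x)"
    unfolding tendsto_padic_iff
  proof (rule tendsto_sandwich[OF _ _ tendsto_const])
    show "((\<lambda>y. max (pnorm (fst y - fst x) * pnorm (snd y)) (pnorm (fst x) * pnorm (snd y - snd x))) \<longlongrightarrow> 0) (at x)"
      using tendsto_max[OF tendsto_mult[OF f(1) g] tendsto_mult[OF tendsto_const f(2)]] by simp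
    have "fst y * snd y - fst x * snd x = (fst y - fst x) * snd y + fst x * (snd y - snd x)" for y
      by (simp add: algebra_simps)
    then have "pnorm (fst y * snd y - fst x * snd x) \<le> max (pnorm (fst y - fst x) * pnorm (snd y)) (pnorm (fst x) * pnorm (snd y - snd x))" for y
      by (metis pnorm_mult pnorm_ultrametric)
    then show "\<forall>\<^sub>F y in at x. pnorm (fst y * snd y - fst x * snd x) \<le> max (pnorm (fst y - fst x) * pnorm (snd y)) (pnorm (fst x) * pnorm (snd y - snd x))"
      by simp
  qed (simp add: pnorm_nonneg)
qed

lemma continuous_padic_inverse:
  "continuous_on (- {0}) (inverse :: 'p::prime_card padic \<Rightarrow> 'p padic)"
  unfolding continuous_on_def
proof (intro ballI)
  fix x :: "'p padic" assume x: "x \<in> - {0}"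
  have f: "((\<lambda>y. pnorm (y - x)) \<longlongrightarrow> 0) (at x within - {0})"
    by (rule tendsto_padic_iff[THEN iffD1], rule tendsto_ident_at)
  have g: "(pnorm \<longlongrightarrow> pnorm x) (at x within -{0})"
    by (rule continuous_on_tendsto_compose[OF continuous_pnorm tendsto_ident_at]) simp_all
  have nx: "pnorm x \<noteq> 0" using x by (simp add: pnorm_eq_0_iff)
  show "(inverse \<longlongrightarrow> inverse x) (at x within - {0})"
    unfolding tendsto_padic_iff
  proof (rule Lim_transform_eventually)
    show "((\<lambda>y. pnorm (y - x) / (pnorm y * pnorm x)) \<longlongrightarrow> 0) (at x within -{0})"
      using tendsto_divide[OF f tendsto_mult[OF g tendsto_const]] nx by auto
    show "\<forall>\<^sub>F y in at x within - {0}. pnorm (y - x) / (pnorm y * pnorm x) = pnorm (inverse y - inverse x)"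
      unfolding eventually_at_filter
    proof (intro always_eventually allI impI)
      fix y assume "y \<noteq> x" "y \<in> - {0}"
      then have "inverse y - inverse x = (x - y) / (y * x)" using x by (simp add: field_simps)
      then show "pnorm (y - x) / (pnorm y * pnorm x) = pnorm (inverse y - inverse x)"
        by (simp add: pnorm_divide pnorm_mult pnorm_diff_commute)
    qed
  qed
qed

lemma borel_measurable_pnorm [measurable]: "(pnorm :: 'p::prime_card padic \<Rightarrow> real) \<in> borel_measurable borel"
  by (rule borel_measurable_continuous_onI[OF continuous_pnorm])

lemma borel_measurable_padic_add [measurable]:
  fixes f g :: "_ \<Rightarrow> 'p::prime_card padic"
  assumes f: "f \<in> borel_measurable M" and g: "g \<in> borel_measurable M"
  shows "(\<lambda>x. f x + g x) \<in> borel_measurable M"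
  by (rule borel_measurable_continuous_Pair[OF f g continuous_padic_add[unfolded split_beta]])
     
lemma borel_measurable_padic_mult [measurable]:
  fixes f g :: "_ \<Rightarrow> 'p::prime_card padic"
  assumes f: "f \<in> borel_measurable M" and g: "g \<in> borel_measurable M"
  shows "(\<lambda>x. f x * g x) \<in> borel_measurable M"
  by (rule borel_measurable_continuous_Pair[OF f g continuous_padic_mult])

lemma borel_measurable_padic_uminus [measurable]:
  fixes f :: "_ \<Rightarrow> 'p::prime_card padic"
  assumes f [measurable]: "f \<in> borel_measurable M"
  shows "(\<lambda>x. - f x) \<in> borel_measurable M"
proof -
  have "(\<lambda>x. (-1) * f x) \<in> borel_measurable M" by measurable
  then show ?thesis by simp
qed

lemma borel_measurable_padic_diff [measurable]:
  fixes f g :: "_ \<Rightarrow> 'p::prime_card padic"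
  assumes [measurable]: "f \<in> borel_measurable M" "g \<in> borel_measurable M"
  shows "(\<lambda>x. f x - g x) \<in> borel_measurable M"
  unfolding diff_conv_add_uminus by measurable

lemma borel_measurable_padic_inverse [measurable]:
  fixes f :: "_ \<Rightarrow> 'p::prime_card padic"
  assumes f: "f \<in> borel_measurable M"
  shows "(\<lambda>x. inverse (f x)) \<in> borel_measurable M"
proof -
  have "inverse \<in> borel_measurable (borel :: 'p padic measure)"
  \<comment> \<open>The inverse is discontinuous at 0, where its value is 0 by convention, so
    \<open>- {0}\<close> and \<open>{0}\<close> are treated separately.\<close>
  proof (rule measurable_piecewise_restrict[of "{- {0}, {0}}"])
    show "inverse \<in> borel_measurable (restrict_space borel \<Omega>)" if "\<Omega> \<in> {- {0}, {0 :: 'p padic}}" for \<Omega>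
    proof -
      have "continuous_on \<Omega> (inverse :: 'p padic \<Rightarrow> 'p padic)"
        using that continuous_padic_inverse continuous_on_sing[of 0] by blast
      then show ?thesis by (rule borel_measurable_continuous_on_restrict)
    qed
  qed auto
  then show ?thesis using f by (rule measurable_compose_rev)
qed

lemma borel_measurable_padic_sum [measurable]:
  fixes f :: "'i \<Rightarrow> 'a \<Rightarrow> 'p::prime_card padic"
  assumes "\<And>i. i \<in> I \<Longrightarrow> f i \<in> borel_measurable M"
  shows "(\<lambda>x. \<Sum>i\<in>I. f i x) \<in> borel_measurable M"
  using assms by (induction I rule: infinite_finite_induct) auto

lemma borel_measurable_padic_prod [measurable]:
  fixes f :: "'i \<Rightarrow> 'a \<Rightarrow> 'p::prime_card padic"
  assumes "\<And>i. i \<in> I \<Longrightarrow> f i \<in> borel_measurable M"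
  shows "(\<lambda>x. \<Prod>i\<in>I. f i x) \<in> borel_measurable M"
  using assms by (induction I rule: infinite_finite_induct) auto

lemma padic_ints_borel [measurable]: "(padic_ints :: 'p::prime_card padic set) \<in> sets borel"
  unfolding padic_ints_def by measurable

subsection \<open>Residues\<close>

lemma of_int_Padic: "of_int a = (Padic (\<lambda>_. of_int a) :: 'p::prime_card padic)"
  by (cases a) (simp_all add: of_nat_Padic minus_Padic del: of_nat_Suc)

text \<open>Translates balls of radius \<open>p^(-k)\<close> around integers into congruences modulo
  \<open>p^k\<close>.\<close>

lemma pnorm_of_int_le_iff:
  "pnorm (of_int a :: 'p::prime_card padic) \<le> real CARD('p) powi (- int k) \<longleftrightarrow> int CARD('p) ^ k dvd a"
proof (cases "a = 0")
  case False
  have p: "prime CARD('p)" by (rule prime_card)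
  have "pnorm (of_int a :: 'p padic) = real CARD('p) powi (- int (multiplicity (int CARD('p)) a))"
    using padic_abs_divide[OF p False, of 1] by (simp add: of_int_Padic pnorm_Padic_const)
  then have "pnorm (of_int a :: 'p padic) \<le> real CARD('p) powi (- int k)
    \<longleftrightarrow> k \<le> multiplicity (int CARD('p)) a"
    using card_gt_1[where 'p='p] by (simp add: power_int_minus)
  also have "\<dots> \<longleftrightarrow> int CARD('p) ^ k dvd a"
    using False p prime_gt_1_nat[OF p] by (intro power_dvd_iff_le_multiplicity[symmetric]) auto
  finally show ?thesis .
qed (simp add: power_int_minus)

lemma of_int_padic_ints [simp]: "(of_int a :: 'p::prime_card padic) \<in> padic_ints"
  using pnorm_of_int_le_iff[of a 0, where 'p='p] by (simp add: padic_ints_def)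

lemma of_nat_padic_ints [simp]: "(of_nat a :: 'p::prime_card padic) \<in> padic_ints"
  using of_int_padic_ints[of "int a", where 'p='p] by simp

text \<open>A nearby rational \<open>a / b\<close> has norm at most 1, so in lowest terms
  \<open>b\<close> is prime to \<open>p\<close>; replacing the division by \<open>b\<close> with
  multiplication by its inverse \<open>c\<close> modulo \<open>p^k\<close> gives the integer
  \<open>a * c\<close>.\<close>

lemma padic_int_approx:
  assumes x: "(x :: 'p::prime_card padic) \<in> padic_ints"
  obtains m :: int where "pnorm (x - of_int m) \<le> real CARD('p) powi (- int k)"
proof -
  let ?p = "int CARD('p)" and ?e = "real CARD('p) powi (- int k)"
  have p: "prime CARD('p)" by (rule prime_card)
  have e: "?e > 0" "?e \<le> 1" using card_gt_1[where 'p='p] by (simp_all add: power_int_minus inverse_le_1_iff)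
  obtain q where q: "pnorm (x - (Padic (\<lambda>_. q) :: 'p padic)) < ?e" using padic_rat_dense[OF e(1)] .
  have "pnorm (Padic (\<lambda>_. q) :: 'p padic) \<le> 1"
    using pnorm_diff_le[of x 1 "x - (Padic (\<lambda>_. q) :: 'p padic)"] x q e by (simp add: padic_ints_def)
  then have q1: "padic_abs CARD('p) q \<le> 1" by (simp add: pnorm_Padic_const)
  obtain a b where ab: "quotient_of q = (a, b)" by fastforce
  have b: "b > 0" using ab quotient_of_denom_pos by blast
  have cop: "coprime a b" using ab quotient_of_coprime by blast
  have qe: "q = of_int a / of_int b" using ab quotient_of_div by blast
  have nd: "\<not> ?p dvd b"
  proof
    assume d: "?p dvd b"
    have "\<not> is_unit ?p" using prime_gt_1_nat[OF p] by simp
    then have na: "\<not> ?p dvd a" using coprime_common_divisor[OF cop _ d] by blast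
    then have ma: "multiplicity ?p a = 0" by (rule not_dvd_imp_multiplicity_0)
    have a: "a \<noteq> 0" using na by auto
    have mb: "multiplicity ?p b \<ge> 1" using d b p prime_gt_1_nat[OF p]
      by (intro multiplicity_geI) auto
    have "1 < real CARD('p) powi (int (multiplicity ?p b))"
      using mb by (intro one_less_power_int card_gt_1) simp
    then show False using q1 padic_abs_divide[OF p a, of b] b ma by (simp add: qe)
  qed
  then have "coprime b (?p ^ k)"
    using prime_imp_coprime[of ?p b] p by (simp add: coprime_commute)
  then obtain c where c: "[b * c = 1] (mod ?p ^ k)" using cong_solve_coprime_int by blast
  define m where "m = a * c"
  have "(of_int b :: 'p padic) * (Padic (\<lambda>_. q) - of_int m) = of_int (a * (1 - b * c))"
  proof -
    have "(of_int b :: 'p padic) * Padic (\<lambda>_. q) = of_int a"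
      using b by (simp add: of_int_Padic mult_Padic qe)
    then show ?thesis by (simp add: algebra_simps m_def)
  qed
  then have "pnorm (of_int b :: 'p padic) * pnorm (Padic (\<lambda>_. q) - of_int m :: 'p padic) = pnorm (of_int (a * (1 - b * c)) :: 'p padic)"
    by (metis pnorm_mult)
  also have "\<dots> \<le> ?e" unfolding pnorm_of_int_le_iff using c by (simp add: cong_iff_dvd_diff dvd_diff_commute)
  also have "pnorm (of_int b :: 'p padic) = 1"
    using padic_abs_divide[OF p, of b 1] b nd by (simp add: of_int_Padic pnorm_Padic_const not_dvd_imp_multiplicity_0)
  finally have "pnorm (Padic (\<lambda>_. q) - of_int m :: 'p padic) \<le> ?e" by simp
  then show thesis using that[of m] pnorm_add_le[of "x - Padic (\<lambda>_. q)" ?e "Padic (\<lambda>_. q) - of_int m"] q by simp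
qed

subsection \<open>Uniqueness of invariant measures\<close>

text \<open>A common frame for the field, for square matrices and for pairs of them. The two
  algebraic laws are the identities that the substitutions in \<open>haar_prod\<close> produce; they
  are restricted to the space because functions extended by \<open>undefined\<close> satisfy them
  only there.\<close>

locale meas_group =
  fixes N :: "'a measure" and pl :: "'a \<Rightarrow> 'a \<Rightarrow> 'a" and ng :: "'a \<Rightarrow> 'a"
  assumes pl_measurable: "case_prod pl \<in> N \<Otimes>\<^sub>M N \<rightarrow>\<^sub>M N"
    and ng_measurable: "ng \<in> N \<rightarrow>\<^sub>M N"
    and pl_ng_pl: "\<And>x y. x \<in> space N \<Longrightarrow> y \<in> space N \<Longrightarrow> pl y (pl x (ng y)) = x"
    and pl_ng: "\<And>x y. x \<in> space N \<Longrightarrow> y \<in> space N \<Longrightarrow> pl x (ng (pl y x)) = ng y"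
begin

definition haar :: "'a measure \<Rightarrow> bool" where
  "haar V \<longleftrightarrow> sets V = sets N \<and> sigma_finite_measure V \<and> (\<forall>w\<in>space N. distr V N (\<lambda>z. pl z w) = V)"

lemma haar_nn_integral:
  assumes V: "haar V" and w: "w \<in> space N" and f: "f \<in> borel_measurable N"
  shows "(\<integral>\<^sup>+ z. f (pl z w) \<partial>V) = (\<integral>\<^sup>+ z. f z \<partial>V)"
proof -
  have s: "sets V = sets N" and inv: "distr V N (\<lambda>z. pl z w) = V" using V w by (auto simp: haar_def)
  have m: "(\<lambda>z. pl z w) \<in> V \<rightarrow>\<^sub>M N"
    unfolding measurable_cong_sets[OF s refl]
    using measurable_compose[OF measurable_Pair2'[OF w] pl_measurable] by simp
  have "(\<integral>\<^sup>+ z. f z \<partial>distr V N (\<lambda>z. pl z w)) = (\<integral>\<^sup>+ z. f (pl z w) \<partial>V)"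
    by (rule nn_integral_distr[OF m]) (simp add: f)
  then show ?thesis by (simp add: inv)
qed

text \<open>Integrate \<open>1\<^sub>A(x) 1\<^sub>B(y)\<close>, substituting \<open>y \<mapsto> y + x\<close>, then \<open>x \<mapsto> x - y\<close>, then \<open>y \<mapsto> y + x\<close>.\<close>

lemma haar_prod:
  assumes V: "haar V" and W: "haar W" and A: "A \<in> sets N" and B: "B \<in> sets N"
  shows "emeasure V A * emeasure W B = emeasure W {x\<in>space N. ng x \<in> A} * emeasure V B"
proof -
  have sV [measurable_cong]: "sets V = sets N" and sW [measurable_cong]: "sets W = sets N"
    using V W by (auto simp: haar_def)
  interpret V: sigma_finite_measure V using V by (simp add: haar_def)
  interpret W: sigma_finite_measure W using W by (simp add: haar_def)
  interpret pair_sigma_finite V W by unfold_locales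
  note [measurable] = A B ng_measurable
  have pl [measurable]: "(\<lambda>x. pl (f x) (g x)) \<in> M \<rightarrow>\<^sub>M N"
    if "f \<in> M \<rightarrow>\<^sub>M N" "g \<in> M \<rightarrow>\<^sub>M N" for M :: "'b measure" and f g
    using measurable_compose[OF measurable_Pair[OF that] pl_measurable] by simp
  have spV: "space V = space N" and spW: "space W = space N"
    using sets_eq_imp_space_eq[OF sV] sets_eq_imp_space_eq[OF sW] by auto
  have pls: "pl x y \<in> space N" if "x \<in> space N" "y \<in> space N" for x y
    using measurable_space[OF pl_measurable, of "(x, y)"] that by (simp add: space_pair_measure)
  have ngs: "ng x \<in> space N" if "x \<in> space N" for x
    using measurable_space[OF ng_measurable that] .
  let ?I = "\<lambda>S x. indicator S x :: ennreal"
  have "emeasure V A * emeasure W B = (\<integral>\<^sup>+ x. ?I A x * emeasure W B \<partial>V)"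
    by (simp add: nn_integral_multc)
  also have "\<dots> = (\<integral>\<^sup>+ x. (\<integral>\<^sup>+ y. ?I A x * ?I B y \<partial>W) \<partial>V)"
    by (simp add: nn_integral_cmult)
  also have "\<dots> = (\<integral>\<^sup>+ x. (\<integral>\<^sup>+ y. ?I A x * ?I B (pl y x) \<partial>W) \<partial>V)"
  proof (rule nn_integral_cong)
    fix x assume "x \<in> space V"
    then have x: "x \<in> space N" by (simp add: spV)
    show "(\<integral>\<^sup>+ y. ?I A x * ?I B y \<partial>W) = (\<integral>\<^sup>+ y. ?I A x * ?I B (pl y x) \<partial>W)"
      by (rule haar_nn_integral[OF W x, of "\<lambda>y. ?I A x * ?I B y", symmetric]) simp
  qed
  also have "\<dots> = (\<integral>\<^sup>+ y. (\<integral>\<^sup>+ x. ?I A x * ?I B (pl y x) \<partial>V) \<partial>W)"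
    by (rule Fubini'[symmetric]) measurable
  also have "\<dots> = (\<integral>\<^sup>+ y. (\<integral>\<^sup>+ x. ?I A (pl x (ng y)) * ?I B x \<partial>V) \<partial>W)"
  proof (rule nn_integral_cong)
    fix y assume "y \<in> space W"
    then have y: "y \<in> space N" by (simp add: spW)
    have "(\<integral>\<^sup>+ x. ?I A x * ?I B (pl y x) \<partial>V) = (\<integral>\<^sup>+ x. ?I A (pl x (ng y)) * ?I B (pl y (pl x (ng y))) \<partial>V)"
      by (rule haar_nn_integral[OF V ngs[OF y], of "\<lambda>x. ?I A x * ?I B (pl y x)", symmetric])
         (use y in measurable)
    also have "\<dots> = (\<integral>\<^sup>+ x. ?I A (pl x (ng y)) * ?I B x \<partial>V)"
      by (rule nn_integral_cong) (simp add: pl_ng_pl y spV)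
    finally show "(\<integral>\<^sup>+ x. ?I A x * ?I B (pl y x) \<partial>V) = (\<integral>\<^sup>+ x. ?I A (pl x (ng y)) * ?I B x \<partial>V)" .
  qed
  also have "\<dots> = (\<integral>\<^sup>+ x. (\<integral>\<^sup>+ y. ?I A (pl x (ng y)) * ?I B x \<partial>W) \<partial>V)"
    by (rule Fubini') measurable
  also have "\<dots> = (\<integral>\<^sup>+ x. emeasure W {x\<in>space N. ng x \<in> A} * ?I B x \<partial>V)"
  proof (rule nn_integral_cong)
    fix x assume "x \<in> space V"
    then have x: "x \<in> space N" by (simp add: spV)
    have "(\<integral>\<^sup>+ y. ?I A (pl x (ng y)) * ?I B x \<partial>W) = (\<integral>\<^sup>+ y. ?I A (pl x (ng (pl y x))) * ?I B x \<partial>W)"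
      by (rule haar_nn_integral[OF W x, of "\<lambda>y. ?I A (pl x (ng y)) * ?I B x", symmetric])
         (use x in measurable)
    also have "\<dots> = (\<integral>\<^sup>+ y. ?I {x\<in>space N. ng x \<in> A} y * ?I B x \<partial>W)"
      by (rule nn_integral_cong) (simp add: pl_ng x spW indicator_def)
    also have "\<dots> = emeasure W {x\<in>space N. ng x \<in> A} * ?I B x"
      by (subst nn_integral_multc) auto
    finally show "(\<integral>\<^sup>+ y. ?I A (pl x (ng y)) * ?I B x \<partial>W) = emeasure W {x\<in>space N. ng x \<in> A} * ?I B x" .
  qed
  also have "\<dots> = emeasure W {x\<in>space N. ng x \<in> A} * emeasure V B"
    by (simp add: nn_integral_cmult)
  finally show ?thesis .
qed

lemma haar_unique:
  assumes V: "haar V" and W: "haar W" and K: "K \<in> sets N" "emeasure W K = 1"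
  shows "V = scale_measure (emeasure V K) W"
proof (rule measure_eqI)
  show "sets V = sets (scale_measure (emeasure V K) W)" using V W by (simp add: haar_def)
  fix A assume "A \<in> sets V"
  then have A: "A \<in> sets N" using V by (simp add: haar_def)
  have "emeasure V A = emeasure W {x\<in>space N. ng x \<in> A} * emeasure V K"
    using haar_prod[OF V W A K(1)] K(2) by simp
  \<comment> \<open>With both measures equal to \<open>W\<close> and \<open>B = K\<close>, the
    identity says that \<open>W\<close> is invariant under \<open>ng\<close>.\<close>
  also have "emeasure W {x\<in>space N. ng x \<in> A} = emeasure W A"
    using haar_prod[OF W W A K(1)] K(2) by simp
  finally show "emeasure V A = emeasure (scale_measure (emeasure V K) W) A" by (simp add: mult.commute)
qed

text \<open>Translating by \<open>w\<close> after \<open>T\<close> is the same as translating by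
  \<open>T' w\<close> before it. Combined with \<open>haar_unique\<close>, this makes every linear
  automorphism multiply Haar measure by a constant.\<close>

lemma haar_distr:
  assumes V: "haar V" and T: "T \<in> N \<rightarrow>\<^sub>M N" and T': "T' \<in> N \<rightarrow>\<^sub>M N"
    and inv: "\<And>x. x \<in> space N \<Longrightarrow> T (T' x) = x" "\<And>x. x \<in> space N \<Longrightarrow> T' (T x) = x"
    and add: "\<And>x y. x \<in> space N \<Longrightarrow> y \<in> space N \<Longrightarrow> T (pl x y) = pl (T x) (T y)"
  shows "haar (distr V N T)"
  unfolding haar_def
proof (intro conjI ballI)
  have sV [measurable_cong]: "sets V = sets N" using V by (auto simp: haar_def)
  have spV: "space V = space N" using sets_eq_imp_space_eq[OF sV] .
  note [measurable] = T T'
  have pl [measurable]: "(\<lambda>x. pl x w) \<in> N \<rightarrow>\<^sub>M N" if "w \<in> space N" for w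
    using measurable_compose[OF measurable_Pair2'[OF that] pl_measurable] by simp
  \<comment> \<open>Sigma-finiteness is pulled back along \<open>T'\<close>: the image of
    \<open>distr V N T\<close> under it is \<open>V\<close> again.\<close>
  have "distr (distr V N T) V T' = distr V V (T' \<circ> T)"
    by (rule distr_distr) measurable
  also have "\<dots> = distr V V (\<lambda>x. x)"
    by (rule distr_cong) (simp_all add: inv spV)
  finally have "distr (distr V N T) V T' = V" by (simp add: distr_id)
  then have "sigma_finite_measure (distr (distr V N T) V T')" using V by (simp add: haar_def)
  then show "sigma_finite_measure (distr V N T)"
    by (rule sigma_finite_measure_distr) measurable
  show "sets (distr V N T) = sets N" by simp
  fix w assume w: "w \<in> space N"
  have w': "T' w \<in> space N" using measurable_space[OF T' w] .
  have "distr (distr V N T) N (\<lambda>z. pl z w) = distr V N (\<lambda>x. pl (T x) w)"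
    by (subst distr_distr) (use w in \<open>auto simp: comp_def\<close>)
  also have "\<dots> = distr V N (\<lambda>x. T (pl x (T' w)))"
    by (rule distr_cong) (auto simp: add w' inv w spV)
  also have "\<dots> = distr (distr V N (\<lambda>x. pl x (T' w))) N T"
    by (subst distr_distr) (use w' in \<open>auto simp: comp_def\<close>)
  also have "distr V N (\<lambda>x. pl x (T' w)) = V" using V w' by (simp add: haar_def)
  finally show "distr (distr V N T) N (\<lambda>z. pl z w) = distr V N T" .
qed

end

subsection \<open>Balls\<close>

definition pball :: "'p::prime_card padic \<Rightarrow> nat \<Rightarrow> 'p padic set" where
  "pball a k = {x. pnorm (x - a) \<le> real CARD('p) powi (- int k)}"

text \<open>By the ultrametric inequality every point of a ball is a centre of it; hence two balls
  are nested or disjoint.\<close>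

lemma pball_eq:
  assumes "x \<in> pball a k" shows "pball x k = pball (a :: 'p::prime_card padic) k"
proof -
  have "pnorm (y - x) \<le> e \<longleftrightarrow> pnorm (y - a) \<le> e" if "pnorm (x - a) \<le> e" for y e
    using pnorm_add_le[of "y - x" e "x - a"] pnorm_diff_le[of "y - a" e "x - a"] that by auto
  then show ?thesis using assms by (auto simp: pball_def)
qed

lemma centre_in_pball [simp]: "a \<in> pball a k"
  using card_pos by (simp add: pball_def)

lemma pball_mono: "k \<le> l \<Longrightarrow> pball (a :: 'p::prime_card padic) l \<subseteq> pball a k"
  using power_int_increasing[of "- int l" "- int k" "real CARD('p)"] card_gt_1[where 'p='p]
  by (auto simp: pball_def)

lemma pball_Int: "pball a k \<inter> pball b l \<in> {{}, pball a k, pball (b :: 'p::prime_card padic) l}"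
proof (cases "pball a k \<inter> pball b l = {}")
  case False
  then obtain x where x: "x \<in> pball a k" "x \<in> pball b l" by auto
  then have "pball a k \<subseteq> pball b l \<or> pball b l \<subseteq> pball a k"
    using pball_eq[OF x(1)] pball_eq[OF x(2)] pball_mono[of k l x] pball_mono[of l k x] linear by metis
  then show ?thesis by auto
qed simp

lemma pball_borel [measurable]: "pball a k \<in> sets borel"
  unfolding pball_def by measurable

lemma pball_0_0: "pball 0 0 = padic_ints"
  by (simp add: pball_def padic_ints_def)

lemma ex_pball_radius: "e > 0 \<Longrightarrow> \<exists>k. real CARD('p::prime_card) powi (- int k) < e"
proof -
  assume "e > 0"
  then obtain k where "inverse (real CARD('p)) ^ k < e"
    using real_arch_pow_inv[of e "inverse (real CARD('p))"] card_gt_1[where 'p='p]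
    by (auto simp: inverse_less_1_iff)
  then show ?thesis by (intro exI[of _ k]) (simp add: power_int_minus power_inverse)
qed

lemma open_pball: "open (pball (a :: 'p::prime_card padic) k)"
  unfolding open_contains_ball
proof (intro ballI exI conjI)
  show "real CARD('p) powi (- int k) > 0" using card_pos by simp
  fix x assume "x \<in> pball a k"
  have "ball x (real CARD('p) powi (- int k)) \<subseteq> pball x k"
    by (auto simp: pball_def dist_padic_def pnorm_diff_commute[of x])
  then show "ball x (real CARD('p) powi (- int k)) \<subseteq> pball a k"
    using pball_eq[OF \<open>x \<in> pball a k\<close>] by simp
qed

lemma topological_basis_pball:
  "topological_basis (range (\<lambda>(q, k). pball (Padic (\<lambda>_. q) :: 'p::prime_card padic) k))"
proof (rule topological_basisI)
  fix U :: "'p padic set" and x assume "open U" "x \<in> U"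
  then obtain e where e: "e > 0" "ball x e \<subseteq> U" using open_contains_ball by blast
  obtain k where k: "real CARD('p) powi (- int k) < e" using ex_pball_radius[OF e(1)] by blast
  have pos: "real CARD('p) powi (- int k) > 0" using card_pos by simp
  obtain q where q: "pnorm (x - (Padic (\<lambda>_. q) :: 'p padic)) < real CARD('p) powi (- int k)"
    using padic_rat_dense[OF pos] .
  then have "x \<in> pball (Padic (\<lambda>_. q)) k" by (simp add: pball_def)
  moreover from this have "pball (Padic (\<lambda>_. q)) k = pball x k" by (rule pball_eq[symmetric])
  moreover have "pball x k \<subseteq> ball x e"
    using k by (auto simp: pball_def dist_padic_def pnorm_diff_commute[of x])
  then have "pball x k \<subseteq> U" using e(2) by (rule order_trans)
  ultimately show "\<exists>B\<in>range (\<lambda>(q, k). pball (Padic (\<lambda>_. q)) k). x \<in> B \<and> B \<subseteq> U"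
    by (intro bexI[of _ "pball (Padic (\<lambda>_. q)) k"] range_eqI[of _ _ "(q, k)"]) auto
qed (auto simp: open_pball)

text \<open>Balls with rational centres form a countable basis, and together with \<open>{}\<close>
  and \<open>UNIV\<close> they are stable under intersection because they are nested or disjoint.
  They therefore generate the Borel sets in the way that uniqueness of measures requires.\<close>

lemma measure_eqI_pball:
  fixes V W :: "'p::prime_card padic measure"
  assumes sets: "sets V = sets borel" "sets W = sets borel"
    and fin: "emeasure V UNIV \<noteq> \<infinity>" "emeasure V UNIV = emeasure W UNIV"
    and eq: "\<And>a k. emeasure V (pball a k) = emeasure W (pball a k)"
  shows "V = W"
proof -
  let ?B = "range (\<lambda>(q, k). pball (Padic (\<lambda>_. q) :: 'p padic) k)"
  let ?E = "insert UNIV (insert {} ?B)"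
  have "(borel :: 'p padic measure) = sigma UNIV ?B"
    by (rule borel_eq_countable_basis[OF _ topological_basis_pball]) simp
  from arg_cong[OF this, of sets] have b: "sets (borel :: 'p padic measure) = sigma_sets UNIV ?B"
    by (simp add: sets_measure_of)
  have "sigma_sets UNIV ?E = sigma_sets UNIV ?B"
    by (rule sigma_sets_eqI) (auto intro: sigma_sets_top sigma_sets.intros)
  with b have b': "sets (borel :: 'p padic measure) = sigma_sets UNIV ?E" by simp
  show ?thesis
  proof (rule measure_eqI_generator_eq[where \<Omega> = UNIV and E = ?E and A = "\<lambda>_. UNIV"])
    show "Int_stable ?E"
    proof (rule Int_stableI)
      fix X Y assume "X \<in> ?E" "Y \<in> ?E"
      have "X \<inter> Y \<in> {{}, X, Y}" if "X \<in> ?B" "Y \<in> ?B"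
      proof -
        from that obtain q k q' l where "X = pball (Padic (\<lambda>_. q)) k" "Y = pball (Padic (\<lambda>_. q')) l"
          by (elim rangeE) (auto split: prod.splits)
        then show ?thesis using pball_Int by metis
      qed
      then have "X \<inter> Y \<in> {{}, X, Y}" using \<open>X \<in> ?E\<close> \<open>Y \<in> ?E\<close> by (elim insertE) simp_all
      then show "X \<inter> Y \<in> ?E" using \<open>X \<in> ?E\<close> \<open>Y \<in> ?E\<close> by (elim insertE) simp_all
    qed
  qed (use assms b' in auto)
qed

subsection \<open>The uniform measure on the p-adic integers\<close>

text \<open>Haar measure on the p-adic integers is the law of an expansion with independent,
  uniformly distributed digits; this reduces its existence to that of infinite products of
  measures.\<close>

definition digit_space :: "'p::prime_card itself \<Rightarrow> (nat \<Rightarrow> nat) measure" where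
  "digit_space _ = PiM UNIV (\<lambda>_. measure_pmf (pmf_of_set {..<CARD('p)}))"

definition digit_sum :: "nat \<Rightarrow> (nat \<Rightarrow> nat) \<Rightarrow> nat \<Rightarrow> nat" where
  "digit_sum b \<omega> k = (\<Sum>i<k. \<omega> i * b ^ i)"

definition digit_padic :: "(nat \<Rightarrow> nat) \<Rightarrow> 'p::prime_card padic" where
  "digit_padic \<omega> = Padic (\<lambda>k. of_nat (digit_sum CARD('p) \<omega> k))"

lemma digit_sum_dvd:
  assumes "k \<le> m" shows "int b ^ k dvd int (digit_sum b \<omega> m) - int (digit_sum b \<omega> k)"
proof -
  have "digit_sum b \<omega> m = digit_sum b \<omega> k + (\<Sum>i=k..<m. \<omega> i * b ^ i)"
    using assms unfolding digit_sum_def by (simp add: lessThan_atLeast0 sum.atLeastLessThan_concat)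
  moreover have "b ^ k dvd (\<Sum>i=k..<m. \<omega> i * b ^ i)"
    by (rule dvd_sum) (auto intro: dvd_mult le_imp_power_dvd)
  ultimately show ?thesis by (metis add_diff_cancel_left' int_dvd_int_iff of_nat_add of_nat_power)
qed

lemma digit_sum_less:
  assumes "\<And>i. \<omega> i < b" shows "digit_sum b \<omega> k < b ^ k"
proof (induction k)
  case (Suc k)
  have "digit_sum b \<omega> (Suc k) = digit_sum b \<omega> k + \<omega> k * b ^ k" by (simp add: digit_sum_def)
  also have "\<dots> < b ^ k + \<omega> k * b ^ k" using Suc by simp
  also have "\<dots> = (\<omega> k + 1) * b ^ k" by simp
  also have "\<dots> \<le> b * b ^ k" using assms[of k] by (intro mult_right_mono) auto
  finally show ?case by simp
qed (simp add: digit_sum_def)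

lemma digit_sum_inj:
  assumes "\<And>i. \<omega> i < b" "\<And>i. \<eta> i < b"
  shows "digit_sum b \<omega> k = digit_sum b \<eta> k \<longleftrightarrow> (\<forall>i<k. \<omega> i = \<eta> i)"
proof (induction k)
  case (Suc k)
  have b: "b > 0" using assms(1)[of 0] by simp
  have *: "digit_sum b \<omega> (Suc k) div b ^ k = \<omega> k" "digit_sum b \<omega> (Suc k) mod b ^ k = digit_sum b \<omega> k"
    if "\<And>i. \<omega> i < b" for \<omega>
    using digit_sum_less[of \<omega> b k, OF that] b by (simp_all add: digit_sum_def)
  have "digit_sum b \<omega> (Suc k) = digit_sum b \<eta> (Suc k) \<longleftrightarrow> \<omega> k = \<eta> k \<and> digit_sum b \<omega> k = digit_sum b \<eta> k"
  proof
    assume "digit_sum b \<omega> (Suc k) = digit_sum b \<eta> (Suc k)"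
    then show "\<omega> k = \<eta> k \<and> digit_sum b \<omega> k = digit_sum b \<eta> k"
      using *[of \<omega>, OF assms(1)] *[of \<eta>, OF assms(2)] by metis
  qed (simp add: digit_sum_def)
  then show ?case using Suc by (auto simp: less_Suc_eq)
qed (simp add: digit_sum_def)

lemma digit_sum_of_digits:
  "digit_sum b (\<lambda>i. c div b ^ i mod b) k = c mod b ^ k"
proof (induction k)
  case (Suc k)
  have "c mod b ^ Suc k = b ^ k * (c div b ^ k mod b) + c mod b ^ k"
    using mod_mult2_eq[of c "b ^ k" b] by (simp add: mult.commute)
  then show ?case using Suc by (simp add: digit_sum_def)
qed (simp add: digit_sum_def)

lemma digit_padic_cauchy: "padic_cauchy CARD('p::prime_card) (\<lambda>k. of_nat (digit_sum CARD('p) \<omega> k))"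
  unfolding padic_cauchy_def
proof (intro allI impI)
  fix e :: real assume "e > 0"
  then obtain K where K: "real CARD('p) powi (- int K) < e" using ex_pball_radius by blast
  have "padic_abs CARD('p) (of_nat (digit_sum CARD('p) \<omega> m) - of_nat (digit_sum CARD('p) \<omega> n)) < e"
    if "m \<ge> K" "n \<ge> K" for m n
  proof -
    have "int CARD('p) ^ K dvd (int (digit_sum CARD('p) \<omega> m) - int (digit_sum CARD('p) \<omega> K))
       - (int (digit_sum CARD('p) \<omega> n) - int (digit_sum CARD('p) \<omega> K))"
      by (intro dvd_diff digit_sum_dvd that)
    then have "int CARD('p) ^ K dvd int (digit_sum CARD('p) \<omega> m) - int (digit_sum CARD('p) \<omega> n)" by simp
    then have "pnorm (of_int (int (digit_sum CARD('p) \<omega> m) - int (digit_sum CARD('p) \<omega> n)) :: 'p padic)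
      \<le> real CARD('p) powi (- int K)" by (simp only: pnorm_of_int_le_iff)
    then show ?thesis using K unfolding of_int_Padic pnorm_Padic_const by simp
  qed
  then show "\<exists>K. \<forall>m\<ge>K. \<forall>n\<ge>K. padic_abs CARD('p) (of_nat (digit_sum CARD('p) \<omega> m) - of_nat (digit_sum CARD('p) \<omega> n)) < e"
    by blast
qed

lemma digit_padic_approx:
  "pnorm (digit_padic \<omega> - of_nat (digit_sum CARD('p) \<omega> k) :: 'p::prime_card padic) \<le> real CARD('p) powi (- int k)"
proof -
  let ?S = "digit_sum CARD('p) \<omega>"
  have p: "prime CARD('p)" by (rule prime_card)
  have c: "padic_cauchy CARD('p) (\<lambda>m. of_nat (?S m) + - of_nat (?S k))"
    by (intro padic_cauchy_add[OF p] digit_padic_cauchy) simp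
  have "digit_padic \<omega> - of_nat (?S k) = (Padic (\<lambda>m. of_nat (?S m) + - of_nat (?S k)) :: 'p padic)"
    unfolding digit_padic_def of_nat_Padic diff_conv_add_uminus minus_Padic[OF padic_cauchy_const]
    by (rule add_Padic[OF digit_padic_cauchy]) simp
  moreover have "pnorm (Padic (\<lambda>m. of_nat (?S m) + - of_nat (?S k)) :: 'p padic) \<le> real CARD('p) powi (- int k)"
  proof (rule LIMSEQ_le_const2[OF LIMSEQ_pnorm_Padic[OF c]], intro exI[of _ k] allI impI)
    fix m assume "k \<le> m"
    then have "int CARD('p) ^ k dvd int (?S m) - int (?S k)" by (rule digit_sum_dvd)
    then have "pnorm (of_int (int (?S m) - int (?S k)) :: 'p padic) \<le> real CARD('p) powi (- int k)"
      by (simp only: pnorm_of_int_le_iff)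
    then show "padic_abs CARD('p) (of_nat (?S m) + - of_nat (?S k)) \<le> real CARD('p) powi (- int k)"
      unfolding of_int_Padic pnorm_Padic_const by simp
  qed
  ultimately show ?thesis by simp
qed

lemma digit_padic_measurable [measurable]:
  "(digit_padic :: _ \<Rightarrow> 'p::prime_card padic) \<in> borel_measurable (digit_space TYPE('p))"
proof (rule borel_measurable_LIMSEQ_metric)
  fix k
  have "(\<lambda>\<omega>. of_nat (\<omega> i) * of_nat (CARD('p) ^ i) :: 'p padic) \<in> borel_measurable (digit_space TYPE('p))" for i
    unfolding digit_space_def
    by (rule measurable_compose[OF measurable_component_singleton[of i]]) auto
  then have "(\<lambda>\<omega>. \<Sum>i<k. of_nat (\<omega> i) * of_nat (CARD('p) ^ i) :: 'p padic) \<in> borel_measurable (digit_space TYPE('p))"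
    by (rule borel_measurable_padic_sum)
  then show "(\<lambda>\<omega>. of_nat (digit_sum CARD('p) \<omega> k) :: 'p padic) \<in> borel_measurable (digit_space TYPE('p))"
    by (simp add: digit_sum_def)
next
  fix \<omega>
  have "(\<lambda>k. real CARD('p) powi (- int k)) \<longlonglongrightarrow> 0"
    using LIMSEQ_inverse_realpow_zero[OF card_gt_1[where 'p='p]] by (simp add: power_int_minus)
  then have "(\<lambda>k. pnorm (digit_padic \<omega> - of_nat (digit_sum CARD('p) \<omega> k) :: 'p padic)) \<longlonglongrightarrow> 0"
    by (rule tendsto_sandwich[OF _ _ tendsto_const, rotated 2])
       (auto simp: pnorm_nonneg digit_padic_approx)
  then show "(\<lambda>k. of_nat (digit_sum CARD('p) \<omega> k) :: 'p padic) \<longlonglongrightarrow> digit_padic \<omega>"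
    unfolding tendsto_padic_iff pnorm_diff_commute[of "digit_padic \<omega>"] .
qed

definition unif :: "'p::prime_card padic measure" where
  "unif = distr (digit_space TYPE('p)) borel digit_padic"

lemma prob_space_digit_space: "prob_space (digit_space TYPE('p::prime_card))"
  unfolding digit_space_def by (intro prob_space_PiM measure_pmf.prob_space_axioms)

lemma prob_space_unif: "prob_space unif"
  unfolding unif_def by (rule prob_space.prob_space_distr[OF prob_space_digit_space]) measurable

lemma sets_unif [simp, measurable_cong]: "sets unif = sets borel"
  by (simp add: unif_def)

lemma space_unif [simp]: "space unif = UNIV"
  by (simp add: unif_def)

text \<open>The sample space contains all sequences of naturals; they are sequences of digits only
  almost surely, which is enough for computing masses.\<close>

lemma AE_digits: "AE \<omega> in digit_space TYPE('p::prime_card). \<forall>i. \<omega> i < CARD('p)"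
  unfolding AE_all_countable digit_space_def
proof
  fix i
  interpret product_prob_space "\<lambda>_. measure_pmf (pmf_of_set {..<CARD('p)})" UNIV
    by (intro product_prob_spaceI measure_pmf.prob_space_axioms)
  have "AE x in measure_pmf (pmf_of_set {..<CARD('p)}). x < CARD('p)"
    using card_pos[where 'p='p] by (subst AE_measure_pmf_iff) (auto simp: set_pmf_of_set lessThan_empty_iff)
  then show "AE \<omega> in PiM UNIV (\<lambda>_. measure_pmf (pmf_of_set {..<CARD('p)})). \<omega> i < CARD('p)"
    by (rule AE_component[rotated]) simp
qed

text \<open>Membership in the ball prescribes the first \<open>k\<close> digits, namely those of
  \<open>m\<close> modulo \<open>p^k\<close>, and each prescribed digit costs a factor
  \<open>1 / p\<close>.\<close>

lemma emeasure_unif_of_int: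
  "emeasure unif (pball (of_int m :: 'p::prime_card padic) k) = ennreal (real CARD('p) powi (- int k))"
proof -
  let ?p = "CARD('p)"
  interpret product_prob_space "\<lambda>_. measure_pmf (pmf_of_set {..<?p})" UNIV
    by (intro product_prob_spaceI measure_pmf.prob_space_axioms)
  have p0: "?p > 0" using card_pos[where 'p='p] by simp
  \<comment> \<open>\<open>c\<close> is the residue of \<open>m\<close> in \<open>{0..<p^k}\<close>,
    and \<open>d\<close> below lists its base-p digits.\<close>
  define c where "c = nat (m mod int ?p ^ k)"
  have cm: "int c = m mod int ?p ^ k" using p0 by (simp add: c_def)
  have "int c < int ?p ^ k" unfolding cm using p0 by (intro pos_mod_bound) simp
  then have cl: "c < ?p ^ k" by (metis of_nat_less_iff of_nat_power)
  define d where "d i = c div ?p ^ i mod ?p" for i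
  have d: "d i < ?p" for i using p0 by (simp add: d_def)
  have ball: "digit_padic \<omega> \<in> pball (of_int m :: 'p padic) k \<longleftrightarrow> (\<forall>i\<in>{..<k}. \<omega> i = d i)" if \<omega>: "\<And>i. \<omega> i < ?p" for \<omega>
  proof -
    have "digit_padic \<omega> \<in> pball (of_int m :: 'p padic) k \<longleftrightarrow> pnorm (of_int (int (digit_sum ?p \<omega> k) - m) :: 'p padic) \<le> real CARD('p) powi (- int k)"
      using pnorm_add_le[of "digit_padic \<omega> - of_nat (digit_sum ?p \<omega> k)" "real CARD('p) powi (- int k)" "of_nat (digit_sum ?p \<omega> k) - of_int m :: 'p padic"]
        pnorm_diff_le[of "digit_padic \<omega> - of_int m" "real CARD('p) powi (- int k)" "digit_padic \<omega> - of_nat (digit_sum ?p \<omega> k) :: 'p padic"]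
        digit_padic_approx[of \<omega> k, where 'p='p]
      by (auto simp: pball_def)
    also have "\<dots> \<longleftrightarrow> int (digit_sum ?p \<omega> k) mod int ?p ^ k = m mod int ?p ^ k"
      unfolding pnorm_of_int_le_iff by (simp add: mod_eq_dvd_iff)
    also have "\<dots> \<longleftrightarrow> digit_sum ?p \<omega> k = c"
    proof -
      have "int (digit_sum ?p \<omega> k) mod int ?p ^ k = int (digit_sum ?p \<omega> k)"
        using digit_sum_less[of \<omega> ?p k, OF \<omega>] by (simp flip: of_nat_power)
      then show ?thesis by (simp flip: cm)
    qed
    also have "c = digit_sum ?p d k"
      using digit_sum_of_digits[of ?p c k] cl by (simp add: d_def[abs_def])
    also have "digit_sum ?p \<omega> k = digit_sum ?p d k \<longleftrightarrow> (\<forall>i\<in>{..<k}. \<omega> i = d i)"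
      using digit_sum_inj[of \<omega> ?p d k, OF \<omega> d] \<omega> d by (simp add: Ball_def)
    finally show ?thesis .
  qed
  have cyl: "{\<omega>\<in>space (digit_space TYPE('p)). \<forall>i\<in>{..<k}. \<omega> i = d i}
      = emb UNIV {..<k} (\<Pi>\<^sub>E i\<in>{..<k}. {d i})"
    unfolding digit_space_def prod_emb_def space_PiM
    by (rule Set.set_eqI) (simp add: PiE_UNIV_domain PiE_iff)
  have [measurable]: "{\<omega>\<in>space (digit_space TYPE('p)). \<forall>i\<in>{..<k}. \<omega> i = d i} \<in> sets (digit_space TYPE('p))"
    unfolding cyl unfolding digit_space_def by (rule sets_PiM_I) auto
  have "emeasure unif (pball (of_int m :: 'p padic) k)
      = emeasure (digit_space TYPE('p)) {\<omega>\<in>space (digit_space TYPE('p)). digit_padic \<omega> \<in> pball (of_int m :: 'p padic) k}"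
    unfolding unif_def by (subst emeasure_distr) (auto simp: vimage_def Int_def conj_commute)
  also have "\<dots> = emeasure (digit_space TYPE('p)) {\<omega>\<in>space (digit_space TYPE('p)). \<forall>i\<in>{..<k}. \<omega> i = d i}"
  proof (rule emeasure_eq_AE)
    show "AE \<omega> in digit_space TYPE('p). \<omega> \<in> {\<omega>\<in>space (digit_space TYPE('p)). digit_padic \<omega> \<in> pball (of_int m :: 'p padic) k}
      \<longleftrightarrow> \<omega> \<in> {\<omega>\<in>space (digit_space TYPE('p)). \<forall>i\<in>{..<k}. \<omega> i = d i}"
      using AE_digits[where 'p='p]
    proof (rule eventually_mono)
      fix \<omega> :: "nat \<Rightarrow> nat" assume "\<forall>i. \<omega> i < CARD('p)"
      then show "\<omega> \<in> {\<omega>\<in>space (digit_space TYPE('p)). digit_padic \<omega> \<in> pball (of_int m :: 'p padic) k}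
        \<longleftrightarrow> \<omega> \<in> {\<omega>\<in>space (digit_space TYPE('p)). \<forall>i\<in>{..<k}. \<omega> i = d i}"
        using ball[of \<omega>] by simp
    qed
  qed measurable
  also have "\<dots> = (\<Prod>i<k. emeasure (measure_pmf (pmf_of_set {..<?p})) {d i})"
    unfolding cyl unfolding digit_space_def by (rule emeasure_PiM_emb) auto
  also have "\<dots> = (\<Prod>i<k. ennreal (1 / real ?p))"
    using p0 d by (intro prod.cong refl) (auto simp: emeasure_pmf_single lessThan_empty_iff)
  also have "\<dots> = ennreal ((1 / real ?p) ^ k)"
    by (simp add: ennreal_power)
  also have "(1 / real ?p) ^ k = real CARD('p) powi (- int k)"
    by (simp add: power_int_minus field_simps)
  finally show ?thesis .
qed

lemma emeasure_unif_padic_ints: "emeasure unif (padic_ints :: 'p::prime_card padic set) = 1"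
  using emeasure_unif_of_int[of 0 0, where 'p = 'p] by (simp add: pball_0_0)

text \<open>An integral centre may be moved to an ordinary integer without changing the ball; a ball
  around a centre that is not integral misses \<open>padic_ints\<close>, which carries all the
  mass.\<close>

lemma emeasure_unif_pball:
  "emeasure unif (pball (a :: 'p::prime_card padic) k)
    = (if a \<in> padic_ints then ennreal (real CARD('p) powi (- int k)) else 0)"
proof (cases "a \<in> padic_ints")
  case True
  obtain m where "pnorm (a - of_int m) \<le> real CARD('p) powi (- int k)" using padic_int_approx[OF True] .
  then have "pball a k = pball (of_int m) k" by (intro pball_eq) (simp add: pball_def)
  then show ?thesis using True by (simp add: emeasure_unif_of_int)
next
  case False
  interpret prob_space "unif :: 'p padic measure" by (rule prob_space_unif)
  have "pball a k \<subseteq> - padic_ints"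
  proof
    fix x assume "x \<in> pball a k"
    then have "x \<in> pball a 0" using pball_mono[of 0 k a] by auto
    then have "x \<in> padic_ints \<Longrightarrow> a \<in> padic_ints"
      using pnorm_diff_le[of x 1 "x - a"] by (simp add: pball_def padic_ints_def)
    then show "x \<in> - padic_ints" using False by auto
  qed
  then have "emeasure unif (pball a k) \<le> emeasure unif (- padic_ints :: 'p padic set)"
    by (rule emeasure_mono) (auto simp: padic_ints_borel borel_comp)
  also have "\<dots> = 0"
    using emeasure_compl[of "padic_ints :: 'p padic set" unif] emeasure_unif_padic_ints[where 'p='p] emeasure_space_1
    by (simp add: padic_ints_borel Compl_eq_Diff_UNIV)
  finally show ?thesis using False by simp
qed

text \<open>Translation by an integral \<open>t\<close> maps balls to balls of the same radius and
  does not change whether the centre is integral, so the masses agree.\<close>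

lemma unif_translate:
  assumes t: "t \<in> padic_ints"
  shows "distr unif borel (\<lambda>x. x + t) = (unif :: 'p::prime_card padic measure)"
proof (rule measure_eqI_pball)
  interpret prob_space "unif :: 'p padic measure" by (rule prob_space_unif)
  have v: "(\<lambda>x. x + t) -` pball a k = pball (a - t) k" for a k
    by (auto simp: pball_def algebra_simps)
  have i: "a - t \<in> padic_ints \<longleftrightarrow> a \<in> padic_ints" for a
    using padic_ints_closed(3)[of "a - t" t] padic_ints_closed(4)[of a t] t by auto
  show "emeasure (distr unif borel (\<lambda>x. x + t)) (pball a k) = emeasure unif (pball a k)" for a k
    by (subst emeasure_distr) (auto simp: v emeasure_unif_pball i)
  show "emeasure (distr unif borel (\<lambda>x. x + t)) UNIV = emeasure (unif :: 'p padic measure) UNIV"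
    by (subst emeasure_distr) auto
  then show "emeasure (distr unif borel (\<lambda>x. x + t)) (UNIV :: 'p padic set) \<noteq> \<infinity>"
    using emeasure_space_1 by simp
qed auto

context meas_group
begin

text \<open>Sigma-finiteness comes from invariance: the preimages of \<open>K\<close> under the
  translations by the countable set \<open>R\<close> cover the space, and all have the mass of
  \<open>K\<close>.\<close>

lemma haarI:
  assumes sets: "sets V = sets N" and inv: "\<And>w. w \<in> space N \<Longrightarrow> distr V N (\<lambda>z. pl z w) = V"
    and K: "K \<in> sets N" "emeasure V K \<noteq> \<infinity>" and R: "countable R" "R \<subseteq> space N"
    and cover: "\<And>x. x \<in> space N \<Longrightarrow> \<exists>r\<in>R. pl x r \<in> K"
  shows "haar V"
  unfolding haar_def
proof (intro conjI ballI inv sets)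
  have sp: "space V = space N" by (rule sets_eq_imp_space_eq[OF sets])
  have pl: "(\<lambda>x. pl x w) \<in> V \<rightarrow>\<^sub>M N" if "w \<in> space N" for w
    unfolding measurable_cong_sets[OF sets refl]
    using measurable_compose[OF measurable_Pair2'[OF that] pl_measurable] by simp
  show "sigma_finite_measure V"
  proof
    show "\<exists>A. countable A \<and> A \<subseteq> sets V \<and> \<Union> A = space V \<and> (\<forall>a\<in>A. emeasure V a \<noteq> \<infinity>)"
    proof (intro exI conjI ballI)
      show "countable ((\<lambda>r. (\<lambda>x. pl x r) -` K \<inter> space V) ` R)" using R(1) by simp
      show "(\<lambda>r. (\<lambda>x. pl x r) -` K \<inter> space V) ` R \<subseteq> sets V"
        using measurable_sets[OF pl K(1)] R(2) by auto
      show "\<Union> ((\<lambda>r. (\<lambda>x. pl x r) -` K \<inter> space V) ` R) = space V"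
        using cover by (auto simp: sp)
      fix a assume "a \<in> (\<lambda>r. (\<lambda>x. pl x r) -` K \<inter> space V) ` R"
      then obtain r where r: "r \<in> R" "a = (\<lambda>x. pl x r) -` K \<inter> space V" by auto
      have rs: "r \<in> space N" using r R(2) by auto
      have "emeasure (distr V N (\<lambda>z. pl z r)) K = emeasure V a"
        unfolding r(2) by (rule emeasure_distr[OF pl[OF rs] K(1)])
      then show "emeasure V a \<noteq> \<infinity>" using K(2) by (simp add: inv[OF rs])
    qed
  qed
qed

end

subsection \<open>Haar measure on the p-adic numbers\<close>

text \<open>Picks one element of each coset of the integers; the choice depends only on the coset
  because the predicate does (\<open>padic_rep_eqI\<close>).\<close>

definition padic_rep :: "'p::prime_card padic \<Rightarrow> 'p padic" where
  "padic_rep x = (SOME y. y - x \<in> padic_ints)"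

lemma padic_rep_diff: "padic_rep x - x \<in> padic_ints"
  unfolding padic_rep_def by (rule someI[of _ x]) simp

lemma padic_rep_eqI:
  assumes "x - y \<in> padic_ints" shows "padic_rep x = padic_rep y"
proof -
  have "z - x \<in> padic_ints \<longleftrightarrow> z - y \<in> padic_ints" for z
    using padic_ints_closed(3)[of "z - x" "x - y"] padic_ints_closed(4)[of "z - y" "x - y"] assms by auto
  then show ?thesis by (simp add: padic_rep_def)
qed

lemma padic_rep_idem [simp]: "padic_rep (padic_rep x) = padic_rep x"
  by (rule padic_rep_eqI) (rule padic_rep_diff)

text \<open>Cosets of the integers are balls of radius 1, so each of them contains a
  rational.\<close>

lemma countable_range_padic_rep: "countable (range (padic_rep :: 'p::prime_card padic \<Rightarrow> _))"
proof (rule countable_subset)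
  show "range (padic_rep :: 'p padic \<Rightarrow> _) \<subseteq> range (\<lambda>q. padic_rep (Padic (\<lambda>_. q)))"
  proof
    fix y assume "y \<in> range (padic_rep :: 'p padic \<Rightarrow> _)"
    then obtain x :: "'p padic" where x: "y = padic_rep x" by auto
    obtain q where "pnorm (x - (Padic (\<lambda>_. q) :: 'p padic)) < 1" using padic_rat_dense[of 1 x] by auto
    then have "y = padic_rep (Padic (\<lambda>_. q))"
      unfolding x by (intro padic_rep_eqI) (simp add: padic_ints_def)
    then show "y \<in> range (\<lambda>q. padic_rep (Padic (\<lambda>_. q)))" by auto
  qed
qed simp

text \<open>The sum of the translates of \<^const>\<open>unif\<close> over the cosets of the p-adic integers.\<close>

definition padic_haar :: "'p::prime_card padic measure" where
  "padic_haar = distr (count_space (range padic_rep) \<Otimes>\<^sub>M unif) borel (\<lambda>x. fst x + snd x)"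

lemma sets_padic_haar [simp, measurable_cong]: "sets padic_haar = sets borel"
  by (simp add: padic_haar_def)

lemma space_padic_haar [simp]: "space padic_haar = UNIV"
  by (simp add: padic_haar_def)

lemma emeasure_padic_haar:
  assumes A: "A \<in> sets borel"
  shows "emeasure padic_haar A = (\<integral>\<^sup>+ r. emeasure unif {u. r + u \<in> A} \<partial>count_space (range (padic_rep :: 'p::prime_card padic \<Rightarrow> _)))"
proof -
  interpret U: prob_space "unif :: 'p padic measure" by (rule prob_space_unif)
  let ?C = "count_space (range (padic_rep :: 'p padic \<Rightarrow> _))"
  have [measurable]: "(\<lambda>x. fst x :: 'p padic) \<in> borel_measurable (?C \<Otimes>\<^sub>M (unif :: 'p padic measure))"
    by (rule measurable_compose[OF measurable_fst]) simp
  have [measurable]: "(\<lambda>x. snd x :: 'p padic) \<in> borel_measurable (?C \<Otimes>\<^sub>M (unif :: 'p padic measure))"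
    by (rule measurable_compose[OF measurable_snd]) simp
  have m: "(\<lambda>x. fst x + snd x) \<in> borel_measurable (?C \<Otimes>\<^sub>M (unif :: 'p padic measure))"
    by measurable
  have "emeasure padic_haar A = emeasure (?C \<Otimes>\<^sub>M unif) ((\<lambda>x. fst x + snd x) -` A \<inter> space (?C \<Otimes>\<^sub>M unif))"
    unfolding padic_haar_def by (rule emeasure_distr[OF m A])
  also have "\<dots> = (\<integral>\<^sup>+ r. emeasure unif (Pair r -` ((\<lambda>x. fst x + snd x) -` A \<inter> space (?C \<Otimes>\<^sub>M unif))) \<partial>?C)"
    by (rule U.emeasure_pair_measure_alt[OF measurable_sets[OF m A]])
  also have "\<dots> = (\<integral>\<^sup>+ r. emeasure unif {u. r + u \<in> A} \<partial>?C)"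
    by (intro nn_integral_cong arg_cong[of _ _ "emeasure unif"]) (auto simp: space_pair_measure)
  finally show ?thesis .
qed

lemma unif_translate_set:
  assumes t: "t \<in> padic_ints" and A: "A \<in> sets borel"
  shows "emeasure unif {u. u + t \<in> A} = emeasure (unif :: 'p::prime_card padic measure) A"
proof -
  have "emeasure (distr unif borel (\<lambda>x. x + t)) A = emeasure unif ((\<lambda>x. x + t) -` A \<inter> space unif)"
    by (rule emeasure_distr) (use A in auto)
  then show ?thesis using unif_translate[OF t] by (simp add: vimage_def)
qed

text \<open>Translation by \<open>t\<close> sends the coset of \<open>r\<close> to that of
  \<open>padic_rep (r + t)\<close>, up to an integral shift that \<open>unif\<close> does not
  notice; so the cosets are merely permuted.\<close>

lemma padic_haar_translate: "distr padic_haar borel (\<lambda>x. x + t) = (padic_haar :: 'p::prime_card padic measure)"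
proof (rule measure_eqI)
  fix A :: "'p padic set" assume "A \<in> sets (distr padic_haar borel (\<lambda>x. x + t))"
  then have A [measurable]: "A \<in> sets borel" by simp
  have At: "{x. x + t \<in> A} \<in> sets borel"
    using measurable_sets[of "\<lambda>x. x + t" borel borel A] by (simp add: vimage_def)
  have rA: "{u. r + u \<in> A} \<in> sets borel" for r
    using measurable_sets[of "\<lambda>u. r + u" borel borel A] by (simp add: vimage_def)
  have "emeasure (distr padic_haar borel (\<lambda>x. x + t)) A = emeasure padic_haar {x. x + t \<in> A}"
    by (subst emeasure_distr) (auto simp: vimage_def)
  also have "\<dots> = (\<integral>\<^sup>+ r. emeasure unif {u. r + u + t \<in> A} \<partial>count_space (range (padic_rep :: 'p padic \<Rightarrow> _)))"
    using emeasure_padic_haar[OF At] by simp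
  also have "\<dots> = (\<integral>\<^sup>+ r. emeasure unif {u. padic_rep (r + t) + u \<in> A} \<partial>count_space (range (padic_rep :: 'p padic \<Rightarrow> _)))"
  proof (rule nn_integral_cong)
    fix r :: "'p padic"
    define d where "d = r + t - padic_rep (r + t)"
    have d: "d \<in> padic_ints"
      using padic_ints_closed(5)[OF padic_rep_diff[of "r + t"]] by (simp add: d_def)
    have "{u. r + u + t \<in> A} = {u. u + d \<in> {v. padic_rep (r + t) + v \<in> A}}"
      by (simp add: d_def algebra_simps)
    then show "emeasure unif {u. r + u + t \<in> A} = emeasure unif {u. padic_rep (r + t) + u \<in> A}"
      using unif_translate_set[OF d rA] by simp
  qed
  also have "\<dots> = (\<integral>\<^sup>+ r. emeasure unif {u. r + u \<in> A} \<partial>count_space (range (padic_rep :: 'p padic \<Rightarrow> _)))"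
  proof (rule nn_integral_bij_count_space[of "\<lambda>r. padic_rep (r + t)"])
    show "bij_betw (\<lambda>r. padic_rep (r + t)) (range padic_rep) (range (padic_rep :: 'p padic \<Rightarrow> _))"
      unfolding bij_betw_def
    proof
      show "inj_on (\<lambda>r. padic_rep (r + t)) (range padic_rep)"
      proof (rule inj_onI)
        fix r r' assume r: "r \<in> range padic_rep" "r' \<in> range padic_rep"
          and eq: "padic_rep (r + t) = padic_rep (r' + t)"
        have "r - r' \<in> padic_ints"
          using padic_ints_closed(4)[OF padic_rep_diff[of "r' + t"] padic_rep_diff[of "r + t"]] eq by simp
        then have "padic_rep r = padic_rep r'" by (rule padic_rep_eqI)
        then show "r = r'" using r by auto
      qed
      have "r \<in> (\<lambda>r. padic_rep (r + t)) ` range padic_rep" if "r = padic_rep x" for r x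
      proof -
        have "padic_rep (padic_rep (x - t) + t) = padic_rep x"
          using padic_rep_diff[of "x - t"] by (intro padic_rep_eqI) (simp add: algebra_simps)
        then show ?thesis using that by (auto intro!: image_eqI[of _ _ "padic_rep (x - t)"])
      qed
      then show "(\<lambda>r. padic_rep (r + t)) ` range padic_rep = range (padic_rep :: 'p padic \<Rightarrow> _)" by auto
    qed
  qed
  also have "\<dots> = emeasure padic_haar A"
    by (rule emeasure_padic_haar[OF A, symmetric])
  finally show "emeasure (distr padic_haar borel (\<lambda>x. x + t)) A = emeasure padic_haar A" .
qed simp

text \<open>Only the coset of 0 meets the integers, and its representative is integral, so the
  corresponding translate of \<open>unif\<close> is \<open>unif\<close> itself.\<close>

lemma padic_haar_eq_unif:
  assumes A: "A \<in> sets borel" and sub: "A \<subseteq> padic_ints"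
  shows "emeasure padic_haar A = emeasure (unif :: 'p::prime_card padic measure) A"
proof -
  interpret U: prob_space "unif :: 'p padic measure" by (rule prob_space_unif)
  let ?C = "count_space (range (padic_rep :: 'p padic \<Rightarrow> _))"
  have r0: "padic_rep 0 \<in> (padic_ints :: 'p padic set)" using padic_rep_diff[of "0 :: 'p padic"] by simp
  have "emeasure padic_haar A = (\<integral>\<^sup>+ r. emeasure unif A * indicator {padic_rep 0} r \<partial>?C)"
    unfolding emeasure_padic_haar[OF A]
  proof (rule nn_integral_cong)
    fix r assume "r \<in> space ?C"
    then have r: "padic_rep r = r" by auto
    show "emeasure unif {u. r + u \<in> A} = emeasure unif A * indicator {padic_rep 0} r"
    proof (cases "r = padic_rep 0")
      case True
      then show ?thesis using unif_translate_set[OF r0 A] by (simp add: add.commute)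
    next
      case False
      have "u \<notin> padic_ints" if "r + u \<in> A" for u
      proof
        assume "u \<in> padic_ints"
        then have "r - 0 \<in> padic_ints"
          using that sub padic_ints_closed(4)[of "r + u" u] by auto
        then show False using padic_rep_eqI r False by metis
      qed
      then have "emeasure unif {u. r + u \<in> A} \<le> emeasure unif (space unif - (padic_ints :: 'p padic set))"
        by (intro emeasure_mono) auto
      also have "\<dots> = 0"
        using emeasure_unif_padic_ints[where 'p='p] U.emeasure_space_1 by (subst emeasure_compl) auto
      finally show ?thesis using False by simp
    qed
  qed
  also have "\<dots> = emeasure unif A"
    by (subst nn_integral_cmult_indicator) auto
  finally show ?thesis .
qed

lemma padic_haar_ints: "emeasure padic_haar (padic_ints :: 'p::prime_card padic set) = 1"
  by (simp add: padic_haar_eq_unif emeasure_unif_padic_ints)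

global_interpretation padic_group: meas_group "borel :: 'p::prime_card padic measure" "(+)" uminus
proof
  show "case_prod (+) \<in> borel \<Otimes>\<^sub>M borel \<rightarrow>\<^sub>M (borel :: 'p padic measure)"
    unfolding case_prod_beta' by measurable
  show "uminus \<in> borel \<rightarrow>\<^sub>M (borel :: 'p padic measure)"
    using borel_measurable_padic_uminus[of "\<lambda>x. x" borel] by simp
qed simp_all

lemma haar_padic_haar: "padic_group.haar (padic_haar :: 'p::prime_card padic measure)"
proof (rule padic_group.haarI)
  show "countable (range (padic_rep :: 'p padic \<Rightarrow> _))" by (rule countable_range_padic_rep)
  fix x :: "'p padic"
  show "\<exists>r\<in>range padic_rep. x + r \<in> padic_ints"
    using padic_rep_diff[of "- x"] by (auto simp: add.commute)
qed (auto simp: padic_haar_translate padic_haar_ints)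

lemma sigma_finite_padic_haar: "sigma_finite_measure (padic_haar :: 'p::prime_card padic measure)"
  by (rule haar_padic_haar[unfolded padic_group.haar_def, THEN conjunct2, THEN conjunct1])

text \<open>Radii up to 1 are read off from \<open>unif\<close>. A larger ball is the preimage of
  the integers under multiplication by \<open>p^k\<close>, which scales Haar measure by a constant;
  the constant is found from the ball of radius \<open>p^(-k)\<close>, whose preimage is the set of
  integers.\<close>

lemma emeasure_padic_haar_ball:
  "emeasure padic_haar {x :: 'p::prime_card padic. pnorm x \<le> real CARD('p) powi j} = ennreal (real CARD('p) powi j)"
proof -
  have *: "emeasure padic_haar {x :: 'p padic. pnorm x \<le> real CARD('p) powi (- int k)} = ennreal (real CARD('p) powi (- int k))" for k
  proof -
    have "pball (0 :: 'p padic) k \<subseteq> padic_ints"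
      using pball_mono[of 0 k "0 :: 'p padic"] by (simp add: pball_0_0)
    then have "emeasure padic_haar (pball (0 :: 'p padic) k) = ennreal (real CARD('p) powi (- int k))"
      by (simp add: padic_haar_eq_unif emeasure_unif_pball)
    then show ?thesis by (simp add: pball_def)
  qed
  show ?thesis
  proof (cases "j \<le> 0")
    case True
    then show ?thesis using *[of "nat (- j)"] by simp
  next
    case False
    define k where "k = nat j"
    have jk: "j = int k" using False by (simp add: k_def)
    define T :: "'p padic \<Rightarrow> 'p padic" where "T x = of_nat CARD('p) ^ k * x" for x
    define T' :: "'p padic \<Rightarrow> 'p padic" where "T' x = inverse (of_nat CARD('p) ^ k) * x" for x
    have [measurable]: "T \<in> borel_measurable borel" "T' \<in> borel_measurable borel"
      unfolding T_def[abs_def] T'_def[abs_def] by measurable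
    have "pnorm (of_nat CARD('p) :: 'p padic) \<noteq> 0" using card_pos[where 'p='p] by (simp add: pnorm_prime)
    then have nz: "(of_nat CARD('p) :: 'p padic) \<noteq> 0" by (simp add: pnorm_eq_0_iff)
    have nT: "pnorm (T x) = real CARD('p) powi (- int k) * pnorm x" for x
      by (simp add: T_def pnorm_mult pnorm_power pnorm_prime power_int_minus field_simps)
    have pk: "real CARD('p) powi (- int k) * real CARD('p) powi int k = 1"
      using card_pos[where 'p='p] by (simp add: power_int_minus)
    have pos: "real CARD('p) powi (- int k) > 0" "real CARD('p) powi int k > 0"
      using card_pos[where 'p='p] by simp_all
    have h: "padic_group.haar (distr padic_haar borel T)"
      by (rule padic_group.haar_distr[OF haar_padic_haar, of T T'])
         (use nz in \<open>auto simp: T_def T'_def distrib_left\<close>)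
    have eq: "distr padic_haar borel T = scale_measure (emeasure (distr padic_haar borel T) padic_ints) padic_haar"
      by (rule padic_group.haar_unique[OF h haar_padic_haar]) (auto simp: padic_haar_ints)
    have 1: "emeasure (distr padic_haar borel T) padic_ints = emeasure padic_haar {x :: 'p padic. pnorm x \<le> real CARD('p) powi j}"
      using pos by (subst emeasure_distr)
        (auto simp: padic_ints_def nT jk vimage_def power_int_minus field_simps intro!: arg_cong[of _ _ "emeasure padic_haar"])
    have 2: "emeasure (distr padic_haar borel T) {x :: 'p padic. pnorm x \<le> real CARD('p) powi (- int k)} = 1"
      using pos padic_haar_ints[where 'p='p]
      by (subst emeasure_distr) (auto simp: padic_ints_def nT vimage_def)
    have 3: "emeasure padic_haar {x :: 'p padic. pnorm x \<le> real CARD('p) powi j} * ennreal (real CARD('p) powi (- int k)) = 1"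
      using 2 *[of k] by (subst (asm) eq) (simp add: 1)
    have "emeasure padic_haar {x :: 'p padic. pnorm x \<le> real CARD('p) powi j}
       = emeasure padic_haar {x :: 'p padic. pnorm x \<le> real CARD('p) powi j} * ennreal (real CARD('p) powi (- int k) * real CARD('p) powi int k)"
      by (simp only: pk) simp
    also have "\<dots> = ennreal (real CARD('p) powi int k)"
      using 3 pos by (simp add: ennreal_mult flip: mult.assoc)
    finally show ?thesis by (simp add: jk)
  qed
qed

lemma emeasure_padic_haar_scale:
  assumes "d \<noteq> 0"
  shows "emeasure padic_haar {x :: 'p::prime_card padic. x * d \<in> padic_ints} = ennreal (1 / pnorm d)"
proof -
  obtain k where k: "pnorm d = real CARD('p) powi k" using pnorm_value[OF assms] .
  have "pnorm d > 0" using assms pnorm_nonneg[of d] pnorm_eq_0_iff[of d] by linarith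
  then have "{x :: 'p padic. x * d \<in> padic_ints} = {x. pnorm x \<le> real CARD('p) powi (- k)}"
    by (auto simp: padic_ints_def pnorm_mult k power_int_minus field_simps)
  then show ?thesis by (simp only: emeasure_padic_haar_ball) (simp add: k power_int_minus divide_inverse)
qed

subsection \<open>Haar measure on matrix spaces\<close>

definition fplus :: "'i set \<Rightarrow> ('i \<Rightarrow> 'p::prime_card padic) \<Rightarrow> ('i \<Rightarrow> 'p padic) \<Rightarrow> 'i \<Rightarrow> 'p padic" where
  "fplus I z w = (\<lambda>i\<in>I. z i + w i)"

definition fneg :: "'i set \<Rightarrow> ('i \<Rightarrow> 'p::prime_card padic) \<Rightarrow> 'i \<Rightarrow> 'p padic" where
  "fneg I z = (\<lambda>i\<in>I. - z i)"

lemma space_mat_space: "space (mat_space n) = extensional (ix n)"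
  by (rule Set.set_eqI) (simp add: mat_space_def space_PiM PiE_iff)

lemma mat_space_component [measurable]: "ij \<in> ix n \<Longrightarrow> (\<lambda>z. z ij) \<in> borel_measurable (mat_space n)"
  unfolding mat_space_def by (rule measurable_component_singleton)

global_interpretation mat_group: meas_group "mat_space n :: 'p::prime_card mfun measure"
  "fplus (ix n)" "fneg (ix n)" for n
proof
  have "(\<lambda>x. \<lambda>i\<in>ix n. fst x i + snd x i) \<in> mat_space n \<Otimes>\<^sub>M mat_space n \<rightarrow>\<^sub>M (mat_space n :: 'p mfun measure)"
    unfolding mat_space_def[of n] by measurable
  then show "case_prod (fplus (ix n)) \<in> mat_space n \<Otimes>\<^sub>M mat_space n \<rightarrow>\<^sub>M (mat_space n :: 'p mfun measure)"
    by (simp add: case_prod_beta' fplus_def[abs_def])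
  have "(\<lambda>x. \<lambda>i\<in>ix n. - x i) \<in> mat_space n \<rightarrow>\<^sub>M (mat_space n :: 'p mfun measure)"
    unfolding mat_space_def[of n] by measurable
  then show "fneg (ix n) \<in> mat_space n \<rightarrow>\<^sub>M (mat_space n :: 'p mfun measure)"
    by (simp add: fneg_def[abs_def])
qed (auto simp: fplus_def fneg_def space_mat_space fun_eq_iff extensional_def)

definition mat_ints :: "nat \<Rightarrow> 'p::prime_card mfun set" where
  "mat_ints n = (\<Pi>\<^sub>E ij\<in>ix n. padic_ints)"

lemma mat_ints_sets [measurable]: "mat_ints n \<in> sets (mat_space n)"
  unfolding mat_ints_def mat_space_def by (rule sets_PiM_I_finite) auto

abbreviation haar_prod :: "nat \<Rightarrow> 'p::prime_card mfun measure" where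
  "haar_prod n \<equiv> PiM (ix n) (\<lambda>_. padic_haar)"

lemma sets_haar_prod: "sets (haar_prod n) = sets (mat_space n)"
  unfolding mat_space_def by (rule sets_PiM_cong) auto

lemma emeasure_haar_prod:
  assumes "\<And>ij. ij \<in> ix n \<Longrightarrow> A ij \<in> sets borel"
  shows "emeasure (haar_prod n) (Pi\<^sub>E (ix n) A) = (\<Prod>ij\<in>ix n. emeasure padic_haar (A ij))"
proof -
  interpret product_sigma_finite "\<lambda>_. padic_haar" by (simp add: product_sigma_finite_def sigma_finite_padic_haar)
  show ?thesis using assms by (intro emeasure_PiM) auto
qed

lemma emeasure_haar_prod_mat_ints: "emeasure (haar_prod n) (mat_ints n) = 1"
  unfolding mat_ints_def by (subst emeasure_haar_prod) (auto simp: padic_haar_ints)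

lemma fplus_measurable: "w \<in> space (mat_space n) \<Longrightarrow> (\<lambda>z. fplus (ix n) z w) \<in> mat_space n \<rightarrow>\<^sub>M mat_space n"
  using measurable_compose[OF measurable_Pair2' mat_group.pl_measurable] by simp

lemma haar_haar_prod: "mat_group.haar n (haar_prod n)"
  unfolding mat_group.haar_def
proof (intro conjI ballI)
  interpret product_sigma_finite "\<lambda>_. padic_haar" by (simp add: product_sigma_finite_def sigma_finite_padic_haar)
  show "sets (haar_prod n) = sets (mat_space n)" by (rule sets_haar_prod)
  show "sigma_finite_measure (haar_prod n)" by (rule sigma_finite) simp
  fix w :: "'a mfun" assume w: "w \<in> space (mat_space n)"
  show "distr (haar_prod n) (mat_space n) (\<lambda>z. fplus (ix n) z w) = haar_prod n"
  proof (rule PiM_eqI)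
    fix A :: "nat \<times> nat \<Rightarrow> 'a padic set" assume "\<And>i. i \<in> ix n \<Longrightarrow> A i \<in> sets padic_haar"
    then have A: "A i \<in> sets borel" if "i \<in> ix n" for i using that by simp
    have A': "{x. x + w i \<in> A i} \<in> sets borel" if "i \<in> ix n" for i
      using measurable_sets[of "\<lambda>x. x + w i" borel borel "A i"] A[OF that] by (simp add: vimage_def)
    have "emeasure (distr (haar_prod n) (mat_space n) (\<lambda>z. fplus (ix n) z w)) (Pi\<^sub>E (ix n) A)
      = emeasure (haar_prod n) ((\<lambda>z. fplus (ix n) z w) -` Pi\<^sub>E (ix n) A \<inter> space (haar_prod n))"
    proof (rule emeasure_distr)
      show "(\<lambda>z. fplus (ix n) z w) \<in> haar_prod n \<rightarrow>\<^sub>M mat_space n"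
        unfolding measurable_cong_sets[OF sets_haar_prod refl] by (rule fplus_measurable[OF w])
      show "Pi\<^sub>E (ix n) A \<in> sets (mat_space n)"
        unfolding mat_space_def using A by (intro sets_PiM_I_finite) auto
    qed
    also have "(\<lambda>z. fplus (ix n) z w) -` Pi\<^sub>E (ix n) A \<inter> space (haar_prod n) = Pi\<^sub>E (ix n) (\<lambda>i. {x. x + w i \<in> A i})"
    proof (rule Set.set_eqI)
      fix z :: "'a mfun"
      have "fplus (ix n) z w \<in> Pi\<^sub>E (ix n) A \<longleftrightarrow> (\<forall>i\<in>ix n. z i + w i \<in> A i)"
        unfolding fplus_def by (rule restrict_PiE_iff)
      moreover have "z \<in> space (haar_prod n) \<longleftrightarrow> z \<in> extensional (ix n)"
        by (simp add: space_PiM PiE_iff)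
      ultimately show "z \<in> (\<lambda>z. fplus (ix n) z w) -` Pi\<^sub>E (ix n) A \<inter> space (haar_prod n)
          \<longleftrightarrow> z \<in> Pi\<^sub>E (ix n) (\<lambda>i. {x. x + w i \<in> A i})"
        unfolding PiE_iff vimage_eq Int_iff mem_Collect_eq by blast
    qed
    also have "emeasure (haar_prod n) \<dots> = (\<Prod>i\<in>ix n. emeasure padic_haar {x. x + w i \<in> A i})"
      by (rule emeasure_haar_prod) (rule A')
    also have "\<dots> = (\<Prod>i\<in>ix n. emeasure padic_haar (A i))"
    proof (rule prod.cong[OF refl])
      fix i assume i: "i \<in> ix n"
      have "(\<lambda>x. x + w i) \<in> borel_measurable padic_haar"
        by (intro borel_measurable_padic_add measurable_ident_sets[OF sets_padic_haar] borel_measurable_const)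
      then have "emeasure (distr padic_haar borel (\<lambda>x. x + w i)) (A i) = emeasure padic_haar {x. x + w i \<in> A i}"
        by (subst emeasure_distr[OF _ A[OF i]]) (simp_all add: vimage_def)
      then show "emeasure padic_haar {x. x + w i \<in> A i} = emeasure padic_haar (A i)"
        by (simp add: padic_haar_translate)
    qed
    finally show "emeasure (distr (haar_prod n) (mat_space n) (\<lambda>z. fplus (ix n) z w)) (Pi\<^sub>E (ix n) A) = (\<Prod>i\<in>ix n. emeasure padic_haar (A i))" .
  qed (simp_all add: sets_haar_prod)
qed

text \<open>The description in \<open>vol\<close> demands only invariance and a normalisation. Any
  measure that satisfies it is sigma-finite by \<open>haarI\<close>, with the countably many
  matrices of coset representatives as translations, and then \<open>haar_unique\<close>
  applies.\<close>

lemma vol_eq: "vol n = (haar_prod n :: 'p::prime_card mfun measure)"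
  unfolding vol_def
proof (rule the_equality)
  let ?H = "haar_prod n :: 'p mfun measure"
  show "sets ?H = sets (mat_space n) \<and>
    (\<forall>w\<in>space (mat_space n). distr ?H (mat_space n) (\<lambda>z. \<lambda>ij\<in>ix n. z ij + w ij) = ?H) \<and>
    emeasure ?H (\<Pi>\<^sub>E ij\<in>ix n. padic_ints) = 1"
    using haar_haar_prod[of n, where 'a='p] emeasure_haar_prod_mat_ints[of n, where 'a='p]
    by (simp add: mat_group.haar_def fplus_def mat_ints_def)
next
  let ?H = "haar_prod n :: 'p mfun measure"
  fix V :: "'p mfun measure"
  assume V: "sets V = sets (mat_space n) \<and>
    (\<forall>w\<in>space (mat_space n). distr V (mat_space n) (\<lambda>z. \<lambda>ij\<in>ix n. z ij + w ij) = V) \<and>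
    emeasure V (\<Pi>\<^sub>E ij\<in>ix n. padic_ints) = 1"
  have "mat_group.haar n V"
  proof (rule mat_group.haarI)
    show "countable (\<Pi>\<^sub>E ij\<in>ix n. range (padic_rep :: 'p padic \<Rightarrow> _))"
      by (rule countable_PiE) (auto intro: countable_range_padic_rep)
    fix x :: "'p mfun"
    show "\<exists>r\<in>\<Pi>\<^sub>E ij\<in>ix n. range padic_rep. fplus (ix n) x r \<in> mat_ints n"
      using padic_rep_diff[of "- x _"]
      by (intro bexI[of _ "\<lambda>ij\<in>ix n. padic_rep (- x ij)"]) (auto simp: fplus_def mat_ints_def add.commute)
  qed (use V in \<open>auto simp: fplus_def mat_ints_def[symmetric] space_mat_space PiE_iff\<close>)
  then have "V = scale_measure (emeasure V (mat_ints n)) ?H"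
    by (rule mat_group.haar_unique[OF _ haar_haar_prod]) (auto simp: emeasure_haar_prod_mat_ints)
  also have "emeasure V (mat_ints n) = 1" using V by (simp add: mat_ints_def)
  finally show "V = ?H" by simp
qed

lemma haar_vol: "mat_group.haar n (vol n)"
  unfolding vol_eq by (rule haar_haar_prod)

lemma sets_vol [simp, measurable_cong]: "sets (vol n) = sets (mat_space n)"
  unfolding vol_eq by (rule sets_haar_prod)

lemma space_vol [simp]: "space (vol n) = extensional (ix n)"
  using sets_eq_imp_space_eq[OF sets_vol] by (simp add: space_mat_space)

lemma sigma_finite_vol: "sigma_finite_measure (vol n)"
  by (rule haar_vol[unfolded mat_group.haar_def, THEN conjunct2, THEN conjunct1])

lemma emeasure_vol_mat_ints: "emeasure (vol n) (mat_ints n) = 1"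
  unfolding vol_eq by (rule emeasure_haar_prod_mat_ints)

subsection \<open>Matrices over the p-adic numbers\<close>

definition fun_of :: "nat \<Rightarrow> 'a Matrix.mat \<Rightarrow> nat \<times> nat \<Rightarrow> 'a" where
  "fun_of n A = (\<lambda>ij\<in>ix n. A $$ ij)"

lemma fun_of_extensional [simp]: "fun_of n A \<in> extensional (ix n)"
  by (simp add: fun_of_def)

lemma mat_fun_of: "A \<in> carrier_mat n n \<Longrightarrow> Matrix.mat n n (fun_of n A) = A"
  by (rule eq_matI) (auto simp: fun_of_def)

lemma fun_of_mat: "z \<in> extensional (ix n) \<Longrightarrow> fun_of n (Matrix.mat n n z) = z"
  by (auto simp: fun_of_def fun_eq_iff extensional_def)

definition int_mat :: "'p::prime_card padic Matrix.mat \<Rightarrow> bool" where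
  "int_mat A \<longleftrightarrow> elements_mat A \<subseteq> padic_ints"

lemma int_mat_iff:
  "A \<in> carrier_mat n m \<Longrightarrow> int_mat A \<longleftrightarrow> (\<forall>i<n. \<forall>j<m. A $$ (i, j) \<in> padic_ints)"
  unfolding int_mat_def by fastforce

lemma int_mat_mult:
  assumes "A \<in> carrier_mat n m" "B \<in> carrier_mat m l" "int_mat A" "int_mat B"
  shows "int_mat (A * B)"
proof -
  have AB: "A * B \<in> carrier_mat n l" using assms by simp
  show ?thesis unfolding int_mat_iff[OF AB]
    using assms by (auto simp: int_mat_iff scalar_prod_def intro!: padic_ints_sum)
qed

lemma int_mat_one: "int_mat (1\<^sub>m n)"
  by (subst int_mat_iff[OF one_carrier_mat]) auto

lemma signof_padic_ints: "(signof q :: 'p::prime_card padic) \<in> padic_ints"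
  by (cases q rule: sign_cases) simp_all

lemma int_mat_det:
  assumes A: "A \<in> carrier_mat n n" "int_mat A"
  shows "Determinant.det A \<in> padic_ints"
  unfolding det_def'[OF A(1)]
proof (intro padic_ints_sum padic_ints_closed padic_ints_prod signof_padic_ints)
  fix q i assume "q \<in> {q. q permutes {0..<n}}" "i \<in> {0..<n}"
  then have "i < n" "q i < n" using permutes_in_image[of q "{0..<n}" i] by auto
  then show "A $$ (i, q i) \<in> padic_ints" using A by (auto simp: int_mat_iff)
qed

lemma int_mat_adj:
  assumes A: "A \<in> carrier_mat n n" "int_mat A"
  shows "int_mat (adj_mat A)"
  unfolding int_mat_iff[OF adj_mat(1)[OF A(1)]]
proof (intro allI impI)
  fix i j assume ij: "i < n" "j < n"
  have c: "mat_delete A j i \<in> carrier_mat (n - 1) (n - 1)" using A(1) by (rule mat_delete_carrier)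
  have "int_mat (mat_delete A j i)"
    unfolding int_mat_iff[OF c]
  proof (intro allI impI)
    fix i' j' assume ij': "i' < n - 1" "j' < n - 1"
    then have "mat_delete A j i $$ (i', j') = A $$ (if i' < j then i' else Suc i', if j' < i then j' else Suc j')"
      using A(1) by (simp add: mat_delete_def)
    also have "\<dots> \<in> padic_ints" using A ij ij' by (auto simp: int_mat_iff)
    finally show "mat_delete A j i $$ (i', j') \<in> padic_ints" .
  qed
  then have "Determinant.det (mat_delete A j i) \<in> padic_ints" by (rule int_mat_det[OF c])
  moreover have "((-1) ^ (j + i) :: 'a padic) \<in> padic_ints"
    by (induction "j + i" arbitrary: i j) (auto simp: padic_ints_def pnorm_power pnorm_minus)
  ultimately show "adj_mat A $$ (i, j) \<in> padic_ints"
    using A(1) ij by (simp add: adj_mat_def cofactor_def)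
qed

lemma int_mat_smult: "c \<in> padic_ints \<Longrightarrow> A \<in> carrier_mat n m \<Longrightarrow> int_mat A \<Longrightarrow> int_mat (c \<cdot>\<^sub>m A)"
  by (subst int_mat_iff[OF smult_carrier_mat]) (auto simp: int_mat_iff)

lemma int_mat_fun_of: "A \<in> carrier_mat n n \<Longrightarrow> fun_of n A \<in> mat_ints n \<longleftrightarrow> int_mat A"
  by (auto simp: fun_of_def mat_ints_def int_mat_iff PiE_iff)

lemma int_mat_mat: "z \<in> extensional (ix n) \<Longrightarrow> int_mat (Matrix.mat n n z) \<longleftrightarrow> z \<in> mat_ints n"
  using int_mat_fun_of[of "Matrix.mat n n z" n] by (simp add: fun_of_mat)

text \<open>The adjugate formula gives a total function whose entries depend measurably on those of
  \<open>A\<close>, and which preserves integrality when the determinant is a unit. A singular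
  matrix is sent to zero.\<close>

definition inv_mat :: "'a::field Matrix.mat \<Rightarrow> 'a Matrix.mat" where
  "inv_mat A = inverse (Determinant.det A) \<cdot>\<^sub>m adj_mat A"

lemma inv_mat_carrier [simp]: "A \<in> carrier_mat n n \<Longrightarrow> inv_mat A \<in> carrier_mat n n"
  by (simp add: inv_mat_def adj_mat(1))

lemma inv_mat:
  assumes A: "A \<in> carrier_mat n n" and d: "Determinant.det A \<noteq> 0"
  shows "A * inv_mat A = 1\<^sub>m n" "inv_mat A * A = 1\<^sub>m n"
proof -
  note adj = adj_mat[OF A]
  have "A * inv_mat A = inverse (Determinant.det A) \<cdot>\<^sub>m (A * adj_mat A)"
    unfolding inv_mat_def by (rule mult_smult_distrib[OF A adj(1)])
  also have "\<dots> = 1\<^sub>m n" unfolding adj(2) using d by (intro eq_matI) auto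
  finally show "A * inv_mat A = 1\<^sub>m n" .
  have "inv_mat A * A = inverse (Determinant.det A) \<cdot>\<^sub>m (adj_mat A * A)"
    unfolding inv_mat_def by (rule mult_smult_assoc_mat[OF adj(1) A])
  also have "\<dots> = 1\<^sub>m n" unfolding adj(3) using d by (intro eq_matI) auto
  finally show "inv_mat A * A = 1\<^sub>m n" .
qed

section \<open>Invertible matrices over the p-adic integers\<close>

lemma det_inverse_mat:
  assumes A: "(A :: 'a::field Matrix.mat) \<in> carrier_mat n n" and B: "B \<in> carrier_mat n n" and AB: "A * B = 1\<^sub>m n"
  shows "Determinant.det A * Determinant.det B = 1"
  using det_mult[OF A B] AB by simp

lemma pnorm_det_le_1: "A \<in> carrier_mat n n \<Longrightarrow> int_mat A \<Longrightarrow> pnorm (Determinant.det A) \<le> 1"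
  using int_mat_det by (auto simp: padic_ints_def)

lemma int_mat_inv_mat:
  assumes A: "A \<in> carrier_mat n n" "int_mat A" "pnorm (Determinant.det A) = 1"
  shows "int_mat (inv_mat A)"
  unfolding inv_mat_def using A adj_mat(1)[OF A(1)] int_mat_adj[OF A(1,2)]
  by (intro int_mat_smult[of _ _ n n]) (auto simp: padic_ints_def pnorm_inverse)

text \<open>Determinants of integral matrices have norm at most 1, so two of them with product 1
  have norm exactly 1; conversely the adjugate is integral and only has to be divided by a
  unit.\<close>

lemma GL_int_iff:
  "A \<in> GL_int n \<longleftrightarrow> A \<in> carrier_mat n n \<and> int_mat A \<and> pnorm (Determinant.det A) = 1"
proof
  assume "A \<in> GL_int n"
  then obtain B where A: "A \<in> carrier_mat n n" "int_mat A" and B: "B \<in> carrier_mat n n" "int_mat B"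
    and AB: "A * B = 1\<^sub>m n" unfolding GL_int_def int_mat_def by blast
  have "pnorm (Determinant.det A) * pnorm (Determinant.det B) = 1"
    using det_inverse_mat[OF A(1) B(1) AB] by (simp flip: pnorm_mult)
  moreover have "pnorm (Determinant.det A) * pnorm (Determinant.det B) \<le> pnorm (Determinant.det A)"
    using pnorm_det_le_1[OF B] pnorm_nonneg[of "Determinant.det A"] by (simp add: mult_left_le)
  ultimately show "A \<in> carrier_mat n n \<and> int_mat A \<and> pnorm (Determinant.det A) = 1"
    using pnorm_det_le_1[OF A] A by auto
next
  assume A: "A \<in> carrier_mat n n \<and> int_mat A \<and> pnorm (Determinant.det A) = 1"
  then have d: "Determinant.det A \<noteq> 0" using pnorm_eq_0_iff[of "Determinant.det A"] by auto
  have "int_mat (inv_mat A)" using A by (intro int_mat_inv_mat) auto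
  then show "A \<in> GL_int n"
    using A inv_mat[of A n] d unfolding GL_int_def int_mat_def by (auto intro!: bexI[of _ "inv_mat A"])
qed

lemma GL_int_mult: "A \<in> GL_int n \<Longrightarrow> B \<in> GL_int n \<Longrightarrow> A * B \<in> GL_int n"
  by (auto simp: GL_int_iff int_mat_mult det_mult pnorm_mult)

lemma GL_int_inv_mat: "A \<in> GL_int n \<Longrightarrow> inv_mat A \<in> GL_int n"
proof -
  assume "A \<in> GL_int n"
  then have A: "A \<in> carrier_mat n n" "int_mat A" and d: "pnorm (Determinant.det A) = 1" by (auto simp: GL_int_iff)
  then have nz: "Determinant.det A \<noteq> 0" using pnorm_eq_0_iff[of "Determinant.det A"] by auto
  have "int_mat (inv_mat A)" by (rule int_mat_inv_mat[OF A d])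
  moreover have "pnorm (Determinant.det A) * pnorm (Determinant.det (inv_mat A)) = 1"
    using det_inverse_mat[OF A(1) inv_mat_carrier[OF A(1)] inv_mat(1)[OF A(1) nz]] by (simp flip: pnorm_mult)
  ultimately show ?thesis using A d by (simp add: GL_int_iff)
qed

lemma GL_int_det_nonzero: "A \<in> GL_int n \<Longrightarrow> Determinant.det A \<noteq> 0"
  by (auto simp: GL_int_iff)

lemma int_mat_mult_GL_right:
  assumes x: "x \<in> carrier_mat m n" and A: "A \<in> GL_int n"
  shows "int_mat (x * A) \<longleftrightarrow> int_mat x"
proof
  have Ac: "A \<in> carrier_mat n n" and Ai: "inv_mat A \<in> carrier_mat n n" "int_mat (inv_mat A)"
    using A GL_int_inv_mat[OF A] by (auto simp: GL_int_iff)
  assume "int_mat (x * A)"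
  then have "int_mat (x * A * inv_mat A)" using x Ac Ai int_mat_mult[of "x * A" m n "inv_mat A" n] by auto
  also have "x * A * inv_mat A = x"
    using x Ac Ai inv_mat[OF Ac GL_int_det_nonzero[OF A]] by (simp add: assoc_mult_mat[of _ m n _ n _ n])
  finally show "int_mat x" .
next
  assume "int_mat x"
  then show "int_mat (x * A)" using A x int_mat_mult[of x m n A n] by (auto simp: GL_int_iff)
qed

lemma int_mat_transpose: "int_mat (transpose_mat A) \<longleftrightarrow> int_mat A"
  using int_mat_iff[of A "dim_row A" "dim_col A"] int_mat_iff[of "transpose_mat A" "dim_col A" "dim_row A"]
  by auto

subsection \<open>Measurability of matrix operations\<close>

text \<open>The matrix type contains all sizes, so measurability is expressed entrywise at a fixed
  size.\<close>

definition mat_measurable ::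
  "'a measure \<Rightarrow> nat \<Rightarrow> nat \<Rightarrow> ('a \<Rightarrow> 'p::prime_card padic Matrix.mat) \<Rightarrow> bool" where
  "mat_measurable \<Omega> n m f \<longleftrightarrow> (\<forall>\<omega>. f \<omega> \<in> carrier_mat n m) \<and>
     (\<forall>i<n. \<forall>j<m. (\<lambda>\<omega>. f \<omega> $$ (i, j)) \<in> borel_measurable \<Omega>)"

lemma mat_measurableD:
  assumes "mat_measurable \<Omega> n m f"
  shows "f \<omega> \<in> carrier_mat n m" "i < n \<Longrightarrow> j < m \<Longrightarrow> (\<lambda>\<omega>. f \<omega> $$ (i, j)) \<in> borel_measurable \<Omega>"
  using assms by (auto simp: mat_measurable_def)

lemma mat_measurable_const: "A \<in> carrier_mat n m \<Longrightarrow> mat_measurable \<Omega> n m (\<lambda>_. A)"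
  by (simp add: mat_measurable_def)

lemma mat_measurable_mat:
  assumes "f \<in> \<Omega> \<rightarrow>\<^sub>M mat_space n"
  shows "mat_measurable \<Omega> n n (\<lambda>\<omega>. Matrix.mat n n (f \<omega>))"
  using measurable_compose[OF assms mat_space_component] by (auto simp: mat_measurable_def)

lemma mat_measurable_mat_id: "mat_measurable (mat_space n) n n (Matrix.mat n n)"
  by (rule mat_measurable_mat[OF measurable_ident_sets[OF refl]])

lemma mat_measurable_mult:
  assumes f: "mat_measurable \<Omega> n m f" and g: "mat_measurable \<Omega> m l g"
  shows "mat_measurable \<Omega> n l (\<lambda>\<omega>. f \<omega> * g \<omega>)"
  unfolding mat_measurable_def
proof (intro conjI allI impI)
  show "f \<omega> * g \<omega> \<in> carrier_mat n l" for \<omega>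
    by (rule mult_carrier_mat[OF mat_measurableD(1)[OF f] mat_measurableD(1)[OF g]])
  fix i j assume ij: "i < n" "j < l"
  have "(\<lambda>\<omega>. \<Sum>k<m. f \<omega> $$ (i, k) * g \<omega> $$ (k, j)) \<in> borel_measurable \<Omega>"
    using mat_measurableD(2)[OF f] mat_measurableD(2)[OF g] ij
    by (intro borel_measurable_padic_sum borel_measurable_padic_mult) auto
  also have "(\<lambda>\<omega>. \<Sum>k<m. f \<omega> $$ (i, k) * g \<omega> $$ (k, j)) = (\<lambda>\<omega>. (f \<omega> * g \<omega>) $$ (i, j))"
  proof
    fix \<omega> show "(\<Sum>k<m. f \<omega> $$ (i, k) * g \<omega> $$ (k, j)) = (f \<omega> * g \<omega>) $$ (i, j)"
      using mat_measurableD(1)[OF f, of \<omega>] mat_measurableD(1)[OF g, of \<omega>] ij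
      by (auto simp: scalar_prod_def lessThan_atLeast0 intro!: sum.cong)
  qed
  finally show "(\<lambda>\<omega>. (f \<omega> * g \<omega>) $$ (i, j)) \<in> borel_measurable \<Omega>" .
qed

lemma det_measurable:
  assumes f: "mat_measurable \<Omega> n n f"
  shows "(\<lambda>\<omega>. Determinant.det (f \<omega>)) \<in> borel_measurable \<Omega>"
  unfolding det_def'[OF mat_measurableD(1)[OF f]]
proof (intro borel_measurable_padic_sum borel_measurable_padic_mult borel_measurable_padic_prod borel_measurable_const)
  fix q i assume "q \<in> {q. q permutes {0..<n}}" "i \<in> {0..<n}"
  then have "i < n" "q i < n" using permutes_in_image[of q "{0..<n}" i] by auto
  then show "(\<lambda>\<omega>. f \<omega> $$ (i, q i)) \<in> borel_measurable \<Omega>" by (rule mat_measurableD(2)[OF f])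
qed

lemma mat_measurable_inv_mat:
  assumes f: "mat_measurable \<Omega> n n f"
  shows "mat_measurable \<Omega> n n (\<lambda>\<omega>. inv_mat (f \<omega>))"
  unfolding mat_measurable_def
proof (intro conjI allI impI)
  have c: "f \<omega> \<in> carrier_mat n n" for \<omega> by (rule mat_measurableD(1)[OF f])
  show "inv_mat (f \<omega>) \<in> carrier_mat n n" for \<omega> using c by simp
  fix i j assume ij: "i < n" "j < n"
  have "mat_measurable \<Omega> (n - 1) (n - 1) (\<lambda>\<omega>. mat_delete (f \<omega>) j i)"
    unfolding mat_measurable_def
  proof (intro conjI allI impI)
    show "mat_delete (f \<omega>) j i \<in> carrier_mat (n - 1) (n - 1)" for \<omega> using c by (rule mat_delete_carrier)
    fix i' j' assume ij': "i' < n - 1" "j' < n - 1"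
    define k l where "k = (if i' < j then i' else Suc i')" and "l = (if j' < i then j' else Suc j')"
    have kl: "k < n" "l < n" using ij' by (auto simp: k_def l_def)
    have "mat_delete (f \<omega>) j i $$ (i', j') = f \<omega> $$ (k, l)" for \<omega>
      using c[of \<omega>] ij' by (auto simp: mat_delete_def k_def l_def)
    then show "(\<lambda>\<omega>. mat_delete (f \<omega>) j i $$ (i', j')) \<in> borel_measurable \<Omega>"
      using mat_measurableD(2)[OF f kl] by simp
  qed
  then have d: "(\<lambda>\<omega>. Determinant.det (mat_delete (f \<omega>) j i)) \<in> borel_measurable \<Omega>" by (rule det_measurable)
  have "inv_mat (f \<omega>) $$ (i, j) = inverse (Determinant.det (f \<omega>)) * ((-1) ^ (j + i) * Determinant.det (mat_delete (f \<omega>) j i))" for \<omega>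
    using c[of \<omega>] adj_mat(1)[OF c[of \<omega>]] ij by (auto simp: inv_mat_def adj_mat_def cofactor_def)
  then show "(\<lambda>\<omega>. inv_mat (f \<omega>) $$ (i, j)) \<in> borel_measurable \<Omega>"
    using d det_measurable[OF f] by simp
qed

lemma fun_of_measurable:
  assumes f: "mat_measurable \<Omega> n n f"
  shows "(\<lambda>\<omega>. fun_of n (f \<omega>)) \<in> \<Omega> \<rightarrow>\<^sub>M mat_space n"
  unfolding fun_of_def mat_space_def using mat_measurableD(2)[OF f]
  by (intro measurable_restrict) auto

lemma int_mat_measurable:
  assumes f: "mat_measurable \<Omega> n n f"
  shows "{\<omega>\<in>space \<Omega>. int_mat (f \<omega>)} \<in> sets \<Omega>"
proof -
  have "{\<omega>\<in>space \<Omega>. int_mat (f \<omega>)} = (\<lambda>\<omega>. fun_of n (f \<omega>)) -` mat_ints n \<inter> space \<Omega>"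
    using int_mat_fun_of[OF mat_measurableD(1)[OF f]] by auto
  then show ?thesis using measurable_sets[OF fun_of_measurable[OF f] mat_ints_sets] by simp
qed

subsection \<open>Linear changes of variables\<close>

lemma mat_fplus: "Matrix.mat n n (fplus (ix n) z w) = Matrix.mat n n z + Matrix.mat n n w"
  by (rule eq_matI) (auto simp: fplus_def)

lemma fun_of_add:
  "A \<in> carrier_mat n n \<Longrightarrow> B \<in> carrier_mat n n \<Longrightarrow> fun_of n (A + B) = fplus (ix n) (fun_of n A) (fun_of n B)"
  by (auto simp: fun_of_def fplus_def fun_eq_iff)

text \<open>The image of \<open>vol n\<close> under an additive automorphism is again a Haar
  measure, hence a multiple of \<open>vol n\<close>; the factor is the mass that the image gives to
  \<open>mat_ints n\<close>.\<close>

lemma nn_integral_vol_linear: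
  fixes T T' :: "'p::prime_card mfun \<Rightarrow> 'p mfun"
  assumes T: "T \<in> mat_space n \<rightarrow>\<^sub>M mat_space n" "T' \<in> mat_space n \<rightarrow>\<^sub>M mat_space n"
    and inv: "\<And>x. x \<in> extensional (ix n) \<Longrightarrow> T (T' x) = x" "\<And>x. x \<in> extensional (ix n) \<Longrightarrow> T' (T x) = x"
    and add: "\<And>x y. x \<in> extensional (ix n) \<Longrightarrow> y \<in> extensional (ix n) \<Longrightarrow> T (fplus (ix n) x y) = fplus (ix n) (T x) (T y)"
    and f: "f \<in> borel_measurable (mat_space n)"
  shows "(\<integral>\<^sup>+ z. f (T z) \<partial>vol n) = (\<integral>\<^sup>+ z. indicator (mat_ints n) (T z) \<partial>vol n) * (\<integral>\<^sup>+ z. f z \<partial>vol n)"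
proof -
  let ?V = "vol n :: 'p mfun measure"
  have TV [measurable]: "T \<in> ?V \<rightarrow>\<^sub>M mat_space n"
    using T(1) by (simp add: measurable_cong_sets[OF sets_vol refl])
  have h: "mat_group.haar n (distr ?V (mat_space n) T)"
    by (rule mat_group.haar_distr[OF haar_vol T]) (auto simp: space_mat_space inv add)
  have eq: "distr ?V (mat_space n) T = scale_measure (emeasure (distr ?V (mat_space n) T) (mat_ints n)) ?V"
    by (rule mat_group.haar_unique[OF h haar_vol]) (auto simp: emeasure_vol_mat_ints)
  have c: "emeasure (distr ?V (mat_space n) T) (mat_ints n) = (\<integral>\<^sup>+ z. indicator (mat_ints n) (T z) \<partial>?V)"
    by (subst nn_integral_indicator[symmetric], simp, subst nn_integral_distr) auto
  have "(\<integral>\<^sup>+ z. f (T z) \<partial>?V) = (\<integral>\<^sup>+ z. f z \<partial>distr ?V (mat_space n) T)"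
    by (rule nn_integral_distr[symmetric, OF TV]) (use f in simp)
  also have "\<dots> = (\<integral>\<^sup>+ z. f z \<partial>scale_measure (\<integral>\<^sup>+ z. indicator (mat_ints n) (T z) \<partial>?V) ?V)"
    by (subst eq) (simp add: c)
  also have "\<dots> = (\<integral>\<^sup>+ z. indicator (mat_ints n) (T z) \<partial>?V) * (\<integral>\<^sup>+ z. f z \<partial>?V)"
    by (rule nn_integral_scale_measure) (use f in \<open>simp add: measurable_cong_sets[OF sets_vol refl]\<close>)
  finally show ?thesis .
qed

definition rmul :: "nat \<Rightarrow> 'p::prime_card padic Matrix.mat \<Rightarrow> 'p mfun \<Rightarrow> 'p mfun" where
  "rmul n h z = fun_of n (Matrix.mat n n z * h)"

lemma mat_mult_carrier [simp]: "h \<in> carrier_mat n n \<Longrightarrow> Matrix.mat n n z * h \<in> carrier_mat n n"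
  by (rule mult_carrier_mat) auto

lemma mat_rmul: "h \<in> carrier_mat n n \<Longrightarrow> Matrix.mat n n (rmul n h z) = Matrix.mat n n z * h"
  by (simp add: rmul_def mat_fun_of)

lemma rmul_measurable: "h \<in> carrier_mat n n \<Longrightarrow> rmul n h \<in> mat_space n \<rightarrow>\<^sub>M mat_space n"
  unfolding rmul_def[abs_def]
  by (rule fun_of_measurable[OF mat_measurable_mult[OF mat_measurable_mat_id mat_measurable_const]])

lemma rmul_rmul: "h \<in> carrier_mat n n \<Longrightarrow> k \<in> carrier_mat n n \<Longrightarrow> rmul n k (rmul n h z) = rmul n (h * k) z"
  unfolding rmul_def[of n k] rmul_def[of n "h * k"] by (simp add: mat_rmul assoc_mult_mat[of _ n n _ n _ n])

lemma rmul_one: "z \<in> extensional (ix n) \<Longrightarrow> rmul n (1\<^sub>m n) z = z"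
  by (simp add: rmul_def fun_of_mat)

lemma rmul_fplus: "h \<in> carrier_mat n n \<Longrightarrow> rmul n h (fplus (ix n) x y) = fplus (ix n) (rmul n h x) (rmul n h y)"
  unfolding rmul_def by (simp add: mat_fplus add_mult_distrib_mat[of _ n n _ _ n] fun_of_add)

text \<open>The modulus of right multiplication by \<open>h\<close>, the factor by which it
  transforms integrals. Its value is found from multiplicativity, diagonal matrices and matrices
  invertible over the integers.\<close>

definition rscale :: "nat \<Rightarrow> 'p::prime_card padic Matrix.mat \<Rightarrow> ennreal" where
  "rscale n h = (\<integral>\<^sup>+ z. indicator (mat_ints n) (rmul n h z) \<partial>vol n)"

lemma nn_integral_rmul_rscale:
  assumes h: "h \<in> carrier_mat n n" "Determinant.det h \<noteq> 0" and f: "f \<in> borel_measurable (mat_space n)"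
  shows "(\<integral>\<^sup>+ z. f (rmul n h z) \<partial>vol n) = rscale n h * (\<integral>\<^sup>+ z. f z \<partial>(vol n :: 'p::prime_card mfun measure))"
  unfolding rscale_def
proof (rule nn_integral_vol_linear[OF _ _ _ _ _ f])
  show "rmul n h \<in> mat_space n \<rightarrow>\<^sub>M mat_space n" "rmul n (inv_mat h) \<in> mat_space n \<rightarrow>\<^sub>M mat_space n"
    using h(1) by (auto intro!: rmul_measurable)
qed (use h in \<open>auto simp: rmul_rmul inv_mat rmul_one rmul_fplus\<close>)

lemma rscale_mult:
  assumes h: "h \<in> carrier_mat n n" "Determinant.det h \<noteq> 0" and k: "k \<in> carrier_mat n n"
  shows "rscale n (h * k) = rscale n h * rscale n (k :: 'p::prime_card padic Matrix.mat)"
proof -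
  have "rscale n (h * k) = (\<integral>\<^sup>+ z. indicator (mat_ints n) (rmul n k (rmul n h z)) \<partial>(vol n :: 'p mfun measure))"
    by (simp add: rscale_def rmul_rmul h k)
  also have "\<dots> = rscale n h * rscale n k"
    unfolding rscale_def[of n k]
    by (rule nn_integral_rmul_rscale[OF h]) (use rmul_measurable[OF k] in measurable)
  finally show ?thesis .
qed

lemma rscale_GL_int:
  assumes h: "h \<in> GL_int n" shows "rscale n (h :: 'p::prime_card padic Matrix.mat) = 1"
proof -
  have hc: "h \<in> carrier_mat n n" using h by (simp add: GL_int_iff)
  have "rscale n h = (\<integral>\<^sup>+ z. indicator (mat_ints n) z \<partial>(vol n :: 'p mfun measure))"
    unfolding rscale_def
  proof (rule nn_integral_cong)
    fix z :: "'p mfun" assume "z \<in> space (vol n)"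
    then have z: "z \<in> extensional (ix n)" by simp
    have "rmul n h z \<in> mat_ints n \<longleftrightarrow> int_mat (Matrix.mat n n z * h)"
      unfolding rmul_def using hc by (intro int_mat_fun_of) auto
    also have "\<dots> \<longleftrightarrow> z \<in> mat_ints n"
      using int_mat_mult_GL_right[OF _ h, of "Matrix.mat n n z" n] int_mat_mat[OF z] by simp
    finally show "indicator (mat_ints n) (rmul n h z) = (indicator (mat_ints n) z :: ennreal)"
      by (simp add: indicator_def)
  qed
  also have "\<dots> = 1" by (subst nn_integral_indicator) (auto simp: emeasure_vol_mat_ints)
  finally show ?thesis .
qed

lemma det_mat_diag: "Determinant.det (mat_diag n f) = (\<Prod>i<n. f i)"
proof -
  have "Determinant.det (mat_diag n f) = prod_list (diag_mat (mat_diag n f))"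
    by (rule det_upper_triangular[of _ n]) (auto simp: mat_diag_def)
  also have "diag_mat (mat_diag n f) = map f [0..<n]"
    by (auto simp: diag_mat_def mat_diag_def)
  also have "prod_list (map f [0..<n]) = (\<Prod>i<n. f i)"
    by (simp add: prod.distinct_set_conv_list[symmetric] lessThan_atLeast0)
  finally show ?thesis .
qed

text \<open>Right multiplication by a diagonal matrix scales column \<open>j\<close> by
  \<open>d j\<close>, so the set to be measured is a box; the \<open>n\<close> rows account for the
  n-th power.\<close>

lemma rscale_mat_diag:
  assumes d: "\<And>j. j < n \<Longrightarrow> d j \<noteq> 0"
  shows "rscale n (mat_diag n d) = ennreal (1 / pnorm (Determinant.det (mat_diag n d :: 'p::prime_card padic Matrix.mat)) ^ n)"
proof -
  let ?V = "vol n :: 'p mfun measure"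
  have S: "{x. x * c \<in> padic_ints} \<in> sets borel" for c :: "'p padic"
    using measurable_sets[of "\<lambda>x. x * c" borel borel padic_ints] by (simp add: vimage_def)
  let ?E = "Pi\<^sub>E (ix n) (\<lambda>(i, j). {x. x * d j \<in> padic_ints})"
  have "rscale n (mat_diag n d) = (\<integral>\<^sup>+ z. indicator ?E z \<partial>?V)"
    unfolding rscale_def
  proof (rule nn_integral_cong)
    fix z :: "'p mfun" assume "z \<in> space ?V"
    then have z: "z \<in> extensional (ix n)" by simp
    have "rmul n (mat_diag n d) z = (\<lambda>ij\<in>ix n. z ij * d (snd ij))"
      unfolding rmul_def by (subst mat_diag_mult_right[of _ n n]) (auto simp: fun_of_def fun_eq_iff)
    then have "rmul n (mat_diag n d) z \<in> mat_ints n \<longleftrightarrow> z \<in> ?E"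
      using z by (auto simp: mat_ints_def PiE_iff)
    then show "indicator (mat_ints n) (rmul n (mat_diag n d) z) = (indicator ?E z :: ennreal)"
      by (simp add: indicator_def)
  qed
  also have "\<dots> = emeasure ?V ?E"
    by (rule nn_integral_indicator) (use S in \<open>auto simp: mat_space_def intro!: sets_PiM_I_finite\<close>)
  also have "\<dots> = (\<Prod>ij\<in>ix n. emeasure padic_haar {x. x * d (snd ij) \<in> padic_ints})"
    unfolding vol_eq by (subst emeasure_haar_prod) (auto simp: S split_beta)
  also have "\<dots> = (\<Prod>ij\<in>ix n. ennreal (1 / pnorm (d (snd ij))))"
    by (intro prod.cong refl) (auto intro!: emeasure_padic_haar_scale d)
  also have "\<dots> = ennreal (\<Prod>ij\<in>ix n. 1 / pnorm (d (snd ij)))"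
    by (intro prod_ennreal) (simp add: pnorm_nonneg)
  also have "(\<Prod>ij\<in>ix n. 1 / pnorm (d (snd ij))) = (\<Prod>i<n. \<Prod>j<n. 1 / pnorm (d j))"
    by (subst prod.cartesian_product) (auto simp: split_beta)
  also have "\<dots> = 1 / pnorm (Determinant.det (mat_diag n d)) ^ n"
    by (simp add: det_mat_diag pnorm_prod prod_dividef power_one_over)
  finally show ?thesis .
qed

subsection \<open>Smith normal form\<close>

definition GL_equiv :: "nat \<Rightarrow> 'p::prime_card padic Matrix.mat \<Rightarrow> 'p padic Matrix.mat \<Rightarrow> bool" where
  "GL_equiv n z w \<longleftrightarrow> (\<exists>A\<in>GL_int n. \<exists>B\<in>GL_int n. z = A * w * B)"

lemma GL_int_carrier: "A \<in> GL_int n \<Longrightarrow> A \<in> carrier_mat n n"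
  by (simp add: GL_int_iff)

lemma GL_int_one: "1\<^sub>m n \<in> GL_int n"
  by (simp add: GL_int_iff int_mat_one)

lemma GL_equiv_refl: "z \<in> carrier_mat n n \<Longrightarrow> GL_equiv n z z"
  unfolding GL_equiv_def using GL_int_one by (intro bexI[of _ "1\<^sub>m n"]) auto

lemma GL_equiv_trans:
  assumes "GL_equiv n x y" "GL_equiv n y z" "z \<in> carrier_mat n n"
  shows "GL_equiv n x z"
proof -
  obtain A B C D where AB: "A \<in> GL_int n" "B \<in> GL_int n" "x = A * y * B"
    and CD: "C \<in> GL_int n" "D \<in> GL_int n" "y = C * z * D"
    using assms(1,2) unfolding GL_equiv_def by blast
  note c = GL_int_carrier[OF AB(1)] GL_int_carrier[OF AB(2)] GL_int_carrier[OF CD(1)] GL_int_carrier[OF CD(2)] assms(3)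
  have "x = A * (C * z * D) * B" using AB CD by simp
  also have "\<dots> = (A * C) * z * (D * B)"
    using c by (simp add: assoc_mult_mat[of _ n n _ n _ n] mult_carrier_mat[of _ n n _ n])
  finally show ?thesis unfolding GL_equiv_def using GL_int_mult AB CD by blast
qed

lemma GL_equivI:
  assumes L: "L \<in> GL_int n" and R: "R \<in> GL_int n" and w: "w \<in> carrier_mat n n"
  shows "GL_equiv n w (L * w * R)"
proof -
  note c = GL_int_carrier[OF L] GL_int_carrier[OF R] w
  note ci = inv_mat_carrier[OF c(1)] inv_mat_carrier[OF c(2)]
  have "inv_mat L * (L * w * R) * inv_mat R = (inv_mat L * L) * w * (R * inv_mat R)"
    using c ci by (simp add: assoc_mult_mat[of _ n n _ n _ n] mult_carrier_mat[of _ n n _ n])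
  also have "\<dots> = w"
    using c inv_mat[OF c(1) GL_int_det_nonzero[OF L]] inv_mat[OF c(2) GL_int_det_nonzero[OF R]] by simp
  finally show ?thesis
    unfolding GL_equiv_def using GL_int_inv_mat[OF L] GL_int_inv_mat[OF R] by metis
qed

lemma GL_int_swaprows_mat: "k < n \<Longrightarrow> l < n \<Longrightarrow> swaprows_mat n k l \<in> GL_int n"
proof -
  assume kl: "k < n" "l < n"
  have "int_mat (swaprows_mat n k l)"
    by (subst int_mat_iff[OF swaprows_mat_carrier]) (auto simp: swaprows_mat_def)
  then show "swaprows_mat n k l \<in> GL_int n"
    unfolding GL_int_def int_mat_def
    by (intro CollectI conjI bexI[of _ "swaprows_mat n k l"] swaprows_mat_inv[OF kl] swaprows_mat_carrier)
qed

lemma mult_mat_entry: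
  assumes "A \<in> carrier_mat n m" "B \<in> carrier_mat m l" "i < n" "j < l"
  shows "(A * B) $$ (i, j) = (\<Sum>k<m. A $$ (i, k) * B $$ (k, j))"
  using assms by (simp add: scalar_prod_def lessThan_atLeast0)

lemma GL_int_elim_row:
  assumes "\<And>i. m < i \<Longrightarrow> i < n \<Longrightarrow> c i \<in> (padic_ints :: 'p::prime_card padic set)"
  shows "Matrix.mat n n (\<lambda>(i, k). (if i = k then 1 else 0) - (if k = m \<and> m < i then c i else 0)) \<in> GL_int n"
    (is "?L \<in> _")
proof -
  have "Determinant.det ?L = prod_list (diag_mat ?L)"
    by (rule det_lower_triangular[of n]) auto
  also have "diag_mat ?L = map (\<lambda>_. 1) [0..<n]" by (auto simp: diag_mat_def)
  also have "prod_list \<dots> = 1" by (induction n) auto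
  finally have "Determinant.det ?L = 1" .
  then show ?thesis using assms by (auto simp: GL_int_iff int_mat_iff[of _ n n])
qed

lemma GL_int_elim_col:
  assumes "\<And>i. m < i \<Longrightarrow> i < n \<Longrightarrow> c i \<in> (padic_ints :: 'p::prime_card padic set)"
  shows "Matrix.mat n n (\<lambda>(k, j). (if k = j then 1 else 0) - (if k = m \<and> m < j then c j else 0)) \<in> GL_int n"
    (is "?L \<in> _")
proof -
  have "Determinant.det ?L = prod_list (diag_mat ?L)"
    by (rule det_upper_triangular[of _ n]) (auto simp: upper_triangular_def)
  also have "diag_mat ?L = map (\<lambda>_. 1) [0..<n]" by (auto simp: diag_mat_def)
  also have "prod_list \<dots> = 1" by (induction n) auto
  finally have "Determinant.det ?L = 1" .
  then show ?thesis using assms by (auto simp: GL_int_iff int_mat_iff[of _ n n])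
qed

text \<open>The invariant of the elimination: the rows and columns with index less than
  \<open>m\<close> are finished, and each finished pivot dominates in norm the whole block to its
  lower right. The domination yields the order of the exponents.\<close>

definition smith_stage :: "nat \<Rightarrow> nat \<Rightarrow> 'p::prime_card padic Matrix.mat \<Rightarrow> bool" where
  "smith_stage n m w \<longleftrightarrow> w \<in> carrier_mat n n \<and>
     (\<forall>i<n. \<forall>j<n. i \<noteq> j \<and> (i < m \<or> j < m) \<longrightarrow> w $$ (i, j) = 0) \<and>
     (\<forall>i<m. \<forall>j k. i \<le> j \<and> j < n \<and> i \<le> k \<and> k < n \<longrightarrow> pnorm (w $$ (j, k)) \<le> pnorm (w $$ (i, i)))"

text \<open>An entry of largest norm in the remaining block is moved to its corner by swapping rows
  and columns of index at least \<open>m\<close>, which leaves the finished part alone.\<close>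

lemma smith_pivot:
  assumes st: "smith_stage n m w" and m: "m < n"
  obtains v where "GL_equiv n w v" "smith_stage n m v"
    "\<And>j k. m \<le> j \<Longrightarrow> j < n \<Longrightarrow> m \<le> k \<Longrightarrow> k < n \<Longrightarrow> pnorm (v $$ (j, k)) \<le> pnorm (v $$ (m, m))"
proof -
  have w: "w \<in> carrier_mat n n" using st by (simp add: smith_stage_def)
  let ?S = "(\<lambda>ij. pnorm (w $$ ij)) ` ({m..<n} \<times> {m..<n})"
  have fin: "finite ?S" and ne: "?S \<noteq> {}" using m by auto
  from Max_in[OF fin ne] obtain i0 j0 where ij0: "m \<le> i0" "i0 < n" "m \<le> j0" "j0 < n"
    and mx: "pnorm (w $$ (i0, j0)) = Max ?S" by auto
  have max: "pnorm (w $$ (j, k)) \<le> pnorm (w $$ (i0, j0))" if "m \<le> j" "j < n" "m \<le> k" "k < n" for j k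
    unfolding mx using that by (intro Max_ge fin) auto
  define \<sigma> where "\<sigma> i = (if i = m then i0 else if i = i0 then m else i)" for i
  define \<tau> where "\<tau> i = (if i = m then j0 else if i = j0 then m else i)" for i
  define v where "v = Matrix.mat n n (\<lambda>(i, j). w $$ (\<sigma> i, \<tau> j))"
  have "v = swapcols m j0 (swaprows m i0 w)"
    by (rule eq_matI) (use w m ij0 in \<open>auto simp: v_def \<sigma>_def \<tau>_def\<close>)
  also have "\<dots> = swaprows_mat n m i0 * w * swaprows_mat n m j0"
    using w m ij0 by (subst swapcols_mat[of _ n n]) (auto simp flip: swaprows_mat[of _ n n])
  finally have ve: "v = swaprows_mat n m i0 * w * swaprows_mat n m j0" .
  have s: "\<sigma> i < n \<longleftrightarrow> i < n" "m \<le> \<sigma> i \<longleftrightarrow> m \<le> i" "i < m \<Longrightarrow> \<sigma> i = i" for i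
    using m ij0 by (auto simp: \<sigma>_def)
  have t: "\<tau> i < n \<longleftrightarrow> i < n" "m \<le> \<tau> i \<longleftrightarrow> m \<le> i" "i < m \<Longrightarrow> \<tau> i = i" for i
    using m ij0 by (auto simp: \<tau>_def)
  have vij: "v $$ (i, j) = w $$ (\<sigma> i, \<tau> j)" if "i < n" "j < n" for i j
    using that by (simp add: v_def)
  have "smith_stage n m v"
    unfolding smith_stage_def
  proof (intro conjI allI impI)
    show "v \<in> carrier_mat n n" by (simp add: v_def)
    fix i j assume ij: "i < n" "j < n" "i \<noteq> j \<and> (i < m \<or> j < m)"
    then have "\<sigma> i \<noteq> \<tau> j \<and> (\<sigma> i < m \<or> \<tau> j < m)"
      using s(2,3)[of i] t(2,3)[of j] by (metis linorder_not_le)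
    then show "v $$ (i, j) = 0" using st ij s(1) t(1) by (simp add: vij smith_stage_def)
  next
    fix i j k assume i: "i < m" and jk: "i \<le> j \<and> j < n \<and> i \<le> k \<and> k < n"
    have "i \<le> \<sigma> j" "i \<le> \<tau> k" using i jk s(2,3)[of j] t(2,3)[of k]
      by (metis linorder_not_le order.strict_implies_order order.trans)+
    then have "pnorm (w $$ (\<sigma> j, \<tau> k)) \<le> pnorm (w $$ (i, i))"
      using st i jk s(1) t(1) by (simp add: smith_stage_def)
    then show "pnorm (v $$ (j, k)) \<le> pnorm (v $$ (i, i))"
      using i jk m s(3) t(3) by (simp add: vij)
  qed
  moreover have "GL_equiv n w v"
    unfolding ve by (rule GL_equivI) (use m ij0 w in \<open>auto intro: GL_int_swaprows_mat\<close>)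
  moreover have "pnorm (v $$ (j, k)) \<le> pnorm (v $$ (m, m))" if "m \<le> j" "j < n" "m \<le> k" "k < n" for j k
    using max[of "\<sigma> j" "\<tau> k"] that m s t by (simp add: vij) (simp add: \<sigma>_def \<tau>_def)
  ultimately show thesis using that by blast
qed

text \<open>Division by an entry of maximal norm gives integral multipliers, so clearing row and
  column \<open>m\<close> amounts to multiplication by unipotent integral matrices; by the
  ultrametric inequality the pivot still dominates the block afterwards.\<close>

lemma smith_step:
  assumes st: "smith_stage n m w" and m: "m < n"
  obtains v where "GL_equiv n w v" "smith_stage n (Suc m) v"
proof -
  obtain u where wu: "GL_equiv n w u" and us: "smith_stage n m u"
    and max: "\<And>j k. m \<le> j \<Longrightarrow> j < n \<Longrightarrow> m \<le> k \<Longrightarrow> k < n \<Longrightarrow> pnorm (u $$ (j, k)) \<le> pnorm (u $$ (m, m))"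
    using smith_pivot[OF st m] by metis
  have u: "u \<in> carrier_mat n n" using us by (simp add: smith_stage_def)
  have u0: "u $$ (i, j) = 0" if "i < n" "j < n" "i \<noteq> j" "i < m \<or> j < m" for i j
    using us that by (simp add: smith_stage_def)
  define x where "x = u $$ (m, m)"
  define c where "c i = u $$ (i, m) / x" for i
  define r where "r j = u $$ (m, j) / x" for j
  \<comment> \<open>If the pivot is 0, maximality makes its row and column vanish within the block,
    so the equations hold with the multipliers 0 that division by 0 returns.\<close>
  have xc: "x * c i = u $$ (i, m)" "x * r i = u $$ (m, i)" if "m \<le> i" "i < n" for i
    using max[of i m] max[of m i] that m by (auto simp: c_def r_def x_def pnorm_eq_0_iff)
      (metis pnorm_0 pnorm_eq_0_iff pnorm_nonneg order.antisym)+
  have ci: "c i \<in> padic_ints" "r i \<in> padic_ints" if "m \<le> i" "i < n" for i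
    using max[of i m] max[of m i] that m pnorm_nonneg[of x]
    by (auto simp: c_def r_def x_def pnorm_divide padic_ints_def divide_le_eq_1)
  define L where "L = Matrix.mat n n (\<lambda>(i, k). (if i = k then 1 else 0) - (if k = m \<and> m < i then c i else 0))"
  define R where "R = Matrix.mat n n (\<lambda>(k, j). (if k = j then 1 else 0) - (if k = m \<and> m < j then r j else 0))"
  have L: "L \<in> GL_int n" unfolding L_def using ci by (intro GL_int_elim_row) auto
  have R: "R \<in> GL_int n" unfolding R_def using ci by (intro GL_int_elim_col) auto
  note Lc = GL_int_carrier[OF L] and Rc = GL_int_carrier[OF R]
  have Lu: "(L * u) $$ (i, j) = u $$ (i, j) - (if m < i then c i * u $$ (m, j) else 0)" if ij: "i < n" "j < n" for i j
  proof -
    have "(L * u) $$ (i, j) = (\<Sum>k<n. L $$ (i, k) * u $$ (k, j))"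
      by (rule mult_mat_entry[OF Lc u ij])
    also have "\<dots> = (\<Sum>k<n. (if k = i then u $$ (i, j) else 0) - (if k = m then if m < i then c i * u $$ (m, j) else 0 else 0))"
      using ij by (intro sum.cong) (auto simp: L_def)
    also have "\<dots> = u $$ (i, j) - (if m < i then c i * u $$ (m, j) else 0)"
      using ij m by (simp add: sum_subtractf)
    finally show ?thesis .
  qed
  define v where "v = L * u * R"
  have LuR: "v $$ (i, j) = (L * u) $$ (i, j) - (if m < j then (L * u) $$ (i, m) * r j else 0)" if ij: "i < n" "j < n" for i j
  proof -
    have "v $$ (i, j) = (\<Sum>k<n. (L * u) $$ (i, k) * R $$ (k, j))"
      unfolding v_def by (rule mult_mat_entry[OF mult_carrier_mat[OF Lc u] Rc ij])
    also have "\<dots> = (\<Sum>k<n. (if k = j then (L * u) $$ (i, j) else 0) - (if k = m then if m < j then (L * u) $$ (i, m) * r j else 0 else 0))"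
      using ij by (intro sum.cong) (auto simp: R_def)
    also have "\<dots> = (L * u) $$ (i, j) - (if m < j then (L * u) $$ (i, m) * r j else 0)"
      using ij m by (simp add: sum_subtractf)
    finally show ?thesis .
  qed
  have v: "v $$ (i, j) = (if i \<noteq> j \<and> (i < Suc m \<or> j < Suc m) then 0
      else if m < i \<and> m < j then u $$ (i, j) - c i * u $$ (m, j) else u $$ (i, j))" if ij: "i < n" "j < n" for i j
  proof -
    have Lum: "(L * u) $$ (i, m) = (if i = m then x else 0)"
      using ij m xc[of i] u0[of i m] by (auto simp: Lu x_def[symmetric] mult.commute)
    show ?thesis
      using ij m xc[of j] xc[of i] u0[of i j] u0[of m j] u0[of i m]
      by (auto simp: LuR Lum Lu x_def[symmetric] mult.commute not_less less_Suc_eq)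
  qed
  have vle: "pnorm (v $$ (j, k)) \<le> pnorm x" if jk: "m \<le> j" "j < n" "m \<le> k" "k < n" for j k
  proof -
    have "pnorm (c j * u $$ (m, k)) \<le> 1 * pnorm x"
      unfolding pnorm_mult using ci(1)[of j] jk max[of m k] m pnorm_nonneg
      by (intro mult_mono) (auto simp: padic_ints_def x_def)
    then have "pnorm (u $$ (j, k) - c j * u $$ (m, k)) \<le> pnorm x"
      using max[of j k] jk by (intro pnorm_diff_le) (auto simp: x_def)
    then show ?thesis using max[of j k] jk pnorm_nonneg[of x] by (auto simp: v x_def)
  qed
  have "smith_stage n (Suc m) v"
    unfolding smith_stage_def
  proof (intro conjI allI impI)
    show "v \<in> carrier_mat n n" unfolding v_def using Lc Rc u by (meson mult_carrier_mat)
    show "v $$ (i, j) = 0" if "i < n" "j < n" "i \<noteq> j \<and> (i < Suc m \<or> j < Suc m)" for i j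
      using that by (simp add: v)
    fix i j k assume i: "i < Suc m" and jk: "i \<le> j \<and> j < n \<and> i \<le> k \<and> k < n"
    have vii: "v $$ (i, i) = u $$ (i, i)" using i m by (simp add: v)
    show "pnorm (v $$ (j, k)) \<le> pnorm (v $$ (i, i))"
    proof (cases "i = m")
      case True
      then show ?thesis using vle[of j k] jk m vii by (simp add: x_def)
    next
      case False
      with i have im: "i < m" by simp
      have le: "pnorm (u $$ (a, b)) \<le> pnorm (u $$ (i, i))" if "i \<le> a" "a < n" "i \<le> b" "b < n" for a b
        using us im that by (simp add: smith_stage_def)
      show ?thesis
      proof (cases "m \<le> j \<and> m \<le> k")
        case True
        then have "pnorm (v $$ (j, k)) \<le> pnorm x" using vle jk by simp
        also have "\<dots> \<le> pnorm (u $$ (i, i))" unfolding x_def using le[of m m] im m by simp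
        finally show ?thesis by (simp add: vii)
      next
        case False
        then have "v $$ (j, k) = (if j = k then u $$ (j, k) else 0)" using jk by (auto simp: v)
        then show ?thesis using le[of j k] jk pnorm_nonneg[of "u $$ (i, i)"] by (auto simp: vii)
      qed
    qed
  qed
  moreover have "GL_equiv n w v"
    by (rule GL_equiv_trans[OF wu]) (use GL_equivI[OF L R u] Lc Rc u in \<open>auto simp: v_def intro!: mult_carrier_mat[of _ n n _ n]\<close>)
  ultimately show thesis using that by blast
qed

lemma smith_diag:
  assumes z: "z \<in> carrier_mat n n"
  obtains w where "GL_equiv n z w" "smith_stage n n w"
proof -
  have "\<exists>w. GL_equiv n z w \<and> smith_stage n m w" if "m \<le> n" for m
    using that
  proof (induction m)
    case 0
    then show ?case using GL_equiv_refl[OF z] z by (intro exI[of _ z]) (simp add: smith_stage_def)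
  next
    case (Suc m)
    then obtain w where w: "GL_equiv n z w" "smith_stage n m w" by auto
    obtain v where "GL_equiv n w v" "smith_stage n (Suc m) v"
      using smith_step[OF w(2)] Suc by auto
    then show ?case using GL_equiv_trans[OF w(1)] by (auto simp: smith_stage_def)
  qed
  then show thesis using that by blast
qed

lemma of_nat_card_padic_nonzero: "(of_nat CARD('p) :: 'p::prime_card padic) \<noteq> 0"
proof -
  have "pnorm (of_nat CARD('p) :: 'p padic) \<noteq> 0" using card_pos[where 'p='p] by (simp add: pnorm_prime)
  then show ?thesis by (simp only: pnorm_eq_0_iff not_False_eq_True)
qed

lemma pnorm_card_powi: "pnorm (of_nat CARD('p) powi (- m) :: 'p::prime_card padic) = real CARD('p) powi m"
  unfolding pnorm_power_int pnorm_prime by (simp add: power_int_minus power_int_divide_distrib)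

text \<open>Each nonzero diagonal entry of the Smith form is a unit times a power of the prime. The
  units are absorbed into the left factor, and the zero entries get the exponent
  \<open>None\<close>.\<close>

lemma ex_singular_exponents: "\<exists>k. singular_exponents n (z :: 'p::prime_card mfun) k"
proof -
  have "Matrix.mat n n z \<in> carrier_mat n n" by simp
  then obtain w where zw: "GL_equiv n (Matrix.mat n n z) w" and st: "smith_stage n n w" by (rule smith_diag)
  have w: "w \<in> carrier_mat n n" using st by (simp add: smith_stage_def)
  have "\<exists>k u. w $$ (i, i) = u * p_power_minus k \<and> pnorm u = 1 \<and> (k = None \<longleftrightarrow> w $$ (i, i) = 0)" for i
  proof (cases "w $$ (i, i) = 0")
    case True
    then show ?thesis by (intro exI[of _ None] exI[of _ 1]) (simp add: p_power_minus_def)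
  next
    case False
    obtain m where m: "pnorm (w $$ (i, i)) = real CARD('p) powi m" using pnorm_value[OF False] .
    let ?q = "of_nat CARD('p) powi (- m) :: 'p padic"
    have q: "?q \<noteq> 0" using of_nat_card_padic_nonzero[where 'p='p] by simp
    have "pnorm (w $$ (i, i) / ?q) = 1"
      unfolding pnorm_divide pnorm_card_powi m using card_pos[where 'p='p] by simp
    moreover have "w $$ (i, i) = w $$ (i, i) / ?q * p_power_minus (Some m)" using q by (simp add: p_power_minus_def)
    ultimately show ?thesis using False by blast
  qed
  then obtain k u where ku: "\<And>i. w $$ (i, i) = u i * p_power_minus (k i)" "\<And>i. pnorm (u i) = 1"
      "\<And>i. k i = None \<longleftrightarrow> w $$ (i, i) = 0" by metis
  have U: "mat_diag n u \<in> GL_int n"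
  proof -
    have "int_mat (mat_diag n u)"
      by (subst int_mat_iff[OF mat_diag_dim]) (auto simp: mat_diag_def padic_ints_def ku(2))
    then show ?thesis by (simp add: GL_int_iff det_mat_diag pnorm_prod ku(2))
  qed
  have wd: "w = mat_diag n u * mat_diag n (\<lambda>j. p_power_minus (k j))"
    unfolding mat_diag_diag by (rule eq_matI) (use w st ku(1) in \<open>auto simp: mat_diag_def smith_stage_def\<close>)
  obtain A B where AB: "A \<in> GL_int n" "B \<in> GL_int n" "Matrix.mat n n z = A * w * B"
    using zw unfolding GL_equiv_def by blast
  have "Matrix.mat n n z = (A * mat_diag n u) * mat_diag n (\<lambda>j. p_power_minus (k j)) * B"
    unfolding AB(3) wd using GL_int_carrier[OF AB(1)] by (simp add: assoc_mult_mat[of _ n n _ n _ n])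
  moreover have "k j \<le> k i" if ij: "i \<le> j" "j < n" for i j
  proof (cases "w $$ (j, j) = 0")
    case True
    then show ?thesis using ku(3)[of j] by simp
  next
    case False
    have le: "pnorm (w $$ (j, j)) \<le> pnorm (w $$ (i, i))"
      using st ij by (simp add: smith_stage_def)
    then have "w $$ (i, i) \<noteq> 0" using False pnorm_nonneg[of "w $$ (j, j)"] by (auto simp: pnorm_eq_0_iff order.antisym)
    then obtain a b where ab: "k i = Some a" "k j = Some b" using False ku(3) by fastforce
    have "pnorm (w $$ (i, i)) = real CARD('p) powi a" "pnorm (w $$ (j, j)) = real CARD('p) powi b"
      using ku(1)[of i] ku(1)[of j] ku(2) ab by (simp_all add: pnorm_mult p_power_minus_def pnorm_card_powi)
    then have "b \<le> a" using le power_int_strict_increasing[OF _ card_gt_1[where 'p='p], of a b] by force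
    then show ?thesis by (simp add: ab)
  qed
  ultimately show ?thesis
    unfolding singular_exponents_def using GL_int_mult[OF AB(1) U] AB(2) by blast
qed

subsection \<open>Linear changes of variables, general case\<close>

lemma p_power_minus_norm: "pnorm (p_power_minus (Some m) :: 'p::prime_card padic) = real CARD('p) powi m"
  by (simp add: p_power_minus_def pnorm_card_powi)

text \<open>In the decomposition of \<open>h\<close> both outer factors have modulus 1 and
  determinants of norm 1, so only the diagonal factor counts.\<close>

lemma rscale_eq:
  assumes h: "h \<in> carrier_mat n n" "Determinant.det h \<noteq> 0"
  shows "rscale n h = ennreal (1 / pnorm (Determinant.det (h :: 'p::prime_card padic Matrix.mat)) ^ n)"
proof -
  have hh: "Matrix.mat n n (fun_of n h) = h" by (rule mat_fun_of[OF h(1)])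
  obtain k where "singular_exponents n (fun_of n h) k" using ex_singular_exponents by blast
  then obtain A B where AB: "A \<in> GL_int n" "B \<in> GL_int n"
    and hAB: "h = A * mat_diag n (\<lambda>j. p_power_minus (k j)) * B"
    unfolding singular_exponents_def hh by blast
  let ?D = "mat_diag n (\<lambda>j. p_power_minus (k j)) :: 'p padic Matrix.mat"
  have D: "?D \<in> carrier_mat n n" by simp
  note A = GL_int_carrier[OF AB(1)] and B = GL_int_carrier[OF AB(2)]
  have AD: "A * ?D \<in> carrier_mat n n" using A D by (rule mult_carrier_mat)
  have det: "Determinant.det h = Determinant.det A * Determinant.det ?D * Determinant.det B"
    unfolding hAB by (simp add: det_mult[OF AD B] det_mult[OF A D])
  have Dnz: "Determinant.det ?D \<noteq> 0" using h(2) det by auto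
  have ADnz: "Determinant.det (A * ?D) \<noteq> 0" using h(2) det by (auto simp: det_mult[OF A D])
  have "rscale n h = rscale n A * rscale n ?D * rscale n B"
    unfolding hAB by (simp add: rscale_mult[OF AD ADnz B] rscale_mult[OF A GL_int_det_nonzero[OF AB(1)] D])
  also have "\<dots> = rscale n ?D" by (simp add: rscale_GL_int AB)
  also have "\<dots> = ennreal (1 / pnorm (Determinant.det ?D) ^ n)"
    by (rule rscale_mat_diag) (use Dnz in \<open>auto simp: det_mat_diag\<close>)
  also have "pnorm (Determinant.det ?D) = pnorm (Determinant.det h)"
    using AB by (simp add: det pnorm_mult GL_int_iff)
  finally show ?thesis .
qed

lemma nn_integral_rmul:
  assumes h: "h \<in> carrier_mat n n" "Determinant.det h \<noteq> 0" and f: "f \<in> borel_measurable (mat_space n)"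
  shows "(\<integral>\<^sup>+ z. f (rmul n h z) \<partial>vol n)
    = ennreal (1 / pnorm (Determinant.det h) ^ n) * (\<integral>\<^sup>+ z. f z \<partial>(vol n :: 'p::prime_card mfun measure))"
  using nn_integral_rmul_rscale[OF h f] by (simp add: rscale_eq[OF h])

section \<open>Transposition and left multiplication\<close>

definition ftranspose :: "nat \<Rightarrow> 'p::prime_card mfun \<Rightarrow> 'p mfun" where
  "ftranspose n z = (\<lambda>ij\<in>ix n. z (snd ij, fst ij))"

lemma mat_ftranspose: "Matrix.mat n n (ftranspose n z) = transpose_mat (Matrix.mat n n z)"
  by (rule eq_matI) (auto simp: ftranspose_def)

lemma ftranspose_measurable: "ftranspose n \<in> mat_space n \<rightarrow>\<^sub>M mat_space n"
proof -
  have "(\<lambda>z. \<lambda>ij\<in>ix n. z (snd ij, fst ij)) \<in> mat_space n \<rightarrow>\<^sub>M PiM (ix n) (\<lambda>_. borel)"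
    by (rule measurable_restrict) (auto intro: mat_space_component)
  then show ?thesis by (simp add: mat_space_def ftranspose_def[abs_def])
qed

lemma ftranspose_ftranspose: "z \<in> extensional (ix n) \<Longrightarrow> ftranspose n (ftranspose n z) = z"
  by (auto simp: ftranspose_def fun_eq_iff extensional_def)

lemma nn_integral_ftranspose:
  assumes f: "f \<in> borel_measurable (mat_space n)"
  shows "(\<integral>\<^sup>+ z. f (ftranspose n z) \<partial>vol n) = (\<integral>\<^sup>+ z. f z \<partial>(vol n :: 'p::prime_card mfun measure))"
proof -
  let ?V = "vol n :: 'p mfun measure"
  have "(\<integral>\<^sup>+ z. f (ftranspose n z) \<partial>?V) = (\<integral>\<^sup>+ z. indicator (mat_ints n) (ftranspose n z) \<partial>?V) * (\<integral>\<^sup>+ z. f z \<partial>?V)"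
    by (rule nn_integral_vol_linear[OF ftranspose_measurable ftranspose_measurable _ _ _ f])
       (auto simp: ftranspose_ftranspose, auto simp: ftranspose_def fplus_def fun_eq_iff)
  also have "(\<integral>\<^sup>+ z. indicator (mat_ints n) (ftranspose n z) \<partial>?V) = (\<integral>\<^sup>+ z. indicator (mat_ints n) z \<partial>?V)"
  proof (rule nn_integral_cong)
    fix z :: "'p mfun" assume "z \<in> space ?V"
    then have z: "z \<in> extensional (ix n)" by simp
    have "ftranspose n z \<in> extensional (ix n)" by (simp add: ftranspose_def)
    then have "ftranspose n z \<in> mat_ints n \<longleftrightarrow> z \<in> mat_ints n"
      using int_mat_mat[OF z] int_mat_mat[of "ftranspose n z" n] by (simp add: mat_ftranspose int_mat_transpose)
    then show "indicator (mat_ints n) (ftranspose n z) = (indicator (mat_ints n) z :: ennreal)"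
      by (simp add: indicator_def)
  qed
  also have "\<dots> = 1" by (subst nn_integral_indicator) (auto simp: emeasure_vol_mat_ints)
  finally show ?thesis by simp
qed

definition lmul :: "nat \<Rightarrow> 'p::prime_card padic Matrix.mat \<Rightarrow> 'p mfun \<Rightarrow> 'p mfun" where
  "lmul n h z = fun_of n (h * Matrix.mat n n z)"

lemma mat_lmul: "h \<in> carrier_mat n n \<Longrightarrow> Matrix.mat n n (lmul n h z) = h * Matrix.mat n n z"
  unfolding lmul_def by (rule mat_fun_of) (rule mult_carrier_mat, auto)

lemma lmul_extensional [simp]: "lmul n h z \<in> extensional (ix n)"
  by (simp add: lmul_def)

lemma extensional_eqI:
  assumes "x \<in> extensional (ix n)" "y \<in> extensional (ix n)" "Matrix.mat n n x = Matrix.mat n n y"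
  shows "x = y"
  by (metis fun_of_mat assms)

text \<open>Transposition preserves \<open>vol n\<close> and conjugates left multiplication by
  \<open>h\<close> into right multiplication by the transpose of \<open>h\<close>.\<close>

lemma nn_integral_lmul:
  assumes h: "h \<in> carrier_mat n n" "Determinant.det h \<noteq> 0" and f: "f \<in> borel_measurable (mat_space n)"
  shows "(\<integral>\<^sup>+ z. f (lmul n h z) \<partial>vol n)
    = ennreal (1 / pnorm (Determinant.det h) ^ n) * (\<integral>\<^sup>+ z. f z \<partial>(vol n :: 'p::prime_card mfun measure))"
proof -
  have ht: "transpose_mat h \<in> carrier_mat n n" using h by simp
  note [measurable] = f rmul_measurable[OF ht] ftranspose_measurable
  have eq: "lmul n h z = ftranspose n (rmul n (transpose_mat h) (ftranspose n z))" for z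
  proof (rule extensional_eqI)
    show "Matrix.mat n n (lmul n h z) = Matrix.mat n n (ftranspose n (rmul n (transpose_mat h) (ftranspose n z)))"
      using h(1) by (simp add: mat_lmul mat_ftranspose mat_rmul[OF ht] transpose_mult[of _ n n _ n])
  qed (simp_all add: ftranspose_def)
  have "(\<integral>\<^sup>+ z. f (lmul n h z) \<partial>vol n) = (\<integral>\<^sup>+ z. f (ftranspose n (rmul n (transpose_mat h) z)) \<partial>(vol n :: 'p mfun measure))"
    unfolding eq by (rule nn_integral_ftranspose[of "\<lambda>z. f (ftranspose n (rmul n (transpose_mat h) z))"]) measurable
  also have "\<dots> = ennreal (1 / pnorm (Determinant.det h) ^ n) * (\<integral>\<^sup>+ z. f (ftranspose n z) \<partial>(vol n :: 'p mfun measure))"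
  proof -
    have "(\<lambda>z. f (ftranspose n z)) \<in> borel_measurable (mat_space n)" by measurable
    then show ?thesis using nn_integral_rmul[OF ht, of "\<lambda>z. f (ftranspose n z)"] h by (simp add: det_transpose[OF h(1)])
  qed
  finally show ?thesis by (simp add: nn_integral_ftranspose[OF f])
qed

subsection \<open>The function gamma\<close>

text \<open>The matrices \<open>x\<close> over the integers with \<open>x z\<close> over the integers form the lattice \<open>Mat(n) h\<inverse>\<close>, whose index
  is \<^term>\<open>gamma n z ^ n\<close>.\<close>

lemma singular_exponents_lattice:
  fixes z :: "'p::prime_card mfun"
  assumes k: "singular_exponents n z k"
  obtains h where "h \<in> carrier_mat n n"
    "pnorm (Determinant.det h) = (\<Prod>j | j < n \<and> Some 0 < k j. real CARD('p) powi the (k j))"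
    "\<And>x. x \<in> carrier_mat n n \<Longrightarrow> int_mat (x * h) \<longleftrightarrow> int_mat x \<and> int_mat (x * Matrix.mat n n z)"
proof -
  obtain A B where AB: "A \<in> GL_int n" "B \<in> GL_int n"
    and z: "Matrix.mat n n z = A * mat_diag n (\<lambda>j. p_power_minus (k j)) * B"
    using k unfolding singular_exponents_def by blast
  note A = GL_int_carrier[OF AB(1)] and B = GL_int_carrier[OF AB(2)]
  define d :: "nat \<Rightarrow> 'p padic" where "d j = p_power_minus (k j)" for j
  \<comment> \<open>That a number and its product with \<open>d j\<close> are both integral is a
    single condition: for \<open>k j > 0\<close> the product decides, since \<open>d j\<close> has
    norm at least 1; otherwise the number itself decides, since \<open>d j\<close> is
    integral.\<close>
  define e :: "nat \<Rightarrow> 'p padic" where "e j = (if Some 0 < k j then d j else 1)" for j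
  have de: "x * e j \<in> padic_ints \<longleftrightarrow> x \<in> padic_ints \<and> x * d j \<in> padic_ints" for x j
  proof (cases "Some 0 < k j")
    case True
    then obtain m where m: "k j = Some m" "m > 0" by (cases "k j") auto
    have "1 \<le> pnorm (d j)"
      unfolding d_def m(1) p_power_minus_norm using m(2) one_less_power_int[OF card_gt_1[where 'p='p], of m] by simp
    then have "pnorm x \<le> pnorm (x * d j)" using pnorm_nonneg[of x] by (simp add: pnorm_mult mult_le_cancel_left1)
    then show ?thesis using True by (auto simp: e_def padic_ints_def)
  next
    case False
    have "d j \<in> padic_ints"
    proof (cases "k j")
      case (Some m)
      then have "m \<le> 0" using False by simp
      then have "real CARD('p) powi m \<le> 1"
        using power_int_increasing[of m 0 "real CARD('p)"] card_gt_1[where 'p='p] by simp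
      then show ?thesis by (simp add: d_def Some padic_ints_def p_power_minus_norm)
    qed (simp add: d_def p_power_minus_def)
    then show ?thesis using False by (auto simp: e_def)
  qed
  have D: "mat_diag n d \<in> carrier_mat n n" "mat_diag n e \<in> carrier_mat n n" by simp_all
  define h where "h = A * mat_diag n e"
  have hc: "h \<in> carrier_mat n n" unfolding h_def by (rule mult_carrier_mat[OF A D(2)])
  have "pnorm (Determinant.det h) = (\<Prod>j<n. pnorm (e j))"
    using AB by (simp add: h_def det_mult[OF A D(2)] pnorm_mult det_mat_diag pnorm_prod GL_int_iff)
  also have "\<dots> = (\<Prod>j | j < n \<and> Some 0 < k j. real CARD('p) powi the (k j))"
  proof (rule prod.mono_neutral_cong_right)
    show "pnorm (e j) = real CARD('p) powi the (k j)" if "j \<in> {j. j < n \<and> Some 0 < k j}" for j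
      using that by (cases "k j") (auto simp: e_def d_def p_power_minus_norm)
  qed (auto simp: e_def)
  finally have det: "pnorm (Determinant.det h) = (\<Prod>j | j < n \<and> Some 0 < k j. real CARD('p) powi the (k j))" .
  have "int_mat (x * h) \<longleftrightarrow> int_mat x \<and> int_mat (x * Matrix.mat n n z)" if x: "x \<in> carrier_mat n n" for x
  proof -
    have xA: "x * A \<in> carrier_mat n n" using x A by (rule mult_carrier_mat)
    have diag: "int_mat (x * A * mat_diag n c) \<longleftrightarrow> (\<forall>i<n. \<forall>j<n. (x * A) $$ (i, j) * c j \<in> padic_ints)" for c
      unfolding mat_diag_mult_right[OF xA] by (subst int_mat_iff[of _ n n]) auto
    have "int_mat (x * h) \<longleftrightarrow> int_mat (x * A * mat_diag n e)"
      unfolding h_def by (simp add: assoc_mult_mat[OF x A D(2)])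
    also have "\<dots> \<longleftrightarrow> int_mat (x * A) \<and> int_mat (x * A * mat_diag n d)"
      unfolding diag int_mat_iff[OF xA] using de by blast
    also have "int_mat (x * A) \<longleftrightarrow> int_mat x" by (rule int_mat_mult_GL_right[OF x AB(1)])
    also have "int_mat (x * A * mat_diag n d) \<longleftrightarrow> int_mat (x * A * mat_diag n d * B)"
      by (rule int_mat_mult_GL_right[OF mult_carrier_mat[OF xA D(1)] AB(2), symmetric])
    also have "x * A * mat_diag n d * B = x * Matrix.mat n n z"
      unfolding z d_def[symmetric]
      using x A B D(1) by (simp add: assoc_mult_mat[of _ n n _ n _ n] mult_carrier_mat[of _ n n _ n])
    finally show ?thesis .
  qed
  with hc det show thesis by (rule that)
qed

lemma vol_lattice:
  fixes h :: "'p::prime_card padic Matrix.mat"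
  assumes h: "h \<in> carrier_mat n n" "Determinant.det h \<noteq> 0"
  shows "emeasure (vol n) {x \<in> extensional (ix n). int_mat (Matrix.mat n n x * h)} = ennreal (1 / pnorm (Determinant.det h) ^ n)"
proof -
  have m: "mat_measurable (vol n) n n (\<lambda>x. Matrix.mat n n x * h)"
    using mat_measurable_mult[OF mat_measurable_mat_id mat_measurable_const[OF h(1)]]
    by (simp add: mat_measurable_def measurable_cong_sets[OF sets_vol refl])
  have "ennreal (1 / pnorm (Determinant.det h) ^ n) = (\<integral>\<^sup>+ x. indicator (mat_ints n) (rmul n h x) \<partial>(vol n :: 'p mfun measure))"
    using rscale_eq[OF h] by (simp add: rscale_def)
  also have "\<dots> = (\<integral>\<^sup>+ x. indicator {x \<in> extensional (ix n). int_mat (Matrix.mat n n x * h)} x \<partial>(vol n :: 'p mfun measure))"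
    by (rule nn_integral_cong) (auto simp: indicator_def rmul_def int_mat_fun_of[OF mat_mult_carrier[OF h(1)]])
  also have "\<dots> = emeasure (vol n) {x \<in> extensional (ix n). int_mat (Matrix.mat n n x * h)}"
    by (rule nn_integral_indicator) (use int_mat_measurable[OF m] in simp)
  finally show ?thesis by simp
qed

text \<open>For every admissible \<open>k\<close> the product determines the volume of the set of
  integral \<open>x\<close> with \<open>x z\<close> integral, a set in which \<open>k\<close> does
  not occur. So the product is the same for all \<open>k\<close>, and the definite description
  denotes it.\<close>

lemma gamma_eq:
  fixes z :: "'p::prime_card mfun"
  assumes k: "singular_exponents n z k"
  shows "gamma n z = (\<Prod>j | j < n \<and> Some 0 < k j. real CARD('p) powi the (k j))"
  unfolding gamma_def
proof (rule the_equality)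
  show "\<exists>k'. singular_exponents n z k' \<and>
    (\<Prod>j | j < n \<and> Some 0 < k j. real CARD('p) powi the (k j)) = (\<Prod>j | j < n \<and> Some 0 < k' j. real CARD('p) powi the (k' j))"
    using k by blast
  have pos: "(\<Prod>j | j < n \<and> Some 0 < k j. real CARD('p) powi the (k j)) > 0" for k
    using card_pos[where 'p='p] by (intro prod_pos) auto
  have vol: "emeasure (vol n) {x \<in> extensional (ix n). int_mat (Matrix.mat n n x) \<and> int_mat (Matrix.mat n n x * Matrix.mat n n z)}
      = ennreal (1 / (\<Prod>j | j < n \<and> Some 0 < k j. real CARD('p) powi the (k j)) ^ n)"
    if k: "singular_exponents n z k" for k
  proof -
    obtain h where h: "h \<in> carrier_mat n n"
      and det: "pnorm (Determinant.det h) = (\<Prod>j | j < n \<and> Some 0 < k j. real CARD('p) powi the (k j))"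
      and int: "\<And>x. x \<in> carrier_mat n n \<Longrightarrow> int_mat (x * h) \<longleftrightarrow> int_mat x \<and> int_mat (x * Matrix.mat n n z)"
      using singular_exponents_lattice[OF k] by blast
    have "Determinant.det h \<noteq> 0" using det pos[of k] by auto
    from vol_lattice[OF h this] show ?thesis by (simp add: int det)
  qed
  fix r assume "\<exists>k'. singular_exponents n z k' \<and> r = (\<Prod>j | j < n \<and> Some 0 < k' j. real CARD('p) powi the (k' j))"
  then obtain k' where k': "singular_exponents n z k'" "r = (\<Prod>j | j < n \<and> Some 0 < k' j. real CARD('p) powi the (k' j))"
    by blast
  show "r = (\<Prod>j | j < n \<and> Some 0 < k j. real CARD('p) powi the (k j))"
  \<comment> \<open>The volume determines only the n-th power of the product; for
    \<open>n = 0\<close> both products are empty.\<close>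
  proof (cases "n = 0")
    case False
    define q where "q = (\<Prod>j | j < n \<and> Some 0 < k j. real CARD('p) powi the (k j))"
    have qr: "q > 0" "r > 0" using pos by (auto simp: q_def k'(2))
    have "ennreal (1 / q ^ n) = ennreal (1 / r ^ n)"
      using vol[OF k] vol[OF k'(1)] by (simp add: q_def k'(2))
    then have "1 / q ^ n = 1 / r ^ n" using qr by (subst (asm) ennreal_inj) auto
    then have "q ^ n = r ^ n" using qr by (simp add: field_simps)
    then show ?thesis using power_eq_imp_eq_base[of q n r] qr False by (simp add: q_def)
  qed (simp add: k')
qed

lemma gamma_lattice:
  fixes z :: "'p::prime_card mfun"
  obtains h where "h \<in> carrier_mat n n" "pnorm (Determinant.det h) = gamma n z" "gamma n z > 0"
    "\<And>x. x \<in> carrier_mat n n \<Longrightarrow> int_mat (x * h) \<longleftrightarrow> int_mat x \<and> int_mat (x * Matrix.mat n n z)"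
proof -
  obtain k where k: "singular_exponents n z k" using ex_singular_exponents by blast
  obtain h where h: "h \<in> carrier_mat n n"
    "pnorm (Determinant.det h) = (\<Prod>j | j < n \<and> Some 0 < k j. real CARD('p) powi the (k j))"
    "\<And>x. x \<in> carrier_mat n n \<Longrightarrow> int_mat (x * h) \<longleftrightarrow> int_mat x \<and> int_mat (x * Matrix.mat n n z)"
    using singular_exponents_lattice[OF k] by blast
  have "(\<Prod>j | j < n \<and> Some 0 < k j. real CARD('p) powi the (k j)) > 0"
    using card_pos[where 'p='p] by (intro prod_pos) auto
  with h show thesis using that by (simp add: gamma_eq[OF k])
qed

section \<open>Moments of the determinant over lattices\<close>

definition abs_det_fun :: "nat \<Rightarrow> 'p::prime_card mfun \<Rightarrow> real" where
  "abs_det_fun n x = pnorm (Determinant.det (Matrix.mat n n x))"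

lemma abs_det_fun_nonneg: "abs_det_fun n x \<ge> 0"
  by (simp add: abs_det_fun_def pnorm_nonneg)

lemma abs_det_fun_measurable [measurable]: "abs_det_fun n \<in> borel_measurable (mat_space n)"
  unfolding abs_det_fun_def[abs_def] using det_measurable[OF mat_measurable_mat_id] by measurable

definition det_moment :: "'p::prime_card itself \<Rightarrow> nat \<Rightarrow> real \<Rightarrow> ennreal" where
  "det_moment _ n t = (\<integral>\<^sup>+ x. indicator (mat_ints n) x * ennreal (abs_det_fun n x powr t) \<partial>(vol n :: 'p mfun measure))"

text \<open>Substituting \<open>y = x h\<close> with the matrix \<open>h\<close> of the lattice
  costs the Jacobian \<open>gamma^(-n)\<close>, and \<open>|det x|^t\<close> becomes
  \<open>gamma^(-t) |det y|^t\<close>. For \<open>t = s + n\<close> this produces the power of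
  \<open>gamma\<close> in \<open>mu n s\<close>.\<close>

lemma nn_integral_lattice_det:
  fixes z :: "'p::prime_card mfun"
  shows "(\<integral>\<^sup>+ x. indicator (mat_ints n) x * indicator (mat_ints n) (rmul n (Matrix.mat n n z) x) * ennreal (abs_det_fun n x powr t) \<partial>vol n)
    = ennreal (gamma n z powr (- t - real n)) * det_moment TYPE('p) n t"
proof -
  obtain h where h: "h \<in> carrier_mat n n" "pnorm (Determinant.det h) = gamma n z" "gamma n z > 0"
    and int: "\<And>x. x \<in> carrier_mat n n \<Longrightarrow> int_mat (x * h) \<longleftrightarrow> int_mat x \<and> int_mat (x * Matrix.mat n n z)"
    using gamma_lattice by blast
  have d: "Determinant.det h \<noteq> 0" using h by auto
  define f where "f y = ennreal (gamma n z powr (- t)) * (indicator (mat_ints n) y * ennreal (abs_det_fun n y powr t))" for y :: "'p mfun"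
  have [measurable]: "f \<in> borel_measurable (mat_space n)" unfolding f_def[abs_def] by measurable
  have "(\<integral>\<^sup>+ x. indicator (mat_ints n) x * indicator (mat_ints n) (rmul n (Matrix.mat n n z) x) * ennreal (abs_det_fun n x powr t) \<partial>vol n)
    = (\<integral>\<^sup>+ x. f (rmul n h x) \<partial>vol n)"
  proof (rule nn_integral_cong)
    fix x :: "'p mfun" assume "x \<in> space (vol n)"
    then have x: "x \<in> extensional (ix n)" by simp
    have "rmul n h x \<in> mat_ints n \<longleftrightarrow> x \<in> mat_ints n \<and> rmul n (Matrix.mat n n z) x \<in> mat_ints n"
      unfolding rmul_def int_mat_mat[OF x, symmetric]
      by (simp add: int_mat_fun_of[OF mat_mult_carrier] h int)
    moreover have "abs_det_fun n (rmul n h x) = abs_det_fun n x * gamma n z"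
      using h by (simp add: abs_det_fun_def mat_rmul det_mult[of _ n] pnorm_mult)
    then have "gamma n z powr (- t) * abs_det_fun n (rmul n h x) powr t = abs_det_fun n x powr t"
      using h(3) abs_det_fun_nonneg[of n x] by (simp add: powr_mult powr_minus field_simps)
    then have "ennreal (gamma n z powr (- t)) * ennreal (abs_det_fun n (rmul n h x) powr t) = ennreal (abs_det_fun n x powr t)"
      by (simp flip: ennreal_mult)
    ultimately show "indicator (mat_ints n) x * indicator (mat_ints n) (rmul n (Matrix.mat n n z) x) * ennreal (abs_det_fun n x powr t) = f (rmul n h x)"
      by (simp add: f_def indicator_def)
  qed
  also have "\<dots> = ennreal (1 / gamma n z ^ n) * (\<integral>\<^sup>+ x. f x \<partial>vol n)"
    using nn_integral_rmul[OF h(1) d, of f] h by simp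
  also have "(\<integral>\<^sup>+ x. f x \<partial>vol n) = ennreal (gamma n z powr (- t)) * det_moment TYPE('p) n t"
    unfolding f_def det_moment_def by (rule nn_integral_cmult) measurable
  also have "ennreal (1 / gamma n z ^ n) * (ennreal (gamma n z powr (- t)) * det_moment TYPE('p) n t)
    = ennreal (gamma n z powr (- real n) * gamma n z powr (- t)) * det_moment TYPE('p) n t"
  proof -
    have "1 / gamma n z ^ n = gamma n z powr (- real n)"
      using h(3) by (simp add: powr_minus powr_realpow inverse_eq_divide)
    then show ?thesis by (simp add: ennreal_mult mult.assoc)
  qed
  also have "gamma n z powr (- real n) * gamma n z powr (- t) = gamma n z powr (- t - real n)"
    by (metis powr_add add_uminus_conv_diff add.commute)
  finally show ?thesis .
qed

subsection \<open>Singular matrices form a null set\<close>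

text \<open>Characteristic 0 supplies arbitrarily many distinct scalars that are moreover integral;
  they serve as shifts in \<open>vol_singular_ints\<close>.\<close>

lemma of_nat_padic_inj: "inj (of_nat :: nat \<Rightarrow> 'p::prime_card padic)"
proof -
  have p: "prime CARD('p)" by (rule prime_card)
  have "(of_nat a :: 'p padic) = of_nat b \<longleftrightarrow> a = b" for a b
  proof -
    have "padic_abs CARD('p) (of_nat a - of_nat b) = 0 \<longleftrightarrow> of_nat a - of_nat b = (0 :: rat)"
      by (rule padic_abs_eq_0_iff[OF p])
    then show ?thesis
      unfolding of_nat_Padic by (subst eq_Padic) (auto simp: padic_vanishes_def LIMSEQ_const_iff)
  qed
  then show ?thesis by (auto intro: injI)
qed

text \<open>The zeros are the negatives of the eigenvalues, that is, of the roots of the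
  characteristic polynomial, which is monic of degree \<open>n\<close>.\<close>

lemma card_det_shift_zero:
  fixes A :: "'a::field Matrix.mat"
  assumes A: "A \<in> carrier_mat n n"
  shows "finite {t. Determinant.det (A + t \<cdot>\<^sub>m 1\<^sub>m n) = 0}" "card {t. Determinant.det (A + t \<cdot>\<^sub>m 1\<^sub>m n) = 0} \<le> n"
proof -
  let ?R = "{t. poly (char_poly A) t = 0}"
  have cp: "char_poly A \<noteq> 0" and deg: "degree (char_poly A) = n"
    using degree_monic_char_poly[OF A] by auto
  have "Determinant.det (A + t \<cdot>\<^sub>m 1\<^sub>m n) = 0 \<longleftrightarrow> - t \<in> ?R" for t
  proof -
    have "A + t \<cdot>\<^sub>m 1\<^sub>m n = char_matrix A (- t)" using A by (simp add: char_matrix_def)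
    then show ?thesis using eigenvalue_det[OF A, of "- t"] eigenvalue_root_char_poly[OF A, of "- t"] by simp
  qed
  then have "{t. Determinant.det (A + t \<cdot>\<^sub>m 1\<^sub>m n) = 0} = {t. - t \<in> ?R}" by (simp only:)
  also have "\<dots> = uminus ` ?R"
  proof (intro Set.set_eqI iffI)
    fix t assume "t \<in> {t. - t \<in> ?R}"
    then have "- t \<in> ?R" by (rule CollectD)
    then show "t \<in> uminus ` ?R" by (rule image_eqI[rotated]) simp
  qed auto
  finally have eq: "{t. Determinant.det (A + t \<cdot>\<^sub>m 1\<^sub>m n) = 0} = uminus ` ?R" .
  have fin: "finite ?R" using cp by (rule poly_roots_finite)
  then show "finite {t. Determinant.det (A + t \<cdot>\<^sub>m 1\<^sub>m n) = 0}" by (simp add: eq)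
  have "card (uminus ` ?R) \<le> card ?R" by (rule card_image_le[OF fin])
  also have "\<dots> \<le> n" using card_poly_roots_bound[OF cp] by (simp add: deg)
  finally show "card {t. Determinant.det (A + t \<cdot>\<^sub>m 1\<^sub>m n) = 0} \<le> n" by (simp add: eq)
qed

text \<open>Since \<open>det (x + t 1)\<close> has at most \<open>n\<close> zeros \<open>t\<close>, any \<open>N\<close> translates of the set by scalar
  matrices cover each point at most \<open>n\<close> times.\<close>

lemma vol_singular_ints:
  "emeasure (vol n) {x \<in> mat_ints n. abs_det_fun n (x :: 'p::prime_card mfun) = 0} = 0"
proof -
  let ?V = "vol n :: 'p mfun measure"
    and ?Z = "{x \<in> mat_ints n. abs_det_fun n (x :: 'p mfun) = 0}"
  have Z: "?Z \<in> sets (mat_space n)"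
  proof -
    have "{x \<in> space (mat_space n). x \<in> mat_ints n \<and> abs_det_fun n x = 0} \<in> sets (mat_space n)" by measurable
    moreover have "{x \<in> space (mat_space n). x \<in> mat_ints n \<and> abs_det_fun n x = 0} = ?Z"
      by (auto simp: space_mat_space mat_ints_def PiE_iff)
    ultimately show ?thesis by simp
  qed
  define sh :: "nat \<Rightarrow> 'p mfun" where "sh t = fun_of n (of_nat t \<cdot>\<^sub>m 1\<^sub>m n)" for t
  have she: "sh t \<in> extensional (ix n)" for t by (simp add: sh_def)
  have msh: "Matrix.mat n n (sh t) = of_nat t \<cdot>\<^sub>m 1\<^sub>m n" for t unfolding sh_def by (rule mat_fun_of) simp
  have inv: "(\<integral>\<^sup>+ x. indicator ?Z (fplus (ix n) x (sh t)) \<partial>?V) = emeasure ?V ?Z" for t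
    using mat_group.haar_nn_integral[OF haar_vol, of "sh t" n "indicator ?Z"] Z she by (simp add: space_mat_space)
  have m: "(\<lambda>x. fplus (ix n) x (sh t)) \<in> mat_space n \<rightarrow>\<^sub>M mat_space n" for t
    by (rule fplus_measurable) (simp add: space_mat_space she)
  have bound: "of_nat N * emeasure ?V ?Z \<le> of_nat n" for N
  proof -
    have "of_nat N * emeasure ?V ?Z = (\<Sum>t<N. (\<integral>\<^sup>+ x. indicator ?Z (fplus (ix n) x (sh t)) \<partial>?V))"
      by (simp add: inv)
    also have "\<dots> = (\<integral>\<^sup>+ x. (\<Sum>t<N. indicator ?Z (fplus (ix n) x (sh t))) \<partial>?V)"
      using measurable_compose[OF m borel_measurable_indicator[OF Z]]
      by (intro nn_integral_sum[symmetric]) (simp add: measurable_cong_sets[OF sets_vol refl])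
    also have "\<dots> \<le> (\<integral>\<^sup>+ x. of_nat n * indicator (mat_ints n) x \<partial>?V)"
    proof (rule nn_integral_mono)
      fix x :: "'p mfun" assume "x \<in> space ?V"
      then have x: "x \<in> extensional (ix n)" by simp
      let ?A = "Matrix.mat n n x"
      have A: "?A \<in> carrier_mat n n" by simp
      have sub: "x \<in> mat_ints n \<and> Determinant.det (?A + of_nat t \<cdot>\<^sub>m 1\<^sub>m n) = 0" if "fplus (ix n) x (sh t) \<in> ?Z" for t
      proof
        show "Determinant.det (?A + of_nat t \<cdot>\<^sub>m 1\<^sub>m n) = 0"
          using that by (simp add: abs_det_fun_def pnorm_eq_0_iff mat_fplus msh)
        have "x ij \<in> padic_ints" if ij: "ij \<in> ix n" for ij
        proof -
          have "sh t ij \<in> padic_ints" using ij by (auto simp: sh_def fun_of_def)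
          moreover have "x ij + sh t ij \<in> padic_ints"
            using \<open>fplus (ix n) x (sh t) \<in> ?Z\<close> ij by (auto simp: fplus_def mat_ints_def PiE_iff)
          ultimately show ?thesis using padic_ints_closed(4)[of "x ij + sh t ij" "sh t ij"] by simp
        qed
        then show "x \<in> mat_ints n" using x by (auto simp: mat_ints_def PiE_iff)
      qed
      let ?S = "{t\<in>{..<N}. fplus (ix n) x (sh t) \<in> ?Z}"
      have "(\<Sum>t<N. indicator ?Z (fplus (ix n) x (sh t))) = (\<Sum>t<N. indicator ?S t :: ennreal)"
        by (rule sum.cong) (auto simp: indicator_def)
      also have "\<dots> = (\<Sum>t\<in>?S. 1)" by (rule sum.mono_neutral_cong_right) auto
      also have "\<dots> = of_nat (card ?S)" by simp
      also have "\<dots> \<le> of_nat n * indicator (mat_ints n) x"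
      proof (cases "?S = {}")
        case False
        then have xK: "x \<in> mat_ints n" using sub by blast
        have "card ?S \<le> card {t. Determinant.det (?A + t \<cdot>\<^sub>m 1\<^sub>m n) = 0}"
        proof (rule card_inj_on_le[of "of_nat"])
          show "inj_on (of_nat :: nat \<Rightarrow> 'p padic) ?S" by (rule inj_on_subset[OF of_nat_padic_inj]) simp
          show "(of_nat :: nat \<Rightarrow> 'p padic) ` ?S \<subseteq> {t. Determinant.det (?A + t \<cdot>\<^sub>m 1\<^sub>m n) = 0}" using sub by blast
        qed (rule card_det_shift_zero[OF A])
        also have "\<dots> \<le> n" by (rule card_det_shift_zero[OF A])
        finally show ?thesis using xK by simp
      next
        case True
        show ?thesis unfolding True by simp
      qed
      finally show "(\<Sum>t<N. indicator ?Z (fplus (ix n) x (sh t))) \<le> (of_nat n * indicator (mat_ints n) x :: ennreal)" .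
    qed
    also have "\<dots> = of_nat n" by (subst nn_integral_cmult_indicator) (auto simp: emeasure_vol_mat_ints)
    finally show ?thesis .
  qed
  show ?thesis
  proof (rule ccontr)
    assume nz: "emeasure ?V ?Z \<noteq> 0"
    have "emeasure ?V ?Z \<le> of_nat n" using bound[of 1] by simp
    then have fin: "emeasure ?V ?Z \<noteq> \<infinity>" by (metis ennreal_of_nat_eq_real_of_nat ennreal_less_top infinity_ennreal_def not_less top.not_eq_extremum)
    obtain e where e: "emeasure ?V ?Z = ennreal e" "e > 0"
      using nz fin by (cases "emeasure ?V ?Z") (auto simp: less_le)
    obtain N where N: "real n < real N * e" using reals_Archimedean3[OF e(2)] by blast
    have "ennreal (real N * e) \<le> ennreal (real n)"
      using bound[of N] e by (simp add: ennreal_mult ennreal_of_nat_eq_real_of_nat)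
    then show False using N by simp
  qed
qed

lemma AE_vol_det: "AE x in (vol n :: 'p::prime_card mfun measure). x \<in> mat_ints n \<longrightarrow> abs_det_fun n x \<noteq> 0"
proof (rule AE_I')
  let ?Z = "{x \<in> mat_ints n. abs_det_fun n (x :: 'p mfun) = 0}"
  have "{x \<in> space (mat_space n). x \<in> mat_ints n \<and> abs_det_fun n x = 0} \<in> sets (mat_space n :: 'p mfun measure)" by measurable
  moreover have "{x \<in> space (mat_space n). x \<in> mat_ints n \<and> abs_det_fun n x = 0} = ?Z"
    by (auto simp: space_mat_space mat_ints_def PiE_iff)
  ultimately show "?Z \<in> null_sets (vol n)" using vol_singular_ints[of n] by (auto simp: null_sets_def)
qed auto

text \<open>On integral matrices the determinant has norm at most 1, so for \<open>t \<ge> 0\<close>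
  the integrand is bounded by the indicator of a set of mass 1; on that set it is almost everywhere
  positive.\<close>

lemma det_moment_bounds:
  assumes "t \<ge> 0"
  shows "det_moment TYPE('p::prime_card) n t \<noteq> 0" "det_moment TYPE('p) n t \<noteq> \<infinity>"
proof -
  let ?V = "vol n :: 'p mfun measure"
  let ?f = "\<lambda>x :: 'p mfun. indicator (mat_ints n) x * ennreal (abs_det_fun n x powr t)"
  have m: "?f \<in> borel_measurable ?V" by measurable
  show "det_moment TYPE('p) n t \<noteq> 0"
  proof
    assume "det_moment TYPE('p) n t = 0"
    then have "AE x in ?V. ?f x = 0" unfolding det_moment_def nn_integral_0_iff_AE[OF m] .
    then have "AE x in ?V. x \<notin> mat_ints n"
      using AE_vol_det[of n] by eventually_elim (auto simp: abs_det_fun_nonneg indicator_def split: if_splits)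
    then have "emeasure ?V (mat_ints n) = 0" by (subst (asm) AE_iff_null_sets[symmetric]) auto
    then show False by (simp add: emeasure_vol_mat_ints)
  qed
  have "det_moment TYPE('p) n t \<le> (\<integral>\<^sup>+ x. indicator (mat_ints n) x \<partial>?V)"
    unfolding det_moment_def
  proof (rule nn_integral_mono)
    fix x :: "'p mfun"
    assume "x \<in> space ?V"
    then have "abs_det_fun n x \<le> 1" if "x \<in> mat_ints n"
      using that pnorm_det_le_1[of "Matrix.mat n n x" n] int_mat_mat[of x n] by (simp add: abs_det_fun_def)
    then show "?f x \<le> indicator (mat_ints n) x"
      using assms abs_det_fun_nonneg[of n x] by (auto simp: indicator_def intro: powr_le1)
  qed
  also have "\<dots> = 1" by (subst nn_integral_indicator) (auto simp: emeasure_vol_mat_ints)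
  finally show "det_moment TYPE('p) n t \<noteq> \<infinity>" by (auto simp: top_unique)
qed

subsection \<open>The measure on finite matrices as the law of a quotient\<close>

lemma gamma_pos: "gamma n (z :: 'p::prime_card mfun) > 0"
  using gamma_lattice[of n z] by metis

lemma rmul_pair_measurable:
  "(\<lambda>v. rmul n (Matrix.mat n n (snd v)) (fst v)) \<in> mat_space n \<Otimes>\<^sub>M mat_space n \<rightarrow>\<^sub>M mat_space n"
  unfolding rmul_def[abs_def]
  by (intro fun_of_measurable mat_measurable_mult[of _ n n _ n] mat_measurable_mat) measurable

text \<open>A definite description has no visible measurability; but by
  \<open>nn_integral_lattice_det\<close> a negative power of \<open>gamma n z\<close> is, up to a
  constant, a parameter integral, which is measurable in \<open>z\<close>.\<close>

lemma gamma_measurable: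
  assumes n: "n > 0"
  shows "gamma n \<in> borel_measurable (mat_space n :: 'p::prime_card mfun measure)"
proof -
  let ?V = "vol n :: 'p mfun measure" and ?N = "mat_space n :: 'p mfun measure"
  interpret sigma_finite_measure ?V by (rule sigma_finite_vol)
  \<comment> \<open>The exponent 1 is a convenient choice: its moment is positive and finite, and
    the resulting power \<open>- 1 - n\<close> of \<open>gamma\<close> can be inverted.\<close>
  define J where "J z = (\<integral>\<^sup>+ x. indicator (mat_ints n) x * indicator (mat_ints n) (rmul n (Matrix.mat n n z) x) * ennreal (abs_det_fun n x powr 1) \<partial>?V)" for z
  have "(\<lambda>v. rmul n (Matrix.mat n n (fst v)) (snd v)) \<in> ?N \<Otimes>\<^sub>M ?V \<rightarrow>\<^sub>M ?N"
    unfolding rmul_def[abs_def]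
    by (intro fun_of_measurable mat_measurable_mult[of _ n n _ n] mat_measurable_mat) measurable
  note [measurable] = this
  have J [measurable]: "J \<in> borel_measurable ?N"
    unfolding J_def[abs_def]
    by (rule borel_measurable_nn_integral) (simp add: case_prod_beta', measurable)
  obtain q where q: "det_moment TYPE('p) n 1 = ennreal q" "q > 0"
    using det_moment_bounds[of 1 n, where 'p='p] by (cases "det_moment TYPE('p) n 1") (auto simp: less_le)
  have "gamma n z = (enn2real (J z) / q) powr (- 1 / (real n + 1))" for z :: "'p mfun"
  proof -
    have "J z = ennreal (gamma n z powr (- 1 - real n) * q)"
      unfolding J_def nn_integral_lattice_det q(1) using q(2) by (simp add: ennreal_mult)
    then have "enn2real (J z) / q = gamma n z powr (- 1 - real n)" using q(2) by simp
    then have "(enn2real (J z) / q) powr (- 1 / (real n + 1)) = gamma n z powr ((- 1 - real n) * (- 1 / (real n + 1)))"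
      by (simp add: powr_powr)
    also have "(- 1 - real n) * (- 1 / (real n + 1)) = 1" by (simp add: field_simps)
    finally show ?thesis using gamma_pos[of n z] by simp
  qed
  then have "gamma n = (\<lambda>z :: 'p mfun. (enn2real (J z) / q) powr (- 1 / (real n + 1)))" by blast
  also have "\<dots> \<in> borel_measurable ?N" by measurable
  finally show ?thesis .
qed

lemma sets_mu [simp, measurable_cong]: "sets (mu n s) = sets (mat_space n)"
  by (simp add: mu_def)

lemma space_mu [simp]: "space (mu n s) = extensional (ix n)"
  by (simp add: mu_def)

definition fquot :: "nat \<Rightarrow> 'p::prime_card mfun \<Rightarrow> 'p mfun \<Rightarrow> 'p mfun" where
  "fquot n x y = fun_of n (inv_mat (Matrix.mat n n x) * Matrix.mat n n y)"

lemma fquot_measurable: "(\<lambda>v. fquot n (fst v) (snd v)) \<in> mat_space n \<Otimes>\<^sub>M mat_space n \<rightarrow>\<^sub>M mat_space n"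
  unfolding fquot_def[abs_def]
  by (intro fun_of_measurable mat_measurable_mult[of _ n n _ n] mat_measurable_inv_mat mat_measurable_mat) measurable

definition quot_weight :: "nat \<Rightarrow> real \<Rightarrow> 'p::prime_card mfun \<Rightarrow> 'p mfun \<Rightarrow> ennreal" where
  "quot_weight n s x y = indicator (mat_ints n) x * indicator (mat_ints n) y * ennreal (abs_det_fun n x powr s)"

lemma quot_weight_measurable:
  "(\<lambda>v. quot_weight n s (fst v) (snd v)) \<in> borel_measurable (mat_space n \<Otimes>\<^sub>M mat_space n)"
  unfolding quot_weight_def by measurable

text \<open>Substituting \<open>y = x z\<close> gives the density \<open>\<integral> 1\<^sub>K(x) 1\<^sub>K(x z) |det x|\<^bsup>s+n\<^esup> dx\<close> at \<open>z\<close>, where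
  \<open>K\<close> denotes the matrices over the integers; by the lattice description of \<^const>\<open>gamma\<close> it is a
  multiple of \<open>gamma(z)\<^bsup>-s-2n\<^esup>\<close>. The constants are finite because \<^term>\<open>mu n s\<close> is a probability.\<close>

lemma mu_quotient:
  assumes n: "n > 0" and s: "s > -1" and prob: "prob_space (mu n s :: 'p::prime_card mfun measure)"
  obtains c where "c \<noteq> 0" "c \<noteq> \<infinity>"
    "\<And>f. f \<in> borel_measurable (mat_space n) \<Longrightarrow>
      (\<integral>\<^sup>+ x. (\<integral>\<^sup>+ y. quot_weight n s x y * f (fquot n x y) \<partial>vol n) \<partial>vol n)
      = c * (\<integral>\<^sup>+ z. f z \<partial>(mu n s :: 'p mfun measure))"
proof -
  let ?V = "vol n :: 'p mfun measure" and ?N = "mat_space n :: 'p mfun measure"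
  interpret V: sigma_finite_measure ?V by (rule sigma_finite_vol)
  interpret pair_sigma_finite ?V ?V by unfold_locales
  note [measurable] = gamma_measurable[OF n] rmul_pair_measurable fquot_measurable quot_weight_measurable
  define k where "k = mu_const TYPE('p) n (s + 2 * real n)"
  let ?g = "\<lambda>z. ennreal (gamma n z powr (- s - 2 * real n))"
  have "emeasure (mu n s) (space (mu n s :: 'p mfun measure)) = (\<integral>\<^sup>+ z. ?g z / k \<partial>?V)"
  proof -
    have "extensional (ix n) \<in> sets ?N" using sets.top[of ?N] by (simp add: space_mat_space)
    then show ?thesis
      unfolding mu_def k_def[symmetric] by (subst emeasure_density) (auto intro!: nn_integral_cong)
  qed
  also have "\<dots> = (\<integral>\<^sup>+ z. ?g z \<partial>?V) / k" by (rule nn_integral_divide) measurable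
  also have "(\<integral>\<^sup>+ z. ?g z \<partial>?V) = k" unfolding k_def mu_const_def by (simp add: algebra_simps)
  finally have kk: "k / k = 1" using prob_space.emeasure_space_1[OF prob] by simp
  \<comment> \<open>In the extended nonnegative reals \<open>0 / 0\<close> and
    \<open>\<infinity> / \<infinity>\<close> are both 0, so a total mass of 1 rules them
    out.\<close>
  have k: "k \<noteq> 0" "k \<noteq> \<infinity>" using kk by (auto simp: divide_ennreal_def)
  define F where "F = det_moment TYPE('p) n (s + real n)"
  have F: "F \<noteq> 0" "F \<noteq> \<infinity>" using det_moment_bounds[of "s + real n" n, where 'p='p] s n by (auto simp: F_def)
  show thesis
  proof (rule that[of "F * k"])
    show "F * k \<noteq> 0" "F * k \<noteq> \<infinity>" using F k by (auto simp: ennreal_mult_eq_top_iff)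
    fix f :: "'p mfun \<Rightarrow> ennreal" assume f [measurable]: "f \<in> borel_measurable ?N"
    have "(\<integral>\<^sup>+ x. (\<integral>\<^sup>+ y. quot_weight n s x y * f (fquot n x y) \<partial>?V) \<partial>?V)
      = (\<integral>\<^sup>+ x. (\<integral>\<^sup>+ z. indicator (mat_ints n) x * indicator (mat_ints n) (rmul n (Matrix.mat n n z) x) * ennreal (abs_det_fun n x powr (s + real n)) * f z \<partial>?V) \<partial>?V)"
    proof (rule nn_integral_cong)
      fix x :: "'p mfun" assume "x \<in> space ?V"
      then have x: "x \<in> extensional (ix n)" "x \<in> space ?N" by (simp_all add: space_mat_space)
      let ?X = "Matrix.mat n n x"
      show "(\<integral>\<^sup>+ y. quot_weight n s x y * f (fquot n x y) \<partial>?V)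
        = (\<integral>\<^sup>+ z. indicator (mat_ints n) x * indicator (mat_ints n) (rmul n (Matrix.mat n n z) x) * ennreal (abs_det_fun n x powr (s + real n)) * f z \<partial>?V)"
      \<comment> \<open>If \<open>x\<close> is singular no substitution is available, but both
        integrands vanish, because \<open>0 powr t = 0\<close> for every \<open>t\<close>.\<close>
      proof (cases "abs_det_fun n x = 0")
        case True
        then show ?thesis by (simp add: quot_weight_def)
      next
        case False
        then have d: "Determinant.det ?X \<noteq> 0" by (auto simp: abs_det_fun_def)
        have pos: "abs_det_fun n x > 0" using False abs_det_fun_nonneg[of n x] by simp
        have X: "?X \<in> carrier_mat n n" by simp
        have h: "(\<lambda>y. quot_weight n s x y * f (fquot n x y)) \<in> borel_measurable ?N"
          using measurable_compose[OF measurable_Pair1'[OF x(2)] quot_weight_measurable[of n s]]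
            measurable_compose[OF measurable_compose[OF measurable_Pair1'[OF x(2)] fquot_measurable] f]
          by (simp add: borel_measurable_times)
        \<comment> \<open>The substitution \<open>y = x z\<close>. Multiplying by
          \<open>|det x|^n\<close> then moves its Jacobian to the other side, where it raises the
          exponent from \<open>s\<close> to \<open>s + n\<close>.\<close>
        have "(\<integral>\<^sup>+ z. quot_weight n s x (lmul n ?X z) * f (fquot n x (lmul n ?X z)) \<partial>?V)
          = ennreal (1 / abs_det_fun n x ^ n) * (\<integral>\<^sup>+ y. quot_weight n s x y * f (fquot n x y) \<partial>?V)"
          using nn_integral_lmul[OF X d h] by (simp add: abs_det_fun_def)
        then have "ennreal (abs_det_fun n x ^ n) * (\<integral>\<^sup>+ z. quot_weight n s x (lmul n ?X z) * f (fquot n x (lmul n ?X z)) \<partial>?V)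
          = ennreal (abs_det_fun n x ^ n * (1 / abs_det_fun n x ^ n)) * (\<integral>\<^sup>+ y. quot_weight n s x y * f (fquot n x y) \<partial>?V)"
          using pos by (subst ennreal_mult) (auto simp: mult.assoc)
        then have "(\<integral>\<^sup>+ y. quot_weight n s x y * f (fquot n x y) \<partial>?V)
          = ennreal (abs_det_fun n x ^ n) * (\<integral>\<^sup>+ z. quot_weight n s x (lmul n ?X z) * f (fquot n x (lmul n ?X z)) \<partial>?V)"
          using pos by simp
        also have "\<dots> = (\<integral>\<^sup>+ z. ennreal (abs_det_fun n x ^ n) * (quot_weight n s x (lmul n ?X z) * f (fquot n x (lmul n ?X z))) \<partial>?V)"
        proof (rule nn_integral_cmult[symmetric])
          have "lmul n ?X \<in> ?N \<rightarrow>\<^sub>M ?N"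
            unfolding lmul_def[abs_def]
            by (rule fun_of_measurable[OF mat_measurable_mult[OF mat_measurable_const[OF X] mat_measurable_mat_id]])
          from measurable_compose[OF this h]
          show "(\<lambda>z. quot_weight n s x (lmul n ?X z) * f (fquot n x (lmul n ?X z))) \<in> borel_measurable ?V"
            by (simp add: measurable_cong_sets[OF sets_vol refl])
        qed
        also have "\<dots> = (\<integral>\<^sup>+ z. indicator (mat_ints n) x * indicator (mat_ints n) (rmul n (Matrix.mat n n z) x) * ennreal (abs_det_fun n x powr (s + real n)) * f z \<partial>?V)"
        proof (rule nn_integral_cong)
          fix z :: "'p mfun" assume "z \<in> space ?V"
          then have z: "z \<in> extensional (ix n)" by simp
          have "inv_mat ?X * (?X * Matrix.mat n n z) = Matrix.mat n n z"
            using inv_mat(2)[OF X d] X by (subst assoc_mult_mat[of _ n n _ n _ n, symmetric]) auto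
          then have 1: "fquot n x (lmul n ?X z) = z"
            unfolding fquot_def mat_lmul[OF X] using fun_of_mat[OF z] by simp
          have 2: "lmul n ?X z = rmul n (Matrix.mat n n z) x" by (simp add: lmul_def rmul_def)
          have AB: "ennreal (abs_det_fun n x ^ n) * ennreal (abs_det_fun n x powr s) = ennreal (abs_det_fun n x powr (s + real n))"
            using pos by (simp add: powr_add powr_realpow mult.commute flip: ennreal_mult)
          show "ennreal (abs_det_fun n x ^ n) * (quot_weight n s x (lmul n ?X z) * f (fquot n x (lmul n ?X z)))
            = indicator (mat_ints n) x * indicator (mat_ints n) (rmul n (Matrix.mat n n z) x) * ennreal (abs_det_fun n x powr (s + real n)) * f z"
            unfolding 1 unfolding 2 quot_weight_def AB[symmetric] by (simp only: mult_ac)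
        qed
        finally show ?thesis .
      qed
    qed
    also have "\<dots> = (\<integral>\<^sup>+ z. (\<integral>\<^sup>+ x. indicator (mat_ints n) x * indicator (mat_ints n) (rmul n (Matrix.mat n n z) x) * ennreal (abs_det_fun n x powr (s + real n)) * f z \<partial>?V) \<partial>?V)"
      by (rule Fubini'[symmetric]) (simp add: case_prod_beta', measurable)
    also have "\<dots> = (\<integral>\<^sup>+ z. F * (?g z * f z) \<partial>?V)"
    proof (rule nn_integral_cong)
      fix z :: "'p mfun" assume "z \<in> space ?V"
      then have z: "z \<in> space ?N" by (simp add: space_mat_space)
      have [measurable]: "rmul n (Matrix.mat n n z) \<in> ?N \<rightarrow>\<^sub>M ?N" by (rule rmul_measurable) simp
      have "(\<integral>\<^sup>+ x. indicator (mat_ints n) x * indicator (mat_ints n) (rmul n (Matrix.mat n n z) x) * ennreal (abs_det_fun n x powr (s + real n)) * f z \<partial>?V)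
        = (\<integral>\<^sup>+ x. indicator (mat_ints n) x * indicator (mat_ints n) (rmul n (Matrix.mat n n z) x) * ennreal (abs_det_fun n x powr (s + real n)) \<partial>?V) * f z"
        by (rule nn_integral_multc) measurable
      also have "\<dots> = F * (?g z * f z)"
        unfolding nn_integral_lattice_det F_def[symmetric] by (simp add: algebra_simps)
      finally show "(\<integral>\<^sup>+ x. indicator (mat_ints n) x * indicator (mat_ints n) (rmul n (Matrix.mat n n z) x) * ennreal (abs_det_fun n x powr (s + real n)) * f z \<partial>?V)
        = F * (?g z * f z)" .
    qed
    also have "\<dots> = F * (\<integral>\<^sup>+ z. ?g z * f z \<partial>?V)" by (rule nn_integral_cmult) measurable
    also have "(\<integral>\<^sup>+ z. ?g z * f z \<partial>?V) = (\<integral>\<^sup>+ z. k * (?g z / k * f z) \<partial>?V)"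
    proof (rule nn_integral_cong)
      fix z :: "'p mfun"
      have "k * (?g z / k) = ?g z"
        using k by (simp add: ennreal_times_divide mult.commute[of k] ennreal_mult_divide_eq)
      then show "?g z * f z = k * (?g z / k * f z)" by (simp flip: mult.assoc)
    qed
    also have "\<dots> = k * (\<integral>\<^sup>+ z. ?g z / k * f z \<partial>?V)" by (rule nn_integral_cmult) measurable
    also have "(\<integral>\<^sup>+ z. ?g z / k * f z \<partial>?V) = (\<integral>\<^sup>+ z. f z \<partial>mu n s)"
      unfolding mu_def k_def[symmetric] by (rule nn_integral_density[symmetric]) measurable
    finally show "(\<integral>\<^sup>+ x. (\<integral>\<^sup>+ y. quot_weight n s x y * f (fquot n x y) \<partial>?V) \<partial>?V) = F * k * (\<integral>\<^sup>+ z. f z \<partial>mu n s)"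
      by (simp add: mult.assoc)
  qed
qed

subsection \<open>Right multiplication on pairs of matrices\<close>

text \<open>A pair \<open>(x, y)\<close> is written as one matrix with \<open>n\<close> rows and
  \<open>2 n\<close> columns, so that \<open>g\<close> acts by a single right
  multiplication.\<close>

definition hcat :: "nat \<Rightarrow> 'a Matrix.mat \<Rightarrow> 'a Matrix.mat \<Rightarrow> 'a Matrix.mat" where
  "hcat n X Y = Matrix.mat n (n + n) (\<lambda>(i, j). if j < n then X $$ (i, j) else Y $$ (i, j - n))"

definition lhalf :: "nat \<Rightarrow> 'a Matrix.mat \<Rightarrow> 'a Matrix.mat" where
  "lhalf n W = Matrix.mat n n (\<lambda>(i, j). W $$ (i, j))"

definition rhalf :: "nat \<Rightarrow> 'a Matrix.mat \<Rightarrow> 'a Matrix.mat" where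
  "rhalf n W = Matrix.mat n n (\<lambda>(i, j). W $$ (i, j + n))"

lemma hcat_carrier [simp]: "hcat n X Y \<in> carrier_mat n (n + n)"
  and lhalf_carrier [simp]: "lhalf n W \<in> carrier_mat n n"
  and rhalf_carrier [simp]: "rhalf n W \<in> carrier_mat n n"
  by (simp_all add: hcat_def lhalf_def rhalf_def)

lemma lhalf_hcat: "X \<in> carrier_mat n n \<Longrightarrow> lhalf n (hcat n X Y) = X"
  by (rule eq_matI) (auto simp: hcat_def lhalf_def)

lemma rhalf_hcat: "Y \<in> carrier_mat n n \<Longrightarrow> rhalf n (hcat n X Y) = Y"
  by (rule eq_matI) (auto simp: hcat_def rhalf_def)

lemma hcat_halves: "W \<in> carrier_mat n (n + n) \<Longrightarrow> hcat n (lhalf n W) (rhalf n W) = W"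
  by (rule eq_matI) (auto simp: hcat_def lhalf_def rhalf_def)

lemma hcat_inject:
  assumes "X \<in> carrier_mat n n" "Y \<in> carrier_mat n n" "X' \<in> carrier_mat n n" "Y' \<in> carrier_mat n n"
    "hcat n X Y = hcat n X' Y'"
  shows "X = X'" "Y = Y'"
  using lhalf_hcat[OF assms(1), of Y] lhalf_hcat[OF assms(3), of Y']
    rhalf_hcat[OF assms(2), of X] rhalf_hcat[OF assms(4), of X'] assms(5) by simp_all

lemma mult_hcat:
  assumes A: "A \<in> carrier_mat n n" and X: "X \<in> carrier_mat n n" and Y: "Y \<in> carrier_mat n n"
  shows "A * hcat n X Y = hcat n (A * X) (A * Y)"
proof (rule eq_matI)
  fix i j assume "i < dim_row (hcat n (A * X) (A * Y))" "j < dim_col (hcat n (A * X) (A * Y))"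
  then have ij: "i < n" "j < n + n" by (simp_all add: hcat_def)
  show "(A * hcat n X Y) $$ (i, j) = hcat n (A * X) (A * Y) $$ (i, j)"
  proof (cases "j < n")
    case True
    then show ?thesis using ij mult_mat_entry[OF A hcat_carrier ij, of X Y] mult_mat_entry[OF A X ij(1) True]
      by (simp add: hcat_def)
  next
    case False
    then have j: "j - n < n" using ij by simp
    show ?thesis using ij False mult_mat_entry[OF A hcat_carrier ij, of X Y] mult_mat_entry[OF A Y ij(1) j]
      by (simp add: hcat_def)
  qed
qed (use A in \<open>simp_all add: hcat_def\<close>)

lemma int_mat_hcat:
  assumes "X \<in> carrier_mat n n" "Y \<in> carrier_mat n n"
  shows "int_mat (hcat n X Y) \<longleftrightarrow> int_mat X \<and> int_mat Y"
proof
  assume h: "int_mat (hcat n X Y)"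
  have "X $$ (i, j) \<in> padic_ints" "Y $$ (i, j) \<in> padic_ints" if "i < n" "j < n" for i j
  proof -
    have "hcat n X Y $$ (i, j) \<in> padic_ints" "hcat n X Y $$ (i, j + n) \<in> padic_ints"
      using h that by (simp_all add: int_mat_iff[OF hcat_carrier])
    then show "X $$ (i, j) \<in> padic_ints" "Y $$ (i, j) \<in> padic_ints" using that by (simp_all add: hcat_def)
  qed
  then show "int_mat X \<and> int_mat Y" using assms by (simp add: int_mat_iff)
next
  assume "int_mat X \<and> int_mat Y"
  then show "int_mat (hcat n X Y)"
    unfolding int_mat_iff[OF hcat_carrier] using assms by (auto simp: int_mat_iff hcat_def)
qed

lemma hcat_add:
  assumes "X \<in> carrier_mat n n" "Y \<in> carrier_mat n n" "X' \<in> carrier_mat n n" "Y' \<in> carrier_mat n n"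
  shows "hcat n (X + X') (Y + Y') = hcat n X Y + hcat n X' Y'"
  by (rule eq_matI) (use assms in \<open>auto simp: hcat_def\<close>)

definition pair_mat :: "nat \<Rightarrow> (nat \<times> nat \<Rightarrow> 'a) \<times> (nat \<times> nat \<Rightarrow> 'a) \<Rightarrow> 'a Matrix.mat" where
  "pair_mat n v = hcat n (Matrix.mat n n (fst v)) (Matrix.mat n n (snd v))"

definition pair_mul :: "nat \<Rightarrow> 'p::prime_card padic Matrix.mat \<Rightarrow> 'p mfun \<times> 'p mfun
    \<Rightarrow> 'p mfun \<times> 'p mfun" where
  "pair_mul n g v = (fun_of n (lhalf n (pair_mat n v * g)), fun_of n (rhalf n (pair_mat n v * g)))"

lemma pair_mat_carrier [simp]: "pair_mat n v \<in> carrier_mat n (n + n)"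
  by (simp add: pair_mat_def)

lemma pair_mat_Pair: "pair_mat n (x, y) = hcat n (Matrix.mat n n x) (Matrix.mat n n y)"
  by (simp add: pair_mat_def)

lemma pair_mat_mul:
  "g \<in> carrier_mat (n + n) (n + n) \<Longrightarrow> pair_mat n (pair_mul n g v) = pair_mat n v * g"
  by (simp add: pair_mul_def pair_mat_Pair mat_fun_of hcat_halves mult_carrier_mat[OF pair_mat_carrier])

lemma pair_mul_one: "v \<in> extensional (ix n) \<times> extensional (ix n) \<Longrightarrow> pair_mul n (1\<^sub>m (n + n)) v = v"
  by (cases v) (simp add: pair_mul_def right_mult_one_mat[OF hcat_carrier] pair_mat_Pair lhalf_hcat rhalf_hcat fun_of_mat)

lemma pair_mul_pair_mul:
  assumes "g \<in> carrier_mat (n + n) (n + n)" "h \<in> carrier_mat (n + n) (n + n)"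
  shows "pair_mul n h (pair_mul n g v) = pair_mul n (g * h) v"
  unfolding pair_mul_def[of n h] pair_mul_def[of n "g * h"] pair_mat_mul[OF assms(1)]
  by (simp add: assoc_mult_mat[OF pair_mat_carrier assms])

lemma mat_measurable_hcat:
  assumes f: "mat_measurable \<Omega> n n f" and g: "mat_measurable \<Omega> n n g"
  shows "mat_measurable \<Omega> n (n + n) (\<lambda>\<omega>. hcat n (f \<omega>) (g \<omega>))"
  unfolding mat_measurable_def
proof (intro conjI allI impI)
  fix i j assume ij: "i < n" "j < n + n"
  show "(\<lambda>\<omega>. hcat n (f \<omega>) (g \<omega>) $$ (i, j)) \<in> borel_measurable \<Omega>"
  proof (cases "j < n")
    case True
    then show ?thesis using mat_measurableD(2)[OF f ij(1) True] ij by (simp add: hcat_def)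
  next
    case False
    then have "j - n < n" using ij by simp
    then show ?thesis using mat_measurableD(2)[OF g ij(1), of "j - n"] ij False by (simp add: hcat_def)
  qed
qed simp

lemma mat_measurable_halves:
  assumes f: "mat_measurable \<Omega> n (n + n) f"
  shows "mat_measurable \<Omega> n n (\<lambda>\<omega>. lhalf n (f \<omega>))" "mat_measurable \<Omega> n n (\<lambda>\<omega>. rhalf n (f \<omega>))"
  using mat_measurableD(2)[OF f] by (auto simp: mat_measurable_def lhalf_def rhalf_def)

lemma pair_mul_measurable:
  assumes g: "g \<in> carrier_mat (n + n) (n + n)"
  shows "pair_mul n g \<in> mat_space n \<Otimes>\<^sub>M mat_space n \<rightarrow>\<^sub>M mat_space n \<Otimes>\<^sub>M mat_space n"
proof -
  have "mat_measurable (mat_space n \<Otimes>\<^sub>M mat_space n) n (n + n) (\<lambda>v. pair_mat n v * g)"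
    unfolding pair_mat_def
    by (intro mat_measurable_mult[of _ n "n + n"] mat_measurable_hcat mat_measurable_mat mat_measurable_const g) measurable
  note fun_of_measurable[OF mat_measurable_halves(1)[OF this]] fun_of_measurable[OF mat_measurable_halves(2)[OF this]]
  then show ?thesis unfolding pair_mul_def[abs_def] by (rule measurable_Pair)
qed

definition pair_plus :: "nat \<Rightarrow> 'p::prime_card mfun \<times> 'p mfun
    \<Rightarrow> 'p mfun \<times> 'p mfun \<Rightarrow> 'p mfun \<times> 'p mfun" where
  "pair_plus n v w = (fplus (ix n) (fst v) (fst w), fplus (ix n) (snd v) (snd w))"

definition pair_neg :: "nat \<Rightarrow> 'p::prime_card mfun \<times> 'p mfun
    \<Rightarrow> 'p mfun \<times> 'p mfun" where
  "pair_neg n v = (fneg (ix n) (fst v), fneg (ix n) (snd v))"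

lemma pair_mul_plus:
  assumes g: "g \<in> carrier_mat (n + n) (n + n)"
  shows "pair_mul n g (pair_plus n v w) = pair_plus n (pair_mul n g v) (pair_mul n g w)"
proof -
  have "pair_mat n (pair_plus n v w) = pair_mat n v + pair_mat n w"
    unfolding pair_mat_def pair_plus_def fst_conv snd_conv mat_fplus by (rule hcat_add) simp_all
  then have "pair_mat n (pair_plus n v w) * g = pair_mat n v * g + pair_mat n w * g"
    by (simp add: add_mult_distrib_mat[OF pair_mat_carrier pair_mat_carrier g])
  moreover have "lhalf n (A + B) = lhalf n A + lhalf n B" "rhalf n (A + B) = rhalf n A + rhalf n B"
    if "A \<in> carrier_mat n (n + n)" "B \<in> carrier_mat n (n + n)" for A B :: "'a padic Matrix.mat"
    using that by (auto simp: lhalf_def rhalf_def intro!: eq_matI)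
  ultimately show ?thesis
    using mult_carrier_mat[OF pair_mat_carrier g]
    by (simp add: pair_mul_def[of n g] fun_of_add pair_plus_def)
qed

global_interpretation pair_group: meas_group
  "mat_space n \<Otimes>\<^sub>M mat_space n :: ('p::prime_card mfun \<times> 'p mfun) measure"
  "pair_plus n" "pair_neg n" for n
proof
  let ?N = "mat_space n :: 'p mfun measure"
  have pl: "(\<lambda>x. fplus (ix n) (f x) (g x)) \<in> M \<rightarrow>\<^sub>M ?N" if "f \<in> M \<rightarrow>\<^sub>M ?N" "g \<in> M \<rightarrow>\<^sub>M ?N" for f g and M :: "'b measure"
    using measurable_compose[OF measurable_Pair[OF that] mat_group.pl_measurable] by simp
  show "case_prod (pair_plus n) \<in> (?N \<Otimes>\<^sub>M ?N) \<Otimes>\<^sub>M (?N \<Otimes>\<^sub>M ?N) \<rightarrow>\<^sub>M ?N \<Otimes>\<^sub>M ?N"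
    unfolding case_prod_beta' pair_plus_def by (intro measurable_Pair pl) measurable
  show "pair_neg n \<in> ?N \<Otimes>\<^sub>M ?N \<rightarrow>\<^sub>M ?N \<Otimes>\<^sub>M ?N"
    unfolding pair_neg_def[abs_def]
    by (intro measurable_Pair measurable_compose[OF _ mat_group.ng_measurable]) measurable
qed (auto simp: pair_plus_def pair_neg_def space_pair_measure mat_group.pl_ng_pl mat_group.pl_ng)

abbreviation vol2 :: "nat \<Rightarrow> ('p::prime_card mfun \<times> 'p mfun) measure" where
  "vol2 n \<equiv> vol n \<Otimes>\<^sub>M vol n"

lemma sets_vol2: "sets (vol2 n) = sets (mat_space n \<Otimes>\<^sub>M mat_space n)"
  by (rule sets_pair_measure_cong) simp_all

lemma haar_vol2: "pair_group.haar n (vol2 n :: ('p::prime_card mfun \<times> _) measure)"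
  unfolding pair_group.haar_def
proof (intro conjI ballI)
  let ?N = "mat_space n :: 'p mfun measure" and ?V = "vol n :: 'p mfun measure"
  interpret V: sigma_finite_measure ?V by (rule sigma_finite_vol)
  interpret pair_sigma_finite ?V ?V by unfold_locales
  show "sets (vol2 n) = sets (?N \<Otimes>\<^sub>M ?N)" by (rule sets_vol2)
  show "sigma_finite_measure (?V \<Otimes>\<^sub>M ?V)" by unfold_locales
  fix w assume w: "w \<in> space (?N \<Otimes>\<^sub>M ?N)"
  then have w': "fst w \<in> space ?N" "snd w \<in> space ?N" by (auto simp: space_pair_measure)
  have inv: "distr ?V ?N (\<lambda>z. fplus (ix n) z u) = ?V" if "u \<in> space ?N" for u
    using haar_vol[unfolded mat_group.haar_def] that by blast
  have m: "(\<lambda>z. fplus (ix n) z u) \<in> ?V \<rightarrow>\<^sub>M ?N" if "u \<in> space ?N" for u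
    using fplus_measurable[OF that] by (simp add: measurable_cong_sets[OF sets_vol refl])
  have "?V \<Otimes>\<^sub>M ?V = distr ?V ?N (\<lambda>z. fplus (ix n) z (fst w)) \<Otimes>\<^sub>M distr ?V ?N (\<lambda>z. fplus (ix n) z (snd w))"
    by (simp add: inv w')
  also have "\<dots> = distr (?V \<Otimes>\<^sub>M ?V) (?N \<Otimes>\<^sub>M ?N) (\<lambda>(x, y). (fplus (ix n) x (fst w), fplus (ix n) y (snd w)))"
    by (rule pair_measure_distr[OF m[OF w'(1)] m[OF w'(2)]]) (simp add: inv w' sigma_finite_vol)
  also have "\<dots> = distr (?V \<Otimes>\<^sub>M ?V) (?N \<Otimes>\<^sub>M ?N) (\<lambda>z. pair_plus n z w)"
    by (simp add: case_prod_beta' pair_plus_def)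
  finally show "distr (?V \<Otimes>\<^sub>M ?V) (?N \<Otimes>\<^sub>M ?N) (\<lambda>z. pair_plus n z w) = ?V \<Otimes>\<^sub>M ?V" by simp
qed

lemma pair_mul_ints:
  assumes g: "g \<in> GL_int (n + n)" and v: "v \<in> extensional (ix n) \<times> extensional (ix n)"
  shows "pair_mul n g v \<in> mat_ints n \<times> mat_ints n \<longleftrightarrow> v \<in> mat_ints n \<times> mat_ints n"
proof -
  have gc: "g \<in> carrier_mat (n + n) (n + n)" using GL_int_carrier[OF g] .
  have iff: "int_mat (pair_mat n u) \<longleftrightarrow> u \<in> mat_ints n \<times> mat_ints n"
    if "u \<in> extensional (ix n) \<times> extensional (ix n)" for u :: "'a mfun \<times> _"
    using that by (cases u) (simp add: pair_mat_def int_mat_hcat int_mat_mat)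
  have "pair_mul n g v \<in> extensional (ix n) \<times> extensional (ix n)" by (simp add: pair_mul_def)
  from iff[OF this] show ?thesis
    by (simp only: pair_mat_mul[OF gc] int_mat_mult_GL_right[OF pair_mat_carrier g] iff[OF v])
qed

text \<open>The image of \<open>vol2 n\<close> is a Haar measure on pairs, and the preimage of the
  set of pairs of integral matrices is that set itself, so the factor is 1.\<close>

lemma distr_pair_mul:
  assumes g: "g \<in> GL_int (n + n)"
  shows "distr (vol2 n) (mat_space n \<Otimes>\<^sub>M mat_space n) (pair_mul n g) = (vol2 n :: ('p::prime_card mfun \<times> _) measure)"
proof -
  let ?N = "mat_space n :: 'p mfun measure" and ?V = "vol n :: 'p mfun measure"
  let ?K = "mat_ints n \<times> mat_ints n :: ('p mfun \<times> 'p mfun) set"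
  interpret V: sigma_finite_measure ?V by (rule sigma_finite_vol)
  have gc: "g \<in> carrier_mat (n + n) (n + n)" "inv_mat g \<in> carrier_mat (n + n) (n + n)"
    using GL_int_carrier[OF g] by auto
  note inv = inv_mat[OF gc(1) GL_int_det_nonzero[OF g]]
  have K: "emeasure (?V \<Otimes>\<^sub>M ?V) ?K = 1"
    by (subst V.emeasure_pair_measure_Times) (auto simp: emeasure_vol_mat_ints)
  have Ks: "?K \<in> sets (?N \<Otimes>\<^sub>M ?N)" by (intro pair_measureI mat_ints_sets)
  have h: "pair_group.haar n (distr (?V \<Otimes>\<^sub>M ?V) (?N \<Otimes>\<^sub>M ?N) (pair_mul n g))"
    by (rule pair_group.haar_distr[OF haar_vol2 pair_mul_measurable[OF gc(1)] pair_mul_measurable[OF gc(2)]])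
       (auto simp: pair_mul_pair_mul gc inv space_pair_measure space_mat_space pair_mul_one pair_mul_plus)
  have "emeasure (distr (?V \<Otimes>\<^sub>M ?V) (?N \<Otimes>\<^sub>M ?N) (pair_mul n g)) ?K
    = emeasure (?V \<Otimes>\<^sub>M ?V) (pair_mul n g -` ?K \<inter> space (?V \<Otimes>\<^sub>M ?V))"
    by (rule emeasure_distr) (use pair_mul_measurable[OF gc(1)] Ks in \<open>simp_all add: measurable_cong_sets[OF sets_vol2 refl]\<close>)
  also have "pair_mul n g -` ?K \<inter> space (?V \<Otimes>\<^sub>M ?V) = ?K"
  proof (rule Set.set_eqI)
    fix v :: "'p mfun \<times> 'p mfun"
    have sp: "space (?V \<Otimes>\<^sub>M ?V) = extensional (ix n) \<times> extensional (ix n)" by (simp add: space_pair_measure)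
    have "mat_ints n \<subseteq> (extensional (ix n) :: 'p mfun set)"
      unfolding mat_ints_def PiE_def by (rule Int_lower2)
    from Sigma_mono[OF this this] have "?K \<subseteq> extensional (ix n) \<times> extensional (ix n)" .
    then show "v \<in> pair_mul n g -` ?K \<inter> space (?V \<Otimes>\<^sub>M ?V) \<longleftrightarrow> v \<in> ?K"
    proof (cases "v \<in> extensional (ix n) \<times> extensional (ix n)")
      case True
      show ?thesis unfolding sp vimage_eq Int_iff using True pair_mul_ints[OF g True] by (simp only: simp_thms)
    next
      case False
      then show ?thesis unfolding sp vimage_eq Int_iff
        using \<open>?K \<subseteq> extensional (ix n) \<times> extensional (ix n)\<close> by (simp only: simp_thms) (rule contra_subsetD)
    qed
  qed
  finally have "emeasure (distr (?V \<Otimes>\<^sub>M ?V) (?N \<Otimes>\<^sub>M ?N) (pair_mul n g)) ?K = 1" by (simp add: K)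
  then show ?thesis using pair_group.haar_unique[OF h haar_vol2 Ks K] by simp
qed

subsection \<open>Linear fractional transformations of finite matrices\<close>

text \<open>The product of \<open>(1, Z)\<close> with \<open>g\<close> is
  \<open>(a + Z c, b + Z d)\<close>; \<open>lden\<close> and \<open>lnum\<close> are its halves, and
  \<open>lfrac\<close> normalises the left half to 1. This is the action of \<open>g\<close> on
  n-dimensional row spaces, in the chart that represents a space by \<open>(1, Z)\<close>.\<close>

definition lden :: "nat \<Rightarrow> 'a::field Matrix.mat \<Rightarrow> 'a Matrix.mat \<Rightarrow> 'a Matrix.mat" where
  "lden n g Z = lhalf n (hcat n (1\<^sub>m n) Z * g)"

definition lnum :: "nat \<Rightarrow> 'a::field Matrix.mat \<Rightarrow> 'a Matrix.mat \<Rightarrow> 'a Matrix.mat" where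
  "lnum n g Z = rhalf n (hcat n (1\<^sub>m n) Z * g)"

definition lfrac :: "nat \<Rightarrow> 'a::field Matrix.mat \<Rightarrow> 'a Matrix.mat \<Rightarrow> 'a Matrix.mat" where
  "lfrac n g Z = inv_mat (lden n g Z) * lnum n g Z"

lemma lden_carrier [simp]: "lden n g Z \<in> carrier_mat n n"
  and lnum_carrier [simp]: "lnum n g Z \<in> carrier_mat n n"
  by (simp_all add: lden_def lnum_def)

lemma lfrac_carrier [simp]: "lfrac n g Z \<in> carrier_mat n n"
  unfolding lfrac_def by (rule mult_carrier_mat[OF inv_mat_carrier[OF lden_carrier] lnum_carrier])

lemma hcat_den_num:
  "g \<in> carrier_mat (n + n) (n + n) \<Longrightarrow> hcat n (1\<^sub>m n) Z * g = hcat n (lden n g Z) (lnum n g Z)"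
  unfolding lden_def lnum_def by (rule hcat_halves[symmetric], rule mult_carrier_mat[OF hcat_carrier])

text \<open>Comparing halves, a factorisation \<open>(1, Z) g = A (1, W)\<close> identifies
  \<open>A\<close> as the denominator and, if \<open>A\<close> is invertible, \<open>W\<close> as
  the image. Compositions and inverses are handled by exhibiting such a factorisation instead of
  computing with blocks.\<close>

lemma lfrac_eqI:
  assumes g: "g \<in> carrier_mat (n + n) (n + n)" and A: "A \<in> carrier_mat n n" and W: "W \<in> carrier_mat n n"
    and eq: "hcat n (1\<^sub>m n) Z * g = A * hcat n (1\<^sub>m n) W"
  shows "lden n g Z = A" "lnum n g Z = A * W" "Determinant.det A \<noteq> 0 \<Longrightarrow> lfrac n g Z = W"
proof -
  have AW: "A * W \<in> carrier_mat n n" using A W by (rule mult_carrier_mat)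
  have "hcat n (lden n g Z) (lnum n g Z) = hcat n A (A * W)"
    using eq A W by (simp add: hcat_den_num[OF g] mult_hcat)
  from hcat_inject[OF lden_carrier lnum_carrier A AW this]
  show d: "lden n g Z = A" and n: "lnum n g Z = A * W" .
  assume "Determinant.det A \<noteq> 0"
  then show "lfrac n g Z = W"
    unfolding lfrac_def d n using A W inv_mat(2)[OF A]
    by (subst assoc_mult_mat[OF inv_mat_carrier[OF A] A W, symmetric]) simp
qed

lemma lden_times_lfrac: "Determinant.det (lden n G Z) \<noteq> 0 \<Longrightarrow> lden n G Z * lfrac n G Z = lnum n G Z"
  unfolding lfrac_def using inv_mat(1)[OF lden_carrier, of n G Z]
  by (subst assoc_mult_mat[OF lden_carrier inv_mat_carrier[OF lden_carrier] lnum_carrier, symmetric])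
     (simp add: left_mult_one_mat[OF lnum_carrier])

lemma lden_mult_lfrac:
  assumes g: "g \<in> carrier_mat (n + n) (n + n)" and d: "Determinant.det (lden n g Z) \<noteq> 0"
  shows "hcat n (1\<^sub>m n) Z * g = lden n g Z * hcat n (1\<^sub>m n) (lfrac n g Z)"
  using lden_times_lfrac[OF d] by (simp add: mult_hcat hcat_den_num[OF g] right_mult_one_mat[OF lden_carrier])

text \<open>Multiply \<open>(1, Z) g = D (1, W)\<close> by \<open>h\<close> on the right and factor
  once more: the denominators multiply.\<close>

lemma lfrac_mult:
  assumes g: "g \<in> carrier_mat (n + n) (n + n)" and h: "h \<in> carrier_mat (n + n) (n + n)"
    and dg: "Determinant.det (lden n g Z) \<noteq> 0" and dh: "Determinant.det (lden n h (lfrac n g Z)) \<noteq> 0"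
  shows "lden n (g * h) Z = lden n g Z * lden n h (lfrac n g Z)" "lfrac n (g * h) Z = lfrac n h (lfrac n g Z)"
proof -
  let ?W = "lfrac n g Z"
  have gh: "g * h \<in> carrier_mat (n + n) (n + n)" using g h by (rule mult_carrier_mat)
  have dd: "lden n g Z * lden n h ?W \<in> carrier_mat n n" by (rule mult_carrier_mat[OF lden_carrier lden_carrier])
  have "hcat n (1\<^sub>m n) Z * (g * h) = (hcat n (1\<^sub>m n) Z * g) * h"
    by (rule assoc_mult_mat[OF hcat_carrier g h, symmetric])
  also have "\<dots> = lden n g Z * (hcat n (1\<^sub>m n) ?W * h)"
    unfolding lden_mult_lfrac[OF g dg] by (rule assoc_mult_mat[OF lden_carrier hcat_carrier h])
  also have "\<dots> = lden n g Z * lden n h ?W * hcat n (1\<^sub>m n) (lfrac n h ?W)"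
    unfolding lden_mult_lfrac[OF h dh] by (rule assoc_mult_mat[OF lden_carrier lden_carrier hcat_carrier, symmetric])
  finally have eq: "hcat n (1\<^sub>m n) Z * (g * h) = lden n g Z * lden n h ?W * hcat n (1\<^sub>m n) (lfrac n h ?W)" .
  show "lden n (g * h) Z = lden n g Z * lden n h ?W" by (rule lfrac_eqI(1)[OF gh dd lfrac_carrier eq])
  show "lfrac n (g * h) Z = lfrac n h ?W"
    by (rule lfrac_eqI(3)[OF gh dd lfrac_carrier eq]) (use dg dh in \<open>simp add: det_mult[OF lden_carrier lden_carrier]\<close>)
qed

lemma lfrac_one:
  assumes "Z \<in> carrier_mat n n" shows "lden n (1\<^sub>m (n + n)) Z = 1\<^sub>m n" "lfrac n (1\<^sub>m (n + n)) Z = Z"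
proof -
  have eq: "hcat n (1\<^sub>m n) Z * 1\<^sub>m (n + n) = 1\<^sub>m n * hcat n (1\<^sub>m n) Z"
    by (simp add: right_mult_one_mat[OF hcat_carrier] left_mult_one_mat[OF hcat_carrier])
  show "lden n (1\<^sub>m (n + n)) Z = 1\<^sub>m n" "lfrac n (1\<^sub>m (n + n)) Z = Z"
    using lfrac_eqI[OF one_carrier_mat one_carrier_mat assms eq] by auto
qed

text \<open>Multiplying \<open>(1, Z) g^-1 = D (1, W)\<close> by \<open>g\<close> and by
  \<open>D^-1\<close> gives \<open>(1, W) g = D^-1 (1, Z)\<close>: the new denominator is the
  inverse of the old one and therefore nonsingular.\<close>

lemma lfrac_inverse:
  assumes g: "g \<in> carrier_mat (n + n) (n + n)" "Determinant.det g \<noteq> 0" and Z: "Z \<in> carrier_mat n n"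
    and d: "Determinant.det (lden n (inv_mat g) Z) \<noteq> 0"
  shows "Determinant.det (lden n g (lfrac n (inv_mat g) Z)) \<noteq> 0" "lfrac n g (lfrac n (inv_mat g) Z) = Z"
proof -
  let ?W = "lfrac n (inv_mat g) Z" and ?D = "lden n (inv_mat g) Z"
  have gi: "inv_mat g \<in> carrier_mat (n + n) (n + n)" using g by simp
  have "hcat n (1\<^sub>m n) Z = (hcat n (1\<^sub>m n) Z * inv_mat g) * g"
    using g inv_mat(2)[OF g] by (simp add: assoc_mult_mat[OF hcat_carrier gi g(1)] right_mult_one_mat[OF hcat_carrier])
  also have "\<dots> = ?D * (hcat n (1\<^sub>m n) ?W * g)"
    unfolding lden_mult_lfrac[OF gi d] by (rule assoc_mult_mat[OF lden_carrier hcat_carrier g(1)])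
  finally have e: "hcat n (1\<^sub>m n) Z = ?D * (hcat n (1\<^sub>m n) ?W * g)" .
  have "inv_mat ?D * hcat n (1\<^sub>m n) Z = hcat n (1\<^sub>m n) ?W * g"
    unfolding e using inv_mat(2)[OF lden_carrier d]
    by (subst assoc_mult_mat[OF inv_mat_carrier[OF lden_carrier] lden_carrier mult_carrier_mat[OF hcat_carrier g(1)], symmetric])
       (simp add: left_mult_one_mat[OF mult_carrier_mat[OF hcat_carrier g(1)]])
  note eq = lfrac_eqI[OF g(1) inv_mat_carrier[OF lden_carrier] Z this[symmetric]]
  have "Determinant.det ?D * Determinant.det (inv_mat ?D) = 1"
    by (rule det_inverse_mat[OF lden_carrier inv_mat_carrier[OF lden_carrier] inv_mat(1)[OF lden_carrier d]])
  then have nz: "Determinant.det (inv_mat ?D) \<noteq> 0" by auto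
  show "Determinant.det (lden n g ?W) \<noteq> 0" using eq(1) nz by simp
  show "lfrac n g ?W = Z" using eq(3) nz by simp
qed

lemma lfrac_inv_mat:
  assumes G: "G \<in> carrier_mat (n + n) (n + n)" "Determinant.det G \<noteq> 0"
    and Z: "Z \<in> carrier_mat n n" and d: "Determinant.det (lden n G Z) \<noteq> 0"
  shows "lfrac n (inv_mat G) (lfrac n G Z) = Z"
proof -
  let ?W = "lfrac n G Z" and ?D = "lden n G Z"
  have gi: "inv_mat G \<in> carrier_mat (n + n) (n + n)" using G by simp
  have "hcat n (1\<^sub>m n) Z = (hcat n (1\<^sub>m n) Z * G) * inv_mat G"
    using G inv_mat(1)[OF G] by (simp add: assoc_mult_mat[OF hcat_carrier G(1) gi] right_mult_one_mat[OF hcat_carrier])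
  also have "\<dots> = ?D * (hcat n (1\<^sub>m n) ?W * inv_mat G)"
    unfolding lden_mult_lfrac[OF G(1) d] by (rule assoc_mult_mat[OF lden_carrier hcat_carrier gi])
  finally have e: "hcat n (1\<^sub>m n) Z = ?D * (hcat n (1\<^sub>m n) ?W * inv_mat G)" .
  have "inv_mat ?D * hcat n (1\<^sub>m n) Z = hcat n (1\<^sub>m n) ?W * inv_mat G"
    unfolding e using inv_mat(2)[OF lden_carrier d]
    by (subst assoc_mult_mat[OF inv_mat_carrier[OF lden_carrier] lden_carrier mult_carrier_mat[OF hcat_carrier gi], symmetric])
       (simp add: left_mult_one_mat[OF mult_carrier_mat[OF hcat_carrier gi]])
  note eq = lfrac_eqI[OF gi inv_mat_carrier[OF lden_carrier] Z this[symmetric]]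
  have "Determinant.det ?D * Determinant.det (inv_mat ?D) = 1"
    by (rule det_inverse_mat[OF lden_carrier inv_mat_carrier[OF lden_carrier] inv_mat(1)[OF lden_carrier d]])
  then have nz: "Determinant.det (inv_mat ?D) \<noteq> 0" by auto
  show ?thesis using eq(3) nz by simp
qed

lemma lfrac_inj:
  assumes g: "g \<in> carrier_mat (n + n) (n + n)" "Determinant.det g \<noteq> 0"
    and Z: "Z \<in> carrier_mat n n" "Z' \<in> carrier_mat n n"
    and d: "Determinant.det (lden n g Z) \<noteq> 0" "Determinant.det (lden n g Z') \<noteq> 0"
    and eq: "lfrac n g Z = lfrac n g Z'"
  shows "Z = Z'"
  using lfrac_inv_mat[OF g Z(1) d(1)] lfrac_inv_mat[OF g Z(2) d(2)] eq by metis

definition lin_frac :: "nat \<Rightarrow> 'p::prime_card padic Matrix.mat \<Rightarrow> 'p mfun \<Rightarrow> 'p mfun" where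
  "lin_frac n g z = fun_of n (lfrac n g (Matrix.mat n n z))"

definition abs_lden :: "nat \<Rightarrow> 'p::prime_card padic Matrix.mat \<Rightarrow> 'p mfun \<Rightarrow> real" where
  "abs_lden n g z = pnorm (Determinant.det (lden n g (Matrix.mat n n z)))"

lemma lden_num_measurable:
  assumes g: "g \<in> carrier_mat (n + n) (n + n)"
  shows "mat_measurable (mat_space n) n n (\<lambda>z. lden n g (Matrix.mat n n z))"
    "mat_measurable (mat_space n) n n (\<lambda>z. lnum n g (Matrix.mat n n z))"
proof -
  have "mat_measurable (mat_space n) n (n + n) (\<lambda>z. hcat n (1\<^sub>m n) (Matrix.mat n n z) * g)"
    by (intro mat_measurable_mult[of _ n "n + n"] mat_measurable_hcat mat_measurable_mat_id mat_measurable_const g one_carrier_mat)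
  from mat_measurable_halves[OF this]
  show "mat_measurable (mat_space n) n n (\<lambda>z. lden n g (Matrix.mat n n z))"
    "mat_measurable (mat_space n) n n (\<lambda>z. lnum n g (Matrix.mat n n z))" by (simp_all add: lden_def lnum_def)
qed

lemma lin_frac_measurable: "g \<in> carrier_mat (n + n) (n + n) \<Longrightarrow> lin_frac n g \<in> mat_space n \<rightarrow>\<^sub>M mat_space n"
  unfolding lin_frac_def[abs_def] lfrac_def
  by (intro fun_of_measurable mat_measurable_mult[of _ n n _ n] mat_measurable_inv_mat lden_num_measurable)

lemma abs_lden_measurable: "g \<in> carrier_mat (n + n) (n + n) \<Longrightarrow> abs_lden n g \<in> borel_measurable (mat_space n)"
  unfolding abs_lden_def[abs_def] using det_measurable[OF lden_num_measurable(1)] by measurable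

lemma abs_lden_nonneg: "abs_lden n g z \<ge> 0"
  by (simp add: abs_lden_def pnorm_nonneg)

text \<open>With \<open>z = x^-1 y\<close> the pair is \<open>x (1, z)\<close>, so after
  multiplication by \<open>g\<close> the factor \<open>x\<close> still stands on the left and
  cancels in the quotient.\<close>

lemma fquot_pair_mul:
  assumes g: "g \<in> carrier_mat (n + n) (n + n)"
    and x: "x \<in> extensional (ix n)" and y: "y \<in> extensional (ix n)" and dx: "abs_det_fun n x \<noteq> 0"
  shows "abs_det_fun n (fst (pair_mul n g (x, y))) = abs_det_fun n x * abs_lden n g (fquot n x y)"
    and "abs_lden n g (fquot n x y) \<noteq> 0 \<Longrightarrow>
      fquot n (fst (pair_mul n g (x, y))) (snd (pair_mul n g (x, y))) = lin_frac n g (fquot n x y)"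
proof -
  let ?X = "Matrix.mat n n x" and ?Y = "Matrix.mat n n y"
  let ?Z = "inv_mat ?X * ?Y"
  have X: "?X \<in> carrier_mat n n" and Y: "?Y \<in> carrier_mat n n" by simp_all
  have d: "Determinant.det ?X \<noteq> 0" using dx by (auto simp: abs_det_fun_def)
  have Z: "?Z \<in> carrier_mat n n" by (rule mult_carrier_mat[OF inv_mat_carrier[OF X] Y])
  have XZ: "?X * ?Z = ?Y"
    using inv_mat(1)[OF X d] Y by (subst assoc_mult_mat[OF X inv_mat_carrier[OF X] Y, symmetric]) simp
  have mZ: "Matrix.mat n n (fquot n x y) = ?Z" unfolding fquot_def by (rule mat_fun_of[OF Z])
  have "pair_mat n (x, y) = ?X * hcat n (1\<^sub>m n) ?Z"
    using X Z XZ by (simp add: pair_mat_def mult_hcat)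
  then have "pair_mat n (x, y) * g = ?X * (hcat n (1\<^sub>m n) ?Z * g)"
    by (simp add: assoc_mult_mat[OF X hcat_carrier g])
  then have e: "pair_mat n (x, y) * g = hcat n (?X * lden n g ?Z) (?X * lnum n g ?Z)"
    by (simp add: hcat_den_num[OF g] mult_hcat[OF X])
  have Xd: "?X * lden n g ?Z \<in> carrier_mat n n" and Xn: "?X * lnum n g ?Z \<in> carrier_mat n n"
    using mult_carrier_mat[OF X lden_carrier] mult_carrier_mat[OF X lnum_carrier] by auto
  have 1: "Matrix.mat n n (fst (pair_mul n g (x, y))) = ?X * lden n g ?Z"
    and 2: "Matrix.mat n n (snd (pair_mul n g (x, y))) = ?X * lnum n g ?Z"
    unfolding pair_mul_def e by (simp_all add: lhalf_hcat[OF Xd] rhalf_hcat[OF Xn] mat_fun_of Xd Xn)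
  show "abs_det_fun n (fst (pair_mul n g (x, y))) = abs_det_fun n x * abs_lden n g (fquot n x y)"
    unfolding abs_det_fun_def abs_lden_def mZ 1 by (simp add: det_mult[OF X lden_carrier] pnorm_mult)
  assume "abs_lden n g (fquot n x y) \<noteq> 0"
  then have dn: "Determinant.det (lden n g ?Z) \<noteq> 0" unfolding abs_lden_def mZ by auto
  have dXd: "Determinant.det (?X * lden n g ?Z) \<noteq> 0" using d dn by (simp add: det_mult[OF X lden_carrier])
  have "?X * lnum n g ?Z = ?X * lden n g ?Z * lfrac n g ?Z"
    by (simp add: assoc_mult_mat[OF X lden_carrier lfrac_carrier] lden_times_lfrac[OF dn])
  then have "inv_mat (?X * lden n g ?Z) * (?X * lnum n g ?Z) = lfrac n g ?Z"
    using inv_mat(2)[OF Xd dXd]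
    by (simp add: assoc_mult_mat[OF inv_mat_carrier[OF Xd] Xd lfrac_carrier, symmetric] left_mult_one_mat[OF lfrac_carrier])
  then show "fquot n (fst (pair_mul n g (x, y))) (snd (pair_mul n g (x, y))) = lin_frac n g (fquot n x y)"
    unfolding fquot_def[of n "fst _"] 1 2 lin_frac_def mZ by simp
qed

subsection \<open>Quasiinvariance of the measures on finite matrices\<close>

lemma nn_integral_vol2:
  fixes G :: "'p::prime_card mfun \<times> 'p mfun \<Rightarrow> ennreal"
  assumes G: "G \<in> borel_measurable (mat_space n \<Otimes>\<^sub>M mat_space n)"
  shows "(\<integral>\<^sup>+ x. (\<integral>\<^sup>+ y. G (x, y) \<partial>vol n) \<partial>vol n) = (\<integral>\<^sup>+ v. G v \<partial>vol2 n)"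
proof -
  interpret sigma_finite_measure "vol n :: 'p mfun measure" by (rule sigma_finite_vol)
  show ?thesis
    by (rule nn_integral_fst) (use G in \<open>simp add: measurable_cong_sets[OF sets_vol2 refl]\<close>)
qed

lemma nn_integral_pair_mul:
  fixes G :: "'p::prime_card mfun \<times> 'p mfun \<Rightarrow> ennreal"
  assumes g: "g \<in> GL_int (n + n)" and G: "G \<in> borel_measurable (mat_space n \<Otimes>\<^sub>M mat_space n)"
  shows "(\<integral>\<^sup>+ v. G (pair_mul n g v) \<partial>vol2 n) = (\<integral>\<^sup>+ v. G v \<partial>vol2 n)"
proof -
  have m: "pair_mul n g \<in> vol2 n \<rightarrow>\<^sub>M mat_space n \<Otimes>\<^sub>M mat_space n"
    using pair_mul_measurable[OF GL_int_carrier[OF g]] by (simp add: measurable_cong_sets[OF sets_vol2 refl])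
  have "(\<integral>\<^sup>+ v. G v \<partial>vol2 n) = (\<integral>\<^sup>+ v. G v \<partial>distr (vol2 n) (mat_space n \<Otimes>\<^sub>M mat_space n) (pair_mul n g))"
    by (simp add: distr_pair_mul[OF g])
  also have "\<dots> = (\<integral>\<^sup>+ v. G (pair_mul n g v) \<partial>vol2 n)"
    by (rule nn_integral_distr[OF m]) (use G in simp)
  finally show ?thesis by simp
qed

lemma pair_mul_ints':
  assumes "g \<in> GL_int (n + n)" "x \<in> extensional (ix n)" "y \<in> extensional (ix n)"
  shows "fst (pair_mul n g (x, y)) \<in> mat_ints n \<and> snd (pair_mul n g (x, y)) \<in> mat_ints n \<longleftrightarrow> x \<in> mat_ints n \<and> y \<in> mat_ints n"
  using pair_mul_ints[OF assms(1), of "(x, y)"] assms(2,3) by (simp add: mem_Times_iff)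

lemma mu_transform:
  fixes f :: "'p::prime_card mfun \<Rightarrow> ennreal"
  assumes n: "n > 0" and s: "s > -1" and prob: "prob_space (mu n s :: 'p mfun measure)"
    and g: "g \<in> GL_int (n + n)" and f: "f \<in> borel_measurable (mat_space n)"
  shows "(\<integral>\<^sup>+ z. f z \<partial>mu n s) = (\<integral>\<^sup>+ z. f (lin_frac n g z) * ennreal (abs_lden n g z powr s) \<partial>mu n s)"
proof -
  let ?N = "mat_space n :: 'p mfun measure" and ?V = "vol n :: 'p mfun measure"
  have gc: "g \<in> carrier_mat (n + n) (n + n)" by (rule GL_int_carrier[OF g])
  obtain c where c: "c \<noteq> 0" "c \<noteq> \<infinity>" and model: "\<And>f. f \<in> borel_measurable ?N \<Longrightarrow>
      (\<integral>\<^sup>+ x. (\<integral>\<^sup>+ y. quot_weight n s x y * f (fquot n x y) \<partial>?V) \<partial>?V) = c * (\<integral>\<^sup>+ z. f z \<partial>mu n s)"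
    using mu_quotient[OF n s prob] by blast
  define G where "G v = quot_weight n s (fst v) (snd v) * f (fquot n (fst v) (snd v))" for v
  define h where "h z = f (lin_frac n g z) * ennreal (abs_lden n g z powr s)" for z
  have h: "h \<in> borel_measurable ?N"
    unfolding h_def[abs_def] using measurable_compose[OF lin_frac_measurable[OF gc] f] abs_lden_measurable[OF gc] by measurable
  have G: "G \<in> borel_measurable (?N \<Otimes>\<^sub>M ?N)"
    unfolding G_def[abs_def]
    by (intro borel_measurable_times_ennreal quot_weight_measurable measurable_compose[OF fquot_measurable f])
  have G': "(\<lambda>v. G (pair_mul n g v)) \<in> borel_measurable (?N \<Otimes>\<^sub>M ?N)"
    by (rule measurable_compose[OF pair_mul_measurable[OF gc] G])
  have "c * (\<integral>\<^sup>+ z. f z \<partial>mu n s) = (\<integral>\<^sup>+ v. G v \<partial>vol2 n)"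
    using model[OF f] nn_integral_vol2[OF G] by (simp add: G_def)
  also have "\<dots> = (\<integral>\<^sup>+ v. G (pair_mul n g v) \<partial>vol2 n)" by (rule nn_integral_pair_mul[OF g G, symmetric])
  also have "\<dots> = (\<integral>\<^sup>+ x. (\<integral>\<^sup>+ y. G (pair_mul n g (x, y)) \<partial>?V) \<partial>?V)"
    by (rule nn_integral_vol2[OF G', symmetric])
  also have "\<dots> = (\<integral>\<^sup>+ x. (\<integral>\<^sup>+ y. quot_weight n s x y * h (fquot n x y) \<partial>?V) \<partial>?V)"
  proof (rule nn_integral_cong_AE)
    show "AE x in ?V. (\<integral>\<^sup>+ y. G (pair_mul n g (x, y)) \<partial>?V) = (\<integral>\<^sup>+ y. quot_weight n s x y * h (fquot n x y) \<partial>?V)"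
      using AE_vol_det[of n] AE_space
    proof eventually_elim
      case (elim x)
      have x: "x \<in> extensional (ix n)" using elim by simp
      show ?case
      proof (rule nn_integral_cong)
        fix y :: "'p mfun" assume "y \<in> space ?V"
        then have y: "y \<in> extensional (ix n)" by simp
        note ints = pair_mul_ints'[OF g x y]
        show "G (pair_mul n g (x, y)) = quot_weight n s x y * h (fquot n x y)"
        proof (cases "x \<in> mat_ints n \<and> y \<in> mat_ints n")
          case False
          then show ?thesis using ints by (auto simp: G_def quot_weight_def)
        next
          case True
          then have ints': "fst (pair_mul n g (x, y)) \<in> mat_ints n" "snd (pair_mul n g (x, y)) \<in> mat_ints n"
            using ints by auto
          have dx: "abs_det_fun n x \<noteq> 0" using elim True by simp
          note fq = fquot_pair_mul[OF gc x y dx]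
          show ?thesis
          \<comment> \<open>If the denominator is singular, so is the first matrix of the new pair;
            the weight on the left and the factor in \<open>h\<close> then both vanish, whatever the
            value of \<open>lin_frac\<close>.\<close>
          proof (cases "abs_lden n g (fquot n x y) = 0")
            case z: True
            then show ?thesis using fq(1) by (simp add: G_def h_def quot_weight_def)
          next
            case False
            have "ennreal ((abs_det_fun n x * abs_lden n g (fquot n x y)) powr s)
              = ennreal (abs_det_fun n x powr s) * ennreal (abs_lden n g (fquot n x y) powr s)"
              by (simp add: powr_mult abs_det_fun_nonneg abs_lden_nonneg ennreal_mult)
            then show ?thesis
              using True ints' fq(1) fq(2)[OF False] by (simp add: G_def h_def quot_weight_def mult.commute mult.left_commute)
          qed
        qed
      qed
    qed
  qed
  also have "\<dots> = c * (\<integral>\<^sup>+ z. h z \<partial>mu n s)" by (rule model[OF h])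
  finally have "c * (\<integral>\<^sup>+ z. f z \<partial>mu n s) = c * (\<integral>\<^sup>+ z. h z \<partial>mu n s)" .
  then have "(\<integral>\<^sup>+ z. f z \<partial>mu n s) = (\<integral>\<^sup>+ z. h z \<partial>mu n s)"
    using c by (simp add: ennreal_mult_cancel_left)
  then show ?thesis by (simp add: h_def)
qed

text \<open>A singular \<open>a + z c\<close> makes the first half \<open>x (a + z c)\<close> of the
  transformed pair singular. Integral pairs with singular first half form a null set, and so does
  its preimage under the measure preserving map \<open>pair_mul n g\<close>.\<close>

lemma mu_den_nonzero:
  assumes n: "n > 0" and s: "s > -1" and prob: "prob_space (mu n s :: 'p::prime_card mfun measure)"
    and g: "g \<in> GL_int (n + n)"
  shows "AE z in (mu n s :: 'p mfun measure). abs_lden n g z \<noteq> 0"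
proof -
  let ?N = "mat_space n :: 'p mfun measure" and ?V = "vol n :: 'p mfun measure"
  have gc: "g \<in> carrier_mat (n + n) (n + n)" by (rule GL_int_carrier[OF g])
  obtain c where c: "c \<noteq> 0" "c \<noteq> \<infinity>" and model: "\<And>f. f \<in> borel_measurable ?N \<Longrightarrow>
      (\<integral>\<^sup>+ x. (\<integral>\<^sup>+ y. quot_weight n s x y * f (fquot n x y) \<partial>?V) \<partial>?V) = c * (\<integral>\<^sup>+ z. f z \<partial>mu n s)"
    using mu_quotient[OF n s prob] by blast
  let ?S = "{z\<in>space ?N. abs_lden n g z = 0}"
  have S: "?S \<in> sets ?N" using abs_lden_measurable[OF gc] by measurable
  define f :: "'p mfun \<Rightarrow> ennreal" where "f = indicator ?S"
  have f: "f \<in> borel_measurable ?N" unfolding f_def using S by (rule borel_measurable_indicator)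
  define H :: "'p mfun \<times> 'p mfun \<Rightarrow> ennreal" where
    "H v = indicator (mat_ints n) (fst v) * indicator (mat_ints n) (snd v) * indicator {0} (abs_det_fun n (fst v))" for v
  have H: "H \<in> borel_measurable (?N \<Otimes>\<^sub>M ?N)" unfolding H_def[abs_def] by measurable
  have H': "(\<lambda>v. H (pair_mul n g v)) \<in> borel_measurable (vol2 n)"
    using measurable_compose[OF pair_mul_measurable[OF gc] H] by (simp add: measurable_cong_sets[OF sets_vol2 refl])
  have "(\<integral>\<^sup>+ v. H v \<partial>vol2 n) = (\<integral>\<^sup>+ x. (\<integral>\<^sup>+ y. H (x, y) \<partial>?V) \<partial>?V)" by (rule nn_integral_vol2[OF H, symmetric])
  also have "\<dots> = (\<integral>\<^sup>+ x. 0 \<partial>?V)"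
  proof (rule nn_integral_cong_AE)
    show "AE x in ?V. (\<integral>\<^sup>+ y. H (x, y) \<partial>?V) = 0"
      using AE_vol_det[of n]
    proof eventually_elim
      case (elim x)
      then have "H (x, y) = 0" for y by (auto simp: H_def indicator_def)
      then show ?case by simp
    qed
  qed
  finally have "(\<integral>\<^sup>+ v. H (pair_mul n g v) \<partial>vol2 n) = 0" by (simp add: nn_integral_pair_mul[OF g H])
  then have AE: "AE v in vol2 n. H (pair_mul n g v) = 0" unfolding nn_integral_0_iff_AE[OF H'] .
  define G where "G v = quot_weight n s (fst v) (snd v) * f (fquot n (fst v) (snd v))" for v
  have G: "G \<in> borel_measurable (?N \<Otimes>\<^sub>M ?N)"
    unfolding G_def[abs_def]
    by (intro borel_measurable_times_ennreal quot_weight_measurable measurable_compose[OF fquot_measurable f])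
  have "AE v in vol2 n. G v = 0"
    using AE AE_space
  proof eventually_elim
    case (elim v)
    obtain x y where v: "v = (x, y)" by (cases v)
    have xy: "x \<in> extensional (ix n)" "y \<in> extensional (ix n)" using elim(2) by (auto simp: v space_pair_measure)
    show ?case
    proof (cases "x \<in> mat_ints n \<and> y \<in> mat_ints n \<and> abs_det_fun n x \<noteq> 0")
      case False
      then show ?thesis by (auto simp: G_def quot_weight_def v)
    next
      case True
      then have "fst (pair_mul n g (x, y)) \<in> mat_ints n" "snd (pair_mul n g (x, y)) \<in> mat_ints n"
        using pair_mul_ints'[OF g xy] by auto
      then have "abs_det_fun n (fst (pair_mul n g (x, y))) \<noteq> 0" using elim(1) by (auto simp: H_def v)
      then have "abs_lden n g (fquot n x y) \<noteq> 0" using fquot_pair_mul(1)[OF gc xy] True by auto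
      then show ?thesis by (simp add: G_def f_def v)
    qed
  qed
  then have "(\<integral>\<^sup>+ v. G v \<partial>vol2 n) = 0"
    by (subst nn_integral_0_iff_AE) (use G in \<open>simp_all add: measurable_cong_sets[OF sets_vol2 refl]\<close>)
  then have "c * (\<integral>\<^sup>+ z. f z \<partial>mu n s) = 0"
    using model[OF f] nn_integral_vol2[OF G] by (simp add: G_def)
  then have "emeasure (mu n s) ?S = 0" using c S by (simp add: f_def)
  then show ?thesis
    by (intro AE_I'[of ?S]) (use S in \<open>auto simp: null_sets_def space_mat_space\<close>)
qed

subsection \<open>Infinite matrices and their corners\<close>

lemma Sum_any_eq_sum:
  assumes "finite A" "\<And>k. k \<notin> A \<Longrightarrow> f k = 0" shows "Sum_any f = sum f A"
  by (rule Sum_any.expand_superset[OF assms(1)]) (use assms(2) in blast)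

text \<open>Of the \<open>2 n\<close> positions in a finite corner, the first \<open>n\<close>
  belong to the first block and the next \<open>n\<close> to the second; thus \<open>corner2\<close>
  joins the corners of size \<open>n\<close> of all four blocks.\<close>

definition index_emb :: "nat \<Rightarrow> nat \<Rightarrow> nat + nat" where
  "index_emb n i = (if i < n then Inl i else Inr (i - n))"

definition corner2 :: "nat \<Rightarrow> 'p bmat \<Rightarrow> 'p::prime_card padic Matrix.mat" where
  "corner2 n g = Matrix.mat (n + n) (n + n) (\<lambda>(i, j). g (index_emb n i, index_emb n j))"

lemma corner2_carrier [simp]: "corner2 n g \<in> carrier_mat (n + n) (n + n)"
  by (simp add: corner2_def)

lemma corner2_index:
  assumes "i < n" "j < n"
  shows "corner2 n g $$ (i, j) = block_a g (i, j)" "corner2 n g $$ (i, j + n) = block_b g (i, j)"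
    "corner2 n g $$ (i + n, j) = block_c g (i, j)" "corner2 n g $$ (i + n, j + n) = block_d g (i, j)"
  using assms by (simp_all add: corner2_def index_emb_def block_a_def block_b_def block_c_def block_d_def)

section \<open>Denominators, numerators and determinants at the level of corners\<close>

lemma adapted_Suc:
  assumes "adapted g k" shows "adapted g (Suc k)"
proof -
  have "i < Suc k \<Longrightarrow> i < k \<or> i = k" for i by auto
  then show ?thesis using assms unfolding adapted_def by (smt (verit) Suc_leD not_less_eq_eq not_less_eq order_le_less)
qed

lemma adapted_mono:
  assumes "adapted g k" "k \<le> n" shows "adapted g n"
  using assms(2,1) by (induction rule: dec_induct) (auto intro: adapted_Suc)

lemma adaptedD:
  assumes "adapted g n"
  shows "i < n \<Longrightarrow> n \<le> j \<Longrightarrow> block_a g (i, j) = 0" "n \<le> i \<Longrightarrow> i < j \<Longrightarrow> block_a g (i, j) = 0"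
    "n \<le> i \<Longrightarrow> block_c g (i, j) = 0" "n \<le> j \<Longrightarrow> block_c g (i, j) = 0"
    "n \<le> i \<Longrightarrow> j < n \<Longrightarrow> block_d g (i, j) = 0" "n \<le> j \<Longrightarrow> j < i \<Longrightarrow> block_d g (i, j) = 0"
    "n \<le> j \<Longrightarrow> pnorm (block_a g (j, j)) = 1" "n \<le> j \<Longrightarrow> pnorm (block_d g (j, j)) = 1"
  using assms unfolding adapted_def by blast+

lemma sum_lessThan_add: "(\<Sum>k<n + m. f k) = (\<Sum>k<n. f k) + (\<Sum>k<m. f (k + n) :: 'a::comm_monoid_add)" for n m :: nat
  by (induction m) (simp_all add: add_ac)

lemma hcat_one_mult_entry:
  fixes Z G :: "'a::comm_ring_1 Matrix.mat"
  assumes Z: "Z \<in> carrier_mat n n" and G: "G \<in> carrier_mat (n + n) (n + n)" and ij: "i < n" "j < n + n"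
  shows "(hcat n (1\<^sub>m n) Z * G) $$ (i, j) = G $$ (i, j) + (\<Sum>k<n. Z $$ (i, k) * G $$ (k + n, j))"
proof -
  have "(hcat n (1\<^sub>m n) Z * G) $$ (i, j) = (\<Sum>k<n + n. hcat n (1\<^sub>m n) Z $$ (i, k) * G $$ (k, j))"
    by (rule mult_mat_entry[OF hcat_carrier G ij])
  also have "\<dots> = (\<Sum>k<n. if k = i then G $$ (i, j) else 0) + (\<Sum>k<n. Z $$ (i, k) * G $$ (k + n, j))"
    unfolding sum_lessThan_add using ij(1) by (intro arg_cong2[of _ _ _ _ "(+)"] sum.cong) (auto simp: hcat_def)
  also have "(\<Sum>k<n. if k = i then G $$ (i, j) else 0) = G $$ (i, j)" using ij(1) by simp
  finally show ?thesis .
qed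

text \<open>The rows of \<open>c\<close> with index at least \<open>n\<close> vanish, so the sums
  stop at \<open>n\<close> and the corner of \<open>a + z c\<close> depends only on the corner of
  \<open>z\<close>. The numerator behaves in the same way, because \<open>d\<close> has no entries
  below its corner.\<close>

lemma mat_denom:
  assumes "adapted g n"
  shows "Matrix.mat n n (denom g z) = lden n (corner2 n g) (Matrix.mat n n z)"
proof (rule eq_matI)
  fix i j assume "i < dim_row (lden n (corner2 n g) (Matrix.mat n n z))" "j < dim_col (lden n (corner2 n g) (Matrix.mat n n z))"
  then have ij: "i < n" "j < n" by (simp_all add: lden_def lhalf_def)
  have "(z \<star> block_c g) (i, j) = (\<Sum>k<n. z (i, k) * block_c g (k, j))"
    unfolding mmul_def prod.case using adaptedD(3)[OF assms] by (intro Sum_any_eq_sum) auto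
  then show "Matrix.mat n n (denom g z) $$ (i, j) = lden n (corner2 n g) (Matrix.mat n n z) $$ (i, j)"
    using ij hcat_one_mult_entry[OF mat_carrier corner2_carrier, of i n j z g]
    by (simp add: lden_def lhalf_def denom_def corner2_index)
qed (simp_all add: lden_def lhalf_def)

lemma mat_numer:
  assumes "adapted g n"
  shows "Matrix.mat n n (numer g z) = lnum n (corner2 n g) (Matrix.mat n n z)"
proof (rule eq_matI)
  fix i j assume "i < dim_row (lnum n (corner2 n g) (Matrix.mat n n z))" "j < dim_col (lnum n (corner2 n g) (Matrix.mat n n z))"
  then have ij: "i < n" "j < n" by (simp_all add: lnum_def rhalf_def)
  have "(z \<star> block_d g) (i, j) = (\<Sum>k<n. z (i, k) * block_d g (k, j))"
    unfolding mmul_def prod.case using adaptedD(5)[OF assms _ ij(2)] by (intro Sum_any_eq_sum) auto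
  then show "Matrix.mat n n (numer g z) $$ (i, j) = lnum n (corner2 n g) (Matrix.mat n n z) $$ (i, j)"
    using ij hcat_one_mult_entry[OF mat_carrier corner2_carrier, of i n "j + n" z g]
    by (simp add: lnum_def rhalf_def numer_def corner2_index)
qed (simp_all add: lnum_def rhalf_def)

lemma pnorm_det_Suc_col:
  fixes A :: "'p::prime_card mfun"
  assumes "\<And>i. i < n \<Longrightarrow> A (i, n) = 0" "pnorm (A (n, n)) = 1"
  shows "pnorm (Determinant.det (Matrix.mat (Suc n) (Suc n) A)) = pnorm (Determinant.det (Matrix.mat n n A))"
proof -
  let ?A = "Matrix.mat (Suc n) (Suc n) A"
  have "Determinant.det ?A = (\<Sum>i<Suc n. ?A $$ (i, n) * cofactor ?A i n)"
    by (rule laplace_expansion_column) auto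
  also have "\<dots> = A (n, n) * cofactor ?A n n" using assms(1) by simp
  also have "cofactor ?A n n = Determinant.det (mat_delete ?A n n)" by (simp add: cofactor_def)
  also have "mat_delete ?A n n = Matrix.mat n n A" by (rule eq_matI) (auto simp: mat_delete_def)
  finally show ?thesis by (simp add: pnorm_mult assms(2))
qed

lemma pnorm_det_Suc_row:
  fixes A :: "'p::prime_card mfun"
  assumes "\<And>j. j < n \<Longrightarrow> A (n, j) = 0" "pnorm (A (n, n)) = 1"
  shows "pnorm (Determinant.det (Matrix.mat (Suc n) (Suc n) A)) = pnorm (Determinant.det (Matrix.mat n n A))"
proof -
  let ?A = "Matrix.mat (Suc n) (Suc n) A"
  have "Determinant.det ?A = (\<Sum>j<Suc n. ?A $$ (n, j) * cofactor ?A n j)"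
    by (rule laplace_expansion_row) auto
  also have "\<dots> = A (n, n) * cofactor ?A n n" using assms(1) by simp
  also have "cofactor ?A n n = Determinant.det (mat_delete ?A n n)" by (simp add: cofactor_def)
  also have "mat_delete ?A n n = Matrix.mat n n A" by (rule eq_matI) (auto simp: mat_delete_def)
  finally show ?thesis by (simp add: pnorm_mult assms(2))
qed

lemma denom_col_ge:
  assumes "adapted g n" "n \<le> j" shows "denom g z (i, j) = block_a g (i, j)"
proof -
  have "(z \<star> block_c g) (i, j) = 0"
    unfolding mmul_def prod.case using adaptedD(4)[OF assms] by simp
  then show ?thesis by (simp add: denom_def)
qed

text \<open>Past \<open>k\<close> the columns of \<open>a + z c\<close> are those of
  \<open>a\<close>, with zeros above a diagonal entry of norm 1, so enlarging the corner multiplies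
  the determinant by a unit. This makes the least adapted size in \<open>abs_det\<close>
  interchangeable with any other.\<close>

lemma pnorm_det_denom:
  assumes "adapted g k" "k \<le> n"
  shows "pnorm (Determinant.det (Matrix.mat n n (denom g z))) = pnorm (Determinant.det (Matrix.mat k k (denom g z)))"
  using assms(2)
proof (induction n rule: dec_induct)
  case (step n)
  have a: "adapted g n" using adapted_mono[OF assms(1)] step by simp
  have "pnorm (Determinant.det (Matrix.mat (Suc n) (Suc n) (denom g z))) = pnorm (Determinant.det (Matrix.mat n n (denom g z)))"
    by (rule pnorm_det_Suc_col) (use adaptedD[OF a] in \<open>simp_all add: denom_col_ge[OF a]\<close>)
  then show ?case using step by simp
qed simp

lemma abs_det_eq:
  assumes a: "adapted g n"
  shows "abs_det g z = abs_lden n (corner2 n g) z"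
proof -
  have "adapted g (LEAST k. adapted g k)" "(LEAST k. adapted g k) \<le> n"
    using a by (auto intro: LeastI Least_le)
  from pnorm_det_denom[OF this, of z] show ?thesis
    by (simp add: abs_det_def Let_def abs_lden_def mat_denom[OF a])
qed

subsection \<open>Inverses of infinite matrices\<close>

text \<open>Block lower triangular at every cut from \<open>N\<close> on. With such a left factor,
  taking corners is compatible with products (\<open>mat_mmul_corner_lower\<close>), and hence with
  inverses.\<close>

definition corner_lower :: "nat \<Rightarrow> (nat \<times> nat \<Rightarrow> 'a::zero) \<Rightarrow> bool" where
  "corner_lower N A \<longleftrightarrow> (\<forall>n\<ge>N. \<forall>i<n. \<forall>j\<ge>n. A (i, j) = 0)"

lemma mat_mmul_corner_lower:
  fixes A B :: "nat \<times> nat \<Rightarrow> 'a::comm_ring_1"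
  assumes A: "\<And>i j. i < n \<Longrightarrow> n \<le> j \<Longrightarrow> A (i, j) = 0"
  shows "Matrix.mat n n (A \<star> B) = Matrix.mat n n A * Matrix.mat n n B"
proof (rule eq_matI)
  fix i j assume "i < dim_row (Matrix.mat n n A * Matrix.mat n n B)" "j < dim_col (Matrix.mat n n A * Matrix.mat n n B)"
  then have ij: "i < n" "j < n" by simp_all
  have "(A \<star> B) (i, j) = (\<Sum>k<n. A (i, k) * B (k, j))"
    unfolding mmul_def prod.case using A[OF ij(1)] by (intro Sum_any_eq_sum) auto
  then show "Matrix.mat n n (A \<star> B) $$ (i, j) = (Matrix.mat n n A * Matrix.mat n n B) $$ (i, j)"
    using ij mult_mat_entry[of "Matrix.mat n n A" n n "Matrix.mat n n B" n i j] by simp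
qed simp_all

lemma corner_lower_row_finite: "corner_lower N A \<Longrightarrow> row_finite A"
  unfolding row_finite_def
proof
  fix i assume A: "corner_lower N A"
  have "j < Suc (N + i)" if "A (i, j) \<noteq> 0" for j
  proof (rule ccontr)
    assume "\<not> j < Suc (N + i)"
    then have "A (i, j) = 0" using A[unfolded corner_lower_def, rule_format, of "Suc (N + i)" i j] by simp
    then show False using that by simp
  qed
  then have "{j. A (i, j) \<noteq> 0} \<subseteq> {..<Suc (N + i)}" by blast
  then show "finite {j. A (i, j) \<noteq> 0}" by (rule finite_subset) (rule finite_lessThan)
qed

text \<open>The first \<open>n\<close> rows of the large matrix are \<open>(A_n, 0)\<close>, so the
  first \<open>n\<close> rows \<open>Y\<close> of its inverse satisfy \<open>A_n Y = (1, 0)\<close>.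
  Hence \<open>Y = (A_n^-1, 0)\<close>: the inverses of the corners fit together.\<close>

lemma inv_mat_corner:
  fixes A :: "nat \<times> nat \<Rightarrow> 'a::field"
  assumes nm: "n \<le> m" and A: "\<And>i j. i < n \<Longrightarrow> n \<le> j \<Longrightarrow> A (i, j) = 0"
    and d: "Determinant.det (Matrix.mat n n A) \<noteq> 0" "Determinant.det (Matrix.mat m m A) \<noteq> 0"
    and ij: "i < n" "j < m"
  shows "inv_mat (Matrix.mat m m A) $$ (i, j) = (if j < n then inv_mat (Matrix.mat n n A) $$ (i, j) else 0)"
proof -
  let ?An = "Matrix.mat n n A" and ?Am = "Matrix.mat m m A"
  let ?Y = "inv_mat ?Am"
  define Y where "Y = Matrix.mat n m (\<lambda>(i, j). ?Y $$ (i, j))"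
  define T where "T = Matrix.mat n m (\<lambda>(i, j). if i = j then 1 else 0 :: 'a)"
  have An: "?An \<in> carrier_mat n n" and Am: "?Am \<in> carrier_mat m m" by simp_all
  have Y: "Y \<in> carrier_mat n m" and T: "T \<in> carrier_mat n m" by (simp_all add: Y_def T_def)
  have "?An * Y = T"
  proof (rule eq_matI)
    fix i j assume "i < dim_row T" "j < dim_col T"
    then have ij: "i < n" "j < m" by (simp_all add: T_def)
    have im: "i < m" using ij nm by simp
    have "(?An * Y) $$ (i, j) = (\<Sum>k<n. A (i, k) * ?Y $$ (k, j))"
      using mult_mat_entry[OF An Y ij] ij by (simp add: Y_def)
    also have "\<dots> = (\<Sum>k<m. A (i, k) * ?Y $$ (k, j))"
      using nm A[OF ij(1)] by (intro sum.mono_neutral_left) auto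
    also have "\<dots> = (?Am * ?Y) $$ (i, j)"
      using mult_mat_entry[OF Am inv_mat_carrier[OF Am] im ij(2)] im by simp
    also have "\<dots> = T $$ (i, j)" using inv_mat(1)[OF Am d(2)] ij im by (simp add: T_def)
    finally show "(?An * Y) $$ (i, j) = T $$ (i, j)" .
  qed (simp_all add: Y_def T_def)
  then have "inv_mat ?An * T = (inv_mat ?An * ?An) * Y"
    by (simp add: assoc_mult_mat[OF inv_mat_carrier[OF An] An Y])
  then have "Y = inv_mat ?An * T" using inv_mat(2)[OF An d(1)] Y by simp
  moreover have "?Y $$ (i, j) = Y $$ (i, j)" using ij by (simp add: Y_def)
  ultimately have "?Y $$ (i, j) = (inv_mat ?An * T) $$ (i, j)" by (simp only:)
  also have "\<dots> = (\<Sum>k<n. inv_mat ?An $$ (i, k) * T $$ (k, j))"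
    by (rule mult_mat_entry[OF inv_mat_carrier[OF An] T ij])
  also have "\<dots> = (\<Sum>k<n. if k = j then inv_mat ?An $$ (i, j) else 0)"
    using ij by (intro sum.cong) (auto simp: T_def)
  also have "\<dots> = (if j < n then inv_mat ?An $$ (i, j) else 0)" by simp
  finally show ?thesis .
qed

lemma mat_mone: "Matrix.mat n n mone = 1\<^sub>m n"
  by (rule eq_matI) (auto simp: mone_def)

lemma mat_eqI_corners:
  assumes "\<And>n. N \<le> n \<Longrightarrow> Matrix.mat n n B = Matrix.mat n n C" shows "B = C"
proof
  fix ij :: "nat \<times> nat" obtain i j where ij: "ij = (i, j)" by (cases ij)
  have "Matrix.mat (Suc (N + i + j)) (Suc (N + i + j)) B $$ (i, j) = Matrix.mat (Suc (N + i + j)) (Suc (N + i + j)) C $$ (i, j)"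
    using assms[of "Suc (N + i + j)"] by simp
  then show "B ij = C ij" by (simp add: ij)
qed

lemma minv_corner_lower:
  fixes A :: "nat \<times> nat \<Rightarrow> 'a::field"
  assumes A: "corner_lower N A" and d: "\<And>n. N \<le> n \<Longrightarrow> Determinant.det (Matrix.mat n n A) \<noteq> 0"
  shows "corner_lower N (minv A)" "\<And>n. N \<le> n \<Longrightarrow> Matrix.mat n n (minv A) = inv_mat (Matrix.mat n n A)"
proof -
  have A0: "A (i, j) = 0" if "N \<le> n" "i < n" "n \<le> j" for n i j
    using A that by (simp add: corner_lower_def)
  \<comment> \<open>Each entry is read from the inverse of one corner that contains it; by
    \<open>inv_mat_corner\<close> every other size from \<open>N\<close> on that contains it gives
    the same value.\<close>
  define X where "X = (\<lambda>(i, j). inv_mat (Matrix.mat (Suc (N + i + j)) (Suc (N + i + j)) A) $$ (i, j))"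
  have Xn: "inv_mat (Matrix.mat n n A) $$ (i, j) = X (i, j)" if "N \<le> n" "i < n" "j < n" for n i j
  proof (cases "n \<le> Suc (N + i + j)")
    case True
    then show ?thesis
      using inv_mat_corner[OF True A0[OF that(1)] d d, of i j] that by (simp add: X_def)
  next
    case False
    then show ?thesis
      using inv_mat_corner[of "Suc (N + i + j)" n A i j] A0[of "Suc (N + i + j)"] d[of "Suc (N + i + j)"] d[of n] that
      by (simp add: X_def)
  qed
  have matX: "Matrix.mat n n X = inv_mat (Matrix.mat n n A)" if "N \<le> n" for n
  proof -
    have "inv_mat (Matrix.mat n n A) \<in> carrier_mat n n" by simp
    from carrier_matD[OF this] show ?thesis by (intro eq_matI) (simp_all add: Xn[OF that])
  qed
  have X0: "X (i, j) = 0" if "N \<le> n" "i < n" "n \<le> j" for n i j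
  proof -
    have "inv_mat (Matrix.mat (Suc (N + i + j)) (Suc (N + i + j)) A) $$ (i, j) = 0"
      using inv_mat_corner[of n "Suc (N + i + j)" A i j] A0[OF that(1)] d[OF that(1)] d[of "Suc (N + i + j)"] that
      by simp
    then show ?thesis by (simp add: X_def)
  qed
  have cX: "corner_lower N X" using X0 by (simp add: corner_lower_def)
  have AX: "A \<star> X = mone"
  proof (rule mat_eqI_corners[of N])
    fix n assume n: "N \<le> n"
    show "Matrix.mat n n (A \<star> X) = Matrix.mat n n mone"
      using mat_mmul_corner_lower[of n A X] A0[OF n] inv_mat(1)[OF mat_carrier d[OF n]] by (simp add: matX[OF n] mat_mone)
  qed
  have XA: "X \<star> A = mone"
  proof (rule mat_eqI_corners[of N])
    fix n assume n: "N \<le> n"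
    show "Matrix.mat n n (X \<star> A) = Matrix.mat n n mone"
      using mat_mmul_corner_lower[of n X A] X0[OF n] inv_mat(2)[OF mat_carrier d[OF n]] by (simp add: matX[OF n] mat_mone)
  qed
  have "minv A = X"
    unfolding minv_def
  proof (rule the_equality)
    show "row_finite X \<and> A \<star> X = mone \<and> X \<star> A = mone"
      using corner_lower_row_finite[OF cX] AX XA by simp
    fix Y assume Y: "row_finite Y \<and> A \<star> Y = mone \<and> Y \<star> A = mone"
    show "Y = X"
    proof (rule mat_eqI_corners[of N])
      fix n assume n: "N \<le> n"
      let ?A = "Matrix.mat n n A" and ?Y = "Matrix.mat n n Y"
      have A': "?A \<in> carrier_mat n n" and Y': "?Y \<in> carrier_mat n n" by simp_all
      \<comment> \<open>For any competitor \<open>Y\<close> the corners of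
        \<open>A \<star> Y\<close> are products of corners, which forces the corners of
        \<open>Y\<close> to be those of \<open>X\<close>.\<close>
      have AY: "?A * ?Y = 1\<^sub>m n" using mat_mmul_corner_lower[of n A Y] A0[OF n] Y by (simp add: mat_mone)
      have "?Y = (inv_mat ?A * ?A) * ?Y" using inv_mat(2)[OF A' d[OF n]] Y' by simp
      also have "\<dots> = inv_mat ?A * (?A * ?Y)" by (rule assoc_mult_mat[OF inv_mat_carrier[OF A'] A' Y'])
      also have "\<dots> = inv_mat ?A" unfolding AY by (rule right_mult_one_mat[OF inv_mat_carrier[OF A']])
      finally show "?Y = Matrix.mat n n X" by (simp add: matX[OF n])
    qed
  qed
  then show "corner_lower N (minv A)" "\<And>n. N \<le> n \<Longrightarrow> Matrix.mat n n (minv A) = inv_mat (Matrix.mat n n A)"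
    using cX matX by simp_all
qed

text \<open>The left factor of \<open>act\<close> is block lower triangular at all large cuts, and
  the corners of both factors are computed from the corner of \<open>z\<close>. So the action is
  compatible with corners, and the infinite problem becomes a family of finite ones.\<close>

lemma mat_act:
  assumes a: "adapted g n" and z: "z \<in> act_dom g"
  shows "Matrix.mat n n (act g z) = lfrac n (corner2 n g) (Matrix.mat n n z)"
proof -
  have low: "corner_lower n (denom g z)"
    unfolding corner_lower_def
  proof (intro allI impI)
    fix m i j assume "n \<le> m" "i < m" "m \<le> j"
    then show "denom g z (i, j) = 0"
      using denom_col_ge[OF a, of j z i] adaptedD(1)[OF adapted_mono[OF a], of m i j] by simp
  qed
  have d: "Determinant.det (Matrix.mat m m (denom g z)) \<noteq> 0" if "n \<le> m" for m
  proof -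
    have "abs_det g z = pnorm (Determinant.det (Matrix.mat m m (denom g z)))"
      by (simp add: abs_det_eq[OF adapted_mono[OF a that]] abs_lden_def mat_denom[OF adapted_mono[OF a that]])
    then show ?thesis using z by (auto simp: act_dom_def)
  qed
  note inv = minv_corner_lower[OF low d]
  have "Matrix.mat n n (act g z) = Matrix.mat n n (minv (denom g z)) * Matrix.mat n n (numer g z)"
    unfolding act_def by (rule mat_mmul_corner_lower) (use inv(1) in \<open>simp add: corner_lower_def\<close>)
  then show ?thesis
    using inv(2)[of n] by (simp add: lfrac_def mat_denom[OF a] mat_numer[OF a])
qed

subsection \<open>Corners of elements of the group\<close>

text \<open>What the measure theory uses of a group element; it passes to products, and for every
  element of \<open>GL_bar\<close> it holds at all large \<open>n\<close>.\<close>

definition GL_corner :: "'p::prime_card bmat \<Rightarrow> nat \<Rightarrow> bool" where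
  "GL_corner g n \<longleftrightarrow> adapted g n \<and> corner2 n g \<in> GL_int (n + n)"

lemma corner2_mmul:
  fixes g h :: "'p::prime_card bmat"
  assumes z: "\<And>i j k. i < n + n \<Longrightarrow> j < n + n \<Longrightarrow> k \<notin> index_emb n ` {..<n + n} \<Longrightarrow>
      g (index_emb n i, k) * h (k, index_emb n j) = 0"
  shows "corner2 n (g \<star> h) = corner2 n g * corner2 n h"
proof (rule eq_matI)
  fix i j assume "i < dim_row (corner2 n g * corner2 n h)" "j < dim_col (corner2 n g * corner2 n h)"
  then have ij: "i < n + n" "j < n + n" by (simp_all add: corner2_def)
  have inj: "inj_on (index_emb n) {..<n + n}" by (auto simp: inj_on_def index_emb_def split: if_splits)
  have "(g \<star> h) (index_emb n i, index_emb n j) = (\<Sum>k\<in>index_emb n ` {..<n + n}. g (index_emb n i, k) * h (k, index_emb n j))"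
    unfolding mmul_def prod.case using z[OF ij] by (intro Sum_any_eq_sum) auto
  also have "\<dots> = (\<Sum>k<n + n. corner2 n g $$ (i, k) * corner2 n h $$ (k, j))"
    unfolding sum.reindex[OF inj] using ij by (intro sum.cong) (auto simp: corner2_def)
  also have "\<dots> = (corner2 n g * corner2 n h) $$ (i, j)"
    by (rule mult_mat_entry[OF corner2_carrier corner2_carrier ij, symmetric])
  finally show "corner2 n (g \<star> h) $$ (i, j) = (corner2 n g * corner2 n h) $$ (i, j)"
    using ij by (simp add: corner2_def)
qed (simp_all add: corner2_def)

lemma index_emb_range: "index_emb n ` {..<n + n} = Inl ` {..<n} \<union> Inr ` {..<n}"
proof (rule Set.set_eqI)
  fix x :: "nat + nat"
  show "x \<in> index_emb n ` {..<n + n} \<longleftrightarrow> x \<in> Inl ` {..<n} \<union> Inr ` {..<n}"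
  proof (cases x)
    case (Inl i)
    then show ?thesis by (auto simp: index_emb_def image_iff split: if_splits)
  next
    case (Inr i)
    then show ?thesis by (auto simp: index_emb_def image_iff split: if_splits intro!: bexI[of _ "i + n"])
  qed
qed

text \<open>A middle index beyond the corner contributes nothing: if it lies in the first block, the
  entry of \<open>g\<close> vanishes, and if it lies in the second, that of \<open>h\<close>
  does.\<close>

lemma corner2_mmul_adapted:
  assumes g: "adapted g n" and h: "adapted h n"
  shows "corner2 n (g \<star> h) = corner2 n g * corner2 n h"
proof (rule corner2_mmul)
  fix i j k assume ij: "i < n + n" "j < n + n" and k: "k \<notin> index_emb n ` {..<n + n}"
  show "g (index_emb n i, k) * h (k, index_emb n j) = 0"
  proof (cases k)
    case (Inl l)
    then have l: "n \<le> l" using k by (auto simp: index_emb_range image_iff)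
    then have "g (index_emb n i, k) = 0"
      using adaptedD(1)[OF g _ l, of i] adaptedD(4)[OF g l, of "i - n"] Inl
      by (auto simp: index_emb_def block_a_def block_c_def)
    then show ?thesis by simp
  next
    case (Inr l)
    then have l: "n \<le> l" using k by (auto simp: index_emb_range image_iff)
    then have "h (k, index_emb n j) = 0"
      using adaptedD(3)[OF h l, of j] adaptedD(5)[OF h l, of "j - n"] Inr ij
      by (auto simp: index_emb_def block_d_def block_c_def)
    then show ?thesis by simp
  qed
qed

lemma mmul_eq_0: "(\<And>k. g (i, k) * h (k, j) = 0) \<Longrightarrow> (g \<star> h) (i, j) = 0"
  by (simp add: mmul_def)

lemma mmul_eq_single: "(\<And>k. k \<noteq> l \<Longrightarrow> g (i, k) * h (k, j) = 0) \<Longrightarrow> (g \<star> h) (i, j) = g (i, l) * h (l, j)"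
  unfolding mmul_def prod.case by (subst Sum_any_eq_sum[of "{l}"]) auto

text \<open>Each case splits the middle index by block and position, and in every range one of the
  two factors vanishes by triangularity. On the diagonal only the product of the two diagonal
  entries survives.\<close>

lemma adapted_mmul:
  assumes g: "adapted g n" and h: "adapted h n"
  shows "adapted (g \<star> h) n"
proof -
  note D = block_a_def block_b_def block_c_def block_d_def
  note ga = adaptedD[OF g, unfolded D prod.case] and ha = adaptedD[OF h, unfolded D prod.case]
  have A: "(g \<star> h) (Inl i, Inl j) = 0" if "n \<le> j" "i < j" for i j
  proof (rule mmul_eq_0)
    fix k show "g (Inl i, k) * h (k, Inl j) = 0"
    proof (cases k)
      case (Inl l)
      show ?thesis
      proof (cases "l < j")
        case True
        then have "h (Inl l, Inl j) = 0" using ha(1)[of l j] ha(2)[of l j] that by (cases "l < n") auto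
        then show ?thesis by (simp add: Inl)
      next
        case False
        then have "g (Inl i, Inl l) = 0" using ga(1)[of i l] ga(2)[of i l] that by (cases "i < n") auto
        then show ?thesis by (simp add: Inl)
      qed
    next
      case (Inr l)
      then show ?thesis using ha(4)[of j l] that by simp
    qed
  qed
  have C: "(g \<star> h) (Inr i, Inl j) = 0" if "n \<le> i \<or> n \<le> j" for i j
  proof (rule mmul_eq_0)
    fix k show "g (Inr i, k) * h (k, Inl j) = 0"
    proof (cases k)
      case (Inl l)
      then show ?thesis using that ga(3)[of i l] ga(4)[of l i] ha(1)[of l j] by (cases "l < n") auto
    next
      case (Inr l)
      then show ?thesis using that ha(3)[of l j] ha(4)[of j l] ga(5)[of i l] by (cases "l < n") auto
    qed
  qed
  have Dd: "(g \<star> h) (Inr i, Inr j) = 0" if "n \<le> i" "j < i" for i j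
  proof (rule mmul_eq_0)
    fix k show "g (Inr i, k) * h (k, Inr j) = 0"
    proof (cases k)
      case (Inl l)
      then show ?thesis using ga(3)[of i l] that by simp
    next
      case (Inr l)
      show ?thesis
      proof (cases "l < i")
        case True
        then have "g (Inr i, Inr l) = 0" using ga(5)[of i l] ga(6)[of l i] that by (cases "l < n") auto
        then show ?thesis by (simp add: Inr)
      next
        case False
        then have "h (Inr l, Inr j) = 0" using ha(5)[of l j] ha(6)[of j l] that by (cases "j < n") auto
        then show ?thesis by (simp add: Inr)
      qed
    qed
  qed
  have Ad: "pnorm ((g \<star> h) (Inl j, Inl j)) = 1" if j: "n \<le> j" for j
  proof -
    have "(g \<star> h) (Inl j, Inl j) = g (Inl j, Inl j) * h (Inl j, Inl j)"
    proof (rule mmul_eq_single)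
      fix k :: "nat + nat" assume k: "k \<noteq> Inl j"
      show "g (Inl j, k) * h (k, Inl j) = 0"
      proof (cases k)
        case (Inl l)
        show ?thesis
        proof (cases "l < j")
          case True
          then have "h (Inl l, Inl j) = 0" using ha(1)[of l j] ha(2)[of l j] j by (cases "l < n") auto
          then show ?thesis by (simp add: Inl)
        next
          case False
          then have "j < l" using k Inl by auto
          then have "g (Inl j, Inl l) = 0" using ga(2)[of j l] j by auto
          then show ?thesis by (simp add: Inl)
        qed
      next
        case (Inr l)
        then show ?thesis using ha(4)[of j l] j by simp
      qed
    qed
    then show ?thesis using ga(7)[OF j] ha(7)[OF j] by (simp add: pnorm_mult)
  qed
  have Dd1: "pnorm ((g \<star> h) (Inr j, Inr j)) = 1" if j: "n \<le> j" for j
  proof -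
    have "(g \<star> h) (Inr j, Inr j) = g (Inr j, Inr j) * h (Inr j, Inr j)"
    proof (rule mmul_eq_single)
      fix k :: "nat + nat" assume k: "k \<noteq> Inr j"
      show "g (Inr j, k) * h (k, Inr j) = 0"
      proof (cases k)
        case (Inl l)
        then show ?thesis using ga(3)[of j l] j by simp
      next
        case (Inr l)
        show ?thesis
        proof (cases "l < j")
          case True
          then have "g (Inr j, Inr l) = 0" using ga(5)[of j l] ga(6)[of l j] j by (cases "l < n") auto
          then show ?thesis by (simp add: Inr)
        next
          case False
          then have "j < l" using k Inr by auto
          then have "h (Inr l, Inr j) = 0" using ha(6)[of j l] j by auto
          then show ?thesis by (simp add: Inr)
        qed
      qed
    qed
    then show ?thesis using ga(8)[OF j] ha(8)[OF j] by (simp add: pnorm_mult)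
  qed
  show ?thesis
    unfolding adapted_def D prod.case
  proof (intro conjI allI impI)
    show "(g \<star> h) (Inl i, Inl j) = 0" if "i < n \<and> n \<le> j" for i j using that by (intro A) auto
    show "(g \<star> h) (Inl i, Inl j) = 0" if "n \<le> i \<and> i < j" for i j using that by (intro A) auto
    show "(g \<star> h) (Inr i, Inl j) = 0" if "n \<le> i \<or> n \<le> j" for i j using that by (rule C)
    show "(g \<star> h) (Inr i, Inr j) = 0" if "n \<le> i \<and> j < n" for i j using that by (intro Dd) auto
    show "(g \<star> h) (Inr i, Inr j) = 0" if "n \<le> j \<and> j < i" for i j using that by (intro Dd) auto
  qed (rule Ad, simp, rule Dd1, simp)
qed

lemma GL_corner_mmul: "GL_corner g n \<Longrightarrow> GL_corner h n \<Longrightarrow> GL_corner (g \<star> h) n"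
  by (simp add: GL_corner_def adapted_mmul corner2_mmul_adapted GL_int_mult)

lemma int_mat_corner2: "range g \<subseteq> padic_ints \<Longrightarrow> int_mat (corner2 n g)"
  by (subst int_mat_iff[OF corner2_carrier]) (auto simp: corner2_def)

text \<open>At every size the corner is block upper triangular with triangular diagonal blocks, so
  its determinant is a product of units.\<close>

lemma GL_corner_T_2inf:
  assumes g: "g \<in> T_2inf" shows "GL_corner g n"
proof -
  have r: "range g \<subseteq> padic_ints"
    and a0: "\<And>i j. i < j \<Longrightarrow> block_a g (i, j) = 0"
    and c0: "\<And>i j. block_c g (i, j) = 0"
    and d0: "\<And>i j. j < i \<Longrightarrow> block_d g (i, j) = 0"
    and u: "\<And>j. pnorm (block_a g (j, j)) = 1" "\<And>j. pnorm (block_d g (j, j)) = 1"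
    using g unfolding T_2inf_def by blast+
  have ad: "adapted g n" unfolding adapted_def using a0 c0 d0 u by auto
  let ?A = "Matrix.mat n n (block_a g)" and ?B = "Matrix.mat n n (block_b g)" and ?D = "Matrix.mat n n (block_d g)"
  have "corner2 n g = four_block_mat ?A ?B (0\<^sub>m n n) ?D"
  proof (rule eq_matI)
    fix i j assume "i < dim_row (four_block_mat ?A ?B (0\<^sub>m n n) ?D)" "j < dim_col (four_block_mat ?A ?B (0\<^sub>m n n) ?D)"
    then have ij: "i < n + n" "j < n + n" by simp_all
    then show "corner2 n g $$ (i, j) = four_block_mat ?A ?B (0\<^sub>m n n) ?D $$ (i, j)"
      using c0 by (auto simp: corner2_def index_emb_def block_a_def block_b_def block_c_def block_d_def)
  qed (simp_all add: corner2_def)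
  then have "Determinant.det (corner2 n g) = Determinant.det ?A * Determinant.det ?D"
    by (simp add: det_four_block_mat_lower_left_zero[of _ n _ n])
  also have "Determinant.det ?A = prod_list (diag_mat ?A)"
    by (rule det_lower_triangular[of n]) (use a0 in auto)
  also have "diag_mat ?A = map (\<lambda>i. block_a g (i, i)) [0..<n]" by (auto simp: diag_mat_def)
  also have "prod_list \<dots> = (\<Prod>i<n. block_a g (i, i))"
    by (simp add: prod.distinct_set_conv_list[symmetric] lessThan_atLeast0)
  also have "Determinant.det ?D = prod_list (diag_mat ?D)"
    by (rule det_upper_triangular[of _ n]) (use d0 in \<open>auto simp: upper_triangular_def\<close>)
  also have "diag_mat ?D = map (\<lambda>i. block_d g (i, i)) [0..<n]" by (auto simp: diag_mat_def)
  also have "prod_list \<dots> = (\<Prod>i<n. block_d g (i, i))"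
    by (simp add: prod.distinct_set_conv_list[symmetric] lessThan_atLeast0)
  finally have "pnorm (Determinant.det (corner2 n g)) = 1" by (simp add: pnorm_mult pnorm_prod u)
  then show ?thesis using ad int_mat_corner2[OF r] by (simp add: GL_corner_def GL_int_iff)
qed

lemma corner2_mone: "corner2 n (mone :: (nat + nat) \<times> (nat + nat) \<Rightarrow> 'p::prime_card padic) = 1\<^sub>m (n + n)"
  by (rule eq_matI) (auto simp: corner2_def mone_def index_emb_def split: if_splits)

text \<open>Beyond \<open>N\<close> the matrix \<open>g\<close> agrees with the identity. For the
  inverse \<open>h\<close> only integrality is at hand, so the multiplicativity of corners is
  derived from \<open>g\<close> alone; then the corner of \<open>h\<close> inverts that of
  \<open>g\<close>.\<close>

lemma GL_corner_GL_2inf: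
  assumes g: "g \<in> GL_2inf" shows "\<exists>N. \<forall>n\<ge>N. GL_corner g n"
proof -
  obtain h where r: "range g \<subseteq> padic_ints" and fin: "finite {ij. g ij \<noteq> mone ij}"
    and h: "range h \<subseteq> padic_ints" "g \<star> h = mone"
    using g unfolding GL_2inf_def by blast
  define size :: "nat + nat \<Rightarrow> nat" where "size = case_sum (\<lambda>i. i) (\<lambda>i. i)"
  define N where "N = Suc (Max (insert 0 ((\<lambda>(i, j). size i + size j) ` {ij. g ij \<noteq> mone ij})))"
  have out: "g (i, j) = mone (i, j)" if "n \<ge> N" "size i \<ge> n \<or> size j \<ge> n" for i j n
  proof (rule ccontr)
    assume "g (i, j) \<noteq> mone (i, j)"
    then have "size i + size j \<in> (\<lambda>(i, j). size i + size j) ` {ij. g ij \<noteq> mone ij}"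
      by (intro image_eqI[of _ _ "(i, j)"]) auto
    then have "size i + size j < N" unfolding N_def using fin by (simp add: less_Suc_eq_le)
    then show False using that by simp
  qed
  have "GL_corner g n" if n: "n \<ge> N" for n
  proof -
    have ga: "g (Inl i, Inl j) = mone (Inl i :: nat + nat, Inl j)" "g (Inl i, Inr j) = mone (Inl i, Inr j)"
      "g (Inr i, Inl j) = mone (Inr i, Inl j)" "g (Inr i, Inr j) = mone (Inr i :: nat + nat, Inr j)" if "n \<le> i \<or> n \<le> j" for i j
    proof -
      have *: "n \<le> size (Inl i) \<or> n \<le> size (Inl j)" "n \<le> size (Inl i) \<or> n \<le> size (Inr j)"
        "n \<le> size (Inr i) \<or> n \<le> size (Inl j)" "n \<le> size (Inr i) \<or> n \<le> size (Inr j)"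
        using that by (simp_all add: size_def)
      show "g (Inl i, Inl j) = mone (Inl i :: nat + nat, Inl j)" by (rule out[OF n *(1)])
      show "g (Inl i, Inr j) = mone (Inl i, Inr j)" by (rule out[OF n *(2)])
      show "g (Inr i, Inl j) = mone (Inr i, Inl j)" by (rule out[OF n *(3)])
      show "g (Inr i, Inr j) = mone (Inr i :: nat + nat, Inr j)" by (rule out[OF n *(4)])
    qed
    have ad: "adapted g n"
      unfolding adapted_def block_a_def block_b_def block_c_def block_d_def prod.case
      using ga by (auto simp: mone_def)
    have "corner2 n (g \<star> h) = corner2 n g * corner2 n h"
    proof (rule corner2_mmul)
      fix i j k assume ij: "i < n + n" and k: "k \<notin> index_emb n ` {..<n + n}"
      have "size k \<ge> n" using k by (cases k) (auto simp: index_emb_range size_def image_iff)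
      then have "g (index_emb n i, k) = mone (index_emb n i, k)" by (intro out[OF n]) simp
      also have "\<dots> = 0" using k ij by (auto simp: mone_def)
      finally show "g (index_emb n i, k) * h (k, index_emb n j) = 0" by simp
    qed
    then have gh: "corner2 n g * corner2 n h = 1\<^sub>m (n + n)" by (simp add: h(2) corner2_mone)
    then have hg: "corner2 n h * corner2 n g = 1\<^sub>m (n + n)"
      by (rule mat_mult_left_right_inverse[OF corner2_carrier corner2_carrier])
    have "corner2 n g \<in> GL_int (n + n)"
      unfolding GL_int_def
      using gh hg int_mat_corner2[OF r, of n, unfolded int_mat_def] int_mat_corner2[OF h(1), of n, unfolded int_mat_def]
      by (intro CollectI conjI bexI[of _ "corner2 n h"]) simp_all
    then show ?thesis using ad by (simp add: GL_corner_def)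
  qed
  then show ?thesis by blast
qed

lemma GL_bar_GL_corner:
  assumes "g \<in> GL_bar" shows "\<exists>N>0. \<forall>n\<ge>N. GL_corner g n"
proof -
  have "\<exists>N. \<forall>n\<ge>N. GL_corner g n"
    using assms
  proof (induction rule: GL_bar.induct)
    case (GL_2inf g)
    then show ?case by (rule GL_corner_GL_2inf)
  next
    case (T_2inf g)
    then show ?case using GL_corner_T_2inf by blast
  next
    case (mult g h)
    then obtain N N' where "\<forall>n\<ge>N. GL_corner g n" "\<forall>n\<ge>N'. GL_corner h n" by blast
    then show ?case by (intro exI[of _ "max N N'"]) (simp add: GL_corner_mmul)
  qed
  then obtain N where "\<forall>n\<ge>N. GL_corner g n" by blast
  then show ?thesis by (intro exI[of _ "Suc N"]) simp
qed

lemma mone_T_2inf: "(mone :: (nat + nat) \<times> (nat + nat) \<Rightarrow> 'p::prime_card padic) \<in> T_2inf"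
  by (auto simp: T_2inf_def mone_def block_a_def block_c_def block_d_def)

subsection \<open>The inverse transformation\<close>

text \<open>For \<open>w = (a + z c)\<inverse> (b + z d)\<close> one has \<open>z (d - c w) = a w - b\<close>, so that the image of the transformation is
  described by the matrix \<open>d - c w\<close>.\<close>

definition codenom :: "nat \<Rightarrow> 'a::field Matrix.mat \<Rightarrow> 'a Matrix.mat \<Rightarrow> 'a Matrix.mat" where
  "codenom n G W = Matrix.mat n n (\<lambda>(i, j). G $$ (i + n, j + n) - (\<Sum>k<n. G $$ (i + n, k) * W $$ (k, j)))"

lemma codenom_carrier [simp]: "codenom n G W \<in> carrier_mat n n"
  by (simp add: codenom_def)

lemma lden_index:
  assumes "Z \<in> carrier_mat n n" "G \<in> carrier_mat (n + n) (n + n)" "i < n" "j < n"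
  shows "lden n G Z $$ (i, j) = G $$ (i, j) + (\<Sum>k<n. Z $$ (i, k) * G $$ (k + n, j))"
    and "lnum n G Z $$ (i, j) = G $$ (i, j + n) + (\<Sum>k<n. Z $$ (i, k) * G $$ (k + n, j + n))"
  using assms hcat_one_mult_entry[OF assms(1,2,3), of j] hcat_one_mult_entry[OF assms(1,2,3), of "j + n"]
  by (simp_all add: lden_def lhalf_def lnum_def rhalf_def)

text \<open>Multiplying \<open>G\<close> by the unipotent matrices with off-diagonal blocks
  \<open>Z\<close> on the left and \<open>- W\<close> on the right clears the upper right block, by
  the relation between \<open>Z\<close> and \<open>W\<close>, and leaves \<open>lden\<close> and
  \<open>codenom\<close> on the diagonal. So for invertible \<open>G\<close> both are
  nonsingular.\<close>

lemma det_eq_lden_codenom: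
  fixes G :: "'a::field Matrix.mat"
  assumes G: "G \<in> carrier_mat (n + n) (n + n)" and Z: "Z \<in> carrier_mat n n" and W: "W \<in> carrier_mat n n"
    and eq: "lden n G Z * W = lnum n G Z"
  shows "Determinant.det G = Determinant.det (lden n G Z) * Determinant.det (codenom n G W)"
proof -
  let ?A = "Matrix.mat n n (\<lambda>(i, j). G $$ (i, j))" and ?B = "Matrix.mat n n (\<lambda>(i, j). G $$ (i, j + n))"
    and ?C = "Matrix.mat n n (\<lambda>(i, j). G $$ (i + n, j))" and ?D = "Matrix.mat n n (\<lambda>(i, j). G $$ (i + n, j + n))"
  let ?I = "1\<^sub>m n :: 'a Matrix.mat" and ?O = "0\<^sub>m n n :: 'a Matrix.mat"
  let ?P = "lden n G Z" and ?Q = "lnum n G Z"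
  have c: "?A \<in> carrier_mat n n" "?B \<in> carrier_mat n n" "?C \<in> carrier_mat n n" "?D \<in> carrier_mat n n"
    "?I \<in> carrier_mat n n" "?O \<in> carrier_mat n n" "- W \<in> carrier_mat n n" using W by simp_all
  have Gb: "G = four_block_mat ?A ?B ?C ?D"
    by (rule eq_matI) (use G in \<open>auto simp: not_less\<close>)
  let ?U = "four_block_mat ?I Z ?O ?I" and ?V = "four_block_mat ?I (- W) ?O ?I"
  have P: "?I * ?A + Z * ?C = ?P"
  proof (rule eq_matI)
    fix i j assume "i < dim_row ?P" "j < dim_col ?P"
    then have ij: "i < n" "j < n" by (simp_all add: lden_def lhalf_def)
    show "(?I * ?A + Z * ?C) $$ (i, j) = ?P $$ (i, j)"
      using ij Z mult_mat_entry[OF Z c(3) ij] by (simp add: lden_index[OF Z G ij])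
  qed (use Z in \<open>simp_all add: lden_def lhalf_def\<close>)
  have Q: "?I * ?B + Z * ?D = ?Q"
  proof (rule eq_matI)
    fix i j assume "i < dim_row ?Q" "j < dim_col ?Q"
    then have ij: "i < n" "j < n" by (simp_all add: lnum_def rhalf_def)
    show "(?I * ?B + Z * ?D) $$ (i, j) = ?Q $$ (i, j)"
      using ij Z mult_mat_entry[OF Z c(4) ij] by (simp add: lden_index[OF Z G ij])
  qed (use Z in \<open>simp_all add: lnum_def rhalf_def\<close>)
  have "?U * four_block_mat ?A ?B ?C ?D = four_block_mat ?P ?Q ?C ?D"
  proof -
    have "?O * ?A + ?I * ?C = ?C" "?O * ?B + ?I * ?D = ?D" using c by simp_all
    then show ?thesis unfolding mult_four_block_mat[OF c(5) Z c(6) c(5) c(1-4)] P Q by (simp only:)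
  qed
  from this[folded Gb] have UG: "?U * G = four_block_mat ?P ?Q ?C ?D" .
  have B1: "?P * (- W) + ?Q * ?I = ?O"
  proof -
    have "?P * (- W) = - (?P * W)"
      by (rule uminus_mult_right_mat) (use carrier_matD[OF lden_carrier[of n G Z]] carrier_matD[OF W] in simp)
    then show ?thesis by (simp add: eq right_mult_one_mat[OF lnum_carrier] uminus_l_inv_mat[OF lnum_carrier])
  qed
  have B2: "?C * (- W) + ?D * ?I = codenom n G W"
  proof (rule eq_matI)
    fix i j assume "i < dim_row (codenom n G W)" "j < dim_col (codenom n G W)"
    then have ij: "i < n" "j < n" by (simp_all add: codenom_def)
    show "(?C * (- W) + ?D * ?I) $$ (i, j) = codenom n G W $$ (i, j)"
      using ij W mult_mat_entry[OF c(3) W ij] c by (simp add: codenom_def)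
  qed (use W in \<open>simp_all add: codenom_def\<close>)
  have B3: "?P * ?I + ?Q * ?O = ?P" "?C * ?I + ?D * ?O = ?C"
    using c by (simp_all add: right_mult_one_mat[OF lden_carrier] right_mult_zero_mat[OF lnum_carrier] right_add_zero_mat[OF lden_carrier])
  have UGV: "?U * G * ?V = four_block_mat ?P ?O ?C (codenom n G W)"
    unfolding UG mult_four_block_mat[OF lden_carrier lnum_carrier c(3,4) c(5,7,6,5)] B1 B2 B3 ..
  have Uc: "?U \<in> carrier_mat (n + n) (n + n)" and Vc: "?V \<in> carrier_mat (n + n) (n + n)" using Z W by auto
  have dU: "Determinant.det ?U = 1" "Determinant.det ?V = 1"
    using Z W by (simp_all add: det_four_block_mat_lower_left_zero[of _ n _ n])
  have "Determinant.det (?U * G * ?V) = Determinant.det G"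
    using dU by (simp add: det_mult[OF mult_carrier_mat[OF Uc G] Vc] det_mult[OF Uc G])
  moreover have "Determinant.det (four_block_mat ?P ?O ?C (codenom n G W)) = Determinant.det ?P * Determinant.det (codenom n G W)"
    by (rule det_four_block_mat_upper_right_zero[OF lden_carrier refl c(3) codenom_carrier])
  ultimately show ?thesis by (simp add: UGV)
qed

text \<open>Solving \<open>Z (d - c W) = a W - b\<close>, whose right side is \<open>R\<close>,
  gives the candidate for a preimage of \<open>W\<close>; the determinant identity then shows that
  its denominator is nonsingular.\<close>

lemma codenom_solve:
  fixes G :: "'a::field Matrix.mat"
  assumes G: "G \<in> carrier_mat (n + n) (n + n)" "Determinant.det G \<noteq> 0" and W: "W \<in> carrier_mat n n"
    and d: "Determinant.det (codenom n G W) \<noteq> 0"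
  shows "\<exists>Z\<in>carrier_mat n n. Determinant.det (lden n G Z) \<noteq> 0 \<and> lfrac n G Z = W"
proof -
  let ?K = "codenom n G W"
  define R where "R = Matrix.mat n n (\<lambda>(i, j). (\<Sum>k<n. G $$ (i, k) * W $$ (k, j)) - G $$ (i, j + n))"
  define Z where "Z = R * inv_mat ?K"
  have R: "R \<in> carrier_mat n n" by (simp add: R_def)
  have Z: "Z \<in> carrier_mat n n" unfolding Z_def by (rule mult_carrier_mat[OF R inv_mat_carrier[OF codenom_carrier]])
  have ZK: "Z * ?K = R"
    unfolding Z_def using inv_mat(2)[OF codenom_carrier d]
    by (simp add: assoc_mult_mat[OF R inv_mat_carrier[OF codenom_carrier] codenom_carrier] right_mult_one_mat[OF R])
  have eq: "lden n G Z * W = lnum n G Z"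
  proof (rule eq_matI)
    fix i j assume "i < dim_row (lnum n G Z)" "j < dim_col (lnum n G Z)"
    then have ij: "i < n" "j < n" by (simp_all add: lnum_def rhalf_def)
    have "(\<Sum>l<n. Z $$ (i, l) * ?K $$ (l, j)) = R $$ (i, j)"
      using mult_mat_entry[OF Z codenom_carrier ij, of G W] by (simp add: ZK)
    moreover have "(\<Sum>l<n. Z $$ (i, l) * ?K $$ (l, j))
      = (\<Sum>l<n. Z $$ (i, l) * G $$ (l + n, j + n)) - (\<Sum>l<n. \<Sum>k<n. Z $$ (i, l) * G $$ (l + n, k) * W $$ (k, j))"
      using ij by (simp add: codenom_def right_diff_distrib sum_subtractf sum_distrib_left mult.assoc)
    ultimately have e: "(\<Sum>l<n. Z $$ (i, l) * G $$ (l + n, j + n))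
      = R $$ (i, j) + (\<Sum>l<n. \<Sum>k<n. Z $$ (i, l) * G $$ (l + n, k) * W $$ (k, j))"
      by (simp add: algebra_simps)
    have "(lden n G Z * W) $$ (i, j) = (\<Sum>k<n. lden n G Z $$ (i, k) * W $$ (k, j))"
      by (rule mult_mat_entry[OF lden_carrier W ij])
    also have "\<dots> = (\<Sum>k<n. G $$ (i, k) * W $$ (k, j)) + (\<Sum>k<n. \<Sum>l<n. Z $$ (i, l) * G $$ (l + n, k) * W $$ (k, j))"
      using ij by (simp add: lden_index(1)[OF Z G(1)] distrib_right sum.distrib sum_distrib_right)
    also have "(\<Sum>k<n. \<Sum>l<n. Z $$ (i, l) * G $$ (l + n, k) * W $$ (k, j)) = (\<Sum>l<n. \<Sum>k<n. Z $$ (i, l) * G $$ (l + n, k) * W $$ (k, j))"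
      by (rule sum.swap)
    also have "(\<Sum>k<n. G $$ (i, k) * W $$ (k, j)) = R $$ (i, j) + G $$ (i, j + n)" using ij by (simp add: R_def)
    finally show "(lden n G Z * W) $$ (i, j) = lnum n G Z $$ (i, j)"
      by (simp add: lden_index(2)[OF Z G(1) ij] e algebra_simps)
  qed (use W in \<open>simp_all add: lnum_def rhalf_def lden_def lhalf_def\<close>)
  have nz: "Determinant.det (lden n G Z) \<noteq> 0" using det_eq_lden_codenom[OF G(1) Z W eq] G(2) by auto
  have "hcat n (1\<^sub>m n) Z * G = lden n G Z * hcat n (1\<^sub>m n) W"
    using W eq by (simp add: hcat_den_num[OF G(1)] mult_hcat right_mult_one_mat[OF lden_carrier])
  from lfrac_eqI(3)[OF G(1) lden_carrier W this nz] nz Z show ?thesis by blast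
qed

section \<open>An infinite matrix whose corners are eventually invertible over the integers\<close>

locale eventually_GL_corner =
  fixes g :: "'p::prime_card bmat" and N :: nat
  assumes N_pos: "N > 0" and GL_corner: "\<And>n. N \<le> n \<Longrightarrow> GL_corner g n"
begin

abbreviation G :: "nat \<Rightarrow> 'p padic Matrix.mat" where "G n \<equiv> corner2 n g"

lemma adapted: "N \<le> n \<Longrightarrow> adapted g n" and G_GL: "N \<le> n \<Longrightarrow> G n \<in> GL_int (n + n)"
  using GL_corner by (auto simp: GL_corner_def)

lemma G_det: "N \<le> n \<Longrightarrow> Determinant.det (G n) \<noteq> 0"
  using G_GL GL_int_det_nonzero by blast

lemma act_dom_iff: "N \<le> n \<Longrightarrow> z \<in> act_dom g \<longleftrightarrow> Determinant.det (lden n (G n) (Matrix.mat n n z)) \<noteq> 0"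
  by (simp add: act_dom_def abs_det_eq[OF adapted] abs_lden_def pnorm_eq_0_iff)

lemma mat_act': "N \<le> n \<Longrightarrow> z \<in> act_dom g \<Longrightarrow> Matrix.mat n n (act g z) = lfrac n (G n) (Matrix.mat n n z)"
  by (rule mat_act[OF adapted])

text \<open>Defined through one corner only and hence visibly measurable; it is the exact image of
  \<open>act g\<close> by \<open>act_in_act_image\<close> and \<open>act_inv_act\<close>.\<close>

definition act_image :: "'p mfun set" where
  "act_image = {w. Determinant.det (codenom N (G N) (Matrix.mat N N w)) \<noteq> 0}"

text \<open>Past \<open>N\<close> the rows of \<open>d - c w\<close> are those of \<open>d\<close>,
  with zeros to the left of a diagonal entry of norm 1, so the determinant changes by a unit
  whenever the corner grows.\<close>

lemma act_image_iff:
  assumes n: "N \<le> n"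
  shows "w \<in> act_image \<longleftrightarrow> Determinant.det (codenom n (G n) (Matrix.mat n n w)) \<noteq> 0"
proof -
  \<comment> \<open>The columns of \<open>c\<close> past \<open>N\<close> vanish, so a sum of fixed
    length computes \<open>c w\<close>, and all the matrices in question are corners of one infinite
    matrix.\<close>
  define F where "F = (\<lambda>(i, j). block_d g (i, j) - (\<Sum>k<N. block_c g (i, k) * w (k, j)))"
  have F: "codenom n (G n) (Matrix.mat n n w) = Matrix.mat n n F" if n: "N \<le> n" for n
  proof (rule eq_matI)
    fix i j assume "i < dim_row (Matrix.mat n n F)" "j < dim_col (Matrix.mat n n F)"
    then have ij: "i < n" "j < n" by simp_all
    have "(\<Sum>k<n. block_c g (i, k) * w (k, j)) = (\<Sum>k<N. block_c g (i, k) * w (k, j))"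
      using n adaptedD(4)[OF adapted[OF order_refl], of _ i] by (intro sum.mono_neutral_right) auto
    moreover have "G n $$ (i + n, k) = block_c g (i, k)" if "k < n" for k
      by (rule corner2_index(3)[OF ij(1) that])
    ultimately show "codenom n (G n) (Matrix.mat n n w) $$ (i, j) = Matrix.mat n n F $$ (i, j)"
      using ij by (simp add: codenom_def F_def corner2_index(4))
  qed (simp_all add: codenom_def)
  have "pnorm (Determinant.det (Matrix.mat n n F)) = pnorm (Determinant.det (Matrix.mat N N F))"
    using n
  proof (induction n rule: dec_induct)
    case (step n)
    have "pnorm (Determinant.det (Matrix.mat (Suc n) (Suc n) F)) = pnorm (Determinant.det (Matrix.mat n n F))"
    proof (rule pnorm_det_Suc_row)
      have c: "block_c g (n, k) = 0" for k by (rule adaptedD(3)[OF adapted[OF order_refl] step(1)])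
      show "F (n, j) = 0" if "j < n" for j
        using adaptedD(5)[OF adapted[OF step(1)] order_refl that] by (simp add: F_def c)
      show "pnorm (F (n, n)) = 1"
        using adaptedD(8)[OF adapted[OF step(1)] order_refl] by (simp add: F_def c)
    qed
    then show ?case using step by simp
  qed simp
  then show ?thesis
    by (simp add: act_image_def F[OF n] F[OF order_refl]) (metis pnorm_eq_0_iff)
qed

lemma act_in_act_image:
  assumes z: "z \<in> act_dom g" shows "act g z \<in> act_image"
proof -
  have d: "Determinant.det (lden N (G N) (Matrix.mat N N z)) \<noteq> 0" using act_dom_iff[OF order_refl] z by simp
  have "Determinant.det (G N) = Determinant.det (lden N (G N) (Matrix.mat N N z)) * Determinant.det (codenom N (G N) (Matrix.mat N N (act g z)))"
    using d by (intro det_eq_lden_codenom) (simp_all add: mat_act'[OF order_refl z] lden_times_lfrac)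
  then show ?thesis using G_det[OF order_refl] by (auto simp: act_image_def)
qed

lemma act_inj: "inj_on (act g) (act_dom g)"
proof (rule inj_onI)
  fix z z' assume z: "z \<in> act_dom g" "z' \<in> act_dom g" and eq: "act g z = act g z'"
  show "z = z'"
  proof (rule mat_eqI_corners[of N])
    fix n assume n: "N \<le> n"
    show "Matrix.mat n n z = Matrix.mat n n z'"
    proof (rule lfrac_inj[OF corner2_carrier G_det[OF n] mat_carrier mat_carrier])
      show "Determinant.det (lden n (G n) (Matrix.mat n n z)) \<noteq> 0" using z(1) act_dom_iff[OF n] by blast
      show "Determinant.det (lden n (G n) (Matrix.mat n n z')) \<noteq> 0" using z(2) act_dom_iff[OF n] by blast
      show "lfrac n (G n) (Matrix.mat n n z) = lfrac n (G n) (Matrix.mat n n z')"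
        by (simp only: mat_act'[OF n z(1), symmetric] mat_act'[OF n z(2), symmetric] eq)
    qed
  qed
qed

text \<open>Each entry is computed from one finite corner, so the map is measurable on the whole
  space. For the corners of \<open>g\<close> it agrees with \<open>act g\<close> on the domain; for
  their inverses it gives the inverse transformation on the image.\<close>

definition glue :: "(nat \<Rightarrow> 'p padic Matrix.mat) \<Rightarrow> 'p mfun \<Rightarrow> 'p mfun" where
  "glue H z = (\<lambda>(i, j). lin_frac (Suc (N + i + j)) (H (Suc (N + i + j))) (restrict z (ix (Suc (N + i + j)))) (i, j))"

lemma glue_act:
  assumes z: "z \<in> act_dom g" shows "glue G z = act g z"
proof
  fix ij :: "nat \<times> nat" obtain i j where ij: "ij = (i, j)" by (cases ij)
  let ?n = "Suc (N + i + j)"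
  have r: "Matrix.mat ?n ?n (restrict z (ix ?n)) = Matrix.mat ?n ?n z" by (rule eq_matI) auto
  have "glue G z ij = Matrix.mat ?n ?n (act g z) $$ (i, j)"
    by (simp add: glue_def ij lin_frac_def fun_of_def r mat_act'[OF _ z] del: index_mat)
  then show "glue G z ij = act g z ij" by (simp add: ij)
qed

definition inv_act :: "'p mfun \<Rightarrow> 'p mfun" where
  "inv_act = glue (\<lambda>n. inv_mat (G n))"

text \<open>The inverses of the corners of \<open>g\<close> are not given as corners of a group
  element, so their compatibility has to be proved. It follows from the existence of preimages at
  every size and injectivity at the smaller one.\<close>

lemma inv_act_corner:
  assumes w: "w \<in> act_image" and n: "N \<le> n"
  shows "Matrix.mat n n (inv_act w) = lfrac n (inv_mat (G n)) (Matrix.mat n n w)"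
    and "Determinant.det (lden n (G n) (lfrac n (inv_mat (G n)) (Matrix.mat n n w))) \<noteq> 0"
    and "lfrac n (G n) (lfrac n (inv_mat (G n)) (Matrix.mat n n w)) = Matrix.mat n n w"
proof -
  let ?Z = "\<lambda>n. lfrac n (inv_mat (G n)) (Matrix.mat n n w)"
  have sol: "Determinant.det (lden n (G n) (?Z n)) \<noteq> 0 \<and> lfrac n (G n) (?Z n) = Matrix.mat n n w" if n: "N \<le> n" for n
  proof -
    obtain Z where Z: "Z \<in> carrier_mat n n" "Determinant.det (lden n (G n) Z) \<noteq> 0" "lfrac n (G n) Z = Matrix.mat n n w"
      using codenom_solve[OF corner2_carrier G_det[OF n], of "Matrix.mat n n w"] act_image_iff[OF n] w by auto
    have "?Z n = Z" using lfrac_inv_mat[OF corner2_carrier G_det[OF n] Z(1,2)] Z(3) by simp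
    then show ?thesis using Z by simp
  qed
  have compat: "?Z n $$ (i, j) = ?Z m $$ (i, j)" if nm: "N \<le> n" "n \<le> m" and ij: "i < n" "j < n" for n m i j
  proof -
    \<comment> \<open>The solution of size \<open>m\<close> is regarded as an infinite matrix, whose
      entries outside that corner are immaterial. Its image has the same n-corner as
      \<open>w\<close>, and injectivity at size \<open>n\<close> identifies its n-corner with the
      solution of size \<open>n\<close>.\<close>
    define z where "z = (\<lambda>(i, j). ?Z m $$ (i, j))"
    have m: "N \<le> m" using nm by simp
    have zm: "Matrix.mat m m z = ?Z m" by (rule eq_matI) (use carrier_matD[OF lfrac_carrier[of m "inv_mat (G m)" "Matrix.mat m m w"]] in \<open>auto simp: z_def\<close>)
    have zd: "z \<in> act_dom g" using sol[OF m] by (simp add: act_dom_iff[OF m] zm)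
    have "Matrix.mat m m (act g z) = Matrix.mat m m w" using sol[OF m] by (simp add: mat_act'[OF m zd] zm)
    then have "Matrix.mat m m (act g z) $$ (i, j) = Matrix.mat m m w $$ (i, j)" if "i < n" "j < n" for i j by simp
    then have "Matrix.mat n n (act g z) = Matrix.mat n n w" using nm by (intro eq_matI) auto
    then have "lfrac n (G n) (Matrix.mat n n z) = lfrac n (G n) (?Z n)" using sol[OF nm(1)] by (simp add: mat_act'[OF nm(1) zd])
    with sol[OF nm(1)] zd have "Matrix.mat n n z = ?Z n"
      unfolding act_dom_iff[OF nm(1)]
      by (intro lfrac_inj[OF corner2_carrier G_det[OF nm(1)] mat_carrier lfrac_carrier]) blast+
    then have "?Z n $$ (i, j) = Matrix.mat n n z $$ (i, j)" by simp
    then show ?thesis using ij by (simp add: z_def)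
  qed
  show "Matrix.mat n n (inv_act w) = ?Z n"
  proof (rule eq_matI)
    fix i j assume "i < dim_row (?Z n)" "j < dim_col (?Z n)"
    then have ij: "i < n" "j < n" using carrier_matD[OF lfrac_carrier[of n "inv_mat (G n)" "Matrix.mat n n w"]] by simp_all
    let ?k = "Suc (N + i + j)"
    have r: "Matrix.mat ?k ?k (restrict w (ix ?k)) = Matrix.mat ?k ?k w" by (rule eq_matI) auto
    have "inv_act w (i, j) = ?Z ?k $$ (i, j)"
      by (simp add: inv_act_def glue_def lin_frac_def fun_of_def r)
    also have "\<dots> = ?Z n $$ (i, j)"
    proof (cases "n \<le> ?k")
      case True
      show ?thesis by (rule compat[OF n True ij, symmetric])
    next
      case False
      show ?thesis by (rule compat) (use False in auto)
    qed
    finally show "Matrix.mat n n (inv_act w) $$ (i, j) = ?Z n $$ (i, j)" using ij by simp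
  qed (use carrier_matD[OF lfrac_carrier[of n "inv_mat (G n)" "Matrix.mat n n w"]] in simp_all)
  show "Determinant.det (lden n (G n) (?Z n)) \<noteq> 0" "lfrac n (G n) (?Z n) = Matrix.mat n n w"
    using sol[OF n] by auto
qed

lemma inv_act_dom: "w \<in> act_image \<Longrightarrow> inv_act w \<in> act_dom g"
  using inv_act_corner[OF _ order_refl] by (simp add: act_dom_iff[OF order_refl])

lemma act_inv_act:
  assumes w: "w \<in> act_image" shows "act g (inv_act w) = w"
proof (rule mat_eqI_corners[of N])
  fix n assume n: "N \<le> n"
  show "Matrix.mat n n (act g (inv_act w)) = Matrix.mat n n w"
    using inv_act_corner[OF w n] by (simp add: mat_act'[OF n inv_act_dom[OF w]])
qed

lemma inv_act_act:
  assumes z: "z \<in> act_dom g" shows "inv_act (act g z) = z"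
  using act_in_act_image[OF z] act_inj z by (metis act_inv_act inj_onD inv_act_dom)

text \<open>Writes an image as a preimage under the everywhere defined measurable map
  \<open>inv_act\<close>, from which the measurability of images follows.\<close>

lemma image_act: "B \<subseteq> act_dom g \<Longrightarrow> act g ` B = {w \<in> act_image. inv_act w \<in> B}"
  using act_in_act_image inv_act_act act_inv_act by (auto simp: image_iff subset_iff) metis+

end

subsection \<open>Quasiinvariance of the measure on infinite matrices\<close>

lemma mat_restrict [simp]: "Matrix.mat n n (restrict z (ix n)) = Matrix.mat n n z"
  by (rule eq_matI) auto

lemma lin_frac_restrict [simp]: "lin_frac n H (restrict z (ix n)) = lin_frac n H z"
  and abs_lden_restrict [simp]: "abs_lden n H (restrict z (ix n)) = abs_lden n H z"
  by (simp_all add: lin_frac_def abs_lden_def)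

lemma restrict_inf_measurable [measurable]: "(\<lambda>z. restrict z (ix n)) \<in> inf_mat_space \<rightarrow>\<^sub>M mat_space n"
  unfolding inf_mat_space_def mat_space_def by (rule measurable_restrict_subset) simp

lemma space_inf_mat_space [simp]: "space inf_mat_space = UNIV"
  by (simp add: inf_mat_space_def space_PiM)

lemma is_mu_infD:
  assumes "is_mu_inf s M"
  shows "prob_space M" "sets M = sets inf_mat_space" "space M = UNIV"
    "distr M (mat_space n) (\<lambda>z. restrict z (ix n)) = mu n s"
    "(\<lambda>z. restrict z (ix n)) \<in> M \<rightarrow>\<^sub>M mat_space n"
proof -
  show "prob_space M" and s: "sets M = sets inf_mat_space" and "distr M (mat_space n) (\<lambda>z. restrict z (ix n)) = mu n s"
    using assms by (auto simp: is_mu_inf_def)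
  show "space M = UNIV" using sets_eq_imp_space_eq[OF s] by simp
  show "(\<lambda>z. restrict z (ix n)) \<in> M \<rightarrow>\<^sub>M mat_space n"
    unfolding measurable_cong_sets[OF s refl] by (rule restrict_inf_measurable)
qed

lemma prob_space_mu:
  fixes M :: "'p::prime_card mfun measure"
  assumes M: "is_mu_inf s M" shows "prob_space (mu n s :: 'p mfun measure)"
  using prob_space.prob_space_distr[OF is_mu_infD(1)[OF M] is_mu_infD(5)[OF M, of n]]
  by (simp add: is_mu_infD(4)[OF M])

lemma nn_integral_mu:
  assumes M: "is_mu_inf s M" and f: "f \<in> borel_measurable (mat_space n)"
  shows "(\<integral>\<^sup>+ z. f z \<partial>mu n s) = (\<integral>\<^sup>+ z. f (restrict z (ix n)) \<partial>M)"
proof -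
  have "(\<integral>\<^sup>+ z. f z \<partial>distr M (mat_space n) (\<lambda>z. restrict z (ix n))) = (\<integral>\<^sup>+ z. f (restrict z (ix n)) \<partial>M)"
    by (rule nn_integral_distr[OF is_mu_infD(5)[OF M]]) (use f in simp)
  then show ?thesis by (simp add: is_mu_infD(4)[OF M])
qed

lemma AE_mu:
  fixes M :: "'p::prime_card mfun measure" and P :: "'p mfun \<Rightarrow> bool"
  assumes M: "is_mu_inf s M" and AE: "AE z in mu n s. P z" shows "AE z in M. P (restrict z (ix n))"
proof (rule AE_distrD[OF is_mu_infD(5)[OF M]])
  show "AE z in distr M (mat_space n) (\<lambda>z. restrict z (ix n)). P z"
    unfolding is_mu_infD(4)[OF M] by (rule AE)
qed

lemma codenom_measurable:
  "mat_measurable (mat_space n) n n (\<lambda>w. codenom n (G :: 'p::prime_card padic Matrix.mat) (Matrix.mat n n w))"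
  unfolding mat_measurable_def
proof (intro conjI allI impI)
  fix i j assume ij: "i < n" "j < n"
  have "codenom n G (Matrix.mat n n w) $$ (i, j) = G $$ (i + n, j + n) - (\<Sum>k<n. G $$ (i + n, k) * w (k, j))" for w
    using ij by (simp add: codenom_def)
  moreover have "(\<lambda>w. G $$ (i + n, j + n) - (\<Sum>k<n. G $$ (i + n, k) * w (k, j))) \<in> borel_measurable (mat_space n)"
    using ij by (intro borel_measurable_padic_diff borel_measurable_padic_sum borel_measurable_padic_mult borel_measurable_const mat_space_component) auto
  ultimately show "(\<lambda>w. codenom n G (Matrix.mat n n w) $$ (i, j)) \<in> borel_measurable (mat_space n)" by simp
qed simp

lemma codenom_det_sets:
  "{w \<in> space (mat_space n). Determinant.det (codenom n (G :: 'p::prime_card padic Matrix.mat) (Matrix.mat n n w)) \<noteq> 0} \<in> sets (mat_space n)"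
proof -
  have [measurable]: "(\<lambda>w. pnorm (Determinant.det (codenom n G (Matrix.mat n n w)))) \<in> borel_measurable (mat_space n)"
    using det_measurable[OF codenom_measurable] by measurable
  have "{w \<in> space (mat_space n). pnorm (Determinant.det (codenom n G (Matrix.mat n n w))) \<noteq> 0} \<in> sets (mat_space n)"
    by measurable
  then show ?thesis by (simp add: pnorm_eq_0_iff)
qed

context eventually_GL_corner
begin

lemma glue_measurable:
  assumes H: "\<And>n. H n \<in> carrier_mat (n + n) (n + n)"
  shows "glue H \<in> inf_mat_space \<rightarrow>\<^sub>M inf_mat_space"
proof -
  have "(\<lambda>z ij. glue H z ij) \<in> inf_mat_space \<rightarrow>\<^sub>M PiM UNIV (\<lambda>_. borel)"
  proof (rule measurable_PiM_single')
    fix ij :: "nat \<times> nat" obtain i j where ij: "ij = (i, j)" by (cases ij)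
    let ?n = "Suc (N + i + j)"
    have "(\<lambda>z. lin_frac ?n (H ?n) (restrict z (ix ?n)) (i, j)) \<in> borel_measurable inf_mat_space"
      by (rule measurable_compose[OF measurable_compose[OF restrict_inf_measurable lin_frac_measurable[OF H]] mat_space_component]) simp
    then show "(\<lambda>z. glue H z ij) \<in> borel_measurable inf_mat_space" by (simp add: glue_def ij)
  qed simp
  then show ?thesis by (simp add: inf_mat_space_def)
qed

lemma act_dom_sets: "act_dom g \<in> sets inf_mat_space"
proof -
  have "(\<lambda>z. abs_lden N (G N) (restrict z (ix N))) \<in> borel_measurable inf_mat_space"
    by (rule measurable_compose[OF restrict_inf_measurable abs_lden_measurable]) simp
  then have "{z \<in> space inf_mat_space. abs_lden N (G N) (restrict z (ix N)) \<noteq> 0} \<in> sets inf_mat_space" by measurable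
  then show ?thesis by (simp add: act_dom_def abs_det_eq[OF adapted[OF order_refl]])
qed

lemma act_image_sets: "act_image \<in> sets inf_mat_space"
proof -
  have "(\<lambda>z. restrict z (ix N)) -` {w \<in> space (mat_space N). Determinant.det (codenom N (G N) (Matrix.mat N N w)) \<noteq> 0}
      \<inter> space inf_mat_space \<in> sets inf_mat_space"
    by (rule measurable_sets[OF restrict_inf_measurable codenom_det_sets])
  also have "(\<lambda>z. restrict z (ix N)) -` {w \<in> space (mat_space N). Determinant.det (codenom N (G N) (Matrix.mat N N w)) \<noteq> 0}
      \<inter> space inf_mat_space = act_image"
    by (auto simp: act_image_def space_mat_space)
  finally show ?thesis .
qed

lemma inv_act_measurable: "inv_act \<in> inf_mat_space \<rightarrow>\<^sub>M inf_mat_space"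
  unfolding inv_act_def by (rule glue_measurable) simp

lemma abs_det_corner: "N \<le> n \<Longrightarrow> abs_det g z = abs_lden n (G n) (restrict z (ix n))"
  by (simp add: abs_det_eq[OF adapted])

lemma abs_det_measurable: "(\<lambda>z. abs_det g z) \<in> borel_measurable inf_mat_space"
  using measurable_compose[OF restrict_inf_measurable abs_lden_measurable[OF corner2_carrier], of N g]
  by (simp add: abs_det_corner[OF order_refl])

lemma AE_act_dom:
  assumes s: "s > -1" and M: "is_mu_inf s M"
  shows "AE z in M. z \<in> act_dom g"
  using AE_mu[OF M mu_den_nonzero[OF N_pos s prob_space_mu[OF M] G_GL[OF order_refl]]]
  by (simp add: act_dom_def abs_det_eq[OF adapted[OF order_refl]])

text \<open>Almost everywhere the denominator of the inverse corner is nonsingular; there the corner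
  of \<open>w\<close> has a preimage, and the determinant identity makes \<open>d - c w\<close>
  nonsingular.\<close>

lemma AE_act_image:
  assumes s: "s > -1" and M: "is_mu_inf s M"
  shows "AE w in M. w \<in> act_image"
proof -
  have "AE w in M. abs_lden N (inv_mat (G N)) (restrict w (ix N)) \<noteq> 0"
    by (rule AE_mu[OF M mu_den_nonzero[OF N_pos s prob_space_mu[OF M] GL_int_inv_mat[OF G_GL[OF order_refl]]]])
  then show ?thesis
  proof eventually_elim
    case (elim w)
    let ?W = "Matrix.mat N N w"
    let ?Z = "lfrac N (inv_mat (G N)) ?W"
    have d: "Determinant.det (lden N (inv_mat (G N)) ?W) \<noteq> 0" using elim by (auto simp: abs_lden_def)
    note inv = lfrac_inverse[OF corner2_carrier G_det[OF order_refl] mat_carrier d]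
    have "Determinant.det (G N) = Determinant.det (lden N (G N) ?Z) * Determinant.det (codenom N (G N) ?W)"
      by (rule det_eq_lden_codenom[OF corner2_carrier lfrac_carrier mat_carrier]) (use lden_times_lfrac[OF inv(1)] inv(2) in simp)
    then show ?case using G_det[OF order_refl] by (auto simp: act_image_def)
  qed
qed

text \<open>The derivative formula as an equality of measures: pushing \<open>M\<close> forward by
  the inverse map produces the density. A finite measure on the product is determined by cylinders,
  and each cylinder is visible in one corner, where \<open>mu_transform\<close> applies.\<close>

lemma distr_inv_act:
  assumes s: "s > -1" and M: "is_mu_inf s M"
  shows "distr (density M (indicator act_image)) inf_mat_space inv_act = density M (\<lambda>z. ennreal (abs_det g z powr s))"
    (is "?P = ?Q")
proof -
  interpret M: prob_space M by (rule is_mu_infD(1)[OF M])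
  have sM [measurable_cong]: "sets M = sets inf_mat_space" by (rule is_mu_infD(2)[OF M])
  have spM: "space M = UNIV" by (rule is_mu_infD(3)[OF M])
  note [measurable] = act_image_sets inv_act_measurable
  have act_imageM: "act_image \<in> sets M" by (simp add: sM act_image_sets)
  have inv: "inv_act \<in> density M (indicator act_image) \<rightarrow>\<^sub>M inf_mat_space" by measurable
  have sQ: "sets ?Q = sets inf_mat_space" by (simp add: sM)
  have hm: "(\<lambda>z. ennreal (abs_det g z powr s)) \<in> borel_measurable M"
    using abs_det_measurable by (simp add: measurable_cong_sets[OF sM refl])
  have key: "emeasure ?P (prod_emb UNIV (\<lambda>_. borel) J (Pi\<^sub>E J A)) = emeasure ?Q (prod_emb UNIV (\<lambda>_. borel) J (Pi\<^sub>E J A))"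
    if J: "finite J" and A: "\<And>i. i \<in> J \<Longrightarrow> A i \<in> sets borel" for J and A :: "nat \<times> nat \<Rightarrow> 'p padic set"
  proof -
    define S where "S = prod_emb UNIV (\<lambda>_. borel) J (Pi\<^sub>E J A)"
    have S: "S \<in> sets inf_mat_space"
      unfolding S_def inf_mat_space_def using J A by (intro sets_PiM_I) auto
    obtain m where m: "J \<subseteq> ix m"
    proof -
      have "J \<subseteq> ix (Suc (Max (insert 0 (fst ` J \<union> snd ` J))))"
      proof
        fix x assume "x \<in> J"
        then have "fst x \<le> Max (insert 0 (fst ` J \<union> snd ` J))" "snd x \<le> Max (insert 0 (fst ` J \<union> snd ` J))"
          using J by (auto intro!: Max_ge)
        then show "x \<in> ix (Suc (Max (insert 0 (fst ` J \<union> snd ` J))))" by (cases x) auto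
      qed
      then show thesis by (rule that)
    qed
    \<comment> \<open>A corner that sees the cylinder and is large enough for
      \<open>GL_corner g n\<close>.\<close>
    define n where "n = max N m"
    have n: "N \<le> n" and Jn: "J \<subseteq> ix n" using m by (auto simp: n_def)
    have n0: "n > 0" using n N_pos by simp
    define C where "C = {y \<in> space (mat_space n). \<forall>i\<in>J. y i \<in> A i}"
    have C: "C \<in> sets (mat_space n)"
      unfolding C_def
    proof (rule sets.sets_Collect_finite_All[OF _ J])
      fix i assume i: "i \<in> J"
      have "(\<lambda>y. y i) -` A i \<inter> space (mat_space n) \<in> sets (mat_space n)"
        by (rule measurable_sets[OF mat_space_component A]) (use i Jn in auto)
      then show "{y \<in> space (mat_space n). y i \<in> A i} \<in> sets (mat_space n)" by (simp add: vimage_def Int_def conj_commute)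
    qed
    have SC: "z \<in> S \<longleftrightarrow> restrict z (ix n) \<in> C" for z
    proof -
      have "z \<in> S \<longleftrightarrow> (\<forall>i\<in>J. z i \<in> A i)" by (simp add: S_def prod_emb_def Pi_iff)
      also have "\<dots> \<longleftrightarrow> (\<forall>i\<in>J. restrict z (ix n) i \<in> A i)" using Jn by (intro ball_cong refl) auto
      finally show ?thesis by (simp add: C_def space_mat_space)
    qed
    let ?Gi = "inv_mat (G n)"
    have Gi: "?Gi \<in> carrier_mat (n + n) (n + n)" by simp
    let ?E = "{w \<in> space (mat_space n). Determinant.det (codenom n (G n) (Matrix.mat n n w)) \<noteq> 0}"
    \<comment> \<open>The test function for \<open>mu_transform\<close>: after composition with the
      transformation, the inverse transformation cancels and the indicator of the image becomes 1,
      which leaves the indicator of \<open>C\<close>.\<close>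
    define f :: "'p mfun \<Rightarrow> ennreal" where "f y = indicator ?E y * indicator C (lin_frac n ?Gi y)" for y
    have f: "f \<in> borel_measurable (mat_space n)"
      unfolding f_def[abs_def]
      by (intro borel_measurable_times_ennreal borel_measurable_indicator codenom_det_sets
          measurable_compose[OF lin_frac_measurable[OF Gi] borel_measurable_indicator[OF C]])
    define h :: "'p mfun \<Rightarrow> ennreal" where "h y = ennreal (abs_lden n (G n) y powr s) * indicator C y" for y
    have h: "h \<in> borel_measurable (mat_space n)"
      unfolding h_def[abs_def] using C abs_lden_measurable[OF corner2_carrier, of n g] by measurable
    have "emeasure ?P S = emeasure (density M (indicator act_image)) (inv_act -` S \<inter> space (density M (indicator act_image)))"
      by (rule emeasure_distr[OF inv S])
    also have "\<dots> = (\<integral>\<^sup>+ w. indicator act_image w * indicator (inv_act -` S \<inter> space (density M (indicator act_image))) w \<partial>M)"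
      by (rule emeasure_density) (use act_imageM measurable_sets[OF inv S] in simp_all)
    also have "\<dots> = (\<integral>\<^sup>+ w. f (restrict w (ix n)) \<partial>M)"
    proof (rule nn_integral_cong)
      fix w :: "'p mfun"
      have "inv_act w \<in> S \<longleftrightarrow> lin_frac n ?Gi (restrict w (ix n)) \<in> C" if w: "w \<in> act_image"
      proof -
        have "restrict (inv_act w) (ix n) = lin_frac n ?Gi (restrict w (ix n))"
          by (rule extensional_eqI[of _ n]) (simp_all add: inv_act_corner(1)[OF w n] lin_frac_def mat_fun_of)
        then show ?thesis by (simp only: SC)
      qed
      then show "indicator act_image w * indicator (inv_act -` S \<inter> space (density M (indicator act_image))) w = f (restrict w (ix n))"
        by (auto simp: f_def act_image_iff[OF n] indicator_def space_mat_space spM)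
    qed
    also have "\<dots> = (\<integral>\<^sup>+ y. f y \<partial>mu n s)" by (rule nn_integral_mu[OF M f, symmetric])
    also have "\<dots> = (\<integral>\<^sup>+ y. f (lin_frac n (G n) y) * ennreal (abs_lden n (G n) y powr s) \<partial>mu n s)"
      by (rule mu_transform[OF n0 s prob_space_mu[OF M] G_GL[OF n] f])
    also have "\<dots> = (\<integral>\<^sup>+ y. h y \<partial>mu n s)"
    proof (rule nn_integral_cong)
      fix y assume "y \<in> space (mu n s :: 'p mfun measure)"
      then have y: "y \<in> extensional (ix n)" by simp
      let ?Y = "Matrix.mat n n y"
      show "f (lin_frac n (G n) y) * ennreal (abs_lden n (G n) y powr s) = h y"
      \<comment> \<open>A singular denominator gives 0 on both sides, again because
        \<open>0 powr s = 0\<close>.\<close>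
      proof (cases "abs_lden n (G n) y = 0")
        case True
        then show ?thesis by (simp add: h_def)
      next
        case False
        then have d: "Determinant.det (lden n (G n) ?Y) \<noteq> 0" by (auto simp: abs_lden_def)
        have mW: "Matrix.mat n n (lin_frac n (G n) y) = lfrac n (G n) ?Y" by (simp add: lin_frac_def mat_fun_of)
        have "Determinant.det (G n) = Determinant.det (lden n (G n) ?Y) * Determinant.det (codenom n (G n) (lfrac n (G n) ?Y))"
          by (rule det_eq_lden_codenom[OF corner2_carrier mat_carrier lfrac_carrier lden_times_lfrac[OF d]])
        then have "Determinant.det (codenom n (G n) (lfrac n (G n) ?Y)) \<noteq> 0" using G_det[OF n] by auto
        moreover have "lin_frac n (G n) y \<in> extensional (ix n)" by (simp add: lin_frac_def)
        ultimately have E: "lin_frac n (G n) y \<in> ?E" by (simp add: mW space_mat_space)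
        have "lin_frac n ?Gi (lin_frac n (G n) y) = y"
          unfolding lin_frac_def[of n ?Gi] mW lfrac_inv_mat[OF corner2_carrier G_det[OF n] mat_carrier d]
          by (rule fun_of_mat[OF y])
        then show ?thesis using E by (simp add: f_def h_def mult.commute)
      qed
    qed
    also have "\<dots> = (\<integral>\<^sup>+ z. h (restrict z (ix n)) \<partial>M)" by (rule nn_integral_mu[OF M h])
    also have "\<dots> = (\<integral>\<^sup>+ z. ennreal (abs_det g z powr s) * indicator S z \<partial>M)"
      by (rule nn_integral_cong) (simp add: h_def abs_det_corner[OF n] SC indicator_def)
    also have "\<dots> = emeasure ?Q S"
      by (rule emeasure_density[symmetric, OF hm]) (use S in \<open>simp add: sM\<close>)
    finally show ?thesis by (simp add: S_def)
  qed
  \<comment> \<open>Uniqueness on cylinders asks for a finite measure. This is immediate for the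
    side whose density is an indicator, and not for the other, where \<open>s\<close> may be
    negative.\<close>
  have fin: "finite_measure ?P"
  proof
    have U: "UNIV \<in> sets (inf_mat_space :: 'p mfun measure)" "UNIV \<in> sets M"
      using sets.top[of "inf_mat_space :: 'p mfun measure"] by (simp_all add: sM)
    have "emeasure ?P UNIV = emeasure (density M (indicator act_image)) UNIV"
      using emeasure_distr[OF inv U(1)] by (simp add: spM)
    also have "\<dots> = (\<integral>\<^sup>+ w. indicator act_image w * indicator UNIV w \<partial>M)"
      by (rule emeasure_density) (use act_imageM U in simp_all)
    also have "\<dots> = emeasure M act_image" using act_imageM by simp
    finally show "emeasure ?P (space ?P) \<noteq> \<infinity>" by simp
  qed
  show ?thesis
    by (rule measure_eqI_PiM_infinite[where I = UNIV and M = "\<lambda>_. borel"])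
       (use key fin sQ in \<open>simp_all add: inf_mat_space_def\<close>)
qed

text \<open>The image of \<open>B\<close> is the part of \<open>act_image\<close> that
  \<open>inv_act\<close> sends into \<open>B\<close>, so its mass is the one that
  \<open>distr_inv_act\<close> computes for \<open>B\<close>.\<close>

lemma emeasure_image_act:
  assumes s: "s > -1" and M: "is_mu_inf s M" and B: "B \<in> sets M" "B \<subseteq> act_dom g"
  shows "act g ` B \<in> sets M" "emeasure M (act g ` B) = (\<integral>\<^sup>+ z\<in>B. ennreal (abs_det g z powr s) \<partial>M)"
proof -
  have sM: "sets M = sets inf_mat_space" by (rule is_mu_infD(2)[OF M])
  have spM: "space M = UNIV" by (rule is_mu_infD(3)[OF M])
  have act_imageM: "act_image \<in> sets M" by (simp add: sM act_image_sets)
  have inv: "inv_act \<in> M \<rightarrow>\<^sub>M inf_mat_space" using inv_act_measurable by (simp add: measurable_cong_sets[OF sM refl])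
  have inv': "inv_act \<in> density M (indicator act_image) \<rightarrow>\<^sub>M inf_mat_space" using inv by simp
  have B': "B \<in> sets inf_mat_space" using B by (simp add: sM)
  have img: "act g ` B = act_image \<inter> (inv_act -` B \<inter> space M)" using image_act[OF B(2)] by (auto simp: spM)
  have pre: "inv_act -` B \<inter> space M \<in> sets M" by (rule measurable_sets[OF inv B'])
  show "act g ` B \<in> sets M" unfolding img using act_imageM pre by blast
  have "emeasure M (act g ` B) = emeasure (density M (indicator act_image)) (inv_act -` B \<inter> space (density M (indicator act_image)))"
    unfolding img using act_imageM pre by (simp add: emeasure_density indicator_inter_arith[symmetric])
  also have "\<dots> = emeasure (distr (density M (indicator act_image)) inf_mat_space inv_act) B"
    by (rule emeasure_distr[OF inv' B', symmetric])
  also have "\<dots> = emeasure (density M (\<lambda>z. ennreal (abs_det g z powr s))) B"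
    by (simp add: distr_inv_act[OF s M])
  also have "\<dots> = (\<integral>\<^sup>+ z\<in>B. ennreal (abs_det g z powr s) \<partial>M)"
    by (rule emeasure_density[OF _ B(1)]) (use abs_det_measurable in \<open>simp add: measurable_cong_sets[OF sM refl]\<close>)
  finally show "emeasure M (act g ` B) = (\<integral>\<^sup>+ z\<in>B. ennreal (abs_det g z powr s) \<partial>M)" .
qed

text \<open>On the domain the density is strictly positive, so its integral over \<open>B\<close>
  vanishes exactly for null \<open>B\<close>.\<close>

lemma null_image_act:
  assumes s: "s > -1" and M: "is_mu_inf s M" and B: "B \<in> sets M" "B \<subseteq> act_dom g"
  shows "act g ` B \<in> null_sets M \<longleftrightarrow> B \<in> null_sets M"
proof -
  have sM: "sets M = sets inf_mat_space" by (rule is_mu_infD(2)[OF M])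
  have [measurable]: "(\<lambda>z. abs_det g z) \<in> borel_measurable M"
    using abs_det_measurable by (simp add: measurable_cong_sets[OF sM refl])
  note [measurable] = B(1)
  have "act g ` B \<in> null_sets M \<longleftrightarrow> (\<integral>\<^sup>+ z\<in>B. ennreal (abs_det g z powr s) \<partial>M) = 0"
    using emeasure_image_act[OF s M B] by (simp add: null_sets_def)
  also have "\<dots> \<longleftrightarrow> (AE z in M. ennreal (abs_det g z powr s) * indicator B z = 0)"
    by (rule nn_integral_0_iff_AE) measurable
  also have "\<dots> \<longleftrightarrow> (AE z in M. z \<notin> B)"
  proof (rule AE_cong)
    fix z
    have "abs_det g z \<noteq> 0" if "z \<in> B" using that B(2) by (auto simp: act_dom_def)
    moreover have "abs_det g z \<ge> 0" by (simp add: abs_det_corner[OF order_refl] abs_lden_nonneg)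
    ultimately show "ennreal (abs_det g z powr s) * indicator B z = 0 \<longleftrightarrow> z \<notin> B" by (auto simp: indicator_def)
  qed
  also have "\<dots> \<longleftrightarrow> B \<in> null_sets M" by (rule AE_iff_null_sets[OF B(1), symmetric])
  finally show ?thesis .
qed

lemma quasiinvariant_act:
  assumes s: "s > -1" and M: "is_mu_inf s M"
  shows "quasiinvariant M (act_dom g) (act g) (\<lambda>z. abs_det g z powr s)"
  unfolding quasiinvariant_def
proof (intro conjI ballI impI)
  have sM: "sets M = sets inf_mat_space" by (rule is_mu_infD(2)[OF M])
  have spM: "space M = UNIV" by (rule is_mu_infD(3)[OF M])
  have D: "act_dom g \<in> sets M" by (simp add: sM act_dom_sets)
  have act_imageM: "act_image \<in> sets M" by (simp add: sM act_image_sets)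
  show "act_dom g \<in> sets M" by (rule D)
  show "space M - act_dom g \<in> null_sets M"
    by (rule AE_iff_null_sets[THEN iffD2, OF sets.compl_sets[OF D]]) (use AE_act_dom[OF s M] in simp)
  \<comment> \<open>On its domain \<open>act g\<close> coincides with the measurable map
    \<open>glue G\<close>.\<close>
  show "act g \<in> restrict_space M (act_dom g) \<rightarrow>\<^sub>M M"
  proof (rule measurable_cong[THEN iffD1])
    show "glue G z = act g z" if "z \<in> space (restrict_space M (act_dom g))" for z
      using that by (intro glue_act) (simp add: space_restrict_space)
    have "glue G \<in> M \<rightarrow>\<^sub>M M"
      using glue_measurable[of G] by (simp add: measurable_cong_sets[OF sM sM])
    then show "glue G \<in> restrict_space M (act_dom g) \<rightarrow>\<^sub>M M" by (rule measurable_restrict_space1)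
  qed
  show "inj_on (act g) (act_dom g)" by (rule act_inj)
  have "act g ` act_dom g = act_image" using image_act[OF order_refl] inv_act_dom by auto
  then show "space M - act g ` act_dom g \<in> null_sets M"
    using AE_iff_null_sets[THEN iffD2, OF sets.compl_sets[OF act_imageM]] AE_act_image[OF s M] by simp
qed (use emeasure_image_act[OF s M] null_image_act[OF s M] in auto)

end

text \<open>At each large size the corner of the product is the product of the corners, and
  \<open>lfrac_mult\<close> applies. The denominators multiply, so \<open>z\<close> lies in the
  domain of \<open>g \<star> h\<close> as well.\<close>

lemma act_mmul:
  assumes g: "\<And>n. N \<le> n \<Longrightarrow> GL_corner g n" and h: "\<And>n. N \<le> n \<Longrightarrow> GL_corner h n"
    and z: "z \<in> act_dom g" "act g z \<in> act_dom h"
  shows "act (g \<star> h) z = act h (act g z)"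
proof -
  \<comment> \<open>\<open>Suc N\<close> because the locale asks for a positive size.\<close>
  interpret g: eventually_GL_corner g "Suc N" using g by unfold_locales auto
  interpret h: eventually_GL_corner h "Suc N" using h by unfold_locales auto
  interpret gh: eventually_GL_corner "g \<star> h" "Suc N" using g h by unfold_locales (auto intro: GL_corner_mmul)
  have *: "lden n (gh.G n) (Matrix.mat n n z) = lden n (g.G n) (Matrix.mat n n z) * lden n (h.G n) (Matrix.mat n n (act g z))"
    "lfrac n (gh.G n) (Matrix.mat n n z) = lfrac n (h.G n) (Matrix.mat n n (act g z))"
    "Determinant.det (lden n (g.G n) (Matrix.mat n n z)) \<noteq> 0" "Determinant.det (lden n (h.G n) (Matrix.mat n n (act g z))) \<noteq> 0"
    if n: "Suc N \<le> n" for n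
  proof -
    have G: "gh.G n = g.G n * h.G n" by (rule corner2_mmul_adapted[OF g.adapted[OF n] h.adapted[OF n]])
    show dg: "Determinant.det (lden n (g.G n) (Matrix.mat n n z)) \<noteq> 0" using z(1) g.act_dom_iff[OF n] by blast
    show dh: "Determinant.det (lden n (h.G n) (Matrix.mat n n (act g z))) \<noteq> 0" using z(2) h.act_dom_iff[OF n] by blast
    have ma: "Matrix.mat n n (act g z) = lfrac n (g.G n) (Matrix.mat n n z)" by (rule g.mat_act'[OF n z(1)])
    from lfrac_mult[OF corner2_carrier corner2_carrier dg dh[unfolded ma]]
    show "lden n (gh.G n) (Matrix.mat n n z) = lden n (g.G n) (Matrix.mat n n z) * lden n (h.G n) (Matrix.mat n n (act g z))"
      "lfrac n (gh.G n) (Matrix.mat n n z) = lfrac n (h.G n) (Matrix.mat n n (act g z))"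
      unfolding G ma by blast+
  qed
  have zd: "z \<in> act_dom (g \<star> h)"
    unfolding gh.act_dom_iff[OF order_refl] *(1)[OF order_refl] det_mult[OF lden_carrier lden_carrier]
    using *(3,4)[OF order_refl] by simp
  show ?thesis
  proof (rule mat_eqI_corners[of "Suc N"])
    fix n assume n: "Suc N \<le> n"
    show "Matrix.mat n n (act (g \<star> h) z) = Matrix.mat n n (act h (act g z))"
      unfolding gh.mat_act'[OF n zd] h.mat_act'[OF n z(2)] by (rule *(2)[OF n])
  qed
qed

lemma act_mone: "act mone z = (z :: 'p::prime_card mfun)"
proof -
  interpret eventually_GL_corner "mone :: 'p bmat" 1 using GL_corner_T_2inf[OF mone_T_2inf] by unfold_locales auto
  have zd: "z \<in> act_dom mone" unfolding act_dom_iff[OF order_refl] corner2_mone lfrac_one(1)[OF mat_carrier] by simp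
  show ?thesis
  proof (rule mat_eqI_corners[of 1])
    fix n assume n: "1 \<le> (n :: nat)"
    show "Matrix.mat n n (act mone z) = Matrix.mat n n z"
      unfolding mat_act'[OF n zd] corner2_mone by (rule lfrac_one(2)[OF mat_carrier])
  qed
qed

theorem theorem1p5:
  fixes s :: real and M :: "(nat \<times> nat \<Rightarrow> 'p::prime_card padic) measure"
  assumes "s > -1" and "is_mu_inf s M"
  shows "(\<forall>g\<in>GL_bar. quasiinvariant M (act_dom g) (act g) (\<lambda>z. abs_det g z powr s))
    \<and> (\<forall>z :: nat \<times> nat \<Rightarrow> 'p padic. act mone z = z)
    \<and> (\<forall>g\<in>GL_bar. \<forall>h\<in>GL_bar. AE z in M. act (g \<star> h) z = act h (act g z))"
proof (intro conjI ballI allI)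
  have element: "\<exists>N. eventually_GL_corner g N" if "g \<in> GL_bar" for g :: "'p bmat"
    using GL_bar_GL_corner[OF that] by (auto simp: eventually_GL_corner_def)
  have quasi: "quasiinvariant M (act_dom g) (act g) (\<lambda>z. abs_det g z powr s)" if "g \<in> GL_bar" for g
    using element[OF that] eventually_GL_corner.quasiinvariant_act[OF _ assms] by blast
  then show "quasiinvariant M (act_dom g) (act g) (\<lambda>z. abs_det g z powr s)" if "g \<in> GL_bar" for g
    using that .
  show "act mone z = z" for z :: "nat \<times> nat \<Rightarrow> 'p padic" by (rule act_mone)
  fix g h :: "'p bmat" assume g: "g \<in> GL_bar" and h: "h \<in> GL_bar"
  obtain Ng Nh where N: "\<And>n. Ng \<le> n \<Longrightarrow> GL_corner g n" "\<And>n. Nh \<le> n \<Longrightarrow> GL_corner h n"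
    using GL_bar_GL_corner[OF g] GL_bar_GL_corner[OF h] by blast
  \<comment> \<open>The exceptional set of points that \<open>g\<close> sends outside the domain of
    \<open>h\<close>. Its image lies in a null set, and a subset of the domain with null image is
    itself null by quasiinvariance.\<close>
  define B where "B = {z \<in> act_dom g. act g z \<notin> act_dom h}"
  have qg: "act_dom g \<in> sets M" "space M - act_dom g \<in> null_sets M" "act g \<in> restrict_space M (act_dom g) \<rightarrow>\<^sub>M M"
    and qB: "\<And>B. B \<in> sets M \<Longrightarrow> B \<subseteq> act_dom g \<Longrightarrow> act g ` B \<in> sets M \<and> (act g ` B \<in> null_sets M \<longleftrightarrow> B \<in> null_sets M)"
    using quasi[OF g] by (auto simp: quasiinvariant_def)
  have qh: "act_dom h \<in> sets M" "space M - act_dom h \<in> null_sets M"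
    using quasi[OF h] by (auto simp: quasiinvariant_def)
  have spM: "space M = UNIV" by (rule is_mu_infD(3)[OF assms(2)])
  have "act g -` (space M - act_dom h) \<inter> space (restrict_space M (act_dom g)) \<in> sets (restrict_space M (act_dom g))"
    by (rule measurable_sets[OF qg(3)]) (use qh in auto)
  also have "act g -` (space M - act_dom h) \<inter> space (restrict_space M (act_dom g)) = B"
    by (auto simp: B_def space_restrict_space spM)
  finally have B: "B \<in> sets M" using qg(1) by (simp add: sets_restrict_space_iff spM)
  have BD: "B \<subseteq> act_dom g" by (auto simp: B_def)
  have "act g ` B \<in> null_sets M"
    by (rule null_sets_subset[OF qh(2)]) (use qB[OF B BD] in \<open>auto simp: B_def spM\<close>)
  then have "B \<in> null_sets M" using qB[OF B BD] by simp
  then have "AE z in M. z \<notin> B" by (rule AE_not_in)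
  moreover have "AE z in M. z \<notin> space M - act_dom g" by (rule AE_not_in[OF qg(2)])
  ultimately show "AE z in M. act (g \<star> h) z = act h (act g z)"
  proof eventually_elim
    case (elim z)
    then have "z \<in> act_dom g" "act g z \<in> act_dom h" by (auto simp: B_def spM)
    then show ?case using N by (intro act_mmul[of "max Ng Nh"]) auto
  qed
qed

end
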